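(* Let $F$ be a field. The tensor product over $F$ of two semicentral semiassociative $F$-algebras is a semicentral semiassociative $F$-algebra.
   Context: Algebras are unital and not necessarily associative. The associator is $(x,y,z)=(xy)z-x(yz)$; the nucleus $\mathfrak{N}(A)$ is the set of $x\in A$ with $(x,A,A)=(A,x,A)=(A,A,x)=0$, an associative subalgebra; the center is $Z(A)=\{x\in\mathfrak{N}(A):xa=ax\text{ for all }a\in A\}$; $A$ is $F$-central if $Z(A)=F$. An étale $F$-algebra is a finite direct product of finite separable field extensions of $F$. A module over an associative ring is minimally faithful if it is faithful and has no faithful proper section (quotient of submodules). A finite dimensional $F$-central algebra $A$ is semiassociative if there is an étale $F$-subalgebra $K\subseteq\mathfrak{N}(A)$ (containing $1_A$) such that $A$ is minimally faithful (equivalently, faithful and cyclic) as a $K\otimes_F K$-module via $(k\otimes k')a=kak'$. For a semiassociative algebra $A$, let $\sigma(A)=\mathfrak{N}(A)/\mathrm{J}(\mathfrak{N}(A))$, where $\mathrm{J}$ is the Jacobson radical. The simple components of the semisimple algebra $\sigma(A)$ are called the atoms of $A$. A semiassociative $F$-algebra is semicentral if all of its atoms have center $F$. *)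

theory Defs
  imports "HOL-Algebra.Algebra"
begin

section \<open>Unital, not necessarily associative algebras\<close>

text \<open>
  Algebras are \<open>module\<close> records of HOL-Algebra, as in its locale \<open>algebra\<close>, but neither
  associativity nor commutativity of the multiplication is required.
\<close>

locale nonassoc_algebra = field F + module F A
  for F (structure) and A (structure) +
  assumes mult_closed:
      "\<lbrakk>x \<in> carrier A; y \<in> carrier A\<rbrakk> \<Longrightarrow> x \<otimes>\<^bsub>A\<^esub> y \<in> carrier A"
    and one_closed: "\<one>\<^bsub>A\<^esub> \<in> carrier A"
    and one_left: "x \<in> carrier A \<Longrightarrow> \<one>\<^bsub>A\<^esub> \<otimes>\<^bsub>A\<^esub> x = x"
    and one_right: "x \<in> carrier A \<Longrightarrow> x \<otimes>\<^bsub>A\<^esub> \<one>\<^bsub>A\<^esub> = x"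
    and add_mult: "\<lbrakk>x \<in> carrier A; y \<in> carrier A; z \<in> carrier A\<rbrakk> \<Longrightarrow>
      (x \<oplus>\<^bsub>A\<^esub> y) \<otimes>\<^bsub>A\<^esub> z = x \<otimes>\<^bsub>A\<^esub> z \<oplus>\<^bsub>A\<^esub> y \<otimes>\<^bsub>A\<^esub> z"
    and mult_add: "\<lbrakk>x \<in> carrier A; y \<in> carrier A; z \<in> carrier A\<rbrakk> \<Longrightarrow>
      x \<otimes>\<^bsub>A\<^esub> (y \<oplus>\<^bsub>A\<^esub> z) = x \<otimes>\<^bsub>A\<^esub> y \<oplus>\<^bsub>A\<^esub> x \<otimes>\<^bsub>A\<^esub> z"
    and smult_mult: "\<lbrakk>c \<in> carrier F; x \<in> carrier A; y \<in> carrier A\<rbrakk> \<Longrightarrow>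
      (c \<odot>\<^bsub>A\<^esub> x) \<otimes>\<^bsub>A\<^esub> y = c \<odot>\<^bsub>A\<^esub> (x \<otimes>\<^bsub>A\<^esub> y)"
    and mult_smult: "\<lbrakk>c \<in> carrier F; x \<in> carrier A; y \<in> carrier A\<rbrakk> \<Longrightarrow>
      x \<otimes>\<^bsub>A\<^esub> (c \<odot>\<^bsub>A\<^esub> y) = c \<odot>\<^bsub>A\<^esub> (x \<otimes>\<^bsub>A\<^esub> y)"

definition associator :: "('a, 'm) ring_scheme \<Rightarrow> 'a \<Rightarrow> 'a \<Rightarrow> 'a \<Rightarrow> 'a" where
  "associator A x y z = (x \<otimes>\<^bsub>A\<^esub> y) \<otimes>\<^bsub>A\<^esub> z \<ominus>\<^bsub>A\<^esub> x \<otimes>\<^bsub>A\<^esub> (y \<otimes>\<^bsub>A\<^esub> z)"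

definition nucleus :: "('a, 'm) ring_scheme \<Rightarrow> 'a set" where
  "nucleus A = {x \<in> carrier A. \<forall>y \<in> carrier A. \<forall>z \<in> carrier A.
     associator A x y z = \<zero>\<^bsub>A\<^esub> \<and> associator A y x z = \<zero>\<^bsub>A\<^esub> \<and> associator A y z x = \<zero>\<^bsub>A\<^esub>}"

definition alg_center :: "('a, 'm) ring_scheme \<Rightarrow> 'a set" where
  "alg_center A = {x \<in> nucleus A. \<forall>y \<in> carrier A. x \<otimes>\<^bsub>A\<^esub> y = y \<otimes>\<^bsub>A\<^esub> x}"

text \<open>The identification of the base field \<open>F\<close> with the center is along \<open>c \<mapsto> c \<odot> \<one>\<close>;
  its injectivity excludes the zero algebra.\<close>

definition central :: "('f, 'k) ring_scheme \<Rightarrow> ('f, 'a) module \<Rightarrow> bool" where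
  "central F A \<longleftrightarrow> bij_betw (\<lambda>c. c \<odot>\<^bsub>A\<^esub> \<one>\<^bsub>A\<^esub>) (carrier F) (alg_center A)"

definition subalgebra :: "('f, 'k) ring_scheme \<Rightarrow> ('f, 'a) module \<Rightarrow> 'a set \<Rightarrow> bool" where
  "subalgebra F A K \<longleftrightarrow> submodule K F A \<and> \<one>\<^bsub>A\<^esub> \<in> K \<and> (\<forall>x \<in> K. \<forall>y \<in> K. x \<otimes>\<^bsub>A\<^esub> y \<in> K)"

definition module_span ::
    "('r, 'k) ring_scheme \<Rightarrow> ('r, 'a) module \<Rightarrow> 'a set \<Rightarrow> 'a set" where
  "module_span R M S = \<Inter> {N. submodule N R M \<and> S \<subseteq> N}"

definition finite_dimensional :: "('f, 'k) ring_scheme \<Rightarrow> ('f, 'a) module \<Rightarrow> bool" where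
  "finite_dimensional F M \<longleftrightarrow>
     (\<exists>S. finite S \<and> S \<subseteq> carrier M \<and> module_span F M S = carrier M)"

text \<open>The quotient of a module, or of an algebra, by a submodule, or by an ideal.
  On modules the multiplicative part of the record carries no meaning.\<close>

definition quot_alg :: "('r, 'a) module \<Rightarrow> 'a set \<Rightarrow> ('r, 'a set) module" where
  "quot_alg M P = ring.extend (M Quot P)
     (module.fields (\<lambda>r C. \<Union>x \<in> C. P +>\<^bsub>M\<^esub> (r \<odot>\<^bsub>M\<^esub> x)))"


section \<open>Tensor products\<close>

text \<open>
  The tensor product of \<open>A\<close> and \<open>B\<close> is the free module on the set of pairs, with the
  multiplication extending \<open>(a, b) (a', b') = (a a', b b')\<close> bilinearly, modulo the
  bilinearity relations. Elements of the free module are finitely supported functions.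
\<close>

definition pair_algebra ::
    "('f, 'k) ring_scheme \<Rightarrow> ('f, 'a) module \<Rightarrow> ('f, 'b) module \<Rightarrow> ('f, 'a \<times> 'b \<Rightarrow> 'f) module" where
  "pair_algebra F A B =
    \<lparr> carrier = {f. (\<forall>p. f p \<in> carrier F) \<and> finite {p. f p \<noteq> \<zero>\<^bsub>F\<^esub>} \<and>
                    {p. f p \<noteq> \<zero>\<^bsub>F\<^esub>} \<subseteq> carrier A \<times> carrier B},
      monoid.mult = (\<lambda>f g r. \<Oplus>\<^bsub>F\<^esub>p \<in> {p. f p \<noteq> \<zero>\<^bsub>F\<^esub>}. \<Oplus>\<^bsub>F\<^esub>q \<in> {q. g q \<noteq> \<zero>\<^bsub>F\<^esub>}.
                if (fst p \<otimes>\<^bsub>A\<^esub> fst q, snd p \<otimes>\<^bsub>B\<^esub> snd q) = r then f p \<otimes>\<^bsub>F\<^esub> g q else \<zero>\<^bsub>F\<^esub>),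
      one = (\<lambda>p. if p = (\<one>\<^bsub>A\<^esub>, \<one>\<^bsub>B\<^esub>) then \<one>\<^bsub>F\<^esub> else \<zero>\<^bsub>F\<^esub>),
      ring.zero = (\<lambda>p. \<zero>\<^bsub>F\<^esub>),
      add = (\<lambda>f g p. f p \<oplus>\<^bsub>F\<^esub> g p),
      smult = (\<lambda>c f p. c \<otimes>\<^bsub>F\<^esub> f p) \<rparr>"

definition pair_gen :: "('f, 'k) ring_scheme \<Rightarrow> 'a \<Rightarrow> 'b \<Rightarrow> 'a \<times> 'b \<Rightarrow> 'f" where
  "pair_gen F a b = (\<lambda>p. if p = (a, b) then \<one>\<^bsub>F\<^esub> else \<zero>\<^bsub>F\<^esub>)"

definition tensor_relations ::
    "('f, 'k) ring_scheme \<Rightarrow> ('f, 'a) module \<Rightarrow> ('f, 'b) module \<Rightarrow> ('a \<times> 'b \<Rightarrow> 'f) set" where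
  "tensor_relations F A B = (let P = pair_algebra F A B in
     {pair_gen F (a \<oplus>\<^bsub>A\<^esub> a') b \<ominus>\<^bsub>P\<^esub> (pair_gen F a b \<oplus>\<^bsub>P\<^esub> pair_gen F a' b) | a a' b.
        a \<in> carrier A \<and> a' \<in> carrier A \<and> b \<in> carrier B} \<union>
     {pair_gen F a (b \<oplus>\<^bsub>B\<^esub> b') \<ominus>\<^bsub>P\<^esub> (pair_gen F a b \<oplus>\<^bsub>P\<^esub> pair_gen F a b') | a b b'.
        a \<in> carrier A \<and> b \<in> carrier B \<and> b' \<in> carrier B} \<union>
     {pair_gen F (c \<odot>\<^bsub>A\<^esub> a) b \<ominus>\<^bsub>P\<^esub> c \<odot>\<^bsub>P\<^esub> pair_gen F a b | c a b.
        c \<in> carrier F \<and> a \<in> carrier A \<and> b \<in> carrier B} \<union>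
     {pair_gen F a (c \<odot>\<^bsub>B\<^esub> b) \<ominus>\<^bsub>P\<^esub> c \<odot>\<^bsub>P\<^esub> pair_gen F a b | c a b.
        c \<in> carrier F \<and> a \<in> carrier A \<and> b \<in> carrier B})"

definition tensor_alg ::
    "('f, 'k) ring_scheme \<Rightarrow> ('f, 'a) module \<Rightarrow> ('f, 'b) module \<Rightarrow> ('f, ('a \<times> 'b \<Rightarrow> 'f) set) module" where
  "tensor_alg F A B = quot_alg (pair_algebra F A B)
     (module_span F (pair_algebra F A B) (tensor_relations F A B))"

text \<open>The linear map on a tensor product induced by a bilinear map \<open>\<phi>\<close> into \<open>M\<close>, whose
  value is the same on all representatives \<open>f\<close> of the class \<open>t\<close>.\<close>

definition tensor_lift ::
    "('f, 'k) ring_scheme \<Rightarrow> ('f, 'm) module \<Rightarrow> ('a \<Rightarrow> 'b \<Rightarrow> 'm) \<Rightarrow> ('a \<times> 'b \<Rightarrow> 'f) set \<Rightarrow> 'm" where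
  "tensor_lift F M \<phi> t =
     the_elem ((\<lambda>f. \<Oplus>\<^bsub>M\<^esub>p \<in> {p. f p \<noteq> \<zero>\<^bsub>F\<^esub>}. f p \<odot>\<^bsub>M\<^esub> \<phi> (fst p) (snd p)) ` t)"


section \<open>Etale algebras\<close>

text \<open>The derivative of a polynomial, given (as everywhere in HOL-Algebra's \<open>K[X]\<close>) by
  the list of its coefficients in descending order.\<close>

definition poly_deriv :: "('a, 'm) ring_scheme \<Rightarrow> 'a list \<Rightarrow> 'a list" where
  "poly_deriv R p = ring.normalize R
     (map (\<lambda>i. add_pow R (degree p - i) (p ! i)) [0..<degree p])"

definition separable_poly :: "('a, 'm) ring_scheme \<Rightarrow> 'a set \<Rightarrow> 'a list \<Rightarrow> bool" where
  "separable_poly L K p \<longleftrightarrow> (\<exists>u \<in> carrier (K[X]\<^bsub>L\<^esub>). \<exists>v \<in> carrier (K[X]\<^bsub>L\<^esub>).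
     u \<otimes>\<^bsub>K[X]\<^bsub>L\<^esub>\<^esub> p \<oplus>\<^bsub>K[X]\<^bsub>L\<^esub>\<^esub> v \<otimes>\<^bsub>K[X]\<^bsub>L\<^esub>\<^esub> poly_deriv L p = \<one>\<^bsub>K[X]\<^bsub>L\<^esub>\<^esub>)"

definition finite_separable_extension :: "('f, 'k) ring_scheme \<Rightarrow> ('f, 'a) module \<Rightarrow> bool" where
  "finite_separable_extension F L \<longleftrightarrow>
     field L \<and> algebra F L \<and> finite_dimensional F L \<and>
     (let K = (\<lambda>c. c \<odot>\<^bsub>L\<^esub> \<one>\<^bsub>L\<^esub>) ` carrier F
      in \<forall>x \<in> carrier L. separable_poly L K (ring.Irr L K x))"

definition product_alg :: "'i set \<Rightarrow> ('i \<Rightarrow> ('f, 'a) module) \<Rightarrow> ('f, 'i \<Rightarrow> 'a) module" where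
  "product_alg I L =
    \<lparr> carrier = (\<Pi>\<^sub>E i \<in> I. carrier (L i)),
      monoid.mult = (\<lambda>x y. \<lambda>i \<in> I. x i \<otimes>\<^bsub>L i\<^esub> y i),
      one = (\<lambda>i \<in> I. \<one>\<^bsub>L i\<^esub>),
      ring.zero = (\<lambda>i \<in> I. \<zero>\<^bsub>L i\<^esub>),
      add = (\<lambda>x y. \<lambda>i \<in> I. x i \<oplus>\<^bsub>L i\<^esub> y i),
      smult = (\<lambda>c x. \<lambda>i \<in> I. c \<odot>\<^bsub>L i\<^esub> x i) \<rparr>"

definition alg_iso :: "('f, 'k) ring_scheme \<Rightarrow> ('f, 'a) module \<Rightarrow> ('f, 'b) module \<Rightarrow> bool" where
  "alg_iso F A B \<longleftrightarrow> (\<exists>h \<in> ring_iso A B.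
     \<forall>c \<in> carrier F. \<forall>x \<in> carrier A. h (c \<odot>\<^bsub>A\<^esub> x) = c \<odot>\<^bsub>B\<^esub> h x)"

text \<open>It is no restriction that the factors live on the element type of \<open>K\<close>: each
  factor embeds into the product.\<close>

definition etale :: "('f, 'k) ring_scheme \<Rightarrow> ('f, 'a) module \<Rightarrow> bool" where
  "etale F K \<longleftrightarrow> (\<exists>(n::nat) (L :: nat \<Rightarrow> ('f, 'a) module).
     (\<forall>i<n. finite_separable_extension F (L i)) \<and> alg_iso F K (product_alg {..<n} L))"


section \<open>Semiassociative algebras\<close>

definition faithful :: "('r, 'k) ring_scheme \<Rightarrow> ('r, 'a) module \<Rightarrow> bool" where
  "faithful R M \<longleftrightarrow>
     (\<forall>r \<in> carrier R. (\<forall>x \<in> carrier M. r \<odot>\<^bsub>M\<^esub> x = \<zero>\<^bsub>M\<^esub>) \<longrightarrow> r = \<zero>\<^bsub>R\<^esub>)"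

definition minimally_faithful :: "('r, 'k) ring_scheme \<Rightarrow> ('r, 'a) module \<Rightarrow> bool" where
  "minimally_faithful R M \<longleftrightarrow> faithful R M \<and>
     (\<forall>N P. submodule N R M \<and> submodule P R M \<and> P \<subseteq> N \<and>
        faithful R (quot_alg (M\<lparr>carrier := N\<rparr>) P) \<longrightarrow> N = carrier M \<and> P = {\<zero>\<^bsub>M\<^esub>})"

text \<open>\<open>A\<close> with the action \<open>(k \<otimes> k') a = k a k'\<close> of the tensor square of a subset of its
  nucleus.\<close>

definition bimodule ::
    "('f, 'k) ring_scheme \<Rightarrow> ('f, 'a) module \<Rightarrow> (('a \<times> 'a \<Rightarrow> 'f) set, 'a) module" where
  "bimodule F A =
    \<lparr> carrier = carrier A, monoid.mult = monoid.mult A, one = \<one>\<^bsub>A\<^esub>, ring.zero = \<zero>\<^bsub>A\<^esub>, add = add A,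
      smult = (\<lambda>t a. tensor_lift F A (\<lambda>k k'. k \<otimes>\<^bsub>A\<^esub> a \<otimes>\<^bsub>A\<^esub> k') t) \<rparr>"

definition semiassociative :: "('f, 'k) ring_scheme \<Rightarrow> ('f, 'a) module \<Rightarrow> bool" where
  "semiassociative F A \<longleftrightarrow>
     nonassoc_algebra F A \<and> finite_dimensional F A \<and> central F A \<and>
     (\<exists>K. K \<subseteq> nucleus A \<and> subalgebra F A K \<and> etale F (A\<lparr>carrier := K\<rparr>) \<and>
        minimally_faithful (tensor_alg F (A\<lparr>carrier := K\<rparr>) (A\<lparr>carrier := K\<rparr>)) (bimodule F A))"


section \<open>Atoms\<close>

definition left_ideal :: "'a set \<Rightarrow> ('a, 'm) ring_scheme \<Rightarrow> bool" where
  "left_ideal I R \<longleftrightarrow>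
     additive_subgroup I R \<and> (\<forall>r \<in> carrier R. \<forall>x \<in> I. r \<otimes>\<^bsub>R\<^esub> x \<in> I)"

definition maximal_left_ideal :: "'a set \<Rightarrow> ('a, 'm) ring_scheme \<Rightarrow> bool" where
  "maximal_left_ideal I R \<longleftrightarrow> left_ideal I R \<and> I \<noteq> carrier R \<and>
     (\<forall>J. left_ideal J R \<and> I \<subseteq> J \<longrightarrow> J = I \<or> J = carrier R)"

definition jacobson_radical :: "('a, 'm) ring_scheme \<Rightarrow> 'a set" where
  "jacobson_radical R = carrier R \<inter> \<Inter> {I. maximal_left_ideal I R}"

definition sigma_alg :: "('f, 'a) module \<Rightarrow> ('f, 'a set) module" where
  "sigma_alg A = (let N = A\<lparr>carrier := nucleus A\<rparr> in quot_alg N (jacobson_radical N))"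

definition minimal_ideal :: "'a set \<Rightarrow> ('a, 'm) ring_scheme \<Rightarrow> bool" where
  "minimal_ideal I S \<longleftrightarrow> ideal I S \<and> I \<noteq> {\<zero>\<^bsub>S\<^esub>} \<and>
     (\<forall>J. ideal J S \<and> J \<subseteq> I \<longrightarrow> J = {\<zero>\<^bsub>S\<^esub>} \<or> J = I)"

text \<open>The simple components of a semisimple algebra are its minimal two-sided ideals; each
  is an algebra with an identity element of its own.\<close>

definition simple_components :: "('f, 'a) module \<Rightarrow> ('f, 'a) module set" where
  "simple_components S =
     {S\<lparr>carrier := I, one := (THE e. e \<in> I \<and> (\<forall>x \<in> I. e \<otimes>\<^bsub>S\<^esub> x = x \<and> x \<otimes>\<^bsub>S\<^esub> e = x))\<rparr> | I.
        minimal_ideal I S}"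

definition atoms :: "('f, 'a) module \<Rightarrow> ('f, 'a set) module set" where
  "atoms A = simple_components (sigma_alg A)"

definition semicentral :: "('f, 'k) ring_scheme \<Rightarrow> ('f, 'a) module \<Rightarrow> bool" where
  "semicentral F A \<longleftrightarrow> semiassociative F A \<and> (\<forall>B \<in> atoms A. central F B)"

end

theory Submission
  imports Defs
begin

text \<open>
  Thanks to a separability element, every ideal of the etale algebra \<open>K \<otimes> K\<close> is
  generated by an idempotent; hence the bimodule of a semiassociative algebra is minimally faithful
  over it precisely if free of rank one, and freeness is inherited by the tensor
  product, with \<open>K \<otimes> L\<close> as the etale subalgebra. Contracting with linear forms shows that
  the nucleus of \<open>A \<otimes> B\<close> is the tensor product of the nuclei. So \<open>\<sigma>(A \<otimes> B)\<close>
  is spanned by the products of the commuting images of \<open>\<sigma>(A)\<close> and \<open>\<sigma>(B)\<close>. A simple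
  component of it is fixed by the identities of one atom of \<open>A\<close> and one atom of \<open>B\<close>; since
  these are central simple, multiplication operators realise every linear form on them, and applied
  to a central element of the component they turn it into a scalar.
\<close>

section \<open>Linear algebra\<close>

text \<open>Two of the defining conditions do not tensor well as they stand. A tensor product of
  separable extension fields is in general no field, so \<open>etale\<close> is traded for the
  existence of a separability element, which is multiplicative. In a field factor such an element is
  the Bezoutian of a minimal polynomial divided by its derivative. The way back to
  \<open>etale\<close> rests on the same Bezoutian: if the derivative vanished, it would be a
  nonzero nilpotent in an algebra that has a separability element and is therefore reduced. Minimal
  faithfulness speaks of all sections of a module, whereas a free generator can simply be multiplied
  with another one.

  For the atoms, the radical of the nucleus of the tensor product is never computed. It is enough
  that the radicals of both nuclei map into it. After that only two commuting images that span are
  known. Such a span may satisfy further relations, so linear maps on the factors cannot simply be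
  tensored there; multiplication operators can be lifted, and this is why linear forms have to be
  realised by them.\<close>

definition lsum :: "('a, 'm) ring_scheme \<Rightarrow> 'a list \<Rightarrow> 'a" where
  "lsum M xs = foldr (add M) xs \<zero>\<^bsub>M\<^esub>"

lemma lsum_Nil [simp]: "lsum M [] = \<zero>\<^bsub>M\<^esub>"
  and lsum_Cons [simp]: "lsum M (x # xs) = x \<oplus>\<^bsub>M\<^esub> lsum M xs"
  by (simp_all add: lsum_def)

context abelian_monoid
begin

lemma lsum_closed [simp, intro]: "set xs \<subseteq> carrier G \<Longrightarrow> lsum G xs \<in> carrier G"
  by (induction xs) auto

lemma lsum_map_closed [simp, intro]:
  "(\<And>x. x \<in> set xs \<Longrightarrow> f x \<in> carrier G) \<Longrightarrow> lsum G (map f xs) \<in> carrier G"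
  by (rule lsum_closed) auto

lemma lsum_append:
  "set xs \<subseteq> carrier G \<Longrightarrow> set ys \<subseteq> carrier G \<Longrightarrow> lsum G (xs @ ys) = lsum G xs \<oplus> lsum G ys"
  by (induction xs) (auto simp: a_assoc)

lemma lsum_map_zero: "(\<And>x. x \<in> set xs \<Longrightarrow> f x = \<zero>) \<Longrightarrow> lsum G (map f xs) = \<zero>"
  by (induction xs) auto

lemma lsum_map_add:
  "(\<And>x. x \<in> set xs \<Longrightarrow> f x \<in> carrier G) \<Longrightarrow> (\<And>x. x \<in> set xs \<Longrightarrow> g x \<in> carrier G) \<Longrightarrow>
   lsum G (map (\<lambda>x. f x \<oplus> g x) xs) = lsum G (map f xs) \<oplus> lsum G (map g xs)"
  by (induction xs) (auto simp: a_ac)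

lemma lsum_swap:
  "(\<And>x y. x \<in> set xs \<Longrightarrow> y \<in> set ys \<Longrightarrow> f x y \<in> carrier G) \<Longrightarrow>
   lsum G (map (\<lambda>x. lsum G (map (f x) ys)) xs) = lsum G (map (\<lambda>y. lsum G (map (\<lambda>x. f x y) xs)) ys)"
proof (induction xs)
  case Nil
  thus ?case by (simp add: lsum_map_zero)
next
  case (Cons x xs)
  thus ?case by (simp add: lsum_map_add)
qed

lemma lsum_product:
  assumes "\<And>x y. x \<in> set xs \<Longrightarrow> y \<in> set ys \<Longrightarrow> f x y \<in> carrier G"
  shows "lsum G (map (\<lambda>(x, y). f x y) (List.product xs ys))
    = lsum G (map (\<lambda>x. lsum G (map (f x) ys)) xs)"
  using assms
proof (induction xs)
  case (Cons x xs)
  have "lsum G (map (f x) ys @ map (\<lambda>(x, y). f x y) (List.product xs ys)) =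
     lsum G (map (f x) ys) \<oplus> lsum G (map (\<lambda>(x, y). f x y) (List.product xs ys))"
    using Cons.prems by (intro lsum_append) auto
  moreover have "lsum G (map (\<lambda>(x, y). f x y) (List.product xs ys))
    = lsum G (map (\<lambda>x. lsum G (map (f x) ys)) xs)"
    using Cons.prems by (intro Cons.IH) auto
  moreover have "map (\<lambda>(a, y). f a y) (List.product (x # xs) ys)
    = map (f x) ys @ map (\<lambda>(x, y). f x y) (List.product xs ys)"
    by simp
  ultimately show ?case by (simp del: List.product.simps map_append)
qed simp

end

lemma (in abelian_group) a_inv_zero [simp]: "\<ominus> \<zero> = \<zero>"
  by (rule minus_equality) auto

lemma (in abelian_group) a_minus_zero [simp]: "x \<in> carrier G \<Longrightarrow> x \<ominus> \<zero> = x"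
  by (simp add: a_minus_def)

lemma (in abelian_group) minus_eq_minus:
  assumes "u \<oplus> a = v \<oplus> b" "u \<in> carrier G" "v \<in> carrier G" "a \<in> carrier G" "b \<in> carrier G"
  shows "a \<ominus> b = v \<ominus> u"
proof -
  have "a \<ominus> b = \<ominus> u \<oplus> (u \<oplus> a) \<ominus> b"
    using assms(2-) by (simp add: a_minus_def r_neg1)
  also have "\<dots> = \<ominus> u \<oplus> v \<oplus> (b \<ominus> b)"
    unfolding assms(1) using assms(2-) by (simp add: a_minus_def a_assoc)
  also have "\<dots> = v \<ominus> u"
    using assms(2-) by (simp add: a_minus_def r_neg a_comm)
  finally show ?thesis .
qed

text \<open>Linear forms become a special case of linear maps: a form on \<open>V\<close> is a map
  with \<open>lin F V (self_mod F)\<close>.\<close>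

definition self_mod :: "('f, 'k) ring_scheme \<Rightarrow> ('f, 'f) module" where
  "self_mod F = \<lparr>carrier = carrier F, monoid.mult = monoid.mult F, one = \<one>\<^bsub>F\<^esub>,
     ring.zero = \<zero>\<^bsub>F\<^esub>, add = add F, smult = monoid.mult F\<rparr>"

lemma self_mod_simps [simp]:
  "carrier (self_mod F) = carrier F" "monoid.mult (self_mod F) = monoid.mult F"
  "\<one>\<^bsub>self_mod F\<^esub> = \<one>\<^bsub>F\<^esub>" "\<zero>\<^bsub>self_mod F\<^esub> = \<zero>\<^bsub>F\<^esub>" "add (self_mod F) = add F"
  "smult (self_mod F) = monoid.mult F"
  by (simp_all add: self_mod_def)

lemma a_inv_self_mod [simp]: "\<ominus>\<^bsub>self_mod F\<^esub> x = \<ominus>\<^bsub>F\<^esub> x"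
  and a_minus_self_mod [simp]: "x \<ominus>\<^bsub>self_mod F\<^esub> y = x \<ominus>\<^bsub>F\<^esub> y"
  by (simp_all add: a_minus_def a_inv_def m_inv_def)

lemma (in cring) module_self_mod: "module R (self_mod R)"
proof (rule moduleI)
  show "abelian_group (self_mod R)"
    by (rule abelian_groupI) (auto simp: a_ac intro: l_neg bexI[of _ "\<ominus> _"])
qed (auto simp: l_distr r_distr m_assoc is_cring)

definition lin :: "('f, 'k) ring_scheme \<Rightarrow> ('f, 'v) module \<Rightarrow> ('f, 'w) module \<Rightarrow> ('v \<Rightarrow> 'w) \<Rightarrow> bool" where
  "lin F V W h \<longleftrightarrow> h \<in> carrier V \<rightarrow> carrier W \<and>
     (\<forall>x\<in>carrier V. \<forall>y\<in>carrier V. h (x \<oplus>\<^bsub>V\<^esub> y) = h x \<oplus>\<^bsub>W\<^esub> h y) \<and>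
     (\<forall>c\<in>carrier F. \<forall>x\<in>carrier V. h (c \<odot>\<^bsub>V\<^esub> x) = c \<odot>\<^bsub>W\<^esub> h x)"

lemma linI:
  assumes "\<And>x. x \<in> carrier V \<Longrightarrow> h x \<in> carrier W"
    "\<And>x y. x \<in> carrier V \<Longrightarrow> y \<in> carrier V \<Longrightarrow> h (x \<oplus>\<^bsub>V\<^esub> y) = h x \<oplus>\<^bsub>W\<^esub> h y"
    "\<And>c x. c \<in> carrier F \<Longrightarrow> x \<in> carrier V \<Longrightarrow> h (c \<odot>\<^bsub>V\<^esub> x) = c \<odot>\<^bsub>W\<^esub> h x"
  shows "lin F V W h"
  using assms by (auto simp: lin_def)

lemma lin_closed: "lin F V W h \<Longrightarrow> x \<in> carrier V \<Longrightarrow> h x \<in> carrier W"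
  and lin_add: "lin F V W h \<Longrightarrow> x \<in> carrier V \<Longrightarrow> y \<in> carrier V \<Longrightarrow> h (x \<oplus>\<^bsub>V\<^esub> y) = h x \<oplus>\<^bsub>W\<^esub> h y"
  and lin_smult: "lin F V W h \<Longrightarrow> c \<in> carrier F \<Longrightarrow> x \<in> carrier V \<Longrightarrow> h (c \<odot>\<^bsub>V\<^esub> x) = c \<odot>\<^bsub>W\<^esub> h x"
  by (auto simp: lin_def)

text \<open>Restricts \<open>M\<close> to plain \<open>module\<close> records, the type on which
  \<open>module_span\<close> and \<open>quot_alg\<close> are defined.\<close>

locale rmodule = module R M
  for R :: "('r, 'k) ring_scheme" (structure) and M :: "('r, 'a) module" (structure)

locale vspace = R?: field F + rmodule F V
  for F :: "('f, 'k) ring_scheme" (structure) and V :: "('f, 'v) module" (structure)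


lemma (in field) vspace_self_mod: "vspace R (self_mod R)"
  using module_self_mod field_axioms by (simp add: vspace_def rmodule_def)

locale lin_map = V: vspace F V + W: vspace F W
  for F :: "('f, 'k) ring_scheme" (structure) and V :: "('f, 'v) module" (structure)
    and W :: "('f, 'w) module" (structure) +
  fixes h assumes lin: "lin F V W h"
begin

lemma closed [simp, intro]: "x \<in> carrier V \<Longrightarrow> h x \<in> carrier W"
  and add [simp]: "x \<in> carrier V \<Longrightarrow> y \<in> carrier V \<Longrightarrow> h (x \<oplus>\<^bsub>V\<^esub> y) = h x \<oplus>\<^bsub>W\<^esub> h y"
  and smult [simp]: "c \<in> carrier F \<Longrightarrow> x \<in> carrier V \<Longrightarrow> h (c \<odot>\<^bsub>V\<^esub> x) = c \<odot>\<^bsub>W\<^esub> h x"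
  using lin by (auto simp: lin_def)

lemma zero [simp]: "h \<zero>\<^bsub>V\<^esub> = \<zero>\<^bsub>W\<^esub>"
  using smult[of "\<zero>\<^bsub>F\<^esub>" "\<zero>\<^bsub>V\<^esub>"] by (simp del: smult)

lemma neg [simp]: "x \<in> carrier V \<Longrightarrow> h (\<ominus>\<^bsub>V\<^esub> x) = \<ominus>\<^bsub>W\<^esub> h x"
  by (metis W.M.minus_equality add closed V.M.a_inv_closed V.M.l_neg zero)

lemma minus [simp]: "x \<in> carrier V \<Longrightarrow> y \<in> carrier V \<Longrightarrow> h (x \<ominus>\<^bsub>V\<^esub> y) = h x \<ominus>\<^bsub>W\<^esub> h y"
  by (simp add: a_minus_def)

lemma lsum: "set xs \<subseteq> carrier V \<Longrightarrow> h (lsum V xs) = lsum W (map h xs)"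
  by (induction xs) auto

lemma kernel_submodule: "submodule {x \<in> carrier V. h x = \<zero>\<^bsub>W\<^esub>} F V"
  by (rule V.submoduleI) auto

lemma image_submodule:
  assumes U: "submodule U F V"
  shows "submodule (h ` U) F W"
proof (rule W.submoduleI)
  note s = V.submoduleE[OF U]
  show "h ` U \<subseteq> carrier W" using s(1) by auto
  have "\<zero>\<^bsub>V\<^esub> \<in> U" using subgroup.one_closed[OF submodule.axioms(1)[OF U]] by simp
  thus "\<zero>\<^bsub>W\<^esub> \<in> h ` U" using zero by (metis imageI)
  show "\<ominus>\<^bsub>W\<^esub> a \<in> h ` U" if a: "a \<in> h ` U" for a
  proof -
    from a obtain x where "x \<in> U" "a = h x" by blast
    hence "\<ominus>\<^bsub>V\<^esub> x \<in> U" "\<ominus>\<^bsub>W\<^esub> a = h (\<ominus>\<^bsub>V\<^esub> x)" using s(1) s(3)[of x] by auto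
    thus ?thesis by blast
  qed
  show "a \<oplus>\<^bsub>W\<^esub> b \<in> h ` U" if ab: "a \<in> h ` U" "b \<in> h ` U" for a b
  proof -
    from ab obtain x y where "x \<in> U" "a = h x" "y \<in> U" "b = h y" by blast
    hence "x \<oplus>\<^bsub>V\<^esub> y \<in> U" "a \<oplus>\<^bsub>W\<^esub> b = h (x \<oplus>\<^bsub>V\<^esub> y)" using s(1) s(5)[of x y] by (auto simp: subset_iff)
    thus ?thesis by blast
  qed
  show "c \<odot>\<^bsub>W\<^esub> b \<in> h ` U" if cb: "c \<in> carrier F" "b \<in> h ` U" for c b
  proof -
    from cb obtain y where "y \<in> U" "b = h y" by blast
    hence "c \<odot>\<^bsub>V\<^esub> y \<in> U" "c \<odot>\<^bsub>W\<^esub> b = h (c \<odot>\<^bsub>V\<^esub> y)" using cb s(1) s(4)[of c y] by (auto simp: subset_iff)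
    thus ?thesis by blast
  qed
qed

end

lemma lin_mapI: "vspace F V \<Longrightarrow> vspace F W \<Longrightarrow> lin F V W h \<Longrightarrow> lin_map F V W h"
  by (simp add: lin_map_def lin_map_axioms_def)

lemma lin_comp: "lin F V W g \<Longrightarrow> lin F W Y h \<Longrightarrow> lin F V Y (\<lambda>x. h (g x))"
  by (auto simp: lin_def Pi_iff)

lemma lin_id: "lin F V V (\<lambda>x. x)"
  by (auto simp: lin_def)

section \<open>Submodules and spans\<close>

context module
begin

lemma submodule_zero: "submodule N R M \<Longrightarrow> \<zero>\<^bsub>M\<^esub> \<in> N"
  using submodule.axioms(1) subgroup.one_closed by fastforce

lemma submodule_subset: "submodule N R M \<Longrightarrow> N \<subseteq> carrier M"
  and submodule_add: "submodule N R M \<Longrightarrow> x \<in> N \<Longrightarrow> y \<in> N \<Longrightarrow> x \<oplus>\<^bsub>M\<^esub> y \<in> N"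
  and submodule_neg: "submodule N R M \<Longrightarrow> x \<in> N \<Longrightarrow> \<ominus>\<^bsub>M\<^esub> x \<in> N"
  and submodule_smult: "submodule N R M \<Longrightarrow> c \<in> carrier R \<Longrightarrow> x \<in> N \<Longrightarrow> c \<odot>\<^bsub>M\<^esub> x \<in> N"
  using submoduleE(1)[of N] submoduleE(5)[of N x y] submoduleE(3)[of N x] submoduleE(4)[of N c x]
  by simp_all

lemma submodule_mem: "submodule N R M \<Longrightarrow> x \<in> N \<Longrightarrow> x \<in> carrier M"
  using submodule_subset by blast

lemma submodule_minus: "submodule N R M \<Longrightarrow> x \<in> N \<Longrightarrow> y \<in> N \<Longrightarrow> x \<ominus>\<^bsub>M\<^esub> y \<in> N"
  by (simp add: a_minus_def submodule_add submodule_neg)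

lemma submodule_lsum: "submodule N R M \<Longrightarrow> set xs \<subseteq> N \<Longrightarrow> lsum M xs \<in> N"
  by (induction xs) (auto simp: submodule_zero submodule_add)

lemma submodule_zero_set: "submodule {\<zero>\<^bsub>M\<^esub>} R M"
  by (rule submoduleI) auto

lemma submodule_Int: "submodule N R M \<Longrightarrow> submodule P R M \<Longrightarrow> submodule (N \<inter> P) R M"
  by (rule submoduleI) (auto simp: submodule_zero submodule_add submodule_neg submodule_smult submodule_mem)

lemma submodule_sum:
  assumes U: "submodule U R M" and V: "submodule V R M"
  shows "submodule {u \<oplus>\<^bsub>M\<^esub> v | u v. u \<in> U \<and> v \<in> V} R M" (is "submodule ?W R M")
proof (rule submoduleI)
  note mem = submodule_mem[OF U] submodule_mem[OF V]
  show "?W \<subseteq> carrier M" using mem by auto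
  show "\<zero>\<^bsub>M\<^esub> \<in> ?W"
  proof (intro CollectI exI conjI)
    show "\<zero>\<^bsub>M\<^esub> = \<zero>\<^bsub>M\<^esub> \<oplus>\<^bsub>M\<^esub> \<zero>\<^bsub>M\<^esub>" by simp
  qed (use submodule_zero U V in auto)
  show "\<ominus>\<^bsub>M\<^esub> a \<in> ?W" if a: "a \<in> ?W" for a
  proof -
    obtain u v where uv: "u \<in> U" "v \<in> V" "a = u \<oplus>\<^bsub>M\<^esub> v" using a by blast
    hence "\<ominus>\<^bsub>M\<^esub> a = (\<ominus>\<^bsub>M\<^esub> u) \<oplus>\<^bsub>M\<^esub> (\<ominus>\<^bsub>M\<^esub> v)" using mem by (simp add: M.minus_add)
    thus ?thesis using uv submodule_neg[OF U uv(1)] submodule_neg[OF V uv(2)] by blast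
  qed
  show "a \<oplus>\<^bsub>M\<^esub> b \<in> ?W" if a: "a \<in> ?W" and b: "b \<in> ?W" for a b
  proof -
    obtain u v where uv: "u \<in> U" "v \<in> V" "a = u \<oplus>\<^bsub>M\<^esub> v" using a by blast
    obtain u' v' where uv': "u' \<in> U" "v' \<in> V" "b = u' \<oplus>\<^bsub>M\<^esub> v'" using b by blast
    have "a \<oplus>\<^bsub>M\<^esub> b = (u \<oplus>\<^bsub>M\<^esub> u') \<oplus>\<^bsub>M\<^esub> (v \<oplus>\<^bsub>M\<^esub> v')" using uv uv' mem by (simp add: M.a_ac)
    thus ?thesis using submodule_add[OF U uv(1) uv'(1)] submodule_add[OF V uv(2) uv'(2)] by blast
  qed
  show "c \<odot>\<^bsub>M\<^esub> a \<in> ?W" if c: "c \<in> carrier R" and a: "a \<in> ?W" for c a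
  proof -
    obtain u v where uv: "u \<in> U" "v \<in> V" "a = u \<oplus>\<^bsub>M\<^esub> v" using a by blast
    hence "c \<odot>\<^bsub>M\<^esub> a = c \<odot>\<^bsub>M\<^esub> u \<oplus>\<^bsub>M\<^esub> c \<odot>\<^bsub>M\<^esub> v" using mem c by (simp add: smult_r_distr)
    thus ?thesis using uv submodule_smult[OF U c uv(1)] submodule_smult[OF V c uv(2)] by blast
  qed
qed

lemma smult_lsum:
  "c \<in> carrier R \<Longrightarrow> set xs \<subseteq> carrier M \<Longrightarrow> c \<odot>\<^bsub>M\<^esub> lsum M xs = lsum M (map (\<lambda>x. c \<odot>\<^bsub>M\<^esub> x) xs)"
  by (induction xs) (auto simp: smult_r_distr)

end

context rmodule
begin

lemma module_span_submodule:
  assumes "S \<subseteq> carrier M"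
  shows "submodule (module_span R M S) R M"
proof (rule submoduleI)
  show "module_span R M S \<subseteq> carrier M"
    using carrier_is_submodule assms by (auto simp: module_span_def)
qed (auto simp: module_span_def submodule_zero submodule_add submodule_neg submodule_smult)

lemma module_span_base: "x \<in> S \<Longrightarrow> x \<in> module_span R M S"
  by (auto simp: module_span_def)

lemma module_span_least: "submodule N R M \<Longrightarrow> S \<subseteq> N \<Longrightarrow> module_span R M S \<subseteq> N"
  by (auto simp: module_span_def)

end

lemma (in vspace) eq_minus_zero:
  "x \<in> carrier V \<Longrightarrow> y \<in> carrier V \<Longrightarrow> x \<ominus>\<^bsub>V\<^esub> y = \<zero>\<^bsub>V\<^esub> \<longleftrightarrow> x = y"
  by (metis M.minus_eq M.minus_equality M.minus_minus M.r_neg M.a_inv_closed)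

section \<open>Frames and linear forms\<close>

context vspace
begin

lemma smult_inv: "c \<in> carrier F \<Longrightarrow> c \<noteq> \<zero> \<Longrightarrow> x \<in> carrier V \<Longrightarrow> inv c \<odot>\<^bsub>V\<^esub> (c \<odot>\<^bsub>V\<^esub> x) = x"
  using field_Units by (simp add: smult_assoc1[symmetric])

lemma smult_eq_zero: "c \<in> carrier F \<Longrightarrow> x \<in> carrier V \<Longrightarrow> c \<odot>\<^bsub>V\<^esub> x = \<zero>\<^bsub>V\<^esub> \<Longrightarrow> c = \<zero> \<or> x = \<zero>\<^bsub>V\<^esub>"
proof (rule disjCI)
  assume a: "c \<in> carrier F" "x \<in> carrier V" "c \<odot>\<^bsub>V\<^esub> x = \<zero>\<^bsub>V\<^esub>" "x \<noteq> \<zero>\<^bsub>V\<^esub>"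
  show "c = \<zero>"
  proof (rule ccontr)
    assume "c \<noteq> \<zero>"
    hence "inv c \<odot>\<^bsub>V\<^esub> (c \<odot>\<^bsub>V\<^esub> x) = x" "inv c \<in> carrier F" using a smult_inv[of c x] field_Units by auto
    with a show False by simp
  qed
qed

lemma lin_plus: "lin F V V g \<Longrightarrow> lin F V V h \<Longrightarrow> lin F V V (\<lambda>v. g v \<oplus>\<^bsub>V\<^esub> h v)"
  by (rule linI) (auto simp: lin_closed lin_add lin_smult smult_r_distr M.a_ac)

lemma lin_diff: "lin F V V g \<Longrightarrow> lin F V V h \<Longrightarrow> lin F V V (\<lambda>v. g v \<ominus>\<^bsub>V\<^esub> h v)"
  by (rule linI)
    (auto simp: lin_closed lin_add lin_smult smult_r_distr smult_r_minus a_minus_def M.minus_add M.a_ac)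

lemma lin_lsum:
  "(\<And>x. x \<in> set xs \<Longrightarrow> lin F V V (g x)) \<Longrightarrow> lin F V V (\<lambda>v. lsum V (map (\<lambda>x. g x v) xs))"
proof (induction xs)
  case Nil
  thus ?case by (auto simp: lin_def)
next
  case (Cons x xs)
  thus ?case using lin_plus[of "g x" "\<lambda>v. lsum V (map (\<lambda>x. g x v) xs)"] by simp
qed

lemma lin_form_smult: "lin F V (self_mod F) \<phi> \<Longrightarrow> b \<in> carrier V \<Longrightarrow> lin F V V (\<lambda>v. \<phi> v \<odot>\<^bsub>V\<^esub> b)"
  using lin_closed[of F V "self_mod F" \<phi>]
  by (intro linI) (auto simp: lin_add lin_smult smult_l_distr smult_assoc1)

lemma lin_expansion:
  assumes "\<And>b \<phi>. (b, \<phi>) \<in> set fr \<Longrightarrow> b \<in> carrier V \<and> lin F V (self_mod F) \<phi>"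
  shows "lin F V V (\<lambda>v. lsum V (map (\<lambda>(b, \<phi>). \<phi> v \<odot>\<^bsub>V\<^esub> b) fr))"
  using assms
proof (induction fr)
  case Nil
  thus ?case by (auto simp: lin_def)
next
  case (Cons x fr)
  have "lin F V V (\<lambda>v. snd x v \<odot>\<^bsub>V\<^esub> fst x)"
    using Cons.prems[of "fst x" "snd x"] lin_form_smult by simp
  moreover have "lin F V V (\<lambda>v. lsum V (map (\<lambda>(b, \<phi>). \<phi> v \<odot>\<^bsub>V\<^esub> b) fr))"
    using Cons.prems by (intro Cons.IH) auto
  ultimately show ?case using lin_plus by (simp add: split_def)
qed

text \<open>Coordinates modulo \<open>U\<close> without choosing a basis: vectors with forms
  vanishing on \<open>U\<close> such that every \<open>v\<close> is its expansion up to
  \<open>U\<close>. The induction enlarges \<open>U\<close> by the first generator \<open>s\<close>;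
  a frame modulo the larger space becomes one modulo \<open>U\<close> when \<open>s\<close> is added
  together with a form that reads off its coefficient. Projections, separating forms and dual frames
  are all drawn from this.\<close>

lemma frame_mod:
  assumes "submodule U F V" "set ss \<subseteq> carrier V"
    and "\<And>N. submodule N F V \<Longrightarrow> U \<subseteq> N \<Longrightarrow> set ss \<subseteq> N \<Longrightarrow> N = carrier V"
  shows "\<exists>fr. (\<forall>(b, \<phi>) \<in> set fr. b \<in> carrier V \<and> lin F V (self_mod F) \<phi> \<and> (\<forall>u\<in>U. \<phi> u = \<zero>)) \<and>
    (\<forall>v\<in>carrier V. v \<ominus>\<^bsub>V\<^esub> lsum V (map (\<lambda>(b, \<phi>). \<phi> v \<odot>\<^bsub>V\<^esub> b) fr) \<in> U)"
  using assms
proof (induction ss arbitrary: U)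
  case Nil
  thus ?case by (intro exI[of _ "[]"]) (auto simp: a_minus_def submodule_mem)
next
  case (Cons s ss)
  note U = Cons.prems(1)
  have s: "s \<in> carrier V" using Cons by simp
  define U1 where "U1 = {u \<oplus>\<^bsub>V\<^esub> c \<odot>\<^bsub>V\<^esub> s | u c. u \<in> U \<and> c \<in> carrier F}"
  have "lin F (self_mod F) V (\<lambda>c. c \<odot>\<^bsub>V\<^esub> s)" using s by (intro linI) (auto simp: smult_l_distr smult_assoc1)
  then interpret l: lin_map F "self_mod F" V "\<lambda>c. c \<odot>\<^bsub>V\<^esub> s"
    by (intro lin_mapI R.vspace_self_mod vspace_axioms)
  have "U1 = {u \<oplus>\<^bsub>V\<^esub> w | u w. u \<in> U \<and> w \<in> (\<lambda>c. c \<odot>\<^bsub>V\<^esub> s) ` carrier (self_mod F)}" by (auto simp: U1_def)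
  hence U1: "submodule U1 F V"
    by (simp only:) (intro submodule_sum U l.image_submodule l.V.carrier_is_submodule)
  have UU1: "U \<subseteq> U1"
  proof
    fix u assume "u \<in> U"
    thus "u \<in> U1" using s submodule_mem[OF U] unfolding U1_def
      by (intro CollectI exI[of _ u] exI[of _ "\<zero>"]) auto
  qed
  have sU1: "s \<in> U1" using s submodule_zero[OF U] unfolding U1_def
    by (intro CollectI exI[of _ "\<zero>\<^bsub>V\<^esub>"] exI[of _ "\<one>"]) auto
  have "N = carrier V" if "submodule N F V" "U1 \<subseteq> N" "set ss \<subseteq> N" for N
    using Cons.prems(3)[of N] that UU1 sU1 by auto
  from Cons.IH[OF U1 _ this] Cons.prems(2) obtain fr where
    fr: "\<And>b \<phi>. (b, \<phi>) \<in> set fr \<Longrightarrow> b \<in> carrier V \<and> lin F V (self_mod F) \<phi> \<and> (\<forall>u\<in>U1. \<phi> u = \<zero>)"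
    and frU: "\<And>v. v \<in> carrier V \<Longrightarrow> v \<ominus>\<^bsub>V\<^esub> lsum V (map (\<lambda>(b, \<phi>). \<phi> v \<odot>\<^bsub>V\<^esub> b) fr) \<in> U1"
    by auto blast
  show ?case
  proof (cases "s \<in> U")
    case True
    have "U1 \<subseteq> U" using True submodule_add[OF U] submodule_smult[OF U] by (auto simp: U1_def)
    thus ?thesis using fr frU UU1 by (intro exI[of _ fr]) auto
  next
    case False
    have uniq: "c = c'" if "u \<oplus>\<^bsub>V\<^esub> c \<odot>\<^bsub>V\<^esub> s = u' \<oplus>\<^bsub>V\<^esub> c' \<odot>\<^bsub>V\<^esub> s" "u \<in> U" "u' \<in> U" "c \<in> carrier F" "c' \<in> carrier F"
      for u u' c c'
    proof (rule ccontr)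
      assume "c \<noteq> c'"
      define d where "d = c \<ominus> c'"
      have d: "d \<in> carrier F" "d \<noteq> \<zero>" using that \<open>c \<noteq> c'\<close> by (auto simp: d_def r_right_minus_eq)
      have uc: "u \<in> carrier V" "u' \<in> carrier V" using that submodule_mem[OF U] by auto
      have "d \<odot>\<^bsub>V\<^esub> s = c \<odot>\<^bsub>V\<^esub> s \<ominus>\<^bsub>V\<^esub> c' \<odot>\<^bsub>V\<^esub> s"
        using that s by (simp add: d_def a_minus_def smult_l_distr smult_l_minus)
      also have "\<dots> = u' \<ominus>\<^bsub>V\<^esub> u"
        by (rule M.minus_eq_minus) (use that uc s in auto)
      finally have "d \<odot>\<^bsub>V\<^esub> s \<in> U" using submodule_minus[OF U] that by simp
      hence "inv d \<odot>\<^bsub>V\<^esub> (d \<odot>\<^bsub>V\<^esub> s) \<in> U" using submodule_smult[OF U] d field_Units by auto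
      thus False using False d s by (simp add: smult_inv)
    qed
    \<comment> \<open>The coordinate along \<open>s\<close> on \<open>U1\<close>, which is the
      direct sum of \<open>U\<close> and the line of \<open>s\<close> in this case.\<close>
    define lam where "lam v = (THE c. c \<in> carrier F \<and> (\<exists>u\<in>U. v = u \<oplus>\<^bsub>V\<^esub> c \<odot>\<^bsub>V\<^esub> s))" for v
    have lam: "lam (u \<oplus>\<^bsub>V\<^esub> c \<odot>\<^bsub>V\<^esub> s) = c" if "u \<in> U" "c \<in> carrier F" for u c
      unfolding lam_def using that uniq by (intro the_equality) blast+
    have lam_U: "lam u = \<zero>" if "u \<in> U" for u
      using lam[OF that, of \<zero>] s that submodule_mem[OF U] by simp
    have lam_add: "lam (v \<oplus>\<^bsub>V\<^esub> w) = lam v \<oplus> lam w" if "v \<in> U1" "w \<in> U1" for v w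
    proof -
      from that obtain u c u' c' where *: "v = u \<oplus>\<^bsub>V\<^esub> c \<odot>\<^bsub>V\<^esub> s" "u \<in> U" "c \<in> carrier F"
        "w = u' \<oplus>\<^bsub>V\<^esub> c' \<odot>\<^bsub>V\<^esub> s" "u' \<in> U" "c' \<in> carrier F" by (auto simp: U1_def)
      hence "v \<oplus>\<^bsub>V\<^esub> w = (u \<oplus>\<^bsub>V\<^esub> u') \<oplus>\<^bsub>V\<^esub> (c \<oplus> c') \<odot>\<^bsub>V\<^esub> s" "u \<oplus>\<^bsub>V\<^esub> u' \<in> U" "c \<oplus> c' \<in> carrier F"
        using s submodule_mem[OF U] submodule_add[OF U]
        by (auto simp: smult_l_distr M.a_ac)
      thus ?thesis using * lam by auto
    qed
    have lam_smult: "lam (d \<odot>\<^bsub>V\<^esub> v) = d \<otimes> lam v" if "d \<in> carrier F" "v \<in> U1" for d v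
    proof -
      from that obtain u c where *: "v = u \<oplus>\<^bsub>V\<^esub> c \<odot>\<^bsub>V\<^esub> s" "u \<in> U" "c \<in> carrier F"
        by (auto simp: U1_def)
      hence "d \<odot>\<^bsub>V\<^esub> v = d \<odot>\<^bsub>V\<^esub> u \<oplus>\<^bsub>V\<^esub> (d \<otimes> c) \<odot>\<^bsub>V\<^esub> s" "d \<odot>\<^bsub>V\<^esub> u \<in> U" "d \<otimes> c \<in> carrier F"
        using s that submodule_mem[OF U] submodule_smult[OF U]
        by (auto simp: smult_r_distr smult_assoc1)
      thus ?thesis using * lam by auto
    qed
    have lam_closed: "lam v \<in> carrier F" if "v \<in> U1" for v
      using that lam by (auto simp: U1_def)
    \<comment> \<open>\<open>lam\<close> makes sense on \<open>U1\<close> only. Subtracting the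
      expansion maps \<open>V\<close> linearly into \<open>U1\<close> and fixes \<open>U1\<close>,
      where the forms of \<open>fr\<close> vanish; so \<open>lam (p v)\<close> extends
      \<open>lam\<close> to a form on \<open>V\<close>.\<close>
    define p where "p v = v \<ominus>\<^bsub>V\<^esub> lsum V (map (\<lambda>(b, \<phi>). \<phi> v \<odot>\<^bsub>V\<^esub> b) fr)" for v
    have pU1: "p v \<in> U1" if "v \<in> carrier V" for v using frU that by (simp add: p_def)
    have fr_c: "b \<in> carrier V" "v \<in> carrier V \<Longrightarrow> \<phi> v \<in> carrier F"
      "v \<in> carrier V \<Longrightarrow> \<phi> v \<odot>\<^bsub>V\<^esub> b \<in> carrier V"
      if "(b, \<phi>) \<in> set fr" for b \<phi> v
      using fr[OF that] lin_closed[of F V "self_mod F" \<phi>] by auto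
    have fr_s: "(case x of (b, \<phi>) \<Rightarrow> \<phi> v \<odot>\<^bsub>V\<^esub> b) \<in> carrier V" if "x \<in> set fr" "v \<in> carrier V" for x v
      by (cases x) (use that fr_c in auto)
    have "lin F V V p" unfolding p_def using fr by (intro lin_diff lin_id lin_expansion) auto
    note p_add = lin_add[OF this] and p_smult = lin_smult[OF this]
    define \<phi>0 where "\<phi>0 v = lam (p v)" for v
    have l0: "lin F V (self_mod F) \<phi>0"
      by (rule linI) (auto simp: \<phi>0_def p_add p_smult lam_add lam_smult pU1 lam_closed)
    have p_U: "p u = u" if "u \<in> U" for u
    proof -
      have uc: "u \<in> carrier V" using that submodule_mem[OF U] by simp
      have "lsum V (map (\<lambda>(b, \<phi>). \<phi> u \<odot>\<^bsub>V\<^esub> b) fr) = \<zero>\<^bsub>V\<^esub>"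
        using that UU1 by (intro lsum_map_zero) (auto simp: subset_iff dest!: fr)
      thus ?thesis using uc by (simp add: p_def M.minus_eq)
    qed
    show ?thesis
    proof (intro exI[of _ "(s, \<phi>0) # fr"] conjI ballI)
      fix x assume "x \<in> set ((s, \<phi>0) # fr)"
      thus "case x of (b, \<phi>) \<Rightarrow> b \<in> carrier V \<and> lin F V (self_mod F) \<phi> \<and> (\<forall>u\<in>U. \<phi> u = \<zero>)"
        using fr UU1 s l0 lam_U p_U by (auto simp: \<phi>0_def)
    next
      fix v assume v: "v \<in> carrier V"
      from pU1[OF v] obtain u c where *: "p v = u \<oplus>\<^bsub>V\<^esub> c \<odot>\<^bsub>V\<^esub> s" "u \<in> U" "c \<in> carrier F"
        by (auto simp: U1_def)
      have uc: "u \<in> carrier V" using * submodule_mem[OF U] by simp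
      define L where "L = lsum V (map (\<lambda>(b, \<phi>). \<phi> v \<odot>\<^bsub>V\<^esub> b) fr)"
      have L: "L \<in> carrier V" unfolding L_def using fr_s v by auto
      have "v \<ominus>\<^bsub>V\<^esub> lsum V (map (\<lambda>(b, \<phi>). \<phi> v \<odot>\<^bsub>V\<^esub> b) ((s, \<phi>0) # fr)) = v \<ominus>\<^bsub>V\<^esub> (c \<odot>\<^bsub>V\<^esub> s \<oplus>\<^bsub>V\<^esub> L)"
        using * lam by (simp add: \<phi>0_def L_def)
      also have "\<dots> = p v \<ominus>\<^bsub>V\<^esub> c \<odot>\<^bsub>V\<^esub> s"
        unfolding p_def L_def[symmetric] using v s L *(3) by (simp add: a_minus_def M.minus_add M.a_ac)
      also have "\<dots> = u"
        unfolding *(1) using uc s *(3) by (simp add: a_minus_def M.a_assoc M.r_neg)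
      finally show "v \<ominus>\<^bsub>V\<^esub> lsum V (map (\<lambda>(b, \<phi>). \<phi> v \<odot>\<^bsub>V\<^esub> b) ((s, \<phi>0) # fr)) \<in> U"
        using * by simp
    qed
  qed
qed

end

text \<open>A finite dual basis as in the dual basis lemma: the vectors are not asked to be
  independent, only the expansion of each \<open>v\<close> counts.\<close>

definition frame :: "('f, 'k) ring_scheme \<Rightarrow> ('f, 'v) module \<Rightarrow> ('v \<times> ('v \<Rightarrow> 'f)) list \<Rightarrow> bool" where
  "frame F V fr \<longleftrightarrow> (\<forall>(b, \<phi>) \<in> set fr. b \<in> carrier V \<and> lin F V (self_mod F) \<phi>) \<and>
     (\<forall>v\<in>carrier V. v = lsum V (map (\<lambda>(b, \<phi>). \<phi> v \<odot>\<^bsub>V\<^esub> b) fr))"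

lemma frameD:
  assumes "frame F V fr"
  shows "(b, \<phi>) \<in> set fr \<Longrightarrow> b \<in> carrier V" "(b, \<phi>) \<in> set fr \<Longrightarrow> lin F V (self_mod F) \<phi>"
    "v \<in> carrier V \<Longrightarrow> lsum V (map (\<lambda>(b, \<phi>). \<phi> v \<odot>\<^bsub>V\<^esub> b) fr) = v"
  using assms by (auto simp: frame_def)

section \<open>Finite-dimensional spaces\<close>

locale fin_dim = vspace +
  assumes fin: "finite_dimensional F V"
begin

lemma ex_frame_mod:
  assumes "submodule U F V"
  shows "\<exists>fr. (\<forall>(b, \<phi>) \<in> set fr. b \<in> carrier V \<and> lin F V (self_mod F) \<phi> \<and> (\<forall>u\<in>U. \<phi> u = \<zero>)) \<and>
    (\<forall>v\<in>carrier V. v \<ominus>\<^bsub>V\<^esub> lsum V (map (\<lambda>(b, \<phi>). \<phi> v \<odot>\<^bsub>V\<^esub> b) fr) \<in> U)"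
proof -
  from fin obtain S where S: "finite S" "S \<subseteq> carrier V" "module_span F V S = carrier V"
    by (auto simp: finite_dimensional_def)
  from S(1) obtain ss where ss: "set ss = S" using finite_list by blast
  show ?thesis
  proof (rule frame_mod[OF assms, of ss])
    fix N assume "submodule N F V" "set ss \<subseteq> N"
    thus "N = carrier V" using module_span_least[of N S] S ss submodule_subset[of N] by auto
  qed (use S ss in auto)
qed

lemma ex_frame: "\<exists>fr. frame F V fr"
proof -
  from ex_frame_mod[OF submodule_zero_set] obtain fr where
    fr: "\<forall>(b, \<phi>) \<in> set fr. b \<in> carrier V \<and> lin F V (self_mod F) \<phi>"
    and z: "\<And>v. v \<in> carrier V \<Longrightarrow> v \<ominus>\<^bsub>V\<^esub> lsum V (map (\<lambda>(b, \<phi>). \<phi> v \<odot>\<^bsub>V\<^esub> b) fr) = \<zero>\<^bsub>V\<^esub>"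
    by auto
  have "lsum V (map (\<lambda>(b, \<phi>). \<phi> v \<odot>\<^bsub>V\<^esub> b) fr) \<in> carrier V" if "v \<in> carrier V" for v
    using fr that lin_closed[of F V "self_mod F"] by (fastforce intro!: lsum_map_closed)
  hence "frame F V fr" using fr z eq_minus_zero by (auto simp: frame_def)
  thus ?thesis ..
qed

text \<open>A frame modulo \<open>U\<close> expands \<open>x\<close> up to an element of
  \<open>U\<close>. As \<open>x\<close> lies outside \<open>U\<close>, some form of the frame is
  nonzero at \<open>x\<close>, and it can be rescaled.\<close>

lemma ex_form:
  assumes "submodule U F V" "x \<in> carrier V" "x \<notin> U"
  shows "\<exists>\<phi>. lin F V (self_mod F) \<phi> \<and> (\<forall>u\<in>U. \<phi> u = \<zero>) \<and> \<phi> x = \<one>"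
proof -
  from ex_frame_mod[OF assms(1)] obtain fr where
    fr: "\<And>b \<phi>. (b, \<phi>) \<in> set fr \<Longrightarrow> b \<in> carrier V \<and> lin F V (self_mod F) \<phi> \<and> (\<forall>u\<in>U. \<phi> u = \<zero>)"
    and z: "x \<ominus>\<^bsub>V\<^esub> lsum V (map (\<lambda>(b, \<phi>). \<phi> x \<odot>\<^bsub>V\<^esub> b) fr) \<in> U" using assms(2) by auto blast
  have "\<exists>(b, \<phi>) \<in> set fr. \<phi> x \<noteq> \<zero>"
  proof (rule ccontr)
    assume "\<not> ?thesis"
    hence "lsum V (map (\<lambda>(b, \<phi>). \<phi> x \<odot>\<^bsub>V\<^esub> b) fr) = \<zero>\<^bsub>V\<^esub>"
      using fr by (intro lsum_map_zero) auto
    with z assms show False by (simp add: a_minus_def)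
  qed
  then obtain b \<phi> where b: "(b, \<phi>) \<in> set fr" "\<phi> x \<noteq> \<zero>" by auto
  hence l: "lin F V (self_mod F) \<phi>" and x: "\<phi> x \<in> carrier F"
    using fr lin_closed[of F V "self_mod F" \<phi> x] assms by auto
  have i: "inv (\<phi> x) \<in> carrier F" "inv (\<phi> x) \<otimes> \<phi> x = \<one>" using b x field_Units by auto
  have "lin F V (self_mod F) (\<lambda>v. inv (\<phi> x) \<otimes> \<phi> v)"
    using l i lin_closed[OF l] by (intro linI) (auto simp: lin_add lin_smult r_distr m_lcomm)
  moreover have "\<forall>u\<in>U. inv (\<phi> x) \<otimes> \<phi> u = \<zero>" using fr[OF b(1)] i by simp
  ultimately show ?thesis using i by (intro exI[of _ "\<lambda>v. inv (\<phi> x) \<otimes> \<phi> v"]) simp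
qed

text \<open>The remainder of the expansion in a frame modulo \<open>U\<close> lies in
  \<open>U\<close>, and on \<open>U\<close> there is nothing to subtract because all forms of the
  frame vanish there.\<close>

lemma ex_projection:
  assumes U: "submodule U F V"
  shows "\<exists>\<pi>. lin F V V \<pi> \<and> (\<forall>v\<in>carrier V. \<pi> v \<in> U) \<and> (\<forall>u\<in>U. \<pi> u = u)"
proof -
  from ex_frame_mod[OF U] obtain fr where
    fr: "\<And>b \<phi>. (b, \<phi>) \<in> set fr \<Longrightarrow> b \<in> carrier V \<and> lin F V (self_mod F) \<phi> \<and> (\<forall>u\<in>U. \<phi> u = \<zero>)"
    and z: "\<And>v. v \<in> carrier V \<Longrightarrow> v \<ominus>\<^bsub>V\<^esub> lsum V (map (\<lambda>(b, \<phi>). \<phi> v \<odot>\<^bsub>V\<^esub> b) fr) \<in> U"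
    by auto blast
  define \<pi> where "\<pi> v = v \<ominus>\<^bsub>V\<^esub> lsum V (map (\<lambda>(b, \<phi>). \<phi> v \<odot>\<^bsub>V\<^esub> b) fr)" for v
  have "lin F V V \<pi>" unfolding \<pi>_def using fr by (intro lin_diff lin_id lin_expansion) auto
  moreover have "\<pi> u = u" if "u \<in> U" for u
  proof -
    have "lsum V (map (\<lambda>(b, \<phi>). \<phi> u \<odot>\<^bsub>V\<^esub> b) fr) = \<zero>\<^bsub>V\<^esub>"
      using that by (intro lsum_map_zero) (auto dest!: fr)
    thus ?thesis using submodule_mem[OF U that] by (simp add: \<pi>_def a_minus_def)
  qed
  ultimately show ?thesis using z unfolding \<pi>_def by blast
qed

text \<open>The dimension of \<open>U\<close> is read off as the number of positions at which the coordinates of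
  an element of \<open>U\<close> can have their first nonzero entry.\<close>

lemma ex_dim:
  "\<exists>d (n :: nat). \<forall>U U'. submodule U F V \<longrightarrow> submodule U' F V \<longrightarrow>
     d U \<le> n \<and> (U \<subset> U' \<longrightarrow> d U < d U')"
proof -
  obtain fr where fr: "frame F V fr" using ex_frame by blast
  define n where "n = length fr"
  define c where "c i = snd (fr ! i)" for i
  have c: "lin F V (self_mod F) (c i)" if "i < n" for i
    using that frameD(2)[OF fr, of "fst (fr ! i)" "c i"] by (simp add: c_def n_def)
  define lead where "lead U = {i. i < n \<and> (\<exists>u\<in>U. (\<forall>j < i. c j u = \<zero>) \<and> c i u \<noteq> \<zero>)}" for U
  have fl: "lead U \<subseteq> {..<n}" for U by (auto simp: lead_def)
  have eq: "U' \<subseteq> U" if U: "submodule U F V" and U': "submodule U' F V" and "U \<subseteq> U'"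
    and l: "lead U' \<subseteq> lead U" for U U'
  proof -
    \<comment> \<open>Gaussian elimination: only the last \<open>k\<close> coordinates of
      \<open>v\<close> may be nonzero, and a multiple of an element of \<open>U\<close> with the
      same leading position removes one more of them.\<close>
    have "v \<in> U" if "v \<in> U'" "k \<le> n" "\<forall>j < n - k. c j v = \<zero>" for v k
      using that
    proof (induction k arbitrary: v)
      case 0
      hence "v \<in> carrier V" using submodule_mem[OF U'] by simp
      have "lsum V (map (\<lambda>(b, \<phi>). \<phi> v \<odot>\<^bsub>V\<^esub> b) fr) = \<zero>\<^bsub>V\<^esub>"
      proof (rule lsum_map_zero)
        fix x assume "x \<in> set fr"
        then obtain i where "i < n" "x = fr ! i" by (auto simp: in_set_conv_nth n_def)
        thus "(case x of (b, \<phi>) \<Rightarrow> \<phi> v \<odot>\<^bsub>V\<^esub> b) = \<zero>\<^bsub>V\<^esub>"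
          using 0 frameD(1)[OF fr, of "fst x" "snd x"] \<open>x \<in> set fr\<close> by (auto simp: c_def split_def)
      qed
      hence "v = \<zero>\<^bsub>V\<^esub>" using frameD(3)[OF fr \<open>v \<in> carrier V\<close>] by simp
      thus ?case using submodule_zero[OF U] by simp
    next
      case (Suc k)
      define i where "i = n - Suc k"
      have i: "i < n" "n - k = Suc i" using Suc by (auto simp: i_def)
      have vc: "v \<in> carrier V" using Suc submodule_mem[OF U'] by simp
      show ?case
      proof (cases "c i v = \<zero>")
        case True
        with Suc show ?thesis using i by (intro Suc.IH) (auto simp: less_Suc_eq i_def)
      next
        case False
        hence "i \<in> lead U'" using Suc i by (auto simp: lead_def i_def)
        with l have "i \<in> lead U" by blast
        then obtain u where u: "u \<in> U" "\<forall>j < i. c j u = \<zero>" "c i u \<noteq> \<zero>" by (auto simp: lead_def)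
        have uc: "u \<in> carrier V" using u submodule_mem[OF U] by simp
        have cc: "c j w \<in> carrier F" if "j < n" "w \<in> carrier V" for j w
          using lin_closed[OF c[OF that(1)] that(2)] by simp
        define d where "d = c i v \<otimes> inv (c i u)"
        have d: "d \<in> carrier F" "d \<otimes> c i u = c i v"
          using cc i u uc vc field_Units by (auto simp: d_def m_assoc)
        define w where "w = v \<ominus>\<^bsub>V\<^esub> d \<odot>\<^bsub>V\<^esub> u"
        have cw: "c j w = c j v \<ominus> d \<otimes> c j u" if "j < n" for j
        proof -
          interpret l: lin_map F V "self_mod F" "c j"
            using lin_mapI[OF vspace_axioms vspace_self_mod c[OF that]] .
          show ?thesis using l.minus[of v "d \<odot>\<^bsub>V\<^esub> u"] l.smult[of d u] uc vc d
            by (simp add: w_def)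
        qed
        have "w \<in> U"
        proof (rule Suc.IH)
          show "w \<in> U'" using Suc u d \<open>U \<subseteq> U'\<close> unfolding w_def
            by (intro submodule_minus[OF U'] submodule_smult[OF U']) auto
          show "\<forall>j < n - k. c j w = \<zero>"
          proof (intro allI impI)
            fix j assume j: "j < n - k"
            show "c j w = \<zero>"
            proof (cases "j = i")
              case True
              thus ?thesis using cw[of i] i d cc[OF i(1) vc] by (simp add: a_minus_def R.r_neg)
            next
              case False
              hence "j < i" using j i by simp
              thus ?thesis using cw[of j] i u d Suc.prems(3) by (simp add: a_minus_def i_def)
            qed
          qed
        qed (use Suc in auto)
        hence "w \<oplus>\<^bsub>V\<^esub> d \<odot>\<^bsub>V\<^esub> u \<in> U" using u d by (intro submodule_add[OF U] submodule_smult[OF U])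
        moreover have "w \<oplus>\<^bsub>V\<^esub> d \<odot>\<^bsub>V\<^esub> u = v" using vc uc d
          by (simp add: w_def a_minus_def M.a_assoc M.l_neg)
        ultimately show ?thesis by simp
      qed
    qed
    from this[of _ n] show ?thesis by auto
  qed
  have "card (lead U) \<le> n \<and> (U \<subset> U' \<longrightarrow> card (lead U) < card (lead U'))"
    if "submodule U F V" "submodule U' F V" for U U'
  proof (intro conjI impI)
    show "card (lead U) \<le> n" using card_mono[OF _ fl] by simp
    assume "U \<subset> U'"
    hence "lead U \<subseteq> lead U'" by (auto simp: lead_def)
    moreover have "lead U \<noteq> lead U'" using eq[OF that] \<open>U \<subset> U'\<close> by auto
    ultimately show "card (lead U) < card (lead U')"
      by (intro psubset_card_mono) (auto intro: finite_subset[OF fl])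
  qed
  thus ?thesis by (intro exI[of _ "\<lambda>U. card (lead U)"] exI[of _ n]) auto
qed

text \<open>The substitute for chain conditions. It will be applied to families of left ideals, of
  two-sided ideals and of annihilators, all of which consist of subspaces.\<close>

lemma ex_minimal_submodule:
  assumes "\<And>U. U \<in> \<U> \<Longrightarrow> submodule U F V" "U0 \<in> \<U>"
  shows "\<exists>U\<in>\<U>. \<forall>U' \<in> \<U>. U' \<subseteq> U \<longrightarrow> U' = U"
proof -
  obtain d n where d: "\<And>U U'. submodule U F V \<Longrightarrow> submodule U' F V \<Longrightarrow>
     d U \<le> n \<and> (U \<subset> U' \<longrightarrow> d U < (d U' :: nat))" using ex_dim by blast
  from ex_has_least_nat[of "\<lambda>U. U \<in> \<U>", OF assms(2), of d] obtain U where
    "U \<in> \<U>" "\<forall>U' \<in> \<U>. d U \<le> d U'" by auto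
  thus ?thesis using d assms(1) by (metis leD psubsetI)
qed

lemma ex_maximal_submodule:
  assumes "\<And>U. U \<in> \<U> \<Longrightarrow> submodule U F V" "U0 \<in> \<U>"
  shows "\<exists>U\<in>\<U>. \<forall>U' \<in> \<U>. U \<subseteq> U' \<longrightarrow> U' = U"
proof -
  obtain d n where d: "\<And>U U'. submodule U F V \<Longrightarrow> submodule U' F V \<Longrightarrow>
     d U \<le> n \<and> (U \<subset> U' \<longrightarrow> d U < (d U' :: nat))" using ex_dim by blast
  have "\<forall>U. U \<in> \<U> \<longrightarrow> d U \<le> n" using d assms(1) by blast
  with ex_has_greatest_nat[of "\<lambda>U. U \<in> \<U>", OF assms(2), of d "Suc n"] obtain U where
    "U \<in> \<U>" "\<forall>U' \<in> \<U>. d U' \<le> d U" by (auto simp: less_Suc_eq_le)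
  thus ?thesis using d assms(1) by (metis leD psubsetI)
qed

end

lemma fin_dim_image:
  assumes V: "fin_dim F V" and W: "vspace F W" and h: "lin F V W h" and onto: "h ` carrier V = carrier W"
  shows "fin_dim F W"
proof -
  interpret V: fin_dim F V by fact
  interpret h: lin_map F V W h using lin_mapI[OF V.vspace_axioms W h] .
  from V.fin obtain S where S: "finite S" "S \<subseteq> carrier V" "module_span F V S = carrier V"
    by (auto simp: finite_dimensional_def)
  have hS: "h ` S \<subseteq> carrier W" using S by auto
  have "carrier W \<subseteq> N" if N: "submodule N F W" "h ` S \<subseteq> N" for N
  proof -
    have "submodule {v \<in> carrier V. h v \<in> N} F V"
      using h.W.submodule_zero[OF N(1)] h.W.submodule_add[OF N(1)] h.W.submodule_neg[OF N(1)]
        h.W.submodule_smult[OF N(1)]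
      by (intro V.submoduleI) auto
    from V.module_span_least[OF this, of S] S N(2) have "carrier V \<subseteq> {v \<in> carrier V. h v \<in> N}"
      by auto
    hence "h ` carrier V \<subseteq> N" by (rule order_trans[OF image_mono]) auto
    thus ?thesis unfolding onto .
  qed
  hence "carrier W \<subseteq> module_span F W (h ` S)" unfolding module_span_def by blast
  hence "module_span F W (h ` S) = carrier W"
    using h.W.submodule_subset[OF h.W.module_span_submodule[OF hS]] by simp
  hence "finite_dimensional F W" using S(1) hS unfolding finite_dimensional_def
    by (intro exI[of _ "h ` S"]) auto
  thus ?thesis using W by (simp add: fin_dim_def fin_dim_axioms_def)
qed

text \<open>A subspace is the image of a projection, so it inherits finite generation as an
  image.\<close>

lemma fin_dim_submodule:
  assumes V: "fin_dim F V" and U: "submodule U F V"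
  shows "fin_dim F (V\<lparr>carrier := U\<rparr>)"
proof -
  interpret V: fin_dim F V by fact
  obtain \<pi> where p: "lin F V V \<pi>" "\<And>v. v \<in> carrier V \<Longrightarrow> \<pi> v \<in> U" "\<And>u. u \<in> U \<Longrightarrow> \<pi> u = u"
    using V.ex_projection[OF U] by blast
  have "module F (V\<lparr>carrier := U\<rparr>)" using submodule.submodule_is_module[OF U V.module_axioms] .
  hence W: "vspace F (V\<lparr>carrier := U\<rparr>)"
    using V.field_axioms by (simp add: vspace_def rmodule_def)
  show ?thesis
  proof (rule fin_dim_image[OF V W, of \<pi>])
    show "lin F V (V\<lparr>carrier := U\<rparr>) \<pi>" using p by (auto simp: lin_def)
    show "\<pi> ` carrier V = carrier (V\<lparr>carrier := U\<rparr>)"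
      using p V.submodule_subset[OF U] by (auto simp: image_iff subset_iff) metis
  qed
qed

section \<open>Quotients\<close>

locale falg = vspace F A + nonassoc_algebra F A
  for F :: "('f, 'k) ring_scheme" (structure) and A :: "('f, 'a) module" (structure)
begin

declare mult_closed [simp, intro] one_closed [simp, intro] one_left [simp] one_right [simp]

lemma lin_mult_left: "a \<in> carrier A \<Longrightarrow> lin F A A (\<lambda>x. a \<otimes>\<^bsub>A\<^esub> x)"
  by (rule linI) (auto simp: mult_add mult_smult)

lemma lin_mult_right: "a \<in> carrier A \<Longrightarrow> lin F A A (\<lambda>x. x \<otimes>\<^bsub>A\<^esub> a)"
  by (rule linI) (auto simp: add_mult smult_mult)

lemma lin_map_mult_left: "a \<in> carrier A \<Longrightarrow> lin_map F A A (\<lambda>x. a \<otimes>\<^bsub>A\<^esub> x)"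
  by (intro lin_mapI vspace_axioms lin_mult_left)

lemma lin_map_mult_right: "a \<in> carrier A \<Longrightarrow> lin_map F A A (\<lambda>x. x \<otimes>\<^bsub>A\<^esub> a)"
  by (intro lin_mapI vspace_axioms lin_mult_right)

lemma mult_zero [simp]: "a \<in> carrier A \<Longrightarrow> a \<otimes>\<^bsub>A\<^esub> \<zero>\<^bsub>A\<^esub> = \<zero>\<^bsub>A\<^esub>"
  and zero_mult [simp]: "a \<in> carrier A \<Longrightarrow> \<zero>\<^bsub>A\<^esub> \<otimes>\<^bsub>A\<^esub> a = \<zero>\<^bsub>A\<^esub>"
  using lin_map.zero[OF lin_map_mult_left] lin_map.zero[OF lin_map_mult_right] by auto

lemma mult_neg: "a \<in> carrier A \<Longrightarrow> x \<in> carrier A \<Longrightarrow> a \<otimes>\<^bsub>A\<^esub> (\<ominus>\<^bsub>A\<^esub> x) = \<ominus>\<^bsub>A\<^esub> (a \<otimes>\<^bsub>A\<^esub> x)"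
  and neg_mult: "a \<in> carrier A \<Longrightarrow> x \<in> carrier A \<Longrightarrow> (\<ominus>\<^bsub>A\<^esub> x) \<otimes>\<^bsub>A\<^esub> a = \<ominus>\<^bsub>A\<^esub> (x \<otimes>\<^bsub>A\<^esub> a)"
  using lin_map.neg[OF lin_map_mult_left] lin_map.neg[OF lin_map_mult_right] by auto

lemma mult_minus: "a \<in> carrier A \<Longrightarrow> x \<in> carrier A \<Longrightarrow> y \<in> carrier A \<Longrightarrow>
    a \<otimes>\<^bsub>A\<^esub> (x \<ominus>\<^bsub>A\<^esub> y) = a \<otimes>\<^bsub>A\<^esub> x \<ominus>\<^bsub>A\<^esub> a \<otimes>\<^bsub>A\<^esub> y"
  and minus_mult: "a \<in> carrier A \<Longrightarrow> x \<in> carrier A \<Longrightarrow> y \<in> carrier A \<Longrightarrow>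
    (x \<ominus>\<^bsub>A\<^esub> y) \<otimes>\<^bsub>A\<^esub> a = x \<otimes>\<^bsub>A\<^esub> a \<ominus>\<^bsub>A\<^esub> y \<otimes>\<^bsub>A\<^esub> a"
  using lin_map.minus[OF lin_map_mult_left] lin_map.minus[OF lin_map_mult_right] by auto

lemma mult_lsum: "a \<in> carrier A \<Longrightarrow> set xs \<subseteq> carrier A \<Longrightarrow>
    a \<otimes>\<^bsub>A\<^esub> lsum A xs = lsum A (map (\<lambda>x. a \<otimes>\<^bsub>A\<^esub> x) xs)"
  and lsum_mult: "a \<in> carrier A \<Longrightarrow> set xs \<subseteq> carrier A \<Longrightarrow>
    lsum A xs \<otimes>\<^bsub>A\<^esub> a = lsum A (map (\<lambda>x. x \<otimes>\<^bsub>A\<^esub> a) xs)"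
  using lin_map.lsum[OF lin_map_mult_left] lin_map.lsum[OF lin_map_mult_right] by auto

lemma smult_one_mult: "c \<in> carrier F \<Longrightarrow> x \<in> carrier A \<Longrightarrow> (c \<odot>\<^bsub>A\<^esub> \<one>\<^bsub>A\<^esub>) \<otimes>\<^bsub>A\<^esub> x = c \<odot>\<^bsub>A\<^esub> x"
  by (simp add: smult_mult)

end

lemma falgI: "nonassoc_algebra F A \<Longrightarrow> falg F A"
  by (simp add: falg_def vspace_def rmodule_def nonassoc_algebra_def)

lemma quot_alg_simps:
  "carrier (quot_alg M P) = a_rcosets\<^bsub>M\<^esub> P"
  "monoid.mult (quot_alg M P) = rcoset_mult M P"
  "\<one>\<^bsub>quot_alg M P\<^esub> = P +>\<^bsub>M\<^esub> \<one>\<^bsub>M\<^esub>"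
  "\<zero>\<^bsub>quot_alg M P\<^esub> = P"
  "add (quot_alg M P) = set_add M"
  "smult (quot_alg M P) = (\<lambda>r C. \<Union>x \<in> C. P +>\<^bsub>M\<^esub> (r \<odot>\<^bsub>M\<^esub> x))"
  by (simp_all add: quot_alg_def ring.extend_def module.fields_def FactRing_def)

locale quot_module = rmodule +
  fixes P assumes P: "submodule P R M"
begin

abbreviation Q where "Q \<equiv> quot_alg M P"

sublocale coset: abelian_subgroup P M
  using submodule.axioms(1)[OF P] abelian_group_axioms
  by (intro abelian_subgroupI3) (auto simp: additive_subgroup_def)

lemma cls_eq:
  assumes "x \<in> carrier M" "y \<in> carrier M"
  shows "P +>\<^bsub>M\<^esub> x = P +>\<^bsub>M\<^esub> y \<longleftrightarrow> x \<ominus>\<^bsub>M\<^esub> y \<in> P"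
proof
  assume "P +>\<^bsub>M\<^esub> x = P +>\<^bsub>M\<^esub> y"
  hence "x \<in> P +>\<^bsub>M\<^esub> y" using coset.a_rcos_self[OF assms(1)] by simp
  thus "x \<ominus>\<^bsub>M\<^esub> y \<in> P" using coset.a_rcos_module_imp[OF assms(2)] by (simp add: a_minus_def)
next
  assume "x \<ominus>\<^bsub>M\<^esub> y \<in> P"
  hence "x \<in> P +>\<^bsub>M\<^esub> y" using coset.a_rcos_module_rev[OF assms(2,1)] by (simp add: a_minus_def)
  thus "P +>\<^bsub>M\<^esub> x = P +>\<^bsub>M\<^esub> y" using coset.a_repr_independence'[OF _ assms(2)] by simp
qed

lemma cls_mem: "x \<in> carrier M \<Longrightarrow> x \<in> P +>\<^bsub>M\<^esub> x"
  by (rule coset.a_rcos_self)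

lemma cls_memD: "x \<in> carrier M \<Longrightarrow> y \<in> P +>\<^bsub>M\<^esub> x \<Longrightarrow> y \<in> carrier M \<and> P +>\<^bsub>M\<^esub> y = P +>\<^bsub>M\<^esub> x"
  using coset.a_repr_independence'[of y x] coset.a_elemrcos_carrier[of x y] by auto

lemma carrier_quot: "carrier Q = (\<lambda>x. P +>\<^bsub>M\<^esub> x) ` carrier M"
  unfolding quot_alg_simps A_RCOSETS_def' by (auto simp: a_r_coset_def')

lemma quotE: "t \<in> carrier Q \<Longrightarrow> (\<And>x. x \<in> carrier M \<Longrightarrow> t = P +>\<^bsub>M\<^esub> x \<Longrightarrow> thesis) \<Longrightarrow> thesis"
  by (auto simp: carrier_quot)

lemma cls_closed [simp, intro]: "x \<in> carrier M \<Longrightarrow> P +>\<^bsub>M\<^esub> x \<in> carrier Q"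
  by (auto simp: carrier_quot)

lemma cls_zero: "P +>\<^bsub>M\<^esub> \<zero>\<^bsub>M\<^esub> = \<zero>\<^bsub>Q\<^esub>"
  using coset.a_rcos_const submodule_zero[OF P] by (simp add: quot_alg_simps)

lemma cls_eq_zero: "x \<in> carrier M \<Longrightarrow> P +>\<^bsub>M\<^esub> x = \<zero>\<^bsub>Q\<^esub> \<longleftrightarrow> x \<in> P"
  unfolding cls_zero[symmetric] by (simp add: cls_eq)

lemma cls_add: "x \<in> carrier M \<Longrightarrow> y \<in> carrier M \<Longrightarrow>
    (P +>\<^bsub>M\<^esub> x) \<oplus>\<^bsub>Q\<^esub> (P +>\<^bsub>M\<^esub> y) = P +>\<^bsub>M\<^esub> (x \<oplus>\<^bsub>M\<^esub> y)"
  by (simp add: quot_alg_simps coset.a_rcos_sum)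

lemma cls_smult:
  assumes r: "r \<in> carrier R" and x: "x \<in> carrier M"
  shows "r \<odot>\<^bsub>Q\<^esub> (P +>\<^bsub>M\<^esub> x) = P +>\<^bsub>M\<^esub> (r \<odot>\<^bsub>M\<^esub> x)"
proof -
  have "P +>\<^bsub>M\<^esub> (r \<odot>\<^bsub>M\<^esub> y) = P +>\<^bsub>M\<^esub> (r \<odot>\<^bsub>M\<^esub> x)" if "y \<in> P +>\<^bsub>M\<^esub> x" for y
  proof -
    have y: "y \<in> carrier M" "y \<ominus>\<^bsub>M\<^esub> x \<in> P" using cls_memD[OF x that] x cls_eq by auto
    hence "r \<odot>\<^bsub>M\<^esub> (y \<ominus>\<^bsub>M\<^esub> x) \<in> P" using r submodule_smult[OF P] by blast
    thus ?thesis using r x y by (simp add: cls_eq a_minus_def smult_r_distr smult_r_minus)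
  qed
  thus ?thesis unfolding quot_alg_simps by (intro UN_constant_eq[OF cls_mem[OF x]]) blast
qed

lemma quot_module: "rmodule R Q"
proof -
  have "module R Q"
  proof (rule moduleI)
    show "abelian_group Q"
    proof (rule abelian_groupI)
      fix x assume "x \<in> carrier Q"
      then obtain a where "a \<in> carrier M" "x = P +>\<^bsub>M\<^esub> a" by (rule quotE)
      thus "\<exists>y\<in>carrier Q. y \<oplus>\<^bsub>Q\<^esub> x = \<zero>\<^bsub>Q\<^esub>"
        using cls_add[of "\<ominus>\<^bsub>M\<^esub> a" a] by (intro bexI[of _ "P +>\<^bsub>M\<^esub> (\<ominus>\<^bsub>M\<^esub> a)"]) (auto simp: M.l_neg cls_zero)
    qed (auto elim!: quotE simp: cls_add cls_zero[symmetric] M.a_ac)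
  qed (auto elim!: quotE simp: cls_add cls_smult smult_l_distr smult_r_distr smult_assoc1 R.is_cring)
  thus ?thesis by (simp add: rmodule_def)
qed

lemma lin_cls: "lin R M Q (\<lambda>x. P +>\<^bsub>M\<^esub> x)"
  by (rule linI) (auto simp: cls_add cls_smult)

text \<open>Evaluates maps on cosets that are defined by \<open>the_elem\<close> of an image; both
  \<open>tensor_lift\<close> and \<open>quot_map\<close> have this form.\<close>

lemma the_elem_cls:
  assumes "\<And>x y. x \<in> carrier M \<Longrightarrow> y \<in> carrier M \<Longrightarrow> x \<ominus>\<^bsub>M\<^esub> y \<in> P \<Longrightarrow> h x = h y" "x \<in> carrier M"
  shows "the_elem (h ` (P +>\<^bsub>M\<^esub> x)) = h x"
proof -
  have "h y = h x" if "y \<in> P +>\<^bsub>M\<^esub> x" for y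
  proof (rule assms(1))
    show y: "y \<in> carrier M" using cls_memD[OF assms(2) that] by simp
    thus "y \<ominus>\<^bsub>M\<^esub> x \<in> P" using cls_memD[OF assms(2) that] cls_eq[OF y assms(2)] by simp
  qed (rule assms(2))
  hence "h ` (P +>\<^bsub>M\<^esub> x) = {h x}" using cls_mem[OF assms(2)] by blast
  thus ?thesis by simp
qed

end

locale quot_ideal = falg +
  fixes P assumes P: "submodule P F A"
    and P_left: "\<And>x p. x \<in> carrier A \<Longrightarrow> p \<in> P \<Longrightarrow> x \<otimes>\<^bsub>A\<^esub> p \<in> P"
    and P_right: "\<And>x p. x \<in> carrier A \<Longrightarrow> p \<in> P \<Longrightarrow> p \<otimes>\<^bsub>A\<^esub> x \<in> P"
begin

sublocale quot_module F A P
  by (intro quot_module.intro quot_module_axioms.intro rmodule_axioms P)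

text \<open>a b - x y = (a - x) b + x (b - y), and each summand has a factor in \<open>P\<close>.
  Only distributivity enters, so the quotient of a nonassociative algebra is covered.\<close>

lemma cls_mult:
  assumes "x \<in> carrier A" "y \<in> carrier A"
  shows "(P +>\<^bsub>A\<^esub> x) \<otimes>\<^bsub>Q\<^esub> (P +>\<^bsub>A\<^esub> y) = P +>\<^bsub>A\<^esub> (x \<otimes>\<^bsub>A\<^esub> y)"
proof -
  have "P +>\<^bsub>A\<^esub> (a \<otimes>\<^bsub>A\<^esub> b) = P +>\<^bsub>A\<^esub> (x \<otimes>\<^bsub>A\<^esub> y)" if "a \<in> P +>\<^bsub>A\<^esub> x" "b \<in> P +>\<^bsub>A\<^esub> y" for a b
  proof -
    have a: "a \<in> carrier A" "a \<ominus>\<^bsub>A\<^esub> x \<in> P" using cls_memD[OF assms(1) that(1)] assms cls_eq by auto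
    have b: "b \<in> carrier A" "b \<ominus>\<^bsub>A\<^esub> y \<in> P" using cls_memD[OF assms(2) that(2)] assms cls_eq by auto
    have "(a \<ominus>\<^bsub>A\<^esub> x) \<otimes>\<^bsub>A\<^esub> b \<oplus>\<^bsub>A\<^esub> x \<otimes>\<^bsub>A\<^esub> (b \<ominus>\<^bsub>A\<^esub> y) \<in> P"
      using a b assms by (intro submodule_add[OF P] P_left P_right)
    also have "(a \<ominus>\<^bsub>A\<^esub> x) \<otimes>\<^bsub>A\<^esub> b \<oplus>\<^bsub>A\<^esub> x \<otimes>\<^bsub>A\<^esub> (b \<ominus>\<^bsub>A\<^esub> y) = a \<otimes>\<^bsub>A\<^esub> b \<ominus>\<^bsub>A\<^esub> x \<otimes>\<^bsub>A\<^esub> y"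
      using a(1) b(1) assms by (simp add: mult_minus minus_mult) (simp add: a_minus_def M.a_assoc M.r_neg1)
    finally show ?thesis using a(1) b(1) assms by (simp add: cls_eq)
  qed
  hence "(\<Union>b \<in> P +>\<^bsub>A\<^esub> y. P +>\<^bsub>A\<^esub> (a \<otimes>\<^bsub>A\<^esub> b)) = P +>\<^bsub>A\<^esub> (x \<otimes>\<^bsub>A\<^esub> y)" if "a \<in> P +>\<^bsub>A\<^esub> x" for a
    using that by (intro UN_constant_eq[OF cls_mem[OF assms(2)]]) blast
  thus ?thesis unfolding quot_alg_simps rcoset_mult_def
    by (intro UN_constant_eq[OF cls_mem[OF assms(1)]]) blast
qed

lemma cls_one: "P +>\<^bsub>A\<^esub> \<one>\<^bsub>A\<^esub> = \<one>\<^bsub>Q\<^esub>"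
  by (simp add: quot_alg_simps)

lemma quot_falg: "falg F Q"
proof -
  interpret Q: rmodule F Q by (rule quot_module)
  have "nonassoc_algebra F Q"
    by unfold_locales
      (auto elim!: quotE simp: cls_mult cls_add cls_smult cls_one[symmetric] add_mult mult_add smult_mult mult_smult)
  thus ?thesis by (rule falgI)
qed

end

section \<open>The tensor product\<close>

lemma finsum_self_mod [simp]: "finsum (self_mod F) = finsum F"
  by (simp add: fun_eq_iff finsum_def finprod_def)

locale tensor = A: falg F A + B: falg F B
  for F :: "('f, 'k) ring_scheme" (structure) and A :: "('f, 'a) module" (structure)
    and B :: "('f, 'b) module" (structure)
begin

abbreviation "FP \<equiv> pair_algebra F A B"
abbreviation "gen \<equiv> pair_gen F"
abbreviation "D \<equiv> module_span F FP (tensor_relations F A B)"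
abbreviation "T \<equiv> tensor_alg F A B"

text \<open>The linear extension of \<phi> from generators to the free module;
  \<open>tensor_lift\<close> is this map evaluated on representatives.\<close>

definition ext :: "('f, 'm) module \<Rightarrow> ('a \<Rightarrow> 'b \<Rightarrow> 'm) \<Rightarrow> ('a \<times> 'b \<Rightarrow> 'f) \<Rightarrow> 'm" where
  "ext M \<phi> f = (\<Oplus>\<^bsub>M\<^esub>p \<in> {p. f p \<noteq> \<zero>}. f p \<odot>\<^bsub>M\<^esub> \<phi> (fst p) (snd p))"

section \<open>The free module on pairs and its multiplication\<close>

lemma FP_simps:
  "f \<in> carrier FP \<longleftrightarrow> (\<forall>p. f p \<in> carrier F) \<and> finite {p. f p \<noteq> \<zero>} \<and> {p. f p \<noteq> \<zero>} \<subseteq> carrier A \<times> carrier B"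
  "add FP = (\<lambda>f g p. f p \<oplus> g p)" "\<zero>\<^bsub>FP\<^esub> = (\<lambda>p. \<zero>)" "smult FP = (\<lambda>c f p. c \<otimes> f p)"
  "\<one>\<^bsub>FP\<^esub> = gen \<one>\<^bsub>A\<^esub> \<one>\<^bsub>B\<^esub>"
  by (simp_all add: pair_algebra_def pair_gen_def)

lemma FP_val: "f \<in> carrier FP \<Longrightarrow> f p \<in> carrier F"
  by (simp only: FP_simps(1))

lemma FP_module: "rmodule F FP"
proof -
  have "module F FP"
  proof (rule moduleI)
    show "abelian_group FP"
    proof (rule abelian_groupI)
      fix x assume x: "x \<in> carrier FP"
      hence "(\<lambda>p. \<ominus> x p) \<in> carrier FP" 
        by (auto simp: FP_simps A.R.minus_equality elim!: finite_subset[rotated])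
      thus "\<exists>y\<in>carrier FP. y \<oplus>\<^bsub>FP\<^esub> x = \<zero>\<^bsub>FP\<^esub>"
        using x by (intro bexI[of _ "\<lambda>p. \<ominus> x p"]) (auto simp: FP_simps A.R.l_neg)
    next
      fix x y assume "x \<in> carrier FP" "y \<in> carrier FP"
      moreover have "{p. x p \<oplus> y p \<noteq> \<zero>} \<subseteq> {p. x p \<noteq> \<zero>} \<union> {p. y p \<noteq> \<zero>}" by auto
      ultimately show "x \<oplus>\<^bsub>FP\<^esub> y \<in> carrier FP"
        using finite_subset[of "{p. x p \<oplus> y p \<noteq> \<zero>}" "{p. x p \<noteq> \<zero>} \<union> {p. y p \<noteq> \<zero>}"]
        by (auto simp: FP_simps)
    qed (auto simp: FP_simps A.R.a_ac)
  next
    fix c x assume "c \<in> carrier F" "x \<in> carrier FP"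
    moreover from this have "{p. c \<otimes> x p \<noteq> \<zero>} \<subseteq> {p. x p \<noteq> \<zero>}" by auto
    ultimately show "c \<odot>\<^bsub>FP\<^esub> x \<in> carrier FP"
      using finite_subset[of "{p. c \<otimes> x p \<noteq> \<zero>}" "{p. x p \<noteq> \<zero>}"] by (auto simp: FP_simps)
  qed (auto simp: FP_simps A.R.l_distr A.R.r_distr A.R.m_assoc A.R.is_cring)
  thus ?thesis by (simp add: rmodule_def)
qed

lemma FP_vspace: "vspace F FP"
  using FP_module A.R.field_axioms by (simp add: vspace_def)

sublocale FP: vspace F FP by (rule FP_vspace)

lemma gen_closed [simp, intro]: "a \<in> carrier A \<Longrightarrow> b \<in> carrier B \<Longrightarrow> gen a b \<in> carrier FP"
  by (auto simp: FP_simps pair_gen_def)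

text \<open>The solutions of a linear condition form a submodule, so a condition that is linear in
  an element of the free module need only be checked on generators. The algebra laws below are
  obtained in this way, one argument at a time.\<close>

lemma FP_gen_induct:
  assumes N: "submodule N F FP" and g: "\<And>a b. a \<in> carrier A \<Longrightarrow> b \<in> carrier B \<Longrightarrow> gen a b \<in> N"
  shows "N = carrier FP"
proof
  show "N \<subseteq> carrier FP" by (rule FP.submodule_subset[OF N])
  have "f \<in> N" if "finite S" "f \<in> carrier FP" "{p. f p \<noteq> \<zero>} \<subseteq> S" for S f
    using that
  proof (induction S arbitrary: f rule: finite_induct)
    case empty
    hence "f = \<zero>\<^bsub>FP\<^esub>" by (auto simp: FP_simps)
    thus ?case using FP.submodule_zero[OF N] by simp
  next
    case (insert s S)
    show ?case
    proof (cases "f s = \<zero>")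
      case True
      with insert show ?thesis by (intro insert.IH) auto
    next
      case False
      define g where "g p = (if p = s then \<zero> else f p)" for p
      have s: "fst s \<in> carrier A" "snd s \<in> carrier B" using False insert by (auto simp: FP_simps)
      have gc: "g \<in> carrier FP" using insert by (auto simp: FP_simps g_def elim!: finite_subset[rotated])
      have "{p. g p \<noteq> \<zero>} \<subseteq> S" using insert by (auto simp: g_def)
      with gc have "g \<in> N" by (rule insert.IH)
      moreover have "f s \<odot>\<^bsub>FP\<^esub> gen (fst s) (snd s) \<in> N"
        using FP_val[OF insert.prems(1)] s by (intro FP.submodule_smult[OF N] assms)
      ultimately have "g \<oplus>\<^bsub>FP\<^esub> f s \<odot>\<^bsub>FP\<^esub> gen (fst s) (snd s) \<in> N" by (rule FP.submodule_add[OF N])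
      also have "g \<oplus>\<^bsub>FP\<^esub> f s \<odot>\<^bsub>FP\<^esub> gen (fst s) (snd s) = f"
        using insert FP_val[OF insert.prems(1), of s]
          by (auto simp: FP_simps g_def pair_gen_def fun_eq_iff)
      finally show ?thesis .
    qed
  qed
  thus "carrier FP \<subseteq> N" by (auto simp: FP_simps)
qed

context
  fixes M :: "('f, 'm) module" and \<phi>
  assumes M: "vspace F M" and \<phi>: "\<And>a b. a \<in> carrier A \<Longrightarrow> b \<in> carrier B \<Longrightarrow> \<phi> a b \<in> carrier M"
begin

interpretation M: vspace F M by (rule M)

text \<open>Sums over the supports of \<open>f\<close>, of \<open>g\<close> and of their sum can
  only be compared after all of them have been extended to one common finite set.\<close>

lemma ext_superset:
  assumes "f \<in> carrier FP" "finite S" "{p. f p \<noteq> \<zero>} \<subseteq> S" "S \<subseteq> carrier A \<times> carrier B"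
  shows "ext M \<phi> f = (\<Oplus>\<^bsub>M\<^esub>p \<in> S. f p \<odot>\<^bsub>M\<^esub> \<phi> (fst p) (snd p))"
  unfolding ext_def
  by (rule M.M.add.finprod_mono_neutral_cong_left) (use assms \<phi> in \<open>auto simp: FP_simps subset_iff\<close>)

lemma ext_lin: "lin F FP M (ext M \<phi>)"
proof (rule linI)
  have fc: "(\<lambda>p. f p \<odot>\<^bsub>M\<^esub> \<phi> (fst p) (snd p)) \<in> S \<rightarrow> carrier M"
    if "f \<in> carrier FP" "S \<subseteq> carrier A \<times> carrier B" for f S
    using that \<phi> by (auto simp: FP_simps subset_iff)
  show "ext M \<phi> x \<in> carrier M" if "x \<in> carrier FP" for x
    unfolding ext_def using fc[OF that] that by (intro M.M.finsum_closed) (auto simp: FP_simps)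
  show "ext M \<phi> (f \<oplus>\<^bsub>FP\<^esub> g) = ext M \<phi> f \<oplus>\<^bsub>M\<^esub> ext M \<phi> g" if f: "f \<in> carrier FP" and g: "g \<in> carrier FP" for f g
  proof -
    define S where "S = {p. f p \<noteq> \<zero>} \<union> {p. g p \<noteq> \<zero>}"
    have S: "finite S" "S \<subseteq> carrier A \<times> carrier B" using f g by (auto simp: S_def FP_simps)
    have "ext M \<phi> (f \<oplus>\<^bsub>FP\<^esub> g) = (\<Oplus>\<^bsub>M\<^esub>p \<in> S. (f \<oplus>\<^bsub>FP\<^esub> g) p \<odot>\<^bsub>M\<^esub> \<phi> (fst p) (snd p))"
      using f g S by (intro ext_superset FP.M.a_closed) (auto simp: S_def FP_simps)
    also have "\<dots> = (\<Oplus>\<^bsub>M\<^esub>p \<in> S. f p \<odot>\<^bsub>M\<^esub> \<phi> (fst p) (snd p) \<oplus>\<^bsub>M\<^esub> g p \<odot>\<^bsub>M\<^esub> \<phi> (fst p) (snd p))"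
      using f g S \<phi> by (intro M.M.finsum_cong') (auto simp: FP_simps M.smult_l_distr subset_iff)
    also have "\<dots> = ext M \<phi> f \<oplus>\<^bsub>M\<^esub> ext M \<phi> g"
      using f g S fc ext_superset[OF f S(1)] ext_superset[OF g S(1)]
      by (subst M.M.finsum_addf) (auto simp: S_def)
    finally show ?thesis .
  qed
  show "ext M \<phi> (c \<odot>\<^bsub>FP\<^esub> f) = c \<odot>\<^bsub>M\<^esub> ext M \<phi> f" if c: "c \<in> carrier F" and f: "f \<in> carrier FP" for c f
  proof -
    define S where "S = {p. f p \<noteq> \<zero>}"
    have S: "finite S" "S \<subseteq> carrier A \<times> carrier B" using f by (auto simp: S_def FP_simps)
    have "ext M \<phi> (c \<odot>\<^bsub>FP\<^esub> f) = (\<Oplus>\<^bsub>M\<^esub>p \<in> S. (c \<odot>\<^bsub>FP\<^esub> f) p \<odot>\<^bsub>M\<^esub> \<phi> (fst p) (snd p))"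
      using c f S by (intro ext_superset FP.smult_closed) (auto simp: S_def FP_simps)
    also have "\<dots> = (\<Oplus>\<^bsub>M\<^esub>p \<in> S. c \<odot>\<^bsub>M\<^esub> (f p \<odot>\<^bsub>M\<^esub> \<phi> (fst p) (snd p)))"
      using c f S \<phi> by (intro M.M.finsum_cong') (auto simp: FP_simps M.smult_assoc1 subset_iff)
    also have "\<dots> = c \<odot>\<^bsub>M\<^esub> ext M \<phi> f"
      using c S fc[OF f] unfolding ext_def S_def[symmetric] by (subst M.finsum_smult_ldistr) auto
    finally show ?thesis .
  qed
qed

lemma ext_gen: "a \<in> carrier A \<Longrightarrow> b \<in> carrier B \<Longrightarrow> ext M \<phi> (gen a b) = \<phi> a b"
  using ext_superset[of "gen a b" "{(a, b)}"] \<phi>[of a b]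
  by (auto simp: pair_gen_def FP_simps M.M.finsum_insert)

end


text \<open>The structure constants: the coefficient at \<open>r\<close> in the product of the
  generators (a, b) and (c, d).\<close>

definition del :: "'a \<times> 'b \<Rightarrow> 'a \<Rightarrow> 'b \<Rightarrow> 'a \<Rightarrow> 'b \<Rightarrow> 'f" where
  "del r a b c d = (if (a \<otimes>\<^bsub>A\<^esub> c, b \<otimes>\<^bsub>B\<^esub> d) = r then \<one> else \<zero>)"

text \<open>Each coefficient of a product is an iterated linear extension of the structure
  constants, so linearity in the left factor becomes an instance of \<open>ext_lin\<close>.\<close>

lemma FP_mult:
  assumes f: "f \<in> carrier FP" and g: "g \<in> carrier FP"
  shows "(f \<otimes>\<^bsub>FP\<^esub> g) r = ext (self_mod F) (\<lambda>a b. ext (self_mod F) (del r a b) g) f"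
proof -
  have fin: "finite {p. f p \<noteq> \<zero>}" "finite {q. g q \<noteq> \<zero>}" and fc: "\<And>p. f p \<in> carrier F" "\<And>p. g p \<in> carrier F"
    using FP_val[OF f] FP_val[OF g] f g by (simp_all only: FP_simps)
  have "(\<Oplus>q \<in> {q. g q \<noteq> \<zero>}. if (fst p \<otimes>\<^bsub>A\<^esub> fst q, snd p \<otimes>\<^bsub>B\<^esub> snd q) = r then f p \<otimes> g q else \<zero>)
      = f p \<otimes> (\<Oplus>q \<in> {q. g q \<noteq> \<zero>}. g q \<otimes> del r (fst p) (snd p) (fst q) (snd q))" for p
    using fin by (subst A.R.finsum_rdistr) (auto simp: fc del_def intro!: A.R.finsum_cong')
  thus ?thesis
    by (simp add: pair_algebra_def ext_def)
qed

lemma del_closed [simp]: "del r a b c d \<in> carrier F"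
  by (simp add: del_def)

lemma lin_FP_mult_left:
  assumes "g \<in> carrier FP"
  shows "f \<in> carrier FP \<Longrightarrow> f' \<in> carrier FP \<Longrightarrow> (f \<oplus>\<^bsub>FP\<^esub> f') \<otimes>\<^bsub>FP\<^esub> g = f \<otimes>\<^bsub>FP\<^esub> g \<oplus>\<^bsub>FP\<^esub> f' \<otimes>\<^bsub>FP\<^esub> g"
    and "c \<in> carrier F \<Longrightarrow> f \<in> carrier FP \<Longrightarrow> (c \<odot>\<^bsub>FP\<^esub> f) \<otimes>\<^bsub>FP\<^esub> g = c \<odot>\<^bsub>FP\<^esub> (f \<otimes>\<^bsub>FP\<^esub> g)"
proof -
  have 1: "lin F FP (self_mod F) (ext (self_mod F) (del r a b))" for r a b
    by (rule ext_lin[OF A.vspace_self_mod]) simp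
  have l: "lin F FP (self_mod F) (ext (self_mod F) (\<lambda>a b. ext (self_mod F) (del r a b) g))" for r
    using lin_closed[OF 1 assms] by (intro ext_lin[OF A.vspace_self_mod]) simp
  show "(f \<oplus>\<^bsub>FP\<^esub> f') \<otimes>\<^bsub>FP\<^esub> g = f \<otimes>\<^bsub>FP\<^esub> g \<oplus>\<^bsub>FP\<^esub> f' \<otimes>\<^bsub>FP\<^esub> g" if "f \<in> carrier FP" "f' \<in> carrier FP"
  proof
    fix r
    show "((f \<oplus>\<^bsub>FP\<^esub> f') \<otimes>\<^bsub>FP\<^esub> g) r = (f \<otimes>\<^bsub>FP\<^esub> g \<oplus>\<^bsub>FP\<^esub> f' \<otimes>\<^bsub>FP\<^esub> g) r"
      using lin_add[OF l that] that assms FP.M.a_closed[OF that] by (simp add: FP_mult FP_simps(2))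
  qed
  show "(c \<odot>\<^bsub>FP\<^esub> f) \<otimes>\<^bsub>FP\<^esub> g = c \<odot>\<^bsub>FP\<^esub> (f \<otimes>\<^bsub>FP\<^esub> g)" if "c \<in> carrier F" "f \<in> carrier FP"
  proof
    fix r
    show "((c \<odot>\<^bsub>FP\<^esub> f) \<otimes>\<^bsub>FP\<^esub> g) r = (c \<odot>\<^bsub>FP\<^esub> (f \<otimes>\<^bsub>FP\<^esub> g)) r"
      using lin_smult[OF l that] that assms FP.smult_closed[OF that] by (simp add: FP_mult FP_simps(4))
  qed
qed

lemma FP_mult_gen:
  assumes f: "f \<in> carrier FP" and p: "a \<in> carrier A" "b \<in> carrier B"
  shows "(gen a b \<otimes>\<^bsub>FP\<^esub> f) r = ext (self_mod F) (del r a b) f"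
proof -
  have 1: "lin F FP (self_mod F) (ext (self_mod F) (del r a b))" for r a b
    by (rule ext_lin[OF A.vspace_self_mod]) simp
  have 2: "ext (self_mod F) (del r a b) f \<in> carrier F" for r a b
    using lin_closed[OF 1 f] by simp
  show ?thesis
    using f p by (subst FP_mult) (auto simp: 2 intro!: ext_gen[OF A.vspace_self_mod])
qed

lemma FP_gen_mult_gen:
  assumes "a \<in> carrier A" "b \<in> carrier B" "c \<in> carrier A" "d \<in> carrier B"
  shows "gen a b \<otimes>\<^bsub>FP\<^esub> gen c d = gen (a \<otimes>\<^bsub>A\<^esub> c) (b \<otimes>\<^bsub>B\<^esub> d)"
proof
  fix r
  have "ext (self_mod F) (del r a b) (gen c d) = del r a b c d"
    using assms by (intro ext_gen[OF A.vspace_self_mod]) auto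
  moreover have "(gen a b \<otimes>\<^bsub>FP\<^esub> gen c d) r = ext (self_mod F) (del r a b) (gen c d)"
    using assms by (intro FP_mult_gen) auto
  moreover have "del r a b c d = gen (a \<otimes>\<^bsub>A\<^esub> c) (b \<otimes>\<^bsub>B\<^esub> d) r"
    by (auto simp: del_def pair_gen_def)
  ultimately show "(gen a b \<otimes>\<^bsub>FP\<^esub> gen c d) r = gen (a \<otimes>\<^bsub>A\<^esub> c) (b \<otimes>\<^bsub>B\<^esub> d) r" by simp
qed

lemma lin_FP_mult_gen:
  assumes p: "a \<in> carrier A" "b \<in> carrier B"
  shows "f \<in> carrier FP \<Longrightarrow> f' \<in> carrier FP \<Longrightarrow>
      gen a b \<otimes>\<^bsub>FP\<^esub> (f \<oplus>\<^bsub>FP\<^esub> f') = gen a b \<otimes>\<^bsub>FP\<^esub> f \<oplus>\<^bsub>FP\<^esub> gen a b \<otimes>\<^bsub>FP\<^esub> f'"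
    and "c \<in> carrier F \<Longrightarrow> f \<in> carrier FP \<Longrightarrow>
      gen a b \<otimes>\<^bsub>FP\<^esub> (c \<odot>\<^bsub>FP\<^esub> f) = c \<odot>\<^bsub>FP\<^esub> (gen a b \<otimes>\<^bsub>FP\<^esub> f)"
proof -
  have l: "lin F FP (self_mod F) (ext (self_mod F) (del r a b))" for r
    by (rule ext_lin[OF A.vspace_self_mod]) simp
  show "gen a b \<otimes>\<^bsub>FP\<^esub> (f \<oplus>\<^bsub>FP\<^esub> f') = gen a b \<otimes>\<^bsub>FP\<^esub> f \<oplus>\<^bsub>FP\<^esub> gen a b \<otimes>\<^bsub>FP\<^esub> f'"
    if "f \<in> carrier FP" "f' \<in> carrier FP"
  proof
    fix r
    show "(gen a b \<otimes>\<^bsub>FP\<^esub> (f \<oplus>\<^bsub>FP\<^esub> f')) r = (gen a b \<otimes>\<^bsub>FP\<^esub> f \<oplus>\<^bsub>FP\<^esub> gen a b \<otimes>\<^bsub>FP\<^esub> f') r"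
      using lin_add[OF l that] that p FP.M.a_closed[OF that] by (simp add: FP_mult_gen FP_simps(2))
  qed
  show "gen a b \<otimes>\<^bsub>FP\<^esub> (c \<odot>\<^bsub>FP\<^esub> f) = c \<odot>\<^bsub>FP\<^esub> (gen a b \<otimes>\<^bsub>FP\<^esub> f)" if "c \<in> carrier F" "f \<in> carrier FP"
  proof
    fix r
    show "(gen a b \<otimes>\<^bsub>FP\<^esub> (c \<odot>\<^bsub>FP\<^esub> f)) r = (c \<odot>\<^bsub>FP\<^esub> (gen a b \<otimes>\<^bsub>FP\<^esub> f)) r"
      using lin_smult[OF l that] that p FP.smult_closed[OF that] by (simp add: FP_mult_gen FP_simps(4))
  qed
qed

text \<open>\<open>h\<close> is not assumed to take values in the free module, since closure of the
  multiplication is itself proved with this lemma. A point with value in \<open>N\<close> takes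
  over: scaling it by zero gives h 0 = 0.\<close>

lemma submodule_vimage:
  assumes N: "submodule N F FP"
    and add: "\<And>f f'. f \<in> carrier FP \<Longrightarrow> f' \<in> carrier FP \<Longrightarrow> h (f \<oplus>\<^bsub>FP\<^esub> f') = h f \<oplus>\<^bsub>FP\<^esub> h f'"
    and smult: "\<And>c f. c \<in> carrier F \<Longrightarrow> f \<in> carrier FP \<Longrightarrow> h (c \<odot>\<^bsub>FP\<^esub> f) = c \<odot>\<^bsub>FP\<^esub> h f"
    and ne: "\<exists>f\<in>carrier FP. h f \<in> N"
  shows "submodule {f \<in> carrier FP. h f \<in> N} F FP"
proof (rule FP.submoduleI)
  obtain f0 where f0: "f0 \<in> carrier FP" "h f0 \<in> N" using ne by blast
  have "h (\<zero> \<odot>\<^bsub>FP\<^esub> f0) = \<zero> \<odot>\<^bsub>FP\<^esub> h f0" using f0 by (intro smult) auto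
  hence "h \<zero>\<^bsub>FP\<^esub> = \<zero>\<^bsub>FP\<^esub>" using f0 FP.submodule_mem[OF N] by simp
  thus "\<zero>\<^bsub>FP\<^esub> \<in> {f \<in> carrier FP. h f \<in> N}" using FP.submodule_zero[OF N] by simp
  show "\<ominus>\<^bsub>FP\<^esub> a \<in> {f \<in> carrier FP. h f \<in> N}" if "a \<in> {f \<in> carrier FP. h f \<in> N}" for a
  proof -
    have "\<ominus>\<^bsub>FP\<^esub> a = (\<ominus> \<one>) \<odot>\<^bsub>FP\<^esub> a" using that by (simp add: FP.smult_l_minus)
    moreover have "(\<ominus> \<one>) \<odot>\<^bsub>FP\<^esub> a \<in> {f \<in> carrier FP. h f \<in> N}"
      using that smult[of "\<ominus> \<one>" a] FP.submodule_smult[OF N] by auto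
    ultimately show ?thesis by simp
  qed
qed (auto simp: add smult FP.submodule_add[OF N] FP.submodule_smult[OF N])

lemma FP_mult_closed:
  assumes f: "f \<in> carrier FP" and g: "g \<in> carrier FP"
  shows "f \<otimes>\<^bsub>FP\<^esub> g \<in> carrier FP"
proof -
  have ne: "carrier A \<noteq> {}" "carrier B \<noteq> {}" using A.one_closed B.one_closed by auto
  have 1: "gen a b \<otimes>\<^bsub>FP\<^esub> g \<in> carrier FP" if ab: "a \<in> carrier A" "b \<in> carrier B" and g: "g \<in> carrier FP" for a b g
  proof -
    have m: "gen a b \<otimes>\<^bsub>FP\<^esub> gen c d \<in> carrier FP" if "c \<in> carrier A" "d \<in> carrier B" for c d
      using that ab by (auto simp: FP_gen_mult_gen)
    have "submodule {h \<in> carrier FP. gen a b \<otimes>\<^bsub>FP\<^esub> h \<in> carrier FP} F FP"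
      using ab m[of "\<one>\<^bsub>A\<^esub>" "\<one>\<^bsub>B\<^esub>"]
      by (intro submodule_vimage FP.carrier_is_submodule)
        (auto simp: lin_FP_mult_gen intro!: bexI[of _ "gen \<one>\<^bsub>A\<^esub> \<one>\<^bsub>B\<^esub>"])
    hence "{h \<in> carrier FP. gen a b \<otimes>\<^bsub>FP\<^esub> h \<in> carrier FP} = carrier FP"
      using m by (intro FP_gen_induct) auto
    thus ?thesis using g by blast
  qed
  have "submodule {h \<in> carrier FP. h \<otimes>\<^bsub>FP\<^esub> g \<in> carrier FP} F FP"
    using g 1[of "\<one>\<^bsub>A\<^esub>" "\<one>\<^bsub>B\<^esub>" g]
    by (intro submodule_vimage FP.carrier_is_submodule)
      (auto simp: lin_FP_mult_left intro!: bexI[of _ "gen \<one>\<^bsub>A\<^esub> \<one>\<^bsub>B\<^esub>"])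
  hence "{h \<in> carrier FP. h \<otimes>\<^bsub>FP\<^esub> g \<in> carrier FP} = carrier FP"
    using 1 g by (intro FP_gen_induct) auto
  thus ?thesis using f by blast
qed

text \<open>For fixed right factors the defect of linearity is linear in \<open>f\<close>, so it
  suffices to let \<open>f\<close> be a generator, where \<open>lin_FP_mult_gen\<close>
  applies.\<close>

lemma lin_FP_mult_right:
  assumes f: "f \<in> carrier FP" and g: "g \<in> carrier FP" 
  shows "g' \<in> carrier FP \<Longrightarrow> f \<otimes>\<^bsub>FP\<^esub> (g \<oplus>\<^bsub>FP\<^esub> g') = f \<otimes>\<^bsub>FP\<^esub> g \<oplus>\<^bsub>FP\<^esub> f \<otimes>\<^bsub>FP\<^esub> g'"
    and "c \<in> carrier F \<Longrightarrow> f \<otimes>\<^bsub>FP\<^esub> (c \<odot>\<^bsub>FP\<^esub> g) = c \<odot>\<^bsub>FP\<^esub> (f \<otimes>\<^bsub>FP\<^esub> g)"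
proof -
  show "f \<otimes>\<^bsub>FP\<^esub> (g \<oplus>\<^bsub>FP\<^esub> g') = f \<otimes>\<^bsub>FP\<^esub> g \<oplus>\<^bsub>FP\<^esub> f \<otimes>\<^bsub>FP\<^esub> g'" if g': "g' \<in> carrier FP"
  proof -
    have "submodule {h \<in> carrier FP. h \<otimes>\<^bsub>FP\<^esub> (g \<oplus>\<^bsub>FP\<^esub> g') \<ominus>\<^bsub>FP\<^esub> (h \<otimes>\<^bsub>FP\<^esub> g \<oplus>\<^bsub>FP\<^esub> h \<otimes>\<^bsub>FP\<^esub> g') \<in> {\<zero>\<^bsub>FP\<^esub>}} F FP"
      using g g' by (intro submodule_vimage FP.submodule_zero_set)
       (auto simp: lin_FP_mult_left lin_FP_mult_gen FP_mult_closed FP.eq_minus_zero a_minus_def FP.smult_r_distr FP.smult_r_minus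
         FP.M.minus_add FP.M.a_ac FP.M.r_neg intro!: bexI[of _ "gen \<one>\<^bsub>A\<^esub> \<one>\<^bsub>B\<^esub>"])
    hence "{h \<in> carrier FP. h \<otimes>\<^bsub>FP\<^esub> (g \<oplus>\<^bsub>FP\<^esub> g') \<ominus>\<^bsub>FP\<^esub> (h \<otimes>\<^bsub>FP\<^esub> g \<oplus>\<^bsub>FP\<^esub> h \<otimes>\<^bsub>FP\<^esub> g') \<in> {\<zero>\<^bsub>FP\<^esub>}} = carrier FP"
      using g g' by (intro FP_gen_induct) (auto simp: lin_FP_mult_gen FP_mult_closed FP.eq_minus_zero)
    hence "f \<otimes>\<^bsub>FP\<^esub> (g \<oplus>\<^bsub>FP\<^esub> g') \<ominus>\<^bsub>FP\<^esub> (f \<otimes>\<^bsub>FP\<^esub> g \<oplus>\<^bsub>FP\<^esub> f \<otimes>\<^bsub>FP\<^esub> g') = \<zero>\<^bsub>FP\<^esub>" using f by blast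
    thus ?thesis using f g g' by (simp add: FP.eq_minus_zero FP_mult_closed)
  qed
  show "f \<otimes>\<^bsub>FP\<^esub> (c \<odot>\<^bsub>FP\<^esub> g) = c \<odot>\<^bsub>FP\<^esub> (f \<otimes>\<^bsub>FP\<^esub> g)" if c: "c \<in> carrier F"
  proof -
    have "submodule {h \<in> carrier FP. h \<otimes>\<^bsub>FP\<^esub> (c \<odot>\<^bsub>FP\<^esub> g) \<ominus>\<^bsub>FP\<^esub> c \<odot>\<^bsub>FP\<^esub> (h \<otimes>\<^bsub>FP\<^esub> g) \<in> {\<zero>\<^bsub>FP\<^esub>}} F FP"
      using g c by (intro submodule_vimage FP.submodule_zero_set)
       (auto simp: lin_FP_mult_left lin_FP_mult_gen FP_mult_closed FP.eq_minus_zero a_minus_def FP.smult_r_distr FP.smult_r_minus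
         FP.M.minus_add FP.M.a_ac FP.M.r_neg A.R.m_comm FP.smult_assoc1[symmetric] intro!: bexI[of _ "gen \<one>\<^bsub>A\<^esub> \<one>\<^bsub>B\<^esub>"])
    hence "{h \<in> carrier FP. h \<otimes>\<^bsub>FP\<^esub> (c \<odot>\<^bsub>FP\<^esub> g) \<ominus>\<^bsub>FP\<^esub> c \<odot>\<^bsub>FP\<^esub> (h \<otimes>\<^bsub>FP\<^esub> g) \<in> {\<zero>\<^bsub>FP\<^esub>}} = carrier FP"
      using g c by (intro FP_gen_induct) (auto simp: lin_FP_mult_gen FP_mult_closed FP.eq_minus_zero)
    hence "f \<otimes>\<^bsub>FP\<^esub> (c \<odot>\<^bsub>FP\<^esub> g) \<ominus>\<^bsub>FP\<^esub> c \<odot>\<^bsub>FP\<^esub> (f \<otimes>\<^bsub>FP\<^esub> g) = \<zero>\<^bsub>FP\<^esub>" using f by blast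
    thus ?thesis using f g c by (simp add: FP.eq_minus_zero FP_mult_closed)
  qed
qed

lemma FP_one: 
  assumes f: "f \<in> carrier FP"
  shows "\<one>\<^bsub>FP\<^esub> \<otimes>\<^bsub>FP\<^esub> f = f" "f \<otimes>\<^bsub>FP\<^esub> \<one>\<^bsub>FP\<^esub> = f"
proof -
  have o: "\<one>\<^bsub>FP\<^esub> \<in> carrier FP" unfolding FP_simps(5) by auto
  have "submodule {h \<in> carrier FP. \<one>\<^bsub>FP\<^esub> \<otimes>\<^bsub>FP\<^esub> h \<ominus>\<^bsub>FP\<^esub> h \<in> {\<zero>\<^bsub>FP\<^esub>}} F FP"
    using o by (intro submodule_vimage FP.submodule_zero_set)
      (auto simp: lin_FP_mult_right FP_mult_closed FP.eq_minus_zero a_minus_def FP.smult_r_distr FP.smult_r_minus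
         FP.M.minus_add FP.M.a_ac FP.M.r_neg FP_simps(5) FP_gen_mult_gen intro!: bexI[of _ "gen \<one>\<^bsub>A\<^esub> \<one>\<^bsub>B\<^esub>"])
  hence "{h \<in> carrier FP. \<one>\<^bsub>FP\<^esub> \<otimes>\<^bsub>FP\<^esub> h \<ominus>\<^bsub>FP\<^esub> h \<in> {\<zero>\<^bsub>FP\<^esub>}} = carrier FP"
    by (intro FP_gen_induct) (auto simp: FP_gen_mult_gen FP.eq_minus_zero FP_simps(5))
  hence "\<one>\<^bsub>FP\<^esub> \<otimes>\<^bsub>FP\<^esub> f \<ominus>\<^bsub>FP\<^esub> f = \<zero>\<^bsub>FP\<^esub>" using f by blast
  thus "\<one>\<^bsub>FP\<^esub> \<otimes>\<^bsub>FP\<^esub> f = f" using f o by (simp add: FP.eq_minus_zero FP_mult_closed)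
  have "submodule {h \<in> carrier FP. h \<otimes>\<^bsub>FP\<^esub> \<one>\<^bsub>FP\<^esub> \<ominus>\<^bsub>FP\<^esub> h \<in> {\<zero>\<^bsub>FP\<^esub>}} F FP"
    using o by (intro submodule_vimage FP.submodule_zero_set)
      (auto simp: lin_FP_mult_left FP_mult_closed FP.eq_minus_zero a_minus_def FP.smult_r_distr FP.smult_r_minus
         FP.M.minus_add FP.M.a_ac FP.M.r_neg FP_simps(5) FP_gen_mult_gen intro!: bexI[of _ "gen \<one>\<^bsub>A\<^esub> \<one>\<^bsub>B\<^esub>"])
  hence "{h \<in> carrier FP. h \<otimes>\<^bsub>FP\<^esub> \<one>\<^bsub>FP\<^esub> \<ominus>\<^bsub>FP\<^esub> h \<in> {\<zero>\<^bsub>FP\<^esub>}} = carrier FP"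
    by (intro FP_gen_induct) (auto simp: FP_gen_mult_gen FP.eq_minus_zero FP_simps(5))
  hence "f \<otimes>\<^bsub>FP\<^esub> \<one>\<^bsub>FP\<^esub> \<ominus>\<^bsub>FP\<^esub> f = \<zero>\<^bsub>FP\<^esub>" using f by blast
  thus "f \<otimes>\<^bsub>FP\<^esub> \<one>\<^bsub>FP\<^esub> = f" using f o by (simp add: FP.eq_minus_zero FP_mult_closed)
qed

lemma FP_falg: "falg F FP"
proof (rule falgI)
  show "nonassoc_algebra F FP"
    by unfold_locales
      (auto simp: FP_mult_closed FP_one lin_FP_mult_left lin_FP_mult_right intro: FP_simps(5)[THEN ssubst])
qed

sublocale FP: falg F FP by (rule FP_falg)

end

definition bilin :: "('f, 'k) ring_scheme \<Rightarrow> ('f, 'u) module \<Rightarrow> ('f, 'v) module \<Rightarrow> ('f, 'w) module \<Rightarrow>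
    ('u \<Rightarrow> 'v \<Rightarrow> 'w) \<Rightarrow> bool" where
  "bilin F U V W \<beta> \<longleftrightarrow> (\<forall>u\<in>carrier U. lin F V W (\<beta> u)) \<and> (\<forall>v\<in>carrier V. lin F U W (\<lambda>u. \<beta> u v))"

lemma bilinI:
  "(\<And>u. u \<in> carrier U \<Longrightarrow> lin F V W (\<beta> u)) \<Longrightarrow> (\<And>v. v \<in> carrier V \<Longrightarrow> lin F U W (\<lambda>u. \<beta> u v)) \<Longrightarrow> bilin F U V W \<beta>"
  by (auto simp: bilin_def)

lemma bilinD:
  assumes "bilin F U V W \<beta>"
  shows "u \<in> carrier U \<Longrightarrow> lin F V W (\<beta> u)" "v \<in> carrier V \<Longrightarrow> lin F U W (\<lambda>u. \<beta> u v)"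
  using assms by (auto simp: bilin_def)

lemma bilin_comp_lin:
  "bilin F U V W \<beta> \<Longrightarrow> lin F U' U g \<Longrightarrow> lin F V' V h \<Longrightarrow> bilin F U' V' W (\<lambda>u v. \<beta> (g u) (h v))"
  by (auto simp: bilin_def lin_closed intro: lin_comp)

lemma (in falg) bilin_mult: "bilin F A A A (\<lambda>x y. x \<otimes>\<^bsub>A\<^esub> y)"
  by (intro bilinI lin_mult_left lin_mult_right)

section \<open>The quotient by the bilinearity relations\<close>

context tensor
begin

lemma relations_closed: "tensor_relations F A B \<subseteq> carrier FP"
  by (auto simp: tensor_relations_def Let_def)

lemma D_submodule: "submodule D F FP"
  by (rule FP.module_span_submodule[OF relations_closed])

lemma relation_cases:
  assumes "r \<in> tensor_relations F A B"
  obtains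
    (addl) a a' b where "a \<in> carrier A" "a' \<in> carrier A" "b \<in> carrier B"
      "r = gen (a \<oplus>\<^bsub>A\<^esub> a') b \<ominus>\<^bsub>FP\<^esub> (gen a b \<oplus>\<^bsub>FP\<^esub> gen a' b)"
  | (addr) a b b' where "a \<in> carrier A" "b \<in> carrier B" "b' \<in> carrier B"
      "r = gen a (b \<oplus>\<^bsub>B\<^esub> b') \<ominus>\<^bsub>FP\<^esub> (gen a b \<oplus>\<^bsub>FP\<^esub> gen a b')"
  | (sml) c a b where "c \<in> carrier F" "a \<in> carrier A" "b \<in> carrier B"
      "r = gen (c \<odot>\<^bsub>A\<^esub> a) b \<ominus>\<^bsub>FP\<^esub> c \<odot>\<^bsub>FP\<^esub> gen a b"
  | (smr) c a b where "c \<in> carrier F" "a \<in> carrier A" "b \<in> carrier B"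
      "r = gen a (c \<odot>\<^bsub>B\<^esub> b) \<ominus>\<^bsub>FP\<^esub> c \<odot>\<^bsub>FP\<^esub> gen a b"
  using assms unfolding tensor_relations_def Let_def
  by (elim UnE CollectE exE conjE; (rule addl; assumption)?, (rule addr; assumption)?,
      (rule sml; assumption)?, (rule smr; assumption)?)

lemma relation_mem:
  "a \<in> carrier A \<Longrightarrow> a' \<in> carrier A \<Longrightarrow> b \<in> carrier B \<Longrightarrow>
     gen (a \<oplus>\<^bsub>A\<^esub> a') b \<ominus>\<^bsub>FP\<^esub> (gen a b \<oplus>\<^bsub>FP\<^esub> gen a' b) \<in> D"
  "a \<in> carrier A \<Longrightarrow> b \<in> carrier B \<Longrightarrow> b' \<in> carrier B \<Longrightarrow>
     gen a (b \<oplus>\<^bsub>B\<^esub> b') \<ominus>\<^bsub>FP\<^esub> (gen a b \<oplus>\<^bsub>FP\<^esub> gen a b') \<in> D"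
  "c \<in> carrier F \<Longrightarrow> a \<in> carrier A \<Longrightarrow> b \<in> carrier B \<Longrightarrow>
     gen (c \<odot>\<^bsub>A\<^esub> a) b \<ominus>\<^bsub>FP\<^esub> c \<odot>\<^bsub>FP\<^esub> gen a b \<in> D"
  "c \<in> carrier F \<Longrightarrow> a \<in> carrier A \<Longrightarrow> b \<in> carrier B \<Longrightarrow>
     gen a (c \<odot>\<^bsub>B\<^esub> b) \<ominus>\<^bsub>FP\<^esub> c \<odot>\<^bsub>FP\<^esub> gen a b \<in> D"
  unfolding tensor_relations_def Let_def by (rule FP.module_span_base, blast)+

text \<open>By bilinearity of the products of \<open>A\<close> and \<open>B\<close>, a generator
  times a relation is again a relation of the same kind. \<open>D_ideal\<close> extends this to all
  elements of the free module and then to the whole span.\<close>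

lemma relation_mult_gen:
  assumes r: "r \<in> tensor_relations F A B" and c: "c \<in> carrier A" "d \<in> carrier B"
  shows "r \<otimes>\<^bsub>FP\<^esub> gen c d \<in> D" "gen c d \<otimes>\<^bsub>FP\<^esub> r \<in> D"
proof -
  note simps = FP.minus_mult FP.mult_minus FP.add_mult FP.mult_add FP.smult_mult FP.mult_smult FP_gen_mult_gen
    A.add_mult A.mult_add B.add_mult B.mult_add A.smult_mult A.mult_smult B.smult_mult B.mult_smult
  show "r \<otimes>\<^bsub>FP\<^esub> gen c d \<in> D" using r
    by (cases rule: relation_cases) (use c in \<open>simp_all add: simps relation_mem\<close>)
  show "gen c d \<otimes>\<^bsub>FP\<^esub> r \<in> D" using r
    by (cases rule: relation_cases) (use c in \<open>simp_all add: simps relation_mem\<close>)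
qed

lemma D_ideal:
  assumes f: "f \<in> carrier FP" and d: "d \<in> D"
  shows "f \<otimes>\<^bsub>FP\<^esub> d \<in> D" "d \<otimes>\<^bsub>FP\<^esub> f \<in> D"
proof -
  have z: "\<exists>f\<in>carrier FP. f \<otimes>\<^bsub>FP\<^esub> g \<in> D" "\<exists>f\<in>carrier FP. g \<otimes>\<^bsub>FP\<^esub> f \<in> D" if "g \<in> carrier FP" for g
    using FP.submodule_zero[OF D_submodule] that by (auto intro!: bexI[of _ "\<zero>\<^bsub>FP\<^esub>"])
  have rc: "r \<in> carrier FP" if "r \<in> tensor_relations F A B" for r
    using that relations_closed by auto
  have 1: "f \<otimes>\<^bsub>FP\<^esub> r \<in> D" if r: "r \<in> tensor_relations F A B" for r
  proof -
    have "submodule {g \<in> carrier FP. g \<otimes>\<^bsub>FP\<^esub> r \<in> D} F FP"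
      using rc[OF r] z by (intro submodule_vimage[OF D_submodule]) (simp_all add: FP.add_mult FP.smult_mult)
    from FP_gen_induct[OF this] relation_mult_gen(2)[OF r]
    have "{g \<in> carrier FP. g \<otimes>\<^bsub>FP\<^esub> r \<in> D} = carrier FP" by simp
    thus ?thesis using f by blast
  qed
  have 2: "r \<otimes>\<^bsub>FP\<^esub> f \<in> D" if r: "r \<in> tensor_relations F A B" for r
  proof -
    have "submodule {g \<in> carrier FP. r \<otimes>\<^bsub>FP\<^esub> g \<in> D} F FP"
      using rc[OF r] z by (intro submodule_vimage[OF D_submodule]) (simp_all add: FP.mult_add FP.mult_smult)
    from FP_gen_induct[OF this] relation_mult_gen(1)[OF r]
    have "{g \<in> carrier FP. r \<otimes>\<^bsub>FP\<^esub> g \<in> D} = carrier FP" by simp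
    thus ?thesis using f by blast
  qed
  have "submodule {g \<in> carrier FP. f \<otimes>\<^bsub>FP\<^esub> g \<in> D} F FP"
    using f z by (intro submodule_vimage[OF D_submodule]) (simp_all add: FP.mult_add FP.mult_smult)
  from FP.module_span_least[OF this, of "tensor_relations F A B"] 1 rc
  have "D \<subseteq> {g \<in> carrier FP. f \<otimes>\<^bsub>FP\<^esub> g \<in> D}" by blast
  with d show "f \<otimes>\<^bsub>FP\<^esub> d \<in> D" by blast
  have "submodule {g \<in> carrier FP. g \<otimes>\<^bsub>FP\<^esub> f \<in> D} F FP"
    using f z by (intro submodule_vimage[OF D_submodule]) (simp_all add: FP.add_mult FP.smult_mult)
  from FP.module_span_least[OF this, of "tensor_relations F A B"] 2 rc
  have "D \<subseteq> {g \<in> carrier FP. g \<otimes>\<^bsub>FP\<^esub> f \<in> D}" by blast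
  with d show "d \<otimes>\<^bsub>FP\<^esub> f \<in> D" by blast
qed

lemma quot_ideal_D: "quot_ideal F FP D"
  using D_submodule D_ideal FP.falg_axioms
  by (simp add: quot_ideal_def quot_ideal_axioms_def)

interpretation TQ: quot_ideal F FP D by (rule quot_ideal_D)

lemma T_falg: "falg F T"
  unfolding tensor_alg_def by (rule TQ.quot_falg)

sublocale T: falg F T by (rule T_falg)

text \<open>The elementary tensor a \<otimes> b.\<close>

definition tau :: "'a \<Rightarrow> 'b \<Rightarrow> ('a \<times> 'b \<Rightarrow> 'f) set" where
  "tau a b = D +>\<^bsub>FP\<^esub> gen a b"

lemma tau_closed [simp, intro]: "a \<in> carrier A \<Longrightarrow> b \<in> carrier B \<Longrightarrow> tau a b \<in> carrier T"
  unfolding tau_def tensor_alg_def by (rule TQ.cls_closed) simp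

lemma tau_mult: "a \<in> carrier A \<Longrightarrow> b \<in> carrier B \<Longrightarrow> a' \<in> carrier A \<Longrightarrow> b' \<in> carrier B \<Longrightarrow>
    tau a b \<otimes>\<^bsub>T\<^esub> tau a' b' = tau (a \<otimes>\<^bsub>A\<^esub> a') (b \<otimes>\<^bsub>B\<^esub> b')"
  unfolding tau_def tensor_alg_def by (simp add: TQ.cls_mult FP_gen_mult_gen)

lemma one_T: "\<one>\<^bsub>T\<^esub> = tau \<one>\<^bsub>A\<^esub> \<one>\<^bsub>B\<^esub>"
  unfolding tau_def tensor_alg_def by (simp add: TQ.cls_one[symmetric] FP_simps(5))

lemma bilin_tau: "bilin F A B T tau"
proof (intro bilinI linI)
  fix a b b' assume *: "a \<in> carrier A" "b \<in> carrier B" "b' \<in> carrier B"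
  thus "tau a (b \<oplus>\<^bsub>B\<^esub> b') = tau a b \<oplus>\<^bsub>T\<^esub> tau a b'"
    unfolding tau_def tensor_alg_def by (simp add: TQ.cls_add TQ.cls_eq relation_mem)
next
  fix a b c assume *: "a \<in> carrier A" "b \<in> carrier B" "c \<in> carrier F"
  thus "tau a (c \<odot>\<^bsub>B\<^esub> b) = c \<odot>\<^bsub>T\<^esub> tau a b"
    unfolding tau_def tensor_alg_def by (simp add: TQ.cls_smult TQ.cls_eq relation_mem)
next
  fix a a' b assume *: "a \<in> carrier A" "a' \<in> carrier A" "b \<in> carrier B"
  thus "tau (a \<oplus>\<^bsub>A\<^esub> a') b = tau a b \<oplus>\<^bsub>T\<^esub> tau a' b"
    unfolding tau_def tensor_alg_def by (simp add: TQ.cls_add TQ.cls_eq relation_mem)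
next
  fix a b c assume *: "a \<in> carrier A" "b \<in> carrier B" "c \<in> carrier F"
  thus "tau (c \<odot>\<^bsub>A\<^esub> a) b = c \<odot>\<^bsub>T\<^esub> tau a b"
    unfolding tau_def tensor_alg_def by (simp add: TQ.cls_smult TQ.cls_eq relation_mem)
qed auto

lemmas lin_tau_right = bilinD(1)[OF bilin_tau]
lemmas lin_tau_left = bilinD(2)[OF bilin_tau]

lemma T_submodule_induct:
  assumes N: "submodule N F T" and g: "\<And>a b. a \<in> carrier A \<Longrightarrow> b \<in> carrier B \<Longrightarrow> tau a b \<in> N"
  shows "N = carrier T"
proof
  show "N \<subseteq> carrier T" by (rule T.submodule_subset[OF N])
  have l: "lin F FP T (\<lambda>f. D +>\<^bsub>FP\<^esub> f)" unfolding tensor_alg_def by (rule TQ.lin_cls)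
  have NT: "\<And>t. t \<in> N \<Longrightarrow> t \<in> carrier T" by (rule T.submodule_mem[OF N])
  have "submodule {f \<in> carrier FP. (D +>\<^bsub>FP\<^esub> f) \<in> N} F FP"
  proof (rule FP.submoduleI)
    interpret l: lin_map F FP T "\<lambda>f. D +>\<^bsub>FP\<^esub> f"
      by (intro lin_mapI FP.vspace_axioms T.vspace_axioms l)
    show "\<zero>\<^bsub>FP\<^esub> \<in> {f \<in> carrier FP. D +>\<^bsub>FP\<^esub> f \<in> N}"
      using T.submodule_zero[OF N] l.zero by simp
    show "\<ominus>\<^bsub>FP\<^esub> f \<in> {f \<in> carrier FP. D +>\<^bsub>FP\<^esub> f \<in> N}" if "f \<in> {f \<in> carrier FP. D +>\<^bsub>FP\<^esub> f \<in> N}" for f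
      using T.submodule_neg[OF N] l.neg that by simp
    show "f \<oplus>\<^bsub>FP\<^esub> g \<in> {f \<in> carrier FP. D +>\<^bsub>FP\<^esub> f \<in> N}"
      if "f \<in> {f \<in> carrier FP. D +>\<^bsub>FP\<^esub> f \<in> N}" "g \<in> {f \<in> carrier FP. D +>\<^bsub>FP\<^esub> f \<in> N}" for f g
      using T.submodule_add[OF N] l.add[of f g] that by simp
    show "c \<odot>\<^bsub>FP\<^esub> f \<in> {f \<in> carrier FP. D +>\<^bsub>FP\<^esub> f \<in> N}"
      if "c \<in> carrier F" "f \<in> {f \<in> carrier FP. D +>\<^bsub>FP\<^esub> f \<in> N}" for c f
      using T.submodule_smult[OF N] l.smult[of c f] that by simp
  qed auto
  from FP_gen_induct[OF this] g have "{f \<in> carrier FP. (D +>\<^bsub>FP\<^esub> f) \<in> N} = carrier FP"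
    by (simp add: tau_def)
  thus "carrier T \<subseteq> N" using TQ.carrier_quot by (auto simp: tensor_alg_def)
qed

text \<open>Plain sums suffice, without coefficients, because a scalar is absorbed into the left
  entry of an elementary tensor.\<close>

lemma T_list:
  assumes "t \<in> carrier T"
  shows "\<exists>ps. set ps \<subseteq> carrier A \<times> carrier B \<and> t = lsum T (map (\<lambda>(a, b). tau a b) ps)"
proof -
  define N where "N = {lsum T (map (\<lambda>(a, b). tau a b) ps) | ps. set ps \<subseteq> carrier A \<times> carrier B}"
  have c: "set (map (\<lambda>(a, b). tau a b) ps) \<subseteq> carrier T" if "set ps \<subseteq> carrier A \<times> carrier B" for ps
    using that by auto
  have sm: "c \<odot>\<^bsub>T\<^esub> x \<in> N" if cc: "c \<in> carrier F" and x: "x \<in> N" for c x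
  proof -
    from x obtain ps where ps: "set ps \<subseteq> carrier A \<times> carrier B" "x = lsum T (map (\<lambda>(a, b). tau a b) ps)"
      by (auto simp: N_def)
    have "c \<odot>\<^bsub>T\<^esub> x = lsum T (map (\<lambda>x. c \<odot>\<^bsub>T\<^esub> x) (map (\<lambda>(a, b). tau a b) ps))"
      unfolding ps(2) by (rule T.smult_lsum[OF cc c[OF ps(1)]])
    also have "map (\<lambda>x. c \<odot>\<^bsub>T\<^esub> x) (map (\<lambda>(a, b). tau a b) ps) = map (\<lambda>(a, b). tau a b) (map (\<lambda>(a, b). (c \<odot>\<^bsub>A\<^esub> a, b)) ps)"
      using ps cc lin_smult[OF lin_tau_left] by auto
    finally show ?thesis unfolding N_def using ps cc
      by (intro CollectI exI[of _ "map (\<lambda>(a, b). (c \<odot>\<^bsub>A\<^esub> a, b)) ps"]) auto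
  qed
  have "N \<subseteq> carrier T" using T.lsum_closed[OF c] by (auto simp: N_def)
  have "submodule N F T"
  proof (rule T.submoduleI)
    show "\<zero>\<^bsub>T\<^esub> \<in> N" unfolding N_def by (intro CollectI exI[of _ "[]"]) auto
    show "x \<oplus>\<^bsub>T\<^esub> y \<in> N" if xy: "x \<in> N" "y \<in> N" for x y
    proof -
      from xy obtain ps qs where "set ps \<subseteq> carrier A \<times> carrier B" "x = lsum T (map (\<lambda>(a, b). tau a b) ps)"
        "set qs \<subseteq> carrier A \<times> carrier B" "y = lsum T (map (\<lambda>(a, b). tau a b) qs)" by (auto simp: N_def)
      hence "x \<oplus>\<^bsub>T\<^esub> y = lsum T (map (\<lambda>(a, b). tau a b) (ps @ qs))" "set (ps @ qs) \<subseteq> carrier A \<times> carrier B"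
        using T.lsum_append[OF c[of ps] c[of qs]] by (simp_all del: set_map)
      thus ?thesis unfolding N_def by blast
    qed
    show "\<ominus>\<^bsub>T\<^esub> x \<in> N" if "x \<in> N" for x
      using sm[of "\<ominus> \<one>" x] that \<open>N \<subseteq> carrier T\<close> by (auto simp: T.smult_l_minus)
  qed (use \<open>N \<subseteq> carrier T\<close> sm in auto)
  moreover have "tau a b \<in> N" if "a \<in> carrier A" "b \<in> carrier B" for a b
    unfolding N_def using that by (intro CollectI exI[of _ "[(a, b)]"]) auto
  ultimately have "N = carrier T" by (rule T_submodule_induct)
  with assms have "t \<in> N" by simp
  thus ?thesis unfolding N_def by blast
qed

text \<open>There is no case for scalar multiples, which are absorbed into the elementary tensors,
  and none for zero, which is the elementary tensor 0 \<otimes> 0.\<close>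

lemma T_induct [consumes 1, case_names tau add]:
  assumes t: "t \<in> carrier T"
    and tau: "\<And>a b. a \<in> carrier A \<Longrightarrow> b \<in> carrier B \<Longrightarrow> Pr (tau a b)"
    and add: "\<And>s t. s \<in> carrier T \<Longrightarrow> t \<in> carrier T \<Longrightarrow> Pr s \<Longrightarrow> Pr t \<Longrightarrow> Pr (s \<oplus>\<^bsub>T\<^esub> t)"
  shows "Pr t"
proof -
  have "Pr (lsum T (map (\<lambda>(a, b). tau a b) ps)) \<and> lsum T (map (\<lambda>(a, b). tau a b) ps) \<in> carrier T"
    if "set ps \<subseteq> carrier A \<times> carrier B" for ps
    using that
  proof (induction ps)
    case Nil
    have "\<zero>\<^bsub>T\<^esub> = tau \<zero>\<^bsub>A\<^esub> \<zero>\<^bsub>B\<^esub>"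
      using lin_smult[OF lin_tau_left, of "\<zero>\<^bsub>B\<^esub>" \<zero> "\<zero>\<^bsub>A\<^esub>"] by simp
    thus ?case using tau[of "\<zero>\<^bsub>A\<^esub>" "\<zero>\<^bsub>B\<^esub>"] by simp
  next
    case (Cons p ps)
    thus ?case using tau[of "fst p" "snd p"] add[of "tau (fst p) (snd p)"] by (auto simp: split_def)
  qed
  thus ?thesis using T_list[OF t] by auto
qed

section \<open>Universal property and contractions\<close>

context
  fixes M :: "('f, 'm) module" and \<beta>
  assumes M: "vspace F M" and \<beta>: "bilin F A B M \<beta>"
begin

lemma lin_lift_aux: "lin F FP M (ext M \<beta>)"
  using ext_lin[OF M] lin_closed[OF bilinD(1)[OF \<beta>]] by blast

lemma ext_D: "d \<in> D \<Longrightarrow> ext M \<beta> d = \<zero>\<^bsub>M\<^esub>"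
proof -
  interpret M: vspace F M by (rule M)
  interpret e: lin_map F FP M "ext M \<beta>"
    by (intro lin_mapI FP.vspace_axioms M lin_lift_aux)
  have bc: "\<beta> a b \<in> carrier M" if "a \<in> carrier A" "b \<in> carrier B" for a b
    using lin_closed[OF bilinD(1)[OF \<beta>]] that by blast
  have g: "ext M \<beta> (gen a b) = \<beta> a b" if "a \<in> carrier A" "b \<in> carrier B" for a b
    using that bc by (intro ext_gen[OF M]) auto
  have "ext M \<beta> r = \<zero>\<^bsub>M\<^esub>" if "r \<in> tensor_relations F A B" for r
    using that
  proof (cases rule: relation_cases)
    case (addl a a' b)
    thus ?thesis using lin_add[OF bilinD(2)[OF \<beta>]] bc by (simp add: g M.eq_minus_zero)
  next
    case (addr a b b')
    thus ?thesis using lin_add[OF bilinD(1)[OF \<beta>]] bc by (simp add: g M.eq_minus_zero)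
  next
    case (sml c a b)
    thus ?thesis using lin_smult[OF bilinD(2)[OF \<beta>]] bc by (simp add: g M.eq_minus_zero)
  next
    case (smr c a b)
    thus ?thesis using lin_smult[OF bilinD(1)[OF \<beta>]] bc by (simp add: g M.eq_minus_zero)
  qed
  hence "D \<subseteq> {f \<in> carrier FP. ext M \<beta> f = \<zero>\<^bsub>M\<^esub>}"
    using relations_closed by (intro FP.module_span_least e.kernel_submodule) auto
  thus "d \<in> D \<Longrightarrow> ext M \<beta> d = \<zero>\<^bsub>M\<^esub>" by blast
qed

lemma lift_cls: "f \<in> carrier FP \<Longrightarrow> tensor_lift F M \<beta> (D +>\<^bsub>FP\<^esub> f) = ext M \<beta> f"
proof -
  interpret M: vspace F M by (rule M)
  interpret e: lin_map F FP M "ext M \<beta>"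
    by (intro lin_mapI FP.vspace_axioms M lin_lift_aux)
  have h: "ext M \<beta> x = ext M \<beta> y" if "x \<in> carrier FP" "y \<in> carrier FP" "x \<ominus>\<^bsub>FP\<^esub> y \<in> D" for x y
    using ext_D[OF that(3)] that by (simp add: M.eq_minus_zero)
  assume "f \<in> carrier FP"
  from TQ.the_elem_cls[where h = "ext M \<beta>", OF h this] show ?thesis
    unfolding tensor_lift_def ext_def .
qed

lemma lin_lift: "lin F T M (tensor_lift F M \<beta>)"
proof (rule linI)
  note l = lin_lift_aux
  show "tensor_lift F M \<beta> t \<in> carrier M" if "t \<in> carrier T" for t
    using that unfolding tensor_alg_def
    by (elim TQ.quotE) (simp add: lift_cls lin_closed[OF l])
  show "tensor_lift F M \<beta> (s \<oplus>\<^bsub>T\<^esub> t) = tensor_lift F M \<beta> s \<oplus>\<^bsub>M\<^esub> tensor_lift F M \<beta> t"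
    if "s \<in> carrier T" "t \<in> carrier T" for s t
    using that unfolding tensor_alg_def
    by (elim TQ.quotE) (simp add: TQ.cls_add lift_cls lin_add[OF l])
  show "tensor_lift F M \<beta> (c \<odot>\<^bsub>T\<^esub> t) = c \<odot>\<^bsub>M\<^esub> tensor_lift F M \<beta> t"
    if "c \<in> carrier F" "t \<in> carrier T" for c t
    using that unfolding tensor_alg_def
    by (elim TQ.quotE) (simp add: TQ.cls_smult lift_cls lin_smult[OF l])
qed

lemma lift_tau: "a \<in> carrier A \<Longrightarrow> b \<in> carrier B \<Longrightarrow> tensor_lift F M \<beta> (tau a b) = \<beta> a b"
  using lin_closed[OF bilinD(1)[OF \<beta>]]
  by (simp add: tau_def lift_cls) (intro ext_gen[OF M], auto)

end

lemma lin_T_eq: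
  assumes "lin F T M g" "lin F T M h" "\<And>a b. a \<in> carrier A \<Longrightarrow> b \<in> carrier B \<Longrightarrow> g (tau a b) = h (tau a b)"
    and "t \<in> carrier T"
  shows "g t = h t"
  using assms(4) by (induction rule: T_induct) (use assms in \<open>auto simp: lin_add\<close>)

text \<open>The contraction \<phi> \<otimes> id from \<open>T\<close> to \<open>B\<close>;
  \<open>conR\<close> is id \<otimes> \<psi>. Contractions take the place of the coordinates of a
  tensor with respect to a basis of one factor.\<close>

definition conL :: "('a \<Rightarrow> 'f) \<Rightarrow> ('a \<times> 'b \<Rightarrow> 'f) set \<Rightarrow> 'b" where
  "conL \<phi> = tensor_lift F B (\<lambda>a b. \<phi> a \<odot>\<^bsub>B\<^esub> b)"

definition conR :: "('b \<Rightarrow> 'f) \<Rightarrow> ('a \<times> 'b \<Rightarrow> 'f) set \<Rightarrow> 'a" where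
  "conR \<psi> = tensor_lift F A (\<lambda>a b. \<psi> b \<odot>\<^bsub>A\<^esub> a)"

lemma con_bilin:
  "lin F A (self_mod F) \<phi> \<Longrightarrow> bilin F A B B (\<lambda>a b. \<phi> a \<odot>\<^bsub>B\<^esub> b)"
  "lin F B (self_mod F) \<psi> \<Longrightarrow> bilin F A B A (\<lambda>a b. \<psi> b \<odot>\<^bsub>A\<^esub> a)"
proof -
  show "bilin F A B B (\<lambda>a b. \<phi> a \<odot>\<^bsub>B\<^esub> b)" if l: "lin F A (self_mod F) \<phi>"
    using lin_closed[OF l] lin_add[OF l] lin_smult[OF l]
    by (intro bilinI linI)
      (auto simp: B.smult_l_distr B.smult_r_distr B.smult_assoc1[symmetric] A.R.m_comm)
  show "bilin F A B A (\<lambda>a b. \<psi> b \<odot>\<^bsub>A\<^esub> a)" if l: "lin F B (self_mod F) \<psi>"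
    using lin_closed[OF l] lin_add[OF l] lin_smult[OF l]
    by (intro bilinI linI)
      (auto simp: A.smult_l_distr A.smult_r_distr A.smult_assoc1[symmetric] A.R.m_comm)
qed

lemma conL:
  assumes "lin F A (self_mod F) \<phi>"
  shows "lin F T B (conL \<phi>)" "a \<in> carrier A \<Longrightarrow> b \<in> carrier B \<Longrightarrow> conL \<phi> (tau a b) = \<phi> a \<odot>\<^bsub>B\<^esub> b"
  unfolding conL_def using lin_lift lift_tau B.vspace_axioms con_bilin(1)[OF assms] by blast+

lemma conR:
  assumes "lin F B (self_mod F) \<psi>"
  shows "lin F T A (conR \<psi>)" "a \<in> carrier A \<Longrightarrow> b \<in> carrier B \<Longrightarrow> conR \<psi> (tau a b) = \<psi> b \<odot>\<^bsub>A\<^esub> a"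
  unfolding conR_def using lin_lift lift_tau A.vspace_axioms con_bilin(2)[OF assms] by blast+

lemma tau_lsum_right: "a \<in> carrier A \<Longrightarrow> set xs \<subseteq> carrier B \<Longrightarrow> tau a (lsum B xs) = lsum T (map (tau a) xs)"
  by (rule lin_map.lsum[OF lin_mapI[OF B.vspace_axioms T.vspace_axioms lin_tau_right]])

lemma tau_lsum_left: "b \<in> carrier B \<Longrightarrow> set xs \<subseteq> carrier A \<Longrightarrow> tau (lsum A xs) b = lsum T (map (\<lambda>a. tau a b) xs)"
  by (rule lin_map.lsum[OF lin_mapI[OF A.vspace_axioms T.vspace_axioms lin_tau_left]])

text \<open>Both sides are linear in \<open>t\<close>, and on \<open>tau a b\<close> the equation is
  the frame expansion of \<open>a\<close>.\<close>

lemma frame_expand_left: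
  assumes fr: "frame F A fr" and t: "t \<in> carrier T"
  shows "t = lsum T (map (\<lambda>(a, \<phi>). tau a (conL \<phi> t)) fr)"
proof (rule lin_T_eq[OF lin_id _ _ t])
  note frc = frameD(1)[OF fr] and frl = frameD(2)[OF fr]
  show "lin F T T (\<lambda>t. lsum T (map (\<lambda>(a, \<phi>). tau a (conL \<phi> t)) fr))"
    unfolding split_def
  proof (rule T.lin_lsum)
    fix x assume "x \<in> set fr"
    hence "fst x \<in> carrier A" "lin F A (self_mod F) (snd x)"
      using frc[of "fst x" "snd x"] frl[of "fst x" "snd x"] by auto
    thus "lin F T T (\<lambda>t. tau (fst x) (conL (snd x) t))"
      by (intro lin_comp[OF conL(1) lin_tau_right])
  qed
  fix a b assume ab: "a \<in> carrier A" "b \<in> carrier B"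
  have fc: "\<phi> a \<in> carrier F" if "(x, \<phi>) \<in> set fr" for x \<phi>
    using lin_closed[OF frl[OF that] ab(1)] by simp
  have "tau a b = tau (lsum A (map (\<lambda>(b, \<phi>). \<phi> a \<odot>\<^bsub>A\<^esub> b) fr)) b"
    using frameD(3)[OF fr ab(1)] by simp
  also have "\<dots> = lsum T (map (\<lambda>a. tau a b) (map (\<lambda>(b, \<phi>). \<phi> a \<odot>\<^bsub>A\<^esub> b) fr))"
    by (rule tau_lsum_left) (use ab frc fc in auto)
  also have "map (\<lambda>a. tau a b) (map (\<lambda>(b, \<phi>). \<phi> a \<odot>\<^bsub>A\<^esub> b) fr) = map (\<lambda>(x, \<phi>). tau x (conL \<phi> (tau a b))) fr"
    unfolding map_map
  proof (rule map_cong[OF refl])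
    fix p assume "p \<in> set fr"
    moreover obtain x \<phi> where "p = (x, \<phi>)" by (cases p)
    ultimately have p: "p = (x, \<phi>)" "(x, \<phi>) \<in> set fr" by auto
    thus "((\<lambda>a. tau a b) \<circ> (\<lambda>(b, \<phi>). \<phi> a \<odot>\<^bsub>A\<^esub> b)) p = (case p of (x, \<phi>) \<Rightarrow> tau x (conL \<phi> (tau a b)))"
      using ab frc[OF p(2)] fc[OF p(2)] conL(2)[OF frl[OF p(2)] ab] lin_smult[OF lin_tau_left[OF ab(2)]]
        lin_smult[OF lin_tau_right] by simp
  qed
  finally show "tau a b = lsum T (map (\<lambda>(x, \<phi>). tau x (conL \<phi> (tau a b))) fr)" .
qed

lemma frame_expand_right:
  assumes fr: "frame F B fr" and t: "t \<in> carrier T"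
  shows "t = lsum T (map (\<lambda>(b, \<psi>). tau (conR \<psi> t) b) fr)"
proof (rule lin_T_eq[OF lin_id _ _ t])
  note frc = frameD(1)[OF fr] and frl = frameD(2)[OF fr]
  show "lin F T T (\<lambda>t. lsum T (map (\<lambda>(b, \<psi>). tau (conR \<psi> t) b) fr))"
    unfolding split_def
  proof (rule T.lin_lsum)
    fix x assume "x \<in> set fr"
    hence x: "fst x \<in> carrier B" "lin F B (self_mod F) (snd x)"
      using frc[of "fst x" "snd x"] frl[of "fst x" "snd x"] by auto
    thus "lin F T T (\<lambda>t. tau (conR (snd x) t) (fst x))"
      using lin_comp[OF conR(1)[OF x(2)] lin_tau_left[OF x(1)]] by simp
  qed
  fix a b assume ab: "a \<in> carrier A" "b \<in> carrier B"
  have fc: "\<phi> b \<in> carrier F" if "(x, \<phi>) \<in> set fr" for x \<phi>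
    using lin_closed[OF frl[OF that] ab(2)] by simp
  have "tau a b = tau a (lsum B (map (\<lambda>(x, \<phi>). \<phi> b \<odot>\<^bsub>B\<^esub> x) fr))"
    using frameD(3)[OF fr ab(2)] by simp
  also have "\<dots> = lsum T (map (tau a) (map (\<lambda>(x, \<phi>). \<phi> b \<odot>\<^bsub>B\<^esub> x) fr))"
    by (rule tau_lsum_right) (use ab frc fc in auto)
  also have "map (tau a) (map (\<lambda>(x, \<phi>). \<phi> b \<odot>\<^bsub>B\<^esub> x) fr) = map (\<lambda>(x, \<psi>). tau (conR \<psi> (tau a b)) x) fr"
    unfolding map_map
  proof (rule map_cong[OF refl])
    fix p assume "p \<in> set fr"
    moreover obtain x \<phi> where "p = (x, \<phi>)" by (cases p)
    ultimately have p: "p = (x, \<phi>)" "(x, \<phi>) \<in> set fr" by auto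
    thus "(tau a \<circ> (\<lambda>(x, \<phi>). \<phi> b \<odot>\<^bsub>B\<^esub> x)) p = (case p of (x, \<psi>) \<Rightarrow> tau (conR \<psi> (tau a b)) x)"
      using ab frc[OF p(2)] fc[OF p(2)] conR(2)[OF frl[OF p(2)] ab] lin_smult[OF lin_tau_right[OF ab(1)]]
        lin_smult[OF lin_tau_left] by simp
  qed
  finally show "tau a b = lsum T (map (\<lambda>(x, \<psi>). tau (conR \<psi> (tau a b)) x) fr)" .
qed

lemma T_fin_dim:
  assumes "fin_dim F A" "fin_dim F B"
  shows "fin_dim F T"
proof -
  obtain fa where fa: "frame F A fa" using fin_dim.ex_frame[OF assms(1)] by blast
  obtain fb where fb: "frame F B fb" using fin_dim.ex_frame[OF assms(2)] by blast
  define S where "S = (\<lambda>(p, q). tau (fst p) (fst q)) ` (set fa \<times> set fb)"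
  have Sc: "S \<subseteq> carrier T"
    using frameD(1)[OF fa] frameD(1)[OF fb] by (auto simp: S_def)
  have "carrier T \<subseteq> N" if N: "submodule N F T" "S \<subseteq> N" for N
  proof -
    have "tau a b \<in> N" if ab: "a \<in> carrier A" "b \<in> carrier B" for a b
    proof -
      have 1: "tau x b \<in> N" if "(x, \<phi>) \<in> set fa" for x \<phi>
      proof -
        have x: "x \<in> carrier A" using frameD(1)[OF fa that] .
        have "tau x b = tau x (lsum B (map (\<lambda>(y, \<psi>). \<psi> b \<odot>\<^bsub>B\<^esub> y) fb))"
          using frameD(3)[OF fb ab(2)] by simp
        also have "\<dots> = lsum T (map (tau x) (map (\<lambda>(y, \<psi>). \<psi> b \<odot>\<^bsub>B\<^esub> y) fb))"
          using frameD(1)[OF fb] lin_closed[OF frameD(2)[OF fb] ab(2)] x by (intro tau_lsum_right) auto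
        also have "\<dots> \<in> N"
        proof (rule T.submodule_lsum[OF N(1)], rule subsetI)
          fix z assume "z \<in> set (map (tau x) (map (\<lambda>(y, \<psi>). \<psi> b \<odot>\<^bsub>B\<^esub> y) fb))"
          then obtain y \<psi> where y: "(y, \<psi>) \<in> set fb" "z = tau x (\<psi> b \<odot>\<^bsub>B\<^esub> y)" by auto
          have "z = \<psi> b \<odot>\<^bsub>T\<^esub> tau x y"
            unfolding y(2) using lin_closed[OF frameD(2)[OF fb y(1)] ab(2)] frameD(1)[OF fb y(1)]
            by (intro lin_smult[OF lin_tau_right[OF x]]) auto
          moreover have "tau x y \<in> S" using that y by (force simp: S_def)
          ultimately show "z \<in> N"
            using N lin_closed[OF frameD(2)[OF fb y(1)] ab(2)] by (auto intro!: T.submodule_smult)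
        qed
        finally show ?thesis .
      qed
      have "tau a b = tau (lsum A (map (\<lambda>(x, \<phi>). \<phi> a \<odot>\<^bsub>A\<^esub> x) fa)) b"
        using frameD(3)[OF fa ab(1)] by simp
      also have "\<dots> = lsum T (map (\<lambda>a. tau a b) (map (\<lambda>(x, \<phi>). \<phi> a \<odot>\<^bsub>A\<^esub> x) fa))"
        using frameD(1)[OF fa] lin_closed[OF frameD(2)[OF fa] ab(1)] ab by (intro tau_lsum_left) auto
      also have "\<dots> \<in> N"
      proof (rule T.submodule_lsum[OF N(1)], rule subsetI)
        fix z assume "z \<in> set (map (\<lambda>a. tau a b) (map (\<lambda>(x, \<phi>). \<phi> a \<odot>\<^bsub>A\<^esub> x) fa))"
        then obtain x \<phi> where x: "(x, \<phi>) \<in> set fa" "z = tau (\<phi> a \<odot>\<^bsub>A\<^esub> x) b" by auto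
        have "z = \<phi> a \<odot>\<^bsub>T\<^esub> tau x b"
          unfolding x(2) using lin_closed[OF frameD(2)[OF fa x(1)] ab(1)] frameD(1)[OF fa x(1)]
          by (intro lin_smult[OF lin_tau_left[OF ab(2)]]) auto
        thus "z \<in> N"
          using N 1[OF x(1)] lin_closed[OF frameD(2)[OF fa x(1)] ab(1)] by (auto intro!: T.submodule_smult)
      qed
      finally show ?thesis .
    qed
    thus ?thesis using T_submodule_induct[OF N(1)] by simp
  qed
  hence "carrier T \<subseteq> module_span F T S" unfolding module_span_def by blast
  hence "module_span F T S = carrier T"
    using T.submodule_subset[OF T.module_span_submodule[OF Sc]] by simp
  hence "finite_dimensional F T" using Sc unfolding finite_dimensional_def
    by (intro exI[of _ S]) (auto simp: S_def)
  thus ?thesis using T.vspace_axioms by (simp add: fin_dim_def fin_dim_axioms_def)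
qed

end

section \<open>Associative and commutative algebras\<close>

locale assoc_alg = falg +
  assumes assoc: "x \<in> carrier A \<Longrightarrow> y \<in> carrier A \<Longrightarrow> z \<in> carrier A \<Longrightarrow>
    (x \<otimes>\<^bsub>A\<^esub> y) \<otimes>\<^bsub>A\<^esub> z = x \<otimes>\<^bsub>A\<^esub> (y \<otimes>\<^bsub>A\<^esub> z)"
begin

lemma ring_A: "ring A"
  by (intro ringI M.abelian_group_axioms monoidI) (auto simp: assoc add_mult mult_add)

sublocale A: ring A by (rule ring_A)

end

locale comm_alg = assoc_alg +
  assumes comm: "x \<in> carrier A \<Longrightarrow> y \<in> carrier A \<Longrightarrow> x \<otimes>\<^bsub>A\<^esub> y = y \<otimes>\<^bsub>A\<^esub> x"
begin

lemma lcomm: "x \<in> carrier A \<Longrightarrow> y \<in> carrier A \<Longrightarrow> z \<in> carrier A \<Longrightarrow>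
    x \<otimes>\<^bsub>A\<^esub> (y \<otimes>\<^bsub>A\<^esub> z) = y \<otimes>\<^bsub>A\<^esub> (x \<otimes>\<^bsub>A\<^esub> z)"
  by (metis assoc comm)

lemma cring_A: "cring A"
  by (intro cringI M.abelian_group_axioms comm_monoidI)
    (rule mult_closed one_closed one_left assoc comm add_mult; assumption?)+

sublocale A: cring A by (rule cring_A)

lemma algebra_A: "algebra F A"
  by (intro algebra.intro module_axioms cring_A algebra_axioms.intro) (simp add: smult_mult)

end

lemma (in tensor) T_assoc_alg:
  assumes "assoc_alg F A" "assoc_alg F B"
  shows "assoc_alg F T"
proof unfold_locales
  interpret A': assoc_alg F A by fact
  interpret B': assoc_alg F B by fact
  fix x y z assume x: "x \<in> carrier T" and y: "y \<in> carrier T" and z: "z \<in> carrier T"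
  show "x \<otimes>\<^bsub>T\<^esub> y \<otimes>\<^bsub>T\<^esub> z = x \<otimes>\<^bsub>T\<^esub> (y \<otimes>\<^bsub>T\<^esub> z)"
    using x
  proof (induction rule: T_induct)
    case (tau a b)
    note ab = this
    show ?case using y
    proof (induction rule: T_induct)
      case (tau c d)
      note cd = this
      show ?case using z
        by (induction rule: T_induct)
          (use ab cd in \<open>simp_all add: tau_mult A'.assoc B'.assoc T.mult_add\<close>)
    qed (use ab z in \<open>simp_all add: T.mult_add T.add_mult\<close>)
  qed (use y z in \<open>simp_all add: T.mult_add T.add_mult\<close>)
qed

lemma (in tensor) T_comm_alg:
  assumes "comm_alg F A" "comm_alg F B"
  shows "comm_alg F T"
proof -
  interpret A': comm_alg F A by fact
  interpret B': comm_alg F B by fact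
  interpret T': assoc_alg F T by (intro T_assoc_alg A'.assoc_alg_axioms B'.assoc_alg_axioms)
  show ?thesis
  proof unfold_locales
    fix x y assume x: "x \<in> carrier T" and y: "y \<in> carrier T"
    show "x \<otimes>\<^bsub>T\<^esub> y = y \<otimes>\<^bsub>T\<^esub> x"
      using x
    proof (induction rule: T_induct)
      case (tau a b)
      note ab = this
      show ?case using y
        by (induction rule: T_induct)
          (use ab in \<open>simp_all add: tau_mult A'.comm B'.comm T.mult_add T.add_mult\<close>)
    qed (use y in \<open>simp_all add: T.mult_add T.add_mult\<close>)
  qed
qed

section \<open>Separability elements\<close>

definition alg_hom :: "('f, 'k) ring_scheme \<Rightarrow> ('f, 'a) module \<Rightarrow> ('f, 'b) module \<Rightarrow> ('a \<Rightarrow> 'b) \<Rightarrow> bool" where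
  "alg_hom F A B h \<longleftrightarrow> lin F A B h \<and> h \<one>\<^bsub>A\<^esub> = \<one>\<^bsub>B\<^esub> \<and>
     (\<forall>x\<in>carrier A. \<forall>y\<in>carrier A. h (x \<otimes>\<^bsub>A\<^esub> y) = h x \<otimes>\<^bsub>B\<^esub> h y)"

lemma alg_homD:
  assumes "alg_hom F A B h"
  shows "lin F A B h" "h \<one>\<^bsub>A\<^esub> = \<one>\<^bsub>B\<^esub>"
    "x \<in> carrier A \<Longrightarrow> y \<in> carrier A \<Longrightarrow> h (x \<otimes>\<^bsub>A\<^esub> y) = h x \<otimes>\<^bsub>B\<^esub> h y"
    "x \<in> carrier A \<Longrightarrow> h x \<in> carrier B"
    "x \<in> carrier A \<Longrightarrow> y \<in> carrier A \<Longrightarrow> h (x \<oplus>\<^bsub>A\<^esub> y) = h x \<oplus>\<^bsub>B\<^esub> h y"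
    "c \<in> carrier F \<Longrightarrow> x \<in> carrier A \<Longrightarrow> h (c \<odot>\<^bsub>A\<^esub> x) = c \<odot>\<^bsub>B\<^esub> h x"
  using assms by (auto simp: alg_hom_def lin_def)

lemma alg_hom_id: "alg_hom F A A (\<lambda>x. x)"
  by (simp add: alg_hom_def lin_id)

text \<open>\<open>balanced F K ps k\<close> says that \<open>e = \<Sum>x \<otimes> y\<close>, the sum over the pairs of \<open>ps\<close>, satisfies
  \<open>(k \<otimes> 1) e = (1 \<otimes> k) e\<close>. A separability element is such an \<open>e\<close>, for all \<open>k\<close>, with \<open>\<Sum>x y = 1\<close>.\<close>

definition balanced :: "('f, 'k) ring_scheme \<Rightarrow> ('f, 'a) module \<Rightarrow> ('a \<times> 'a) list \<Rightarrow> 'a \<Rightarrow> bool" where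
  "balanced F K ps k \<longleftrightarrow>
     lsum (tensor_alg F K K) (map (\<lambda>p. tensor.tau F K K (k \<otimes>\<^bsub>K\<^esub> fst p) (snd p)) ps) =
     lsum (tensor_alg F K K) (map (\<lambda>p. tensor.tau F K K (fst p) (k \<otimes>\<^bsub>K\<^esub> snd p)) ps)"

text \<open>The image of the listed tensor under the multiplication map from K \<otimes> K to
  \<open>K\<close>.\<close>

definition psum :: "('f, 'a) module \<Rightarrow> ('a \<times> 'a) list \<Rightarrow> 'a" where
  "psum K ps = lsum K (map (\<lambda>p. fst p \<otimes>\<^bsub>K\<^esub> snd p) ps)"

definition separable :: "('f, 'k) ring_scheme \<Rightarrow> ('f, 'a) module \<Rightarrow> bool" where
  "separable F K \<longleftrightarrow> (\<exists>ps. set ps \<subseteq> carrier K \<times> carrier K \<and> psum K ps = \<one>\<^bsub>K\<^esub> \<and>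
     (\<forall>k\<in>carrier K. balanced F K ps k))"

lemma lin_lsum_map:
  assumes "vspace F V" "vspace F W" "lin F V W h" "\<And>x. x \<in> set xs \<Longrightarrow> f x \<in> carrier V"
  shows "h (lsum V (map f xs)) = lsum W (map (\<lambda>x. h (f x)) xs)"
proof -
  interpret h: lin_map F V W h using lin_mapI[OF assms(1-3)] .
  have "set (map f xs) \<subseteq> carrier V" using assms(4) by auto
  from h.lsum[OF this] show ?thesis by (simp add: comp_def)
qed

context comm_alg
begin

lemma tensor: "tensor F A A"
  by (intro tensor.intro falg_axioms)

sublocale TT: tensor F A A by (rule tensor)

lemma pair_mem: "set ps \<subseteq> carrier A \<times> carrier A \<Longrightarrow> p \<in> set ps \<Longrightarrow> fst p \<in> carrier A \<and> snd p \<in> carrier A"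
  by auto

text \<open>Balancedness is an equation in A \<otimes> A, so the linear map induced by any bilinear
  \<beta> may be applied to both sides. This is the form in which it gets used.\<close>

lemma balanced_bilin:
  assumes b: "balanced F A ps k" and ps: "set ps \<subseteq> carrier A \<times> carrier A" and k: "k \<in> carrier A"
    and M: "vspace F M" and \<beta>: "bilin F A A M \<beta>"
  shows "lsum M (map (\<lambda>p. \<beta> (k \<otimes>\<^bsub>A\<^esub> fst p) (snd p)) ps) = lsum M (map (\<lambda>p. \<beta> (fst p) (k \<otimes>\<^bsub>A\<^esub> snd p)) ps)"
proof -
  have p: "fst p \<in> carrier A" "snd p \<in> carrier A" if "p \<in> set ps" for p
    using pair_mem[OF ps that] by auto
  note l = lin_lsum_map[OF TT.T.vspace_axioms M TT.lin_lift[OF M \<beta>]]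
  have "lsum M (map (\<lambda>p. \<beta> (k \<otimes>\<^bsub>A\<^esub> fst p) (snd p)) ps)
    = lsum M (map (\<lambda>p. tensor_lift F M \<beta> (TT.tau (k \<otimes>\<^bsub>A\<^esub> fst p) (snd p))) ps)"
    using p k by (auto intro!: arg_cong[where f = "lsum M"] map_cong simp: TT.lift_tau[OF M \<beta>])
  also have "\<dots> = tensor_lift F M \<beta> (lsum TT.T (map (\<lambda>p. TT.tau (k \<otimes>\<^bsub>A\<^esub> fst p) (snd p)) ps))"
    using p k by (intro l[symmetric]) auto
  also have "\<dots> = tensor_lift F M \<beta> (lsum TT.T (map (\<lambda>p. TT.tau (fst p) (k \<otimes>\<^bsub>A\<^esub> snd p)) ps))"
    using b by (simp add: balanced_def)
  also have "\<dots> = lsum M (map (\<lambda>p. tensor_lift F M \<beta> (TT.tau (fst p) (k \<otimes>\<^bsub>A\<^esub> snd p))) ps)"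
    using p k by (intro l) auto
  also have "\<dots> = lsum M (map (\<lambda>p. \<beta> (fst p) (k \<otimes>\<^bsub>A\<^esub> snd p)) ps)"
    using p k by (auto intro!: arg_cong[where f = "lsum M"] map_cong simp: TT.lift_tau[OF M \<beta>])
  finally show ?thesis .
qed

text \<open>First \<open>l\<close> is moved to the right entry, then \<open>k\<close>. Together with
  \<open>balanced_submodule\<close> this shows that balancedness need only be checked on generators
  of the algebra.\<close>

lemma balanced_mult:
  assumes ps: "set ps \<subseteq> carrier A \<times> carrier A" and k: "k \<in> carrier A" "balanced F A ps k"
    and l: "l \<in> carrier A" "balanced F A ps l"
  shows "balanced F A ps (k \<otimes>\<^bsub>A\<^esub> l)"
proof -
  have p: "fst p \<in> carrier A" "snd p \<in> carrier A" if "p \<in> set ps" for p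
    using pair_mem[OF ps that] by auto
  have 1: "bilin F A A TT.T (\<lambda>a b. TT.tau (k \<otimes>\<^bsub>A\<^esub> a) b)"
    by (rule bilin_comp_lin[OF TT.bilin_tau lin_mult_left[OF k(1)] lin_id])
  have 2: "bilin F A A TT.T (\<lambda>a b. TT.tau a (l \<otimes>\<^bsub>A\<^esub> b))"
    by (rule bilin_comp_lin[OF TT.bilin_tau lin_id lin_mult_left[OF l(1)]])
  have "lsum TT.T (map (\<lambda>p. TT.tau (k \<otimes>\<^bsub>A\<^esub> l \<otimes>\<^bsub>A\<^esub> fst p) (snd p)) ps)
    = lsum TT.T (map (\<lambda>p. TT.tau (k \<otimes>\<^bsub>A\<^esub> (l \<otimes>\<^bsub>A\<^esub> fst p)) (snd p)) ps)"
    using p k l by (auto intro!: arg_cong[where f = "lsum TT.T"] map_cong simp: assoc)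
  also have "\<dots> = lsum TT.T (map (\<lambda>p. TT.tau (k \<otimes>\<^bsub>A\<^esub> fst p) (l \<otimes>\<^bsub>A\<^esub> snd p)) ps)"
    by (rule balanced_bilin[OF l(2) ps l(1) TT.T.vspace_axioms 1])
  also have "\<dots> = lsum TT.T (map (\<lambda>p. TT.tau (fst p) (l \<otimes>\<^bsub>A\<^esub> (k \<otimes>\<^bsub>A\<^esub> snd p))) ps)"
    by (rule balanced_bilin[OF k(2) ps k(1) TT.T.vspace_axioms 2])
  also have "\<dots> = lsum TT.T (map (\<lambda>p. TT.tau (fst p) (k \<otimes>\<^bsub>A\<^esub> l \<otimes>\<^bsub>A\<^esub> snd p)) ps)"
    using p k l by (auto intro!: arg_cong[where f = "lsum TT.T"] map_cong simp: assoc lcomm)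
  finally show ?thesis by (simp add: balanced_def)
qed

lemma balanced_submodule:
  assumes ps: "set ps \<subseteq> carrier A \<times> carrier A"
  shows "submodule {k \<in> carrier A. balanced F A ps k} F A"
proof -
  have p: "fst p \<in> carrier A" "snd p \<in> carrier A" if "p \<in> set ps" for p
    using pair_mem[OF ps that] by auto
  have pc: "lsum TT.T (map (\<lambda>p. TT.tau (k \<otimes>\<^bsub>A\<^esub> fst p) (snd p)) ps) \<in> carrier TT.T"
    "lsum TT.T (map (\<lambda>p. TT.tau (fst p) (k \<otimes>\<^bsub>A\<^esub> snd p)) ps) \<in> carrier TT.T" if "k \<in> carrier A" for k
    using p that by (auto intro!: TT.T.M.lsum_map_closed)
  define h where "h k = lsum TT.T (map (\<lambda>p. TT.tau (k \<otimes>\<^bsub>A\<^esub> fst p) (snd p)) ps) \<ominus>\<^bsub>TT.T\<^esub>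
     lsum TT.T (map (\<lambda>p. TT.tau (fst p) (k \<otimes>\<^bsub>A\<^esub> snd p)) ps)" for k
  have s: "lin F A TT.T (\<lambda>k. lsum TT.T (map (\<lambda>p. g p k) qs))"
    if "\<And>p. p \<in> set qs \<Longrightarrow> lin F A TT.T (g p)" for g qs
    using that
  proof (induction qs)
    case (Cons q qs)
    have 1: "lin F A TT.T (g q)" "lin F A TT.T (\<lambda>k. lsum TT.T (map (\<lambda>p. g p k) qs))"
      using Cons by auto
    show ?case
      by (rule linI) (simp_all add: lin_closed[OF 1(1)] lin_closed[OF 1(2)] lin_add[OF 1(1)] lin_add[OF 1(2)]
        lin_smult[OF 1(1)] lin_smult[OF 1(2)] TT.T.smult_r_distr TT.T.M.a_ac)
  qed (auto simp: lin_def)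
  have 1: "lin F A TT.T (\<lambda>k. lsum TT.T (map (\<lambda>p. TT.tau (k \<otimes>\<^bsub>A\<^esub> fst p) (snd p)) ps))"
    by (rule s, rule lin_comp[OF lin_mult_right TT.lin_tau_left]) (use p in auto)
  have 2: "lin F A TT.T (\<lambda>k. lsum TT.T (map (\<lambda>p. TT.tau (fst p) (k \<otimes>\<^bsub>A\<^esub> snd p)) ps))"
    by (rule s, rule lin_comp[OF lin_mult_right TT.lin_tau_right]) (use p in auto)
  have "lin F A TT.T h" unfolding h_def
    by (rule linI) (simp_all add: lin_closed[OF 1] lin_closed[OF 2] lin_add[OF 1] lin_add[OF 2]
        lin_smult[OF 1] lin_smult[OF 2] TT.T.smult_r_distr TT.T.smult_r_minus a_minus_def TT.T.M.minus_add TT.T.M.a_ac)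
  then interpret h: lin_map F A TT.T h
    by (intro lin_mapI vspace_axioms TT.T.vspace_axioms)
  have "{k \<in> carrier A. balanced F A ps k} = {k \<in> carrier A. h k = \<zero>\<^bsub>TT.T\<^esub>}"
    using TT.T.eq_minus_zero[OF pc] unfolding h_def balanced_def by blast
  thus ?thesis using h.kernel_submodule by simp
qed

text \<open>Averaging a projection onto an ideal over a separability element makes it \<open>A\<close>-linear;
  its value at \<open>1\<close> is then the required idempotent.\<close>

lemma separable_ideal:
  assumes sep: "separable F A" and fin: "fin_dim F A"
    and I: "submodule I F A" "\<And>k x. k \<in> carrier A \<Longrightarrow> x \<in> I \<Longrightarrow> k \<otimes>\<^bsub>A\<^esub> x \<in> I"
  shows "\<exists>e\<in>I. \<forall>x\<in>I. x \<otimes>\<^bsub>A\<^esub> e = x"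
proof -
  obtain \<pi> where l: "lin F A A \<pi>" and \<pi>: "\<And>v. v \<in> carrier A \<Longrightarrow> \<pi> v \<in> I" "\<And>u. u \<in> I \<Longrightarrow> \<pi> u = u"
    using fin_dim.ex_projection[OF fin I(1)] by blast
  obtain ps where ps: "set ps \<subseteq> carrier A \<times> carrier A" "psum A ps = \<one>\<^bsub>A\<^esub>"
    and b: "\<And>k. k \<in> carrier A \<Longrightarrow> balanced F A ps k" using sep by (auto simp: separable_def)
  have p: "fst p \<in> carrier A" "snd p \<in> carrier A" if "p \<in> set ps" for p
    using pair_mem[OF ps(1) that] by auto
  note Ic = submodule_mem[OF I(1)]
  define \<rho> where "\<rho> v = lsum A (map (\<lambda>p. fst p \<otimes>\<^bsub>A\<^esub> \<pi> (snd p \<otimes>\<^bsub>A\<^esub> v)) ps)" for v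
  have \<rho>I: "\<rho> v \<in> I" if "v \<in> carrier A" for v
    unfolding \<rho>_def using that p \<pi> I(2) by (intro submodule_lsum[OF I(1)]) auto
  have \<rho>_mult: "k \<otimes>\<^bsub>A\<^esub> \<rho> v = \<rho> (k \<otimes>\<^bsub>A\<^esub> v)" if k: "k \<in> carrier A" and v: "v \<in> carrier A" for k v
  proof -
    have bl: "bilin F A A A (\<lambda>a b. a \<otimes>\<^bsub>A\<^esub> \<pi> (b \<otimes>\<^bsub>A\<^esub> v))"
      by (rule bilin_comp_lin[OF bilin_mult lin_id lin_comp[OF lin_mult_right[OF v] l]])
    have "k \<otimes>\<^bsub>A\<^esub> \<rho> v = lsum A (map (\<lambda>p. k \<otimes>\<^bsub>A\<^esub> (fst p \<otimes>\<^bsub>A\<^esub> \<pi> (snd p \<otimes>\<^bsub>A\<^esub> v))) ps)"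
      unfolding \<rho>_def using k p v Ic[OF \<pi>(1)]
      by (intro lin_lsum_map[OF vspace_axioms vspace_axioms lin_mult_left[OF k]]) auto
    also have "\<dots> = lsum A (map (\<lambda>p. (k \<otimes>\<^bsub>A\<^esub> fst p) \<otimes>\<^bsub>A\<^esub> \<pi> (snd p \<otimes>\<^bsub>A\<^esub> v)) ps)"
      using k p v Ic[OF \<pi>(1)] by (auto intro!: arg_cong[where f = "lsum A"] map_cong simp: assoc)
    also have "\<dots> = lsum A (map (\<lambda>p. fst p \<otimes>\<^bsub>A\<^esub> \<pi> ((k \<otimes>\<^bsub>A\<^esub> snd p) \<otimes>\<^bsub>A\<^esub> v)) ps)"
      by (rule balanced_bilin[OF b[OF k] ps(1) k vspace_axioms bl])
    also have "\<dots> = \<rho> (k \<otimes>\<^bsub>A\<^esub> v)"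
      unfolding \<rho>_def using k p v by (auto intro!: arg_cong[where f = "lsum A"] map_cong simp: assoc lcomm)
    finally show ?thesis .
  qed
  have \<rho>_id: "\<rho> v = v" if v: "v \<in> I" for v
  proof -
    have "\<rho> v = lsum A (map (\<lambda>p. (fst p \<otimes>\<^bsub>A\<^esub> snd p) \<otimes>\<^bsub>A\<^esub> v) ps)"
      unfolding \<rho>_def using p Ic[OF v] \<pi>(2)[OF I(2)[OF _ v]]
      by (auto intro!: arg_cong[where f = "lsum A"] map_cong simp: assoc)
    also have "\<dots> = psum A ps \<otimes>\<^bsub>A\<^esub> v"
      unfolding psum_def using p Ic[OF v]
      by (intro lin_lsum_map[OF vspace_axioms vspace_axioms lin_mult_right, symmetric]) auto
    finally show ?thesis using ps(2) Ic[OF v] by simp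
  qed
  show ?thesis
  proof (intro bexI[of _ "\<rho> \<one>\<^bsub>A\<^esub>"] ballI)
    show "x \<otimes>\<^bsub>A\<^esub> \<rho> \<one>\<^bsub>A\<^esub> = x" if "x \<in> I" for x
      using \<rho>_mult[of x "\<one>\<^bsub>A\<^esub>"] \<rho>_id[OF that] Ic[OF that] by simp
  qed (use \<rho>I in auto)
qed

end

text \<open>The terms of the product, formed in the algebra C \<otimes> C, of the images of the two
  listed tensors.\<close>

definition pprod :: "('f, 'c) module \<Rightarrow> ('a \<Rightarrow> 'c) \<Rightarrow> ('b \<Rightarrow> 'c) \<Rightarrow> ('a \<times> 'a) list \<Rightarrow> ('b \<times> 'b) list \<Rightarrow> ('c \<times> 'c) list" where
  "pprod C \<alpha> \<beta> ps qs = map (\<lambda>(p, q). (\<alpha> (fst p) \<otimes>\<^bsub>C\<^esub> \<beta> (fst q), \<alpha> (snd p) \<otimes>\<^bsub>C\<^esub> \<beta> (snd q))) (List.product ps qs)"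

text \<open>Covers several uses at once: the tensor product of two algebras, the image of such a
  product in a larger algebra, the component cut out by an idempotent, and, with both maps the
  identity, the combination of two balanced tensors of one algebra.\<close>

locale comm_pair = K: comm_alg F K + L: comm_alg F L + C: comm_alg F C
  for F :: "('f, 'k) ring_scheme" (structure) and K :: "('f, 'a) module" (structure)
    and L :: "('f, 'b) module" (structure) and C :: "('f, 'c) module" (structure) +
  fixes \<alpha> \<beta>
  assumes \<alpha>: "alg_hom F K C \<alpha>" and \<beta>: "alg_hom F L C \<beta>"
begin

lemma pprod_closed:
  assumes ps: "set ps \<subseteq> carrier K \<times> carrier K" and qs: "set qs \<subseteq> carrier L \<times> carrier L"
  shows "set (pprod C \<alpha> \<beta> ps qs) \<subseteq> carrier C \<times> carrier C"
proof
  fix r assume "r \<in> set (pprod C \<alpha> \<beta> ps qs)"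
  then obtain p q where pq: "p \<in> set ps" "q \<in> set qs"
    "r = (\<alpha> (fst p) \<otimes>\<^bsub>C\<^esub> \<beta> (fst q), \<alpha> (snd p) \<otimes>\<^bsub>C\<^esub> \<beta> (snd q))" by (auto simp: pprod_def)
  thus "r \<in> carrier C \<times> carrier C"
    using K.pair_mem[OF ps pq(1)] L.pair_mem[OF qs pq(2)]
    by (simp add: alg_homD(4)[OF \<alpha>] alg_homD(4)[OF \<beta>])
qed

lemma lsum_pprod:
  assumes "abelian_monoid M"
    and "\<And>p q. p \<in> set ps \<Longrightarrow> q \<in> set qs \<Longrightarrow> g (\<alpha> (fst p) \<otimes>\<^bsub>C\<^esub> \<beta> (fst q), \<alpha> (snd p) \<otimes>\<^bsub>C\<^esub> \<beta> (snd q)) \<in> carrier M"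
  shows "lsum M (map g (pprod C \<alpha> \<beta> ps qs)) =
    lsum M (map (\<lambda>p. lsum M (map (\<lambda>q. g (\<alpha> (fst p) \<otimes>\<^bsub>C\<^esub> \<beta> (fst q), \<alpha> (snd p) \<otimes>\<^bsub>C\<^esub> \<beta> (snd q))) qs)) ps)"
proof -
  have "map g (pprod C \<alpha> \<beta> ps qs)
    = map (\<lambda>(p, q). g (\<alpha> (fst p) \<otimes>\<^bsub>C\<^esub> \<beta> (fst q), \<alpha> (snd p) \<otimes>\<^bsub>C\<^esub> \<beta> (snd q))) (List.product ps qs)"
    by (simp add: pprod_def comp_def split_def)
  thus ?thesis using abelian_monoid.lsum_product[OF assms] by simp
qed

lemma psum_pprod:
  assumes ps: "set ps \<subseteq> carrier K \<times> carrier K" and qs: "set qs \<subseteq> carrier L \<times> carrier L"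
  shows "psum C (pprod C \<alpha> \<beta> ps qs) = \<alpha> (psum K ps) \<otimes>\<^bsub>C\<^esub> \<beta> (psum L qs)"
proof -
  have p: "fst p \<in> carrier K" "snd p \<in> carrier K" if "p \<in> set ps" for p
    using K.pair_mem[OF ps that] by auto
  have q: "fst q \<in> carrier L" "snd q \<in> carrier L" if "q \<in> set qs" for q
    using L.pair_mem[OF qs that] by auto
  note ac = alg_homD(4)[OF \<alpha>] and bc = alg_homD(4)[OF \<beta>]
  have 1: "(\<alpha> (fst p) \<otimes>\<^bsub>C\<^esub> \<beta> (fst q)) \<otimes>\<^bsub>C\<^esub> (\<alpha> (snd p) \<otimes>\<^bsub>C\<^esub> \<beta> (snd q))
    = \<alpha> (fst p \<otimes>\<^bsub>K\<^esub> snd p) \<otimes>\<^bsub>C\<^esub> \<beta> (fst q \<otimes>\<^bsub>L\<^esub> snd q)"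
    if "p \<in> set ps" "q \<in> set qs" for p q
    using p[OF that(1)] q[OF that(2)] ac bc
    by (simp add: alg_homD(3)[OF \<alpha>] alg_homD(3)[OF \<beta>] C.assoc C.lcomm)
  have "psum C (pprod C \<alpha> \<beta> ps qs) = lsum C (map (\<lambda>p. lsum C (map (\<lambda>q.
      (\<alpha> (fst p) \<otimes>\<^bsub>C\<^esub> \<beta> (fst q)) \<otimes>\<^bsub>C\<^esub> (\<alpha> (snd p) \<otimes>\<^bsub>C\<^esub> \<beta> (snd q))) qs)) ps)"
    unfolding psum_def using p q ac bc
    by (subst lsum_pprod[OF C.M.abelian_monoid_axioms]) auto
  also have "\<dots> = lsum C (map (\<lambda>p. lsum C (map (\<lambda>q. \<alpha> (fst p \<otimes>\<^bsub>K\<^esub> snd p) \<otimes>\<^bsub>C\<^esub> \<beta> (fst q \<otimes>\<^bsub>L\<^esub> snd q)) qs)) ps)"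
    using 1 by (auto intro!: arg_cong[where f = "lsum C"] map_cong)
  also have "\<dots> = lsum C (map (\<lambda>p. \<alpha> (fst p \<otimes>\<^bsub>K\<^esub> snd p) \<otimes>\<^bsub>C\<^esub> \<beta> (psum L qs)) ps)"
  proof (intro arg_cong[where f = "lsum C"] map_cong refl)
    fix p assume "p \<in> set ps"
    thus "lsum C (map (\<lambda>q. \<alpha> (fst p \<otimes>\<^bsub>K\<^esub> snd p) \<otimes>\<^bsub>C\<^esub> \<beta> (fst q \<otimes>\<^bsub>L\<^esub> snd q)) qs)
      = \<alpha> (fst p \<otimes>\<^bsub>K\<^esub> snd p) \<otimes>\<^bsub>C\<^esub> \<beta> (psum L qs)"
      unfolding psum_def using p q ac
      by (intro lin_lsum_map[OF L.vspace_axioms C.vspace_axioms lin_comp[OF alg_homD(1)[OF \<beta>] C.lin_mult_left], symmetric]) auto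
  qed
  also have "\<dots> = \<alpha> (psum K ps) \<otimes>\<^bsub>C\<^esub> \<beta> (psum L qs)"
  proof -
    have "psum L qs \<in> carrier L" unfolding psum_def using q by auto
    thus ?thesis unfolding psum_def[of K] using p bc
      by (intro lin_lsum_map[OF K.vspace_axioms C.vspace_axioms lin_comp[OF alg_homD(1)[OF \<alpha>] C.lin_mult_right], symmetric]) auto
  qed
  finally show ?thesis .
qed

text \<open>A tensor that is balanced for \<open>k\<close> stays so when it is multiplied by any
  other tensor, as the multiplication in C \<otimes> C is commutative and associative. In the
  computation each entry of \<open>qs\<close> is frozen inside a bilinear map
  \<open>B q\<close>.\<close>

lemma balanced_left:
  assumes ps: "set ps \<subseteq> carrier K \<times> carrier K" and qs: "set qs \<subseteq> carrier L \<times> carrier L"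
    and k: "k \<in> carrier K" "balanced F K ps k"
  shows "balanced F C (pprod C \<alpha> \<beta> ps qs) (\<alpha> k)"
proof -
  have p: "fst p \<in> carrier K" "snd p \<in> carrier K" if "p \<in> set ps" for p
    using K.pair_mem[OF ps that] by auto
  have q: "fst q \<in> carrier L" "snd q \<in> carrier L" if "q \<in> set qs" for q
    using L.pair_mem[OF qs that] by auto
  note ac = alg_homD(4)[OF \<alpha>] and bc = alg_homD(4)[OF \<beta>] and am = alg_homD(3)[OF \<alpha>]
  define B where "B q a b = C.TT.tau (\<alpha> a \<otimes>\<^bsub>C\<^esub> \<beta> (fst q)) (\<alpha> b \<otimes>\<^bsub>C\<^esub> \<beta> (snd q))" for q a b
  have B: "bilin F K K C.TT.T (B q)" if "q \<in> set qs" for q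
    unfolding B_def
    by (intro bilin_comp_lin[OF C.TT.bilin_tau] lin_comp[OF alg_homD(1)[OF \<alpha>] C.lin_mult_right] bc q that)
  have Bc: "B q a b \<in> carrier C.TT.T" if "q \<in> set qs" "a \<in> carrier K" "b \<in> carrier K" for q a b
    using lin_closed[OF bilinD(1)[OF B[OF that(1)] that(2)] that(3)] .
  have "lsum C.TT.T (map (\<lambda>r. C.TT.tau (\<alpha> k \<otimes>\<^bsub>C\<^esub> fst r) (snd r)) (pprod C \<alpha> \<beta> ps qs))
    = lsum C.TT.T (map (\<lambda>p. lsum C.TT.T (map (\<lambda>q. C.TT.tau (\<alpha> k \<otimes>\<^bsub>C\<^esub> (\<alpha> (fst p) \<otimes>\<^bsub>C\<^esub> \<beta> (fst q))) (\<alpha> (snd p) \<otimes>\<^bsub>C\<^esub> \<beta> (snd q))) qs)) ps)"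
    using p q k ac bc by (subst lsum_pprod[OF C.TT.T.M.abelian_monoid_axioms]) auto
  also have "\<dots> = lsum C.TT.T (map (\<lambda>p. lsum C.TT.T (map (\<lambda>q. B q (k \<otimes>\<^bsub>K\<^esub> fst p) (snd p)) qs)) ps)"
    using p q k ac bc am
    by (auto intro!: arg_cong[where f = "lsum C.TT.T"] map_cong simp: B_def C.assoc)
  also have "\<dots> = lsum C.TT.T (map (\<lambda>q. lsum C.TT.T (map (\<lambda>p. B q (k \<otimes>\<^bsub>K\<^esub> fst p) (snd p)) ps)) qs)"
    using p k Bc by (intro C.TT.T.M.lsum_swap) auto
  also have "\<dots> = lsum C.TT.T (map (\<lambda>q. lsum C.TT.T (map (\<lambda>p. B q (fst p) (k \<otimes>\<^bsub>K\<^esub> snd p)) ps)) qs)"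
    by (rule arg_cong[where f = "lsum C.TT.T"], rule map_cong[OF refl],
        rule K.balanced_bilin[OF k(2) ps k(1) C.TT.T.vspace_axioms B])
  also have "\<dots> = lsum C.TT.T (map (\<lambda>p. lsum C.TT.T (map (\<lambda>q. B q (fst p) (k \<otimes>\<^bsub>K\<^esub> snd p)) qs)) ps)"
    using p k Bc by (intro C.TT.T.M.lsum_swap) auto
  also have "\<dots> = lsum C.TT.T (map (\<lambda>p. lsum C.TT.T (map (\<lambda>q. C.TT.tau (\<alpha> (fst p) \<otimes>\<^bsub>C\<^esub> \<beta> (fst q)) (\<alpha> k \<otimes>\<^bsub>C\<^esub> (\<alpha> (snd p) \<otimes>\<^bsub>C\<^esub> \<beta> (snd q)))) qs)) ps)"
    using p q k ac bc am
    by (auto intro!: arg_cong[where f = "lsum C.TT.T"] map_cong simp: B_def C.assoc)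
  also have "\<dots> = lsum C.TT.T (map (\<lambda>r. C.TT.tau (fst r) (\<alpha> k \<otimes>\<^bsub>C\<^esub> snd r)) (pprod C \<alpha> \<beta> ps qs))"
    using p q k ac bc by (subst lsum_pprod[OF C.TT.T.M.abelian_monoid_axioms]) auto
  finally show ?thesis by (simp add: balanced_def)
qed

lemma balanced_right:
  assumes ps: "set ps \<subseteq> carrier K \<times> carrier K" and qs: "set qs \<subseteq> carrier L \<times> carrier L"
    and k: "k \<in> carrier L" "balanced F L qs k"
  shows "balanced F C (pprod C \<alpha> \<beta> ps qs) (\<beta> k)"
proof -
  have p: "fst p \<in> carrier K" "snd p \<in> carrier K" if "p \<in> set ps" for p
    using K.pair_mem[OF ps that] by auto
  have q: "fst q \<in> carrier L" "snd q \<in> carrier L" if "q \<in> set qs" for q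
    using L.pair_mem[OF qs that] by auto
  note ac = alg_homD(4)[OF \<alpha>] and bc = alg_homD(4)[OF \<beta>] and bm = alg_homD(3)[OF \<beta>]
  define B where "B p a b = C.TT.tau (\<alpha> (fst p) \<otimes>\<^bsub>C\<^esub> \<beta> a) (\<alpha> (snd p) \<otimes>\<^bsub>C\<^esub> \<beta> b)" for p a b
  have B: "bilin F L L C.TT.T (B p)" if "p \<in> set ps" for p
    unfolding B_def
    by (intro bilin_comp_lin[OF C.TT.bilin_tau] lin_comp[OF alg_homD(1)[OF \<beta>] C.lin_mult_left] ac p that)
  have "lsum C.TT.T (map (\<lambda>r. C.TT.tau (\<beta> k \<otimes>\<^bsub>C\<^esub> fst r) (snd r)) (pprod C \<alpha> \<beta> ps qs))
    = lsum C.TT.T (map (\<lambda>p. lsum C.TT.T (map (\<lambda>q. C.TT.tau (\<beta> k \<otimes>\<^bsub>C\<^esub> (\<alpha> (fst p) \<otimes>\<^bsub>C\<^esub> \<beta> (fst q))) (\<alpha> (snd p) \<otimes>\<^bsub>C\<^esub> \<beta> (snd q))) qs)) ps)"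
    using p q k ac bc by (subst lsum_pprod[OF C.TT.T.M.abelian_monoid_axioms]) auto
  also have "\<dots> = lsum C.TT.T (map (\<lambda>p. lsum C.TT.T (map (\<lambda>q. B p (k \<otimes>\<^bsub>L\<^esub> fst q) (snd q)) qs)) ps)"
    using p q k ac bc bm
    by (auto intro!: arg_cong[where f = "lsum C.TT.T"] map_cong simp: B_def C.lcomm)
  also have "\<dots> = lsum C.TT.T (map (\<lambda>p. lsum C.TT.T (map (\<lambda>q. B p (fst q) (k \<otimes>\<^bsub>L\<^esub> snd q)) qs)) ps)"
    by (rule arg_cong[where f = "lsum C.TT.T"], rule map_cong[OF refl],
        rule L.balanced_bilin[OF k(2) qs k(1) C.TT.T.vspace_axioms B])
  also have "\<dots> = lsum C.TT.T (map (\<lambda>p. lsum C.TT.T (map (\<lambda>q. C.TT.tau (\<alpha> (fst p) \<otimes>\<^bsub>C\<^esub> \<beta> (fst q)) (\<beta> k \<otimes>\<^bsub>C\<^esub> (\<alpha> (snd p) \<otimes>\<^bsub>C\<^esub> \<beta> (snd q)))) qs)) ps)"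
    using p q k ac bc bm
    by (auto intro!: arg_cong[where f = "lsum C.TT.T"] map_cong simp: B_def C.lcomm)
  also have "\<dots> = lsum C.TT.T (map (\<lambda>r. C.TT.tau (fst r) (\<beta> k \<otimes>\<^bsub>C\<^esub> snd r)) (pprod C \<alpha> \<beta> ps qs))"
    using p q k ac bc by (subst lsum_pprod[OF C.TT.T.M.abelian_monoid_axioms]) auto
  finally show ?thesis by (simp add: balanced_def)
qed

text \<open>The product of the two separability elements is balanced for the images of
  \<open>K\<close> and of \<open>L\<close>, hence for products of these, and such products span
  \<open>C\<close>. Its image under multiplication is 1 times 1.\<close>

lemma separable_span:
  assumes "separable F K" "separable F L"
    and span: "\<And>N. submodule N F C \<Longrightarrow> (\<And>k l. k \<in> carrier K \<Longrightarrow> l \<in> carrier L \<Longrightarrow> \<alpha> k \<otimes>\<^bsub>C\<^esub> \<beta> l \<in> N) \<Longrightarrow> N = carrier C"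
  shows "separable F C"
proof -
  obtain ps where ps: "set ps \<subseteq> carrier K \<times> carrier K" "psum K ps = \<one>\<^bsub>K\<^esub>" "\<And>k. k \<in> carrier K \<Longrightarrow> balanced F K ps k"
    using assms(1) by (auto simp: separable_def)
  obtain qs where qs: "set qs \<subseteq> carrier L \<times> carrier L" "psum L qs = \<one>\<^bsub>L\<^esub>" "\<And>k. k \<in> carrier L \<Longrightarrow> balanced F L qs k"
    using assms(2) by (auto simp: separable_def)
  note rs = pprod_closed[OF ps(1) qs(1)]
  have "{c \<in> carrier C. balanced F C (pprod C \<alpha> \<beta> ps qs) c} = carrier C"
  proof (rule span[OF C.balanced_submodule[OF rs]])
    fix k l assume k: "k \<in> carrier K" and l: "l \<in> carrier L"
    thus "\<alpha> k \<otimes>\<^bsub>C\<^esub> \<beta> l \<in> {c \<in> carrier C. balanced F C (pprod C \<alpha> \<beta> ps qs) c}"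
      using C.balanced_mult[OF rs _ balanced_left[OF ps(1) qs(1) k ps(3)[OF k]] _ balanced_right[OF ps(1) qs(1) l qs(3)[OF l]]]
        alg_homD(4)[OF \<alpha>] alg_homD(4)[OF \<beta>] by auto
  qed
  thus ?thesis using rs psum_pprod[OF ps(1) qs(1)] ps(2) qs(2) alg_homD(2)[OF \<alpha>] alg_homD(2)[OF \<beta>]
    by (auto simp: separable_def)
qed

end

section \<open>Etale algebras\<close>

text \<open>Polynomial evaluation with the coefficients kept in \<open>F\<close>, so that one
  coefficient list can be evaluated in \<open>K\<close> as well as in each of its field
  factors.\<close>

primrec ev :: "('f, 'a) module \<Rightarrow> 'a \<Rightarrow> 'f list \<Rightarrow> 'a" where
  "ev K k [] = \<zero>\<^bsub>K\<^esub>"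
| "ev K k (c # cs) = c \<odot>\<^bsub>K\<^esub> k [^]\<^bsub>K\<^esub> length cs \<oplus>\<^bsub>K\<^esub> ev K k cs"

text \<open>The Bezoutian \<open>(f(X) - f(Y)) / (X - Y)\<close> at \<open>X = k \<otimes> 1\<close>, \<open>Y = 1 \<otimes> k\<close>, where \<open>f\<close> is given by
  its coefficients in descending order; its image under multiplication is \<open>f'(k)\<close>.\<close>

primrec bezoutian :: "('f, 'a) module \<Rightarrow> 'a \<Rightarrow> 'f list \<Rightarrow> ('a \<times> 'a) list" where
  "bezoutian K k [] = []"
| "bezoutian K k (c # cs) =
     map (\<lambda>i. (c \<odot>\<^bsub>K\<^esub> k [^]\<^bsub>K\<^esub> i, k [^]\<^bsub>K\<^esub> (length cs - Suc i))) [0..<length cs] @ bezoutian K k cs"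

lemma (in abelian_monoid) lsum_telescope:
  fixes g :: "nat \<Rightarrow> 'a"
  assumes "\<And>i. g i \<in> carrier G"
  shows "lsum G (map (\<lambda>i. g (Suc i)) [0..<n]) \<oplus> g 0 = lsum G (map g [0..<n]) \<oplus> g n"
proof (induction n)
  case (Suc n)
  define s t where "s = lsum G (map (\<lambda>i. g (Suc i)) [0..<n])" and "t = lsum G (map g [0..<n])"
  have c: "s \<in> carrier G" "t \<in> carrier G"
    using assms by (auto intro!: lsum_map_closed simp: s_def t_def)
  have "lsum G (map (\<lambda>i. g (Suc i)) [0..<Suc n]) = s \<oplus> g (Suc n)" "lsum G (map g [0..<Suc n]) = t \<oplus> g n"
    using assms by (simp_all add: lsum_append image_subset_iff s_def t_def)
  moreover have "s \<oplus> g (Suc n) \<oplus> g 0 = (s \<oplus> g 0) \<oplus> g (Suc n)" using c assms by (simp add: a_ac)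
  ultimately show ?case using Suc unfolding s_def[symmetric] t_def[symmetric] by simp
qed (use assms in simp)

lemma (in abelian_monoid) lsum_const: "a \<in> carrier G \<Longrightarrow> lsum G (map (\<lambda>i. a) [0..<n]) = add_pow G n a"
  by (induction n) (auto simp: lsum_append image_subset_iff)

section \<open>Bezoutians and local separability elements\<close>

context comm_alg
begin

lemma ev_closed [simp]: "k \<in> carrier A \<Longrightarrow> set cs \<subseteq> carrier F \<Longrightarrow> ev A k cs \<in> carrier A"
  by (induction cs) auto

lemma bezoutian_closed: "k \<in> carrier A \<Longrightarrow> set cs \<subseteq> carrier F \<Longrightarrow> set (bezoutian A k cs) \<subseteq> carrier A \<times> carrier A"
  by (induction cs) auto

lemma pow_Suc_left: "k \<in> carrier A \<Longrightarrow> k \<otimes>\<^bsub>A\<^esub> k [^]\<^bsub>A\<^esub> (i::nat) = k [^]\<^bsub>A\<^esub> Suc i"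
  using A.nat_pow_Suc2 by simp

text \<open>This is X b(X, Y) + f(Y) = Y b(X, Y) + f(X) for the Bezoutian b of f, at X = k \<otimes>
  1 and Y = 1 \<otimes> k, pushed through \<beta>. Each coefficient contributes one telescoping
  sum.\<close>

lemma bezoutian_telescope:
  assumes M: "vspace F M" and \<beta>: "bilin F A A M \<beta>" and k: "k \<in> carrier A" and "set cs \<subseteq> carrier F"
  shows "lsum M (map (\<lambda>p. \<beta> (k \<otimes>\<^bsub>A\<^esub> fst p) (snd p)) (bezoutian A k cs)) \<oplus>\<^bsub>M\<^esub> \<beta> \<one>\<^bsub>A\<^esub> (ev A k cs)
    = lsum M (map (\<lambda>p. \<beta> (fst p) (k \<otimes>\<^bsub>A\<^esub> snd p)) (bezoutian A k cs)) \<oplus>\<^bsub>M\<^esub> \<beta> (ev A k cs) \<one>\<^bsub>A\<^esub>"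
  using assms(4)
proof (induction cs)
  case Nil
  interpret M: vspace F M by fact
  have "\<beta> \<one>\<^bsub>A\<^esub> \<zero>\<^bsub>A\<^esub> = \<zero>\<^bsub>M\<^esub>" "\<beta> \<zero>\<^bsub>A\<^esub> \<one>\<^bsub>A\<^esub> = \<zero>\<^bsub>M\<^esub>"
    using lin_map.zero[OF lin_mapI[OF vspace_axioms M bilinD(1)[OF \<beta>]]]
      lin_map.zero[OF lin_mapI[OF vspace_axioms M bilinD(2)[OF \<beta>]]] by auto
  thus ?case by simp
next
  case (Cons c cs)
  interpret M: vspace F M by fact
  have bc: "\<beta> a b \<in> carrier M" if "a \<in> carrier A" "b \<in> carrier A" for a b
    using lin_closed[OF bilinD(1)[OF \<beta>]] that by blast
  have c: "c \<in> carrier F" and cs: "set cs \<subseteq> carrier F" using Cons.prems by auto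
  define n where "n = length cs"
  define g where "g i = \<beta> (c \<odot>\<^bsub>A\<^esub> k [^]\<^bsub>A\<^esub> i) (k [^]\<^bsub>A\<^esub> (n - i))" for i
  define ps where "ps = map (\<lambda>i. (c \<odot>\<^bsub>A\<^esub> k [^]\<^bsub>A\<^esub> i, k [^]\<^bsub>A\<^esub> (n - Suc i))) [0..<n]"
  have gc: "g i \<in> carrier M" for i unfolding g_def using c k bc by auto
  have 1: "map (\<lambda>p. \<beta> (k \<otimes>\<^bsub>A\<^esub> fst p) (snd p)) ps = map (\<lambda>i. g (Suc i)) [0..<n]"
    using c k by (auto simp: ps_def g_def mult_smult pow_Suc_left simp del: A.nat_pow_Suc)
  have 2: "map (\<lambda>p. \<beta> (fst p) (k \<otimes>\<^bsub>A\<^esub> snd p)) ps = map g [0..<n]"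
    using c k by (auto simp: ps_def g_def pow_Suc_left Suc_diff_Suc simp del: A.nat_pow_Suc)
  have g0: "g 0 = \<beta> \<one>\<^bsub>A\<^esub> (c \<odot>\<^bsub>A\<^esub> k [^]\<^bsub>A\<^esub> n)"
    using c k lin_smult[OF bilinD(1)[OF \<beta>]] lin_smult[OF bilinD(2)[OF \<beta>]] by (simp add: g_def)
  have gn: "g n = \<beta> (c \<odot>\<^bsub>A\<^esub> k [^]\<^bsub>A\<^esub> n) \<one>\<^bsub>A\<^esub>" using k by (simp add: g_def)
  have tel: "lsum M (map (\<lambda>p. \<beta> (k \<otimes>\<^bsub>A\<^esub> fst p) (snd p)) ps) \<oplus>\<^bsub>M\<^esub> g 0 = lsum M (map (\<lambda>p. \<beta> (fst p) (k \<otimes>\<^bsub>A\<^esub> snd p)) ps) \<oplus>\<^bsub>M\<^esub> g n"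
    unfolding 1 2 by (rule M.M.lsum_telescope[OF gc])
  have psc: "set ps \<subseteq> carrier A \<times> carrier A" using c k by (auto simp: ps_def)
  have cl: "lsum M (map (\<lambda>p. \<beta> (k \<otimes>\<^bsub>A\<^esub> fst p) (snd p)) qs) \<in> carrier M" "lsum M (map (\<lambda>p. \<beta> (fst p) (k \<otimes>\<^bsub>A\<^esub> snd p)) qs) \<in> carrier M"
    "set (map (\<lambda>p. \<beta> (k \<otimes>\<^bsub>A\<^esub> fst p) (snd p)) qs) \<subseteq> carrier M" "set (map (\<lambda>p. \<beta> (fst p) (k \<otimes>\<^bsub>A\<^esub> snd p)) qs) \<subseteq> carrier M"
    if "set qs \<subseteq> carrier A \<times> carrier A" for qs
    using pair_mem[OF that] k bc by (auto intro!: M.M.lsum_map_closed)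
  note bzc = bezoutian_closed[OF k cs]
  have sum: "\<beta> \<one>\<^bsub>A\<^esub> (ev A k (c # cs)) = g 0 \<oplus>\<^bsub>M\<^esub> \<beta> \<one>\<^bsub>A\<^esub> (ev A k cs)"
    "\<beta> (ev A k (c # cs)) \<one>\<^bsub>A\<^esub> = g n \<oplus>\<^bsub>M\<^esub> \<beta> (ev A k cs) \<one>\<^bsub>A\<^esub>"
    using c k cs lin_add[OF bilinD(1)[OF \<beta>]] lin_add[OF bilinD(2)[OF \<beta>]] by (simp_all add: g0[unfolded n_def] gn[unfolded n_def] n_def)
  have bz: "bezoutian A k (c # cs) = ps @ bezoutian A k cs" by (simp add: ps_def n_def)
  have ec: "\<beta> \<one>\<^bsub>A\<^esub> (ev A k cs) \<in> carrier M" "\<beta> (ev A k cs) \<one>\<^bsub>A\<^esub> \<in> carrier M" using bc k cs by auto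
  have "lsum M (map (\<lambda>p. \<beta> (k \<otimes>\<^bsub>A\<^esub> fst p) (snd p)) (bezoutian A k (c # cs))) \<oplus>\<^bsub>M\<^esub> \<beta> \<one>\<^bsub>A\<^esub> (ev A k (c # cs))
    = (lsum M (map (\<lambda>p. \<beta> (k \<otimes>\<^bsub>A\<^esub> fst p) (snd p)) ps) \<oplus>\<^bsub>M\<^esub> g 0) \<oplus>\<^bsub>M\<^esub>
      (lsum M (map (\<lambda>p. \<beta> (k \<otimes>\<^bsub>A\<^esub> fst p) (snd p)) (bezoutian A k cs)) \<oplus>\<^bsub>M\<^esub> \<beta> \<one>\<^bsub>A\<^esub> (ev A k cs))"
    unfolding sum bz map_append M.M.lsum_append[OF cl(3)[OF psc] cl(3)[OF bzc]]
    using cl[OF psc] cl[OF bzc] gc ec by (simp add: M.M.a_ac)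
  also have "\<dots> = (lsum M (map (\<lambda>p. \<beta> (fst p) (k \<otimes>\<^bsub>A\<^esub> snd p)) ps) \<oplus>\<^bsub>M\<^esub> g n) \<oplus>\<^bsub>M\<^esub>
      (lsum M (map (\<lambda>p. \<beta> (fst p) (k \<otimes>\<^bsub>A\<^esub> snd p)) (bezoutian A k cs)) \<oplus>\<^bsub>M\<^esub> \<beta> (ev A k cs) \<one>\<^bsub>A\<^esub>)"
    unfolding tel Cons.IH[OF cs] ..
  also have "\<dots> = lsum M (map (\<lambda>p. \<beta> (fst p) (k \<otimes>\<^bsub>A\<^esub> snd p)) (bezoutian A k (c # cs))) \<oplus>\<^bsub>M\<^esub> \<beta> (ev A k (c # cs)) \<one>\<^bsub>A\<^esub>"
    unfolding sum bz map_append M.M.lsum_append[OF cl(4)[OF psc] cl(4)[OF bzc]]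
    using cl[OF psc] cl[OF bzc] gc ec by (simp add: M.M.a_ac)
  finally show ?case .
qed

lemma psum_closed [simp]: "set ps \<subseteq> carrier A \<times> carrier A \<Longrightarrow> psum A ps \<in> carrier A"
  unfolding psum_def by (rule M.lsum_map_closed) (auto dest: pair_mem)

text \<open>On the component cut out by \<open>e\<close> the element \<open>k\<close> is a root, so
  the Bezoutian is balanced for \<open>k\<close> there. Its image under multiplication is the
  derivative at \<open>k\<close>, whose inverse on this component is represented by
  \<open>w\<close>; multiplying by \<open>w\<close> turns the image into \<open>e\<close>.\<close>

lemma local_separability:
  assumes k: "k \<in> carrier A" and e: "e \<in> carrier A" "e \<otimes>\<^bsub>A\<^esub> e = e" and w: "w \<in> carrier A" and cs: "set cs \<subseteq> carrier F"
    and 0: "ev A k cs \<otimes>\<^bsub>A\<^esub> e = \<zero>\<^bsub>A\<^esub>" and 1: "psum A (bezoutian A k cs) \<otimes>\<^bsub>A\<^esub> (w \<otimes>\<^bsub>A\<^esub> e) = e"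
  shows "\<exists>ps. set ps \<subseteq> carrier A \<times> carrier A \<and> psum A ps = e \<and> balanced F A ps k"
proof -
  define bs where "bs = bezoutian A k cs"
  define ps where "ps = map (\<lambda>p. (fst p \<otimes>\<^bsub>A\<^esub> e, snd p \<otimes>\<^bsub>A\<^esub> (w \<otimes>\<^bsub>A\<^esub> e))) bs"
  have bs: "set bs \<subseteq> carrier A \<times> carrier A" unfolding bs_def by (rule bezoutian_closed[OF k cs])
  have p: "fst p \<in> carrier A" "snd p \<in> carrier A" if "p \<in> set bs" for p
    using pair_mem[OF bs that] by auto
  have "set ps \<subseteq> carrier A \<times> carrier A" using p e w by (fastforce simp: ps_def)
  moreover have "psum A ps = e"
  proof -
    have "(x \<otimes>\<^bsub>A\<^esub> e) \<otimes>\<^bsub>A\<^esub> (y \<otimes>\<^bsub>A\<^esub> (w \<otimes>\<^bsub>A\<^esub> e)) = (x \<otimes>\<^bsub>A\<^esub> y) \<otimes>\<^bsub>A\<^esub> (w \<otimes>\<^bsub>A\<^esub> e)"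
      if "x \<in> carrier A" "y \<in> carrier A" for x y
    proof -
      have "(x \<otimes>\<^bsub>A\<^esub> e) \<otimes>\<^bsub>A\<^esub> (y \<otimes>\<^bsub>A\<^esub> (w \<otimes>\<^bsub>A\<^esub> e)) = (x \<otimes>\<^bsub>A\<^esub> y) \<otimes>\<^bsub>A\<^esub> (w \<otimes>\<^bsub>A\<^esub> (e \<otimes>\<^bsub>A\<^esub> e))"
        using that e(1) w by (simp add: assoc lcomm comm)
      thus ?thesis unfolding e(2) .
    qed
    hence "psum A ps = lsum A (map (\<lambda>p. (fst p \<otimes>\<^bsub>A\<^esub> snd p) \<otimes>\<^bsub>A\<^esub> (w \<otimes>\<^bsub>A\<^esub> e)) bs)"
      using p by (auto simp: psum_def ps_def intro!: arg_cong[where f = "lsum A"])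
    also have "\<dots> = psum A bs \<otimes>\<^bsub>A\<^esub> (w \<otimes>\<^bsub>A\<^esub> e)"
      unfolding psum_def using p e w
      by (intro lin_lsum_map[OF vspace_axioms vspace_axioms lin_mult_right, symmetric]) auto
    finally show ?thesis using 1 by (simp add: bs_def)
  qed
  moreover have "balanced F A ps k"
  proof -
    define \<beta> where "\<beta> a b = TT.tau (a \<otimes>\<^bsub>A\<^esub> e) (b \<otimes>\<^bsub>A\<^esub> (w \<otimes>\<^bsub>A\<^esub> e))" for a b
    have \<beta>: "bilin F A A TT.T \<beta>" unfolding \<beta>_def
      using e w by (intro bilin_comp_lin[OF TT.bilin_tau] lin_mult_right) auto
    have tz: "TT.tau \<zero>\<^bsub>A\<^esub> x = \<zero>\<^bsub>TT.T\<^esub>" "TT.tau x \<zero>\<^bsub>A\<^esub> = \<zero>\<^bsub>TT.T\<^esub>" if "x \<in> carrier A" for x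
      using lin_map.zero[OF lin_mapI[OF vspace_axioms TT.T.vspace_axioms TT.lin_tau_left]]
        lin_map.zero[OF lin_mapI[OF vspace_axioms TT.T.vspace_axioms TT.lin_tau_right]] that by auto
    have "\<beta> (ev A k cs) \<one>\<^bsub>A\<^esub> = \<zero>\<^bsub>TT.T\<^esub>" using e w by (simp add: \<beta>_def 0 tz)
    moreover have "ev A k cs \<otimes>\<^bsub>A\<^esub> (w \<otimes>\<^bsub>A\<^esub> e) = w \<otimes>\<^bsub>A\<^esub> (ev A k cs \<otimes>\<^bsub>A\<^esub> e)"
      using e w k cs by (simp add: lcomm)
    hence "\<beta> \<one>\<^bsub>A\<^esub> (ev A k cs) = \<zero>\<^bsub>TT.T\<^esub>" using e w by (simp add: \<beta>_def 0 tz)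
    moreover have c: "lsum TT.T (map (\<lambda>p. \<beta> (k \<otimes>\<^bsub>A\<^esub> fst p) (snd p)) bs) \<in> carrier TT.T"
      "lsum TT.T (map (\<lambda>p. \<beta> (fst p) (k \<otimes>\<^bsub>A\<^esub> snd p)) bs) \<in> carrier TT.T"
      using p e w k by (auto intro!: TT.T.M.lsum_map_closed simp: \<beta>_def)
    ultimately have "lsum TT.T (map (\<lambda>p. \<beta> (k \<otimes>\<^bsub>A\<^esub> fst p) (snd p)) bs) = lsum TT.T (map (\<lambda>p. \<beta> (fst p) (k \<otimes>\<^bsub>A\<^esub> snd p)) bs)"
      using bezoutian_telescope[OF TT.T.vspace_axioms \<beta> k cs] by (simp add: bs_def)
    moreover have "map (\<lambda>p. TT.tau (k \<otimes>\<^bsub>A\<^esub> fst p) (snd p)) ps = map (\<lambda>p. \<beta> (k \<otimes>\<^bsub>A\<^esub> fst p) (snd p)) bs"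
      "map (\<lambda>p. TT.tau (fst p) (k \<otimes>\<^bsub>A\<^esub> snd p)) ps = map (\<lambda>p. \<beta> (fst p) (k \<otimes>\<^bsub>A\<^esub> snd p)) bs"
      using p e w k by (auto simp: ps_def \<beta>_def assoc)
    ultimately show ?thesis by (simp add: balanced_def)
  qed
  ultimately show ?thesis by blast
qed

lemma balanced_append:
  assumes ps: "set ps \<subseteq> carrier A \<times> carrier A" and qs: "set qs \<subseteq> carrier A \<times> carrier A" and k: "k \<in> carrier A"
    and b: "balanced F A ps k" "balanced F A qs k"
  shows "balanced F A (ps @ qs) k" "psum A (ps @ qs) = psum A ps \<oplus>\<^bsub>A\<^esub> psum A qs"
proof -
  have c: "set (map (\<lambda>p. TT.tau (k \<otimes>\<^bsub>A\<^esub> fst p) (snd p)) rs) \<subseteq> carrier TT.T"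
    "set (map (\<lambda>p. TT.tau (fst p) (k \<otimes>\<^bsub>A\<^esub> snd p)) rs) \<subseteq> carrier TT.T"
    "set (map (\<lambda>p. fst p \<otimes>\<^bsub>A\<^esub> snd p) rs) \<subseteq> carrier A"
    if "set rs \<subseteq> carrier A \<times> carrier A" for rs
    using pair_mem[OF that] k by auto
  show "balanced F A (ps @ qs) k"
    unfolding balanced_def map_append TT.T.M.lsum_append[OF c(1)[OF ps] c(1)[OF qs]]
      TT.T.M.lsum_append[OF c(2)[OF ps] c(2)[OF qs]]
    using b by (simp add: balanced_def)
  show "psum A (ps @ qs) = psum A ps \<oplus>\<^bsub>A\<^esub> psum A qs"
    unfolding psum_def map_append M.lsum_append[OF c(3)[OF ps] c(3)[OF qs]] ..
qed

text \<open>Glues local tensors: their images under multiplication add up, to 1 when the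
  \<open>es\<close> are the idempotents of a decomposition of 1.\<close>

lemma balanced_concat:
  assumes k: "k \<in> carrier A"
    and "\<And>e. e \<in> set es \<Longrightarrow> \<exists>ps. set ps \<subseteq> carrier A \<times> carrier A \<and> psum A ps = e \<and> balanced F A ps k"
  shows "\<exists>ps. set ps \<subseteq> carrier A \<times> carrier A \<and> psum A ps = lsum A es \<and> balanced F A ps k"
  using assms(2)
proof (induction es)
  case Nil
  thus ?case by (intro exI[of _ "[]"]) (simp add: psum_def balanced_def)
next
  case (Cons e es)
  obtain ps where ps: "set ps \<subseteq> carrier A \<times> carrier A" "psum A ps = e" "balanced F A ps k"
    using Cons.prems[of e] by auto
  obtain qs where qs: "set qs \<subseteq> carrier A \<times> carrier A" "psum A qs = lsum A es" "balanced F A qs k"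
    using Cons by auto
  show ?case using balanced_append[OF ps(1) qs(1) k ps(3) qs(3)] ps qs
    by (intro exI[of _ "ps @ qs"]) auto
qed

text \<open>The tensor may at first depend on \<open>k\<close>: a product of tensors belonging to
  finitely many elements is balanced for all of them, and balancedness on the vectors of a frame
  passes to all linear combinations.\<close>

lemma separable_pointwise:
  assumes fin: "fin_dim F A"
    and ex: "\<And>k. k \<in> carrier A \<Longrightarrow> \<exists>ps. set ps \<subseteq> carrier A \<times> carrier A \<and> psum A ps = \<one>\<^bsub>A\<^esub> \<and> balanced F A ps k"
  shows "separable F A"
proof -
  interpret P: comm_pair F A A A "\<lambda>x. x" "\<lambda>x. x"
    by (intro comm_pair.intro comm_alg_axioms comm_pair_axioms.intro alg_hom_id)
  obtain fr where fr: "frame F A fr" using fin_dim.ex_frame[OF fin] by blast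
  have "\<exists>ps. set ps \<subseteq> carrier A \<times> carrier A \<and> psum A ps = \<one>\<^bsub>A\<^esub> \<and> (\<forall>k\<in>set ks. balanced F A ps k)"
    if "set ks \<subseteq> carrier A" for ks
    using that
  proof (induction ks)
    case Nil
    thus ?case using ex[of "\<one>\<^bsub>A\<^esub>"] by auto
  next
    case (Cons k ks)
    obtain ps where ps: "set ps \<subseteq> carrier A \<times> carrier A" "psum A ps = \<one>\<^bsub>A\<^esub>" "balanced F A ps k"
      using ex[of k] Cons.prems by auto
    obtain qs where qs: "set qs \<subseteq> carrier A \<times> carrier A" "psum A qs = \<one>\<^bsub>A\<^esub>" "\<forall>k\<in>set ks. balanced F A qs k"
      using Cons by auto
    show ?case
    proof (intro exI conjI)
      show "set (pprod A (\<lambda>x. x) (\<lambda>x. x) ps qs) \<subseteq> carrier A \<times> carrier A"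
        by (rule P.pprod_closed[OF ps(1) qs(1)])
      show "psum A (pprod A (\<lambda>x. x) (\<lambda>x. x) ps qs) = \<one>\<^bsub>A\<^esub>"
        using P.psum_pprod[OF ps(1) qs(1)] ps qs by simp
      show "\<forall>k\<in>set (k # ks). balanced F A (pprod A (\<lambda>x. x) (\<lambda>x. x) ps qs) k"
        using P.balanced_left[OF ps(1) qs(1) _ ps(3)] P.balanced_right[OF ps(1) qs(1)] qs(3) Cons.prems
        by (auto simp: subset_iff)
    qed
  qed
  moreover have "set (map fst fr) \<subseteq> carrier A" using frameD(1)[OF fr] by force
  ultimately obtain ps where ps: "set ps \<subseteq> carrier A \<times> carrier A" "psum A ps = \<one>\<^bsub>A\<^esub>"
    "\<forall>k\<in>set (map fst fr). balanced F A ps k" by blast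
  have "balanced F A ps v" if v: "v \<in> carrier A" for v
  proof -
    have "lsum A (map (\<lambda>(b, \<phi>). \<phi> v \<odot>\<^bsub>A\<^esub> b) fr) \<in> {k \<in> carrier A. balanced F A ps k}"
    proof (rule submodule_lsum[OF balanced_submodule[OF ps(1)]], rule subsetI)
      fix x assume "x \<in> set (map (\<lambda>(b, \<phi>). \<phi> v \<odot>\<^bsub>A\<^esub> b) fr)"
      then obtain b \<phi> where b: "(b, \<phi>) \<in> set fr" "x = \<phi> v \<odot>\<^bsub>A\<^esub> b" by auto
      moreover have "b \<in> {k \<in> carrier A. balanced F A ps k}"
        using b ps(3) frameD(1)[OF fr b(1)] by force
      moreover have "\<phi> v \<in> carrier F" using lin_closed[OF frameD(2)[OF fr b(1)] v] by simp
      ultimately show "x \<in> {k \<in> carrier A. balanced F A ps k}"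
        using submodule_smult[OF balanced_submodule[OF ps(1)]] by blast
    qed
    thus ?thesis using frameD(3)[OF fr v] by simp
  qed
  thus ?thesis using ps by (auto simp: separable_def)
qed

end

lemma alg_hom_ev:
  assumes K: "comm_alg F K" and L: "comm_alg F L" and h: "alg_hom F K L h" and k: "k \<in> carrier K"
    and cs: "set cs \<subseteq> carrier F"
  shows "h (ev K k cs) = ev L (h k) cs" "h (psum K (bezoutian K k cs)) = psum L (bezoutian L (h k) cs)"
proof -
  interpret K: comm_alg F K by fact
  interpret L: comm_alg F L by fact
  interpret h: lin_map F K L h by (intro lin_mapI K.vspace_axioms L.vspace_axioms alg_homD(1)[OF h])
  have pow: "h (k [^]\<^bsub>K\<^esub> (i::nat)) = h k [^]\<^bsub>L\<^esub> i" for i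
    by (induction i) (auto simp: alg_homD[OF h] k)
  show "h (ev K k cs) = ev L (h k) cs"
    using cs by (induction cs) (auto simp: pow k)
  have "map h (map (\<lambda>p. fst p \<otimes>\<^bsub>K\<^esub> snd p) (bezoutian K k cs)) = map (\<lambda>p. fst p \<otimes>\<^bsub>L\<^esub> snd p) (bezoutian L (h k) cs)"
    using cs by (induction cs) (auto simp: pow k alg_homD(3)[OF h])
  moreover have "set (map (\<lambda>p. fst p \<otimes>\<^bsub>K\<^esub> snd p) (bezoutian K k cs)) \<subseteq> carrier K"
    using K.pair_mem[OF K.bezoutian_closed[OF k cs]] by auto
  ultimately show "h (psum K (bezoutian K k cs)) = psum L (bezoutian L (h k) cs)"
    using h.lsum by (simp add: psum_def)
qed

lemma comm_algI: "field F \<Longrightarrow> algebra F L \<Longrightarrow> comm_alg F L"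
proof -
  assume F: "field F" and L: "algebra F L"
  interpret C: cring L by (rule algebra.M_cring[OF L])
  interpret F: field F by fact
  interpret L: algebra F L by fact
  interpret V: vspace F L using F L.module by (simp add: vspace_def rmodule_def)
  have sm: "x \<otimes>\<^bsub>L\<^esub> (c \<odot>\<^bsub>L\<^esub> y) = c \<odot>\<^bsub>L\<^esub> (x \<otimes>\<^bsub>L\<^esub> y)" if "c \<in> carrier F" "x \<in> carrier L" "y \<in> carrier L" for c x y
    using that L.smult_assoc2[of c y x] by (simp add: C.m_comm)
  have "nonassoc_algebra F L"
    by unfold_locales (auto simp: C.l_distr C.r_distr L.smult_assoc2 sm)
  hence "falg F L" by (rule falgI)
  thus ?thesis
    by (intro comm_alg.intro assoc_alg.intro assoc_alg_axioms.intro comm_alg_axioms.intro)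
      (assumption | rule C.m_assoc C.m_comm)+
qed

text \<open>Over the isomorphic image of \<open>F\<close> in \<open>L\<close>, the coefficient lists of HOL-Algebra become the
  coefficient lists of \<open>ev\<close> and \<open>bezoutian\<close>.\<close>

context comm_alg
begin

abbreviation emb where "emb c \<equiv> c \<odot>\<^bsub>A\<^esub> \<one>\<^bsub>A\<^esub>"

lemma eval_emb: "set cs \<subseteq> carrier F \<Longrightarrow> x \<in> carrier A \<Longrightarrow> A.eval (map emb cs) x = ev A x cs"
  by (induction cs) (auto simp: smult_one_mult)

text \<open>Recursion for the derivative before normalisation. A new leading coefficient stands in
  degree \<open>length p\<close> and adds one entry, except when the polynomial is constant.\<close>

lemma poly_deriv_Cons:
  "map (\<lambda>i. add_pow A (degree (c # p) - i) ((c # p) ! i)) [0..<degree (c # p)] =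
   (if p = [] then [] else add_pow A (length p) c # map (\<lambda>i. add_pow A (degree p - i) (p ! i)) [0..<degree p])"
proof (cases p)
  case (Cons d q)
  have "[0..<length p] = 0 # map Suc [0..<degree p]" using Cons by (simp add: upt_conv_Cons map_Suc_upt del: upt_Suc)
  thus ?thesis using Cons by (auto simp: comp_def simp del: upt_Suc)
qed simp

text \<open>Normalisation strips leading zeros and leaves values alone. A monomial of degree n
  yields n equal terms in the image of the Bezoutian, which is the factor n of the
  derivative.\<close>

lemma eval_poly_deriv_emb:
  assumes "set cs \<subseteq> carrier F" "x \<in> carrier A"
  shows "A.eval (poly_deriv A (map emb cs)) x = psum A (bezoutian A x cs)"
proof -
  have ap: "add_pow A (n::nat) a \<otimes>\<^bsub>A\<^esub> b = add_pow A n (a \<otimes>\<^bsub>A\<^esub> b)" if "a \<in> carrier A" "b \<in> carrier A" for n a b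
    using that by (rule A.add_pow_ldistr)
  define raw where "raw p = map (\<lambda>i. add_pow A (degree p - i) (p ! i)) [0..<degree p]" for p
  have len: "length (raw p) = degree p" for p by (simp add: raw_def)
  have rc: "set (raw (map emb cs)) \<subseteq> carrier A" if "set cs \<subseteq> carrier F" for cs
    unfolding raw_def
  proof
    fix z assume "z \<in> set (map (\<lambda>i. add_pow A (degree (map emb cs) - i) (map emb cs ! i)) [0..<degree (map emb cs)])"
    then obtain i where "i \<in> set [0..<degree (map emb cs)]" "z = add_pow A (degree (map emb cs) - i) (map emb cs ! i)"
      unfolding set_map by blast
    hence i: "i < length cs" "z = add_pow A (degree (map emb cs) - i) (map emb cs ! i)" by simp_all
    hence "cs ! i \<in> carrier F" using that by auto
    thus "z \<in> carrier A" using i by auto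
  qed
  have "A.eval (raw (map emb cs)) x = psum A (bezoutian A x cs)"
    using assms(1)
  proof (induction cs)
    case Nil
    thus ?case by (simp add: raw_def psum_def)
  next
    case (Cons c cs)
    hence c: "c \<in> carrier F" and cs: "set cs \<subseteq> carrier F" by auto
    define n where "n = length cs"
    have 1: "psum A (map (\<lambda>i. (c \<odot>\<^bsub>A\<^esub> x [^]\<^bsub>A\<^esub> i, x [^]\<^bsub>A\<^esub> (n - Suc i))) [0..<n]) = add_pow A n (c \<odot>\<^bsub>A\<^esub> x [^]\<^bsub>A\<^esub> (n - 1))"
    proof -
      have e: "map (\<lambda>p. fst p \<otimes>\<^bsub>A\<^esub> snd p) (map (\<lambda>i. (c \<odot>\<^bsub>A\<^esub> x [^]\<^bsub>A\<^esub> i, x [^]\<^bsub>A\<^esub> (n - Suc i))) [0..<n])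
        = map (\<lambda>i. c \<odot>\<^bsub>A\<^esub> x [^]\<^bsub>A\<^esub> (n - 1)) [0..<n]"
        using c assms(2) by (auto simp: smult_mult A.nat_pow_mult)
      show ?thesis unfolding psum_def e by (rule M.lsum_const) (use c assms(2) in auto)
    qed
    have ps: "set (map (\<lambda>i. (c \<odot>\<^bsub>A\<^esub> x [^]\<^bsub>A\<^esub> i, x [^]\<^bsub>A\<^esub> (n - Suc i))) [0..<n]) \<subseteq> carrier A \<times> carrier A"
      using c assms(2) by auto
    have app: "psum A (bezoutian A x (c # cs)) = add_pow A n (c \<odot>\<^bsub>A\<^esub> x [^]\<^bsub>A\<^esub> (n - 1)) \<oplus>\<^bsub>A\<^esub> psum A (bezoutian A x cs)"
    proof -
      have c3: "set (map (\<lambda>p. fst p \<otimes>\<^bsub>A\<^esub> snd p) rs) \<subseteq> carrier A" if "set rs \<subseteq> carrier A \<times> carrier A" for rs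
        using pair_mem[OF that] by auto
      show ?thesis unfolding 1[symmetric] bezoutian.simps(2) n_def[symmetric] unfolding psum_def map_append
        by (rule M.lsum_append[OF c3[OF ps] c3[OF bezoutian_closed[OF assms(2) cs]]])
    qed
    show ?case
    proof (cases "cs = []")
      case True
      thus ?thesis by (simp add: raw_def psum_def)
    next
      case False
      have "raw (map emb (c # cs)) = add_pow A n (emb c) # raw (map emb cs)"
        using poly_deriv_Cons[of "emb c" "map emb cs"] False by (simp add: raw_def n_def)
      hence "A.eval (raw (map emb (c # cs))) x = add_pow A n (emb c) \<otimes>\<^bsub>A\<^esub> x [^]\<^bsub>A\<^esub> (n - 1) \<oplus>\<^bsub>A\<^esub> A.eval (raw (map emb cs)) x"
        by (simp add: len n_def)
      also have "add_pow A n (emb c) \<otimes>\<^bsub>A\<^esub> x [^]\<^bsub>A\<^esub> (n - 1) = add_pow A n (c \<odot>\<^bsub>A\<^esub> x [^]\<^bsub>A\<^esub> (n - 1))"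
        using c assms(2) by (simp add: ap smult_one_mult)
      finally show ?thesis using app Cons.IH[OF cs] by simp
    qed
  qed
  thus ?thesis unfolding poly_deriv_def raw_def[symmetric]
    using A.eval_normalize[OF rc[OF assms(1)] assms(2)] by simp
qed

end

section \<open>Finite field extensions\<close>

locale ext_field = comm_alg + A: field A +
  assumes fd: "finite_dimensional F A"
begin

lemma fin_dim: "fin_dim F A"
  using fd vspace_axioms by (simp add: fin_dim_def fin_dim_axioms_def)

abbreviation K0 where "K0 \<equiv> emb ` carrier F"

lemma emb_hom: "ring_hom_ring F A emb"
proof (rule ring_hom_ringI2)
  show "ring F" by (rule R.ring_axioms)
  show "ring A" by (rule ring_A)
  show "emb \<in> ring_hom F A"
    by (rule ring_hom_memI) (auto simp: smult_l_distr smult_one_mult smult_assoc1)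
qed

lemma K0_subfield: "subfield K0 A"
  using ring_hom_ring.img_is_subfield(2)[OF emb_hom R.carrier_is_subfield] by simp

lemma K0_subring: "subring K0 A"
  using subfieldE(1)[OF K0_subfield] .

lemma Span_submodule:
  assumes ssc: "set ss \<subseteq> carrier A"
  shows "submodule (A.Span K0 ss) F A"
proof -
  note Sp = A.Span_subgroup_props[OF K0_subfield ssc]
  show ?thesis
  proof (rule submoduleI)
    show "c \<odot>\<^bsub>A\<^esub> y \<in> A.Span K0 ss" if "c \<in> carrier F" "y \<in> A.Span K0 ss" for c y
    proof -
      have "emb c \<otimes>\<^bsub>A\<^esub> y \<in> A.Span K0 ss"
        using that by (intro A.Span_smult_closed[OF K0_subfield ssc]) auto
      thus ?thesis using that Sp(1) by (simp add: smult_one_mult subset_iff)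
    qed
  qed (use Sp in auto)
qed

text \<open>Finite dimension is transferred from \<open>F\<close> to its copy \<open>K0\<close>: the
  \<open>K0\<close>-span of a generating list is an \<open>F\<close>-submodule containing that list,
  so it is everything.\<close>

lemma algebraic: "x \<in> carrier A \<Longrightarrow> (A.algebraic over K0) x"
proof -
  from fd obtain S where S: "finite S" "S \<subseteq> carrier A" "module_span F A S = carrier A"
    by (auto simp: finite_dimensional_def)
  from S(1) obtain ss where ss: "set ss = S" using finite_list by blast
  have ssc: "set ss \<subseteq> carrier A" using S ss by simp
  note Sp = A.Span_subgroup_props[OF K0_subfield ssc]
  have "submodule (A.Span K0 ss) F A" by (rule Span_submodule[OF ssc])
  moreover have "set ss \<subseteq> A.Span K0 ss" by (rule A.Span_base_incl[OF K0_subfield ssc])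
  ultimately have "carrier A \<subseteq> A.Span K0 ss"
    using module_span_least[of "A.Span K0 ss" S] S(3) ss by simp
  hence "A.Span K0 ss = carrier A" using Sp(1) by blast
  hence "A.finite_dimension K0 (carrier A)"
    using A.Span_finite_dimension[OF K0_subfield ssc] by simp
  thus "x \<in> carrier A \<Longrightarrow> (A.algebraic over K0) x"
    by (rule A.finite_dimension_imp_algebraic[OF K0_subfield A.carrier_is_subring])
qed

lemma polynomial_emb:
  assumes "p \<in> carrier (K0[X]\<^bsub>A\<^esub>)"
  shows "\<exists>cs. set cs \<subseteq> carrier F \<and> p = map emb cs"
proof -
  have p: "set p \<subseteq> K0" using assms A.polynomial_incl unfolding univ_poly_carrier[symmetric] by blast
  define g where "g = inv_into (carrier F) emb"
  have g: "emb (g y) = y" "g y \<in> carrier F" if "y \<in> K0" for y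
    using f_inv_into_f[of y emb "carrier F"] inv_into_into[of y emb "carrier F"] that by (simp_all add: g_def)
  hence "map emb (map g p) = p" using p by (auto intro!: map_idI)
  moreover have "set (map g p) \<subseteq> carrier F" using p g by auto
  ultimately show ?thesis by (intro exI[of _ "map g p"]) simp
qed

lemma Irr_emb:
  assumes x: "x \<in> carrier A"
  obtains cs where "set cs \<subseteq> carrier F" "A.Irr K0 x = map emb cs" "ev A x cs = \<zero>\<^bsub>A\<^esub>"
proof -
  obtain cs where "set cs \<subseteq> carrier F" "A.Irr K0 x = map emb cs"
    using polynomial_emb[OF A.IrrE(1)[OF K0_subfield x algebraic[OF x]]] by blast
  thus ?thesis using that[of cs] A.IrrE(4)[OF K0_subfield x algebraic[OF x]] eval_emb[of cs x] x by simp
qed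

lemma poly_deriv_closed:
  assumes "p \<in> carrier (K0[X]\<^bsub>A\<^esub>)"
  shows "poly_deriv A p \<in> carrier (K0[X]\<^bsub>A\<^esub>)"
proof -
  have p: "set p \<subseteq> K0" using assms A.polynomial_incl unfolding univ_poly_carrier[symmetric] by blast
  have "set (map (\<lambda>i. add_pow A (degree p - i) (p ! i)) [0..<degree p]) \<subseteq> K0"
  proof
    fix z assume "z \<in> set (map (\<lambda>i. add_pow A (degree p - i) (p ! i)) [0..<degree p])"
    then obtain i where "i \<in> set [0..<degree p]" "z = add_pow A (degree p - i) (p ! i)"
      unfolding set_map by blast
    hence z: "i < length p" "z = add_pow A (degree p - i) (p ! i)" by simp_all
    have "add_pow A (m::nat) y \<in> K0" if "y \<in> K0" for m y
    proof (induction m)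
      case 0
      show ?case using imageI[OF R.zero_closed, of emb] by simp
    next
      case (Suc m)
      from Suc obtain c where "c \<in> carrier F" "add_pow A m y = emb c" by blast
      moreover from that obtain d where "d \<in> carrier F" "y = emb d" by blast
      ultimately show ?case by (auto simp: smult_l_distr[symmetric])
    qed
    moreover have "p ! i \<in> K0" using z p nth_mem by blast
    ultimately show "z \<in> K0" using z(2) by blast
  qed
  thus ?thesis unfolding poly_deriv_def univ_poly_carrier[symmetric]
    by (rule A.normalize_gives_polynomial)
qed

text \<open>Evaluating u p + v p' = 1 at the root \<open>x\<close> of p leaves v(x) p'(x) = 1, so
  v(x) is the inverse \<open>w\<close>.\<close>

lemma separable_poly_root:
  assumes x: "x \<in> carrier A" and sep: "separable_poly A K0 (A.Irr K0 x)"
  shows "\<exists>cs w. set cs \<subseteq> carrier F \<and> w \<in> carrier A \<and> ev A x cs = \<zero>\<^bsub>A\<^esub> \<and> psum A (bezoutian A x cs) \<otimes>\<^bsub>A\<^esub> w = \<one>\<^bsub>A\<^esub>"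
proof -
  define p where "p = A.Irr K0 x"
  have p: "p \<in> carrier (K0[X]\<^bsub>A\<^esub>)" unfolding p_def by (rule A.IrrE(1)[OF K0_subfield x algebraic[OF x]])
  obtain cs where cs: "set cs \<subseteq> carrier F" "p = map emb cs" "ev A x cs = \<zero>\<^bsub>A\<^esub>"
    using Irr_emb[OF x] unfolding p_def by blast
  from sep obtain u v where u: "u \<in> carrier (K0[X]\<^bsub>A\<^esub>)" and v: "v \<in> carrier (K0[X]\<^bsub>A\<^esub>)"
    and uv: "u \<otimes>\<^bsub>K0[X]\<^bsub>A\<^esub>\<^esub> p \<oplus>\<^bsub>K0[X]\<^bsub>A\<^esub>\<^esub> v \<otimes>\<^bsub>K0[X]\<^bsub>A\<^esub>\<^esub> poly_deriv A p = \<one>\<^bsub>K0[X]\<^bsub>A\<^esub>\<^esub>"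
    unfolding separable_poly_def p_def by blast
  interpret E: ring_hom_ring "K0[X]\<^bsub>A\<^esub>" A "\<lambda>p. A.eval p x"
    by (rule A.eval_ring_hom[OF K0_subring x])
  have "A.eval (u \<otimes>\<^bsub>K0[X]\<^bsub>A\<^esub>\<^esub> p \<oplus>\<^bsub>K0[X]\<^bsub>A\<^esub>\<^esub> v \<otimes>\<^bsub>K0[X]\<^bsub>A\<^esub>\<^esub> poly_deriv A p) x = \<one>\<^bsub>A\<^esub>"
    unfolding uv by (rule E.hom_one)
  moreover have "A.eval p x = \<zero>\<^bsub>A\<^esub>" using cs x by (simp add: eval_emb)
  moreover have "A.eval (poly_deriv A p) x = psum A (bezoutian A x cs)"
    unfolding cs(2) by (rule eval_poly_deriv_emb[OF cs(1) x])
  ultimately have "A.eval v x \<otimes>\<^bsub>A\<^esub> psum A (bezoutian A x cs) = \<one>\<^bsub>A\<^esub>"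
    using u v p poly_deriv_closed[OF p] E.hom_closed[OF u] E.hom_closed[OF v] bezoutian_closed[OF x cs(1)] by simp
  moreover have "A.eval v x \<in> carrier A" using E.hom_closed[OF v] .
  ultimately show ?thesis using cs bezoutian_closed[OF x cs(1)]
    by (intro exI[of _ cs] exI[of _ "A.eval v x"]) (auto simp: comm)
qed

end

section \<open>Etale algebras have separability elements\<close>

lemma (in abelian_monoid) lsum_single:
  fixes n :: nat
  assumes "a \<in> carrier G" "j < n"
  shows "lsum G (map (\<lambda>i. if i = j then a else \<zero>) [0..<n]) = a"
proof -
  have "lsum G (map (\<lambda>i. if i = j then a else \<zero>) [0..<n]) = (if j < n then a else \<zero>)" for n
    using assms(1) by (induction n) (auto simp: lsum_append image_subset_iff)
  with assms show ?thesis by simp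
qed

text \<open>Replaces the isomorphism by its coordinates: algebra maps \<pi> to the fields that are
  jointly injective and for which a value in one factor can be prescribed with zeros elsewhere.
  Identities in \<open>K\<close> are then checked in each field.\<close>

lemma etale_factors:
  fixes F :: "('f, 'k) ring_scheme" and K :: "('f, 'a) module"
  assumes K: "falg F K" and et: "etale F K"
  obtains n and L :: "nat \<Rightarrow> ('f, 'a) module" and \<pi>
  where "\<And>i. i < n \<Longrightarrow> finite_separable_extension F (L i)" "\<And>i. i < n \<Longrightarrow> ext_field F (L i)"
    "\<And>i. i < n \<Longrightarrow> alg_hom F K (L i) (\<pi> i)"
    "\<And>x y. x \<in> carrier K \<Longrightarrow> y \<in> carrier K \<Longrightarrow> (\<And>i. i < n \<Longrightarrow> \<pi> i x = \<pi> i y) \<Longrightarrow> x = y"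
    "\<And>i y. i < n \<Longrightarrow> y \<in> carrier (L i) \<Longrightarrow> \<exists>x\<in>carrier K. \<pi> i x = y \<and> (\<forall>j < n. j \<noteq> i \<longrightarrow> \<pi> j x = \<zero>\<^bsub>L j\<^esub>)"
proof -
  interpret K: falg F K by fact
  from et obtain n and L :: "nat \<Rightarrow> ('f, 'a) module" where
    L': "\<forall>i<n. finite_separable_extension F (L i)" and iso: "alg_iso F K (product_alg {..<n} L)"
    unfolding etale_def by blast
  have L: "finite_separable_extension F (L i)" if "i < n" for i using L' that by simp
  from iso obtain h where h: "h \<in> ring_iso K (product_alg {..<n} L)"
    and hs': "\<forall>c\<in>carrier F. \<forall>x\<in>carrier K. h (c \<odot>\<^bsub>K\<^esub> x) = c \<odot>\<^bsub>product_alg {..<n} L\<^esub> h x"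
    unfolding alg_iso_def by blast
  have hs: "h (c \<odot>\<^bsub>K\<^esub> x) = c \<odot>\<^bsub>product_alg {..<n} L\<^esub> h x" if "c \<in> carrier F" "x \<in> carrier K" for c x
    using hs' that by simp
  have hh: "h \<in> ring_hom K (product_alg {..<n} L)" and bij: "bij_betw h (carrier K) (carrier (product_alg {..<n} L))"
    using h by (auto simp: ring_iso_def)
  have cP: "carrier (product_alg {..<n} L) = (\<Pi>\<^sub>E i \<in> {..<n}. carrier (L i))" by (simp add: product_alg_def)
  have e: "ext_field F (L i)" if "i < n" for i
    using L[OF that] K.R.field_axioms
    by (auto simp: finite_separable_extension_def ext_field_def ext_field_axioms_def intro: comm_algI)
  have hc: "h x \<in> (\<Pi>\<^sub>E i \<in> {..<n}. carrier (L i))" if "x \<in> carrier K" for x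
    using ring_hom_closed[OF hh that] by (simp add: cP)
  show ?thesis
  proof (rule that[of n L "\<lambda>i x. h x i"])
    show "alg_hom F K (L i) (\<lambda>x. h x i)" if i: "i < n" for i
      unfolding alg_hom_def
    proof (intro conjI ballI linI)
      show "h x i \<in> carrier (L i)" if "x \<in> carrier K" for x
        using hc[OF that] i by auto
      show "h (x \<oplus>\<^bsub>K\<^esub> y) i = h x i \<oplus>\<^bsub>L i\<^esub> h y i" if "x \<in> carrier K" "y \<in> carrier K" for x y
        using ring_hom_add[OF hh that] i by (simp add: product_alg_def)
      show "h (x \<otimes>\<^bsub>K\<^esub> y) i = h x i \<otimes>\<^bsub>L i\<^esub> h y i" if "x \<in> carrier K" "y \<in> carrier K" for x y
        using ring_hom_mult[OF hh that] i by (simp add: product_alg_def)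
      show "h (c \<odot>\<^bsub>K\<^esub> x) i = c \<odot>\<^bsub>L i\<^esub> h x i" if "c \<in> carrier F" "x \<in> carrier K" for c x
        using hs[OF that] i by (simp add: product_alg_def)
      show "h \<one>\<^bsub>K\<^esub> i = \<one>\<^bsub>L i\<^esub>"
        using ring_hom_one[OF hh] i by (simp add: product_alg_def)
    qed
    show "x = y" if "x \<in> carrier K" "y \<in> carrier K" "\<And>i. i < n \<Longrightarrow> h x i = h y i" for x y
    proof -
      have "h x = h y" using hc[OF that(1)] hc[OF that(2)] that(3) by (intro PiE_ext) auto
      thus ?thesis using bij that by (auto simp: bij_betw_def inj_on_def)
    qed
    show "\<exists>x\<in>carrier K. h x i = y \<and> (\<forall>j < n. j \<noteq> i \<longrightarrow> h x j = \<zero>\<^bsub>L j\<^esub>)" if i: "i < n" and y: "y \<in> carrier (L i)" for i y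
    proof -
      define f where "f = (\<lambda>j \<in> {..<n}. if j = i then y else \<zero>\<^bsub>L j\<^esub>)"
      have "\<zero>\<^bsub>L j\<^esub> \<in> carrier (L j)" if "j < n" for j
      proof -
        interpret L: ext_field F "L j" by (rule e[OF that])
        show ?thesis by simp
      qed
      hence "f \<in> carrier (product_alg {..<n} L)" using y by (auto simp: cP f_def)
      hence "f \<in> h ` carrier K" using bij by (simp add: bij_betw_def)
      then obtain x where "x \<in> carrier K" "h x = f" by blast
      thus ?thesis using i by (intro bexI[of _ x]) (auto simp: f_def)
    qed
  qed (use L e in auto)
qed

lemma etale_comm_alg:
  fixes F :: "('f, 'k) ring_scheme" and K :: "('f, 'a) module"
  assumes K: "falg F K" and et: "etale F K"
  shows "comm_alg F K"
proof -
  interpret K: falg F K by fact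
  obtain n and L :: "nat \<Rightarrow> ('f, 'a) module" and \<pi> where
    fs: "\<And>i. i < n \<Longrightarrow> finite_separable_extension F (L i)"
    and e: "\<And>i. i < n \<Longrightarrow> ext_field F (L i)" and \<pi>: "\<And>i. i < n \<Longrightarrow> alg_hom F K (L i) (\<pi> i)"
    and inj: "\<And>x y. x \<in> carrier K \<Longrightarrow> y \<in> carrier K \<Longrightarrow> (\<And>i. i < n \<Longrightarrow> \<pi> i x = \<pi> i y) \<Longrightarrow> x = y"
    and lift: "\<And>i y. i < n \<Longrightarrow> y \<in> carrier (L i) \<Longrightarrow> \<exists>x\<in>carrier K. \<pi> i x = y \<and> (\<forall>j < n. j \<noteq> i \<longrightarrow> \<pi> j x = \<zero>\<^bsub>L j\<^esub>)"
    using etale_factors[OF K et] by blast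
  show ?thesis
  proof unfold_locales
    fix x y z assume xyz: "x \<in> carrier K" "y \<in> carrier K" "z \<in> carrier K"
    show "x \<otimes>\<^bsub>K\<^esub> y \<otimes>\<^bsub>K\<^esub> z = x \<otimes>\<^bsub>K\<^esub> (y \<otimes>\<^bsub>K\<^esub> z)"
    proof (rule inj)
      fix i assume i: "i < n"
      interpret L: ext_field F "L i" by (rule e[OF i])
      show "\<pi> i (x \<otimes>\<^bsub>K\<^esub> y \<otimes>\<^bsub>K\<^esub> z) = \<pi> i (x \<otimes>\<^bsub>K\<^esub> (y \<otimes>\<^bsub>K\<^esub> z))"
        using xyz by (simp add: alg_homD[OF \<pi>[OF i]] L.assoc)
    qed (use xyz in auto)
  next
    fix x y assume xyz: "x \<in> carrier K" "y \<in> carrier K"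
    show "x \<otimes>\<^bsub>K\<^esub> y = y \<otimes>\<^bsub>K\<^esub> x"
    proof (rule inj)
      fix i assume i: "i < n"
      interpret L: ext_field F "L i" by (rule e[OF i])
      show "\<pi> i (x \<otimes>\<^bsub>K\<^esub> y) = \<pi> i (y \<otimes>\<^bsub>K\<^esub> x)"
        using xyz by (simp add: alg_homD[OF \<pi>[OF i]] L.comm)
    qed (use xyz in auto)
  qed
qed

text \<open>For fixed \<open>k\<close>, the minimal polynomial of the i-th coordinate of
  \<open>k\<close> gives a local tensor with image the i-th idempotent \<open>E i\<close>. These add
  up to a tensor with image 1, and \<open>separable_pointwise\<close> removes the dependence on
  \<open>k\<close>.\<close>

lemma etale_separable:
  fixes F :: "('f, 'k) ring_scheme" and K :: "('f, 'a) module"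
  assumes K: "fin_dim F K" "falg F K" and et: "etale F K"
  shows "separable F K"
proof -
  interpret K: comm_alg F K by (rule etale_comm_alg[OF K(2) et])
  obtain n and L :: "nat \<Rightarrow> ('f, 'a) module" and \<pi> where
    fs: "\<And>i. i < n \<Longrightarrow> finite_separable_extension F (L i)"
    and e: "\<And>i. i < n \<Longrightarrow> ext_field F (L i)" and \<pi>: "\<And>i. i < n \<Longrightarrow> alg_hom F K (L i) (\<pi> i)"
    and inj: "\<And>x y. x \<in> carrier K \<Longrightarrow> y \<in> carrier K \<Longrightarrow> (\<And>i. i < n \<Longrightarrow> \<pi> i x = \<pi> i y) \<Longrightarrow> x = y"
    and lift: "\<And>i y. i < n \<Longrightarrow> y \<in> carrier (L i) \<Longrightarrow> \<exists>x\<in>carrier K. \<pi> i x = y \<and> (\<forall>j < n. j \<noteq> i \<longrightarrow> \<pi> j x = \<zero>\<^bsub>L j\<^esub>)"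
    using etale_factors[OF K(2) et] by blast
  have Lc: "comm_alg F (L i)" if "i < n" for i using e[OF that] by (simp add: ext_field_def)
  have "\<exists>x\<in>carrier K. \<pi> i x = \<one>\<^bsub>L i\<^esub> \<and> (\<forall>j < n. j \<noteq> i \<longrightarrow> \<pi> j x = \<zero>\<^bsub>L j\<^esub>)" if i: "i < n" for i
  proof -
    interpret L: ext_field F "L i" by (rule e[OF i])
    show ?thesis using lift[OF i] L.one_closed by blast
  qed
  then obtain E where Ec: "\<And>i. i < n \<Longrightarrow> E i \<in> carrier K" and E1: "\<And>i. i < n \<Longrightarrow> \<pi> i (E i) = \<one>\<^bsub>L i\<^esub>"
    and E0: "\<And>i j. i < n \<Longrightarrow> j < n \<Longrightarrow> j \<noteq> i \<Longrightarrow> \<pi> j (E i) = \<zero>\<^bsub>L j\<^esub>" by metis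
  have 1: "lsum K (map E [0..<n]) = \<one>\<^bsub>K\<^esub>"
  proof (rule inj)
    have Es: "set (map E [0..<n]) \<subseteq> carrier K" using Ec by auto
    thus "lsum K (map E [0..<n]) \<in> carrier K" by (rule K.M.lsum_closed)
    fix j assume j: "j < n"
    interpret L: ext_field F "L j" by (rule e[OF j])
    interpret p: lin_map F K "L j" "\<pi> j"
      by (intro lin_mapI K.vspace_axioms L.vspace_axioms alg_homD(1)[OF \<pi>[OF j]])
    have "\<pi> j (lsum K (map E [0..<n])) = lsum (L j) (map (\<pi> j) (map E [0..<n]))" by (rule p.lsum[OF Es])
    also have "map (\<pi> j) (map E [0..<n]) = map (\<lambda>i. if i = j then \<one>\<^bsub>L j\<^esub> else \<zero>\<^bsub>L j\<^esub>) [0..<n]"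
      using E0 E1 j by auto
    finally show "\<pi> j (lsum K (map E [0..<n])) = \<pi> j \<one>\<^bsub>K\<^esub>"
      using L.M.lsum_single[OF _ j] alg_homD(2)[OF \<pi>[OF j]] by simp
  qed simp
  have "\<exists>ps. set ps \<subseteq> carrier K \<times> carrier K \<and> psum K ps = E i \<and> balanced F K ps k"
    if k: "k \<in> carrier K" and i: "i < n" for i k
  proof -
    interpret L: ext_field F "L i" by (rule e[OF i])
    have x: "\<pi> i k \<in> carrier (L i)" using alg_homD(4)[OF \<pi>[OF i] k] .
    have "separable_poly (L i) L.K0 (ring.Irr (L i) L.K0 (\<pi> i k))"
      using fs[OF i] x by (simp add: finite_separable_extension_def Let_def)
    from L.separable_poly_root[OF x this] obtain cs w where
      cs: "set cs \<subseteq> carrier F" and w: "w \<in> carrier (L i)" and ev0: "ev (L i) (\<pi> i k) cs = \<zero>\<^bsub>L i\<^esub>"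
      and d: "psum (L i) (bezoutian (L i) (\<pi> i k) cs) \<otimes>\<^bsub>L i\<^esub> w = \<one>\<^bsub>L i\<^esub>" by blast
    \<comment> \<open>Any lift of \<open>w\<close> will do: \<open>W\<close> only occurs multiplied
      by \<open>E i\<close>, which erases the other coordinates.\<close>
    obtain W where W: "W \<in> carrier K" "\<pi> i W = w" using lift[OF i w] by blast
    have bzc: "set (bezoutian K k cs) \<subseteq> carrier K \<times> carrier K" by (rule K.bezoutian_closed[OF k cs])
    show ?thesis
    proof (rule K.local_separability[OF k Ec[OF i] _ W(1) cs])
      show "E i \<otimes>\<^bsub>K\<^esub> E i = E i"
      proof (rule inj)
        fix j assume j: "j < n"
        interpret Lj: ext_field F "L j" by (rule e[OF j])
        show "\<pi> j (E i \<otimes>\<^bsub>K\<^esub> E i) = \<pi> j (E i)"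
          using Ec[OF i] E1[OF j] E0[OF i j] by (cases "i = j") (auto simp: alg_homD[OF \<pi>[OF j]])
      qed (use Ec i in auto)
      show "ev K k cs \<otimes>\<^bsub>K\<^esub> E i = \<zero>\<^bsub>K\<^esub>"
      proof (rule inj)
        fix j assume j: "j < n"
        interpret Lj: ext_field F "L j" by (rule e[OF j])
        interpret p: lin_map F K "L j" "\<pi> j"
          by (intro lin_mapI K.vspace_axioms Lj.vspace_axioms alg_homD(1)[OF \<pi>[OF j]])
        have "\<pi> j (ev K k cs) \<in> carrier (L j)" using k cs by simp
        thus "\<pi> j (ev K k cs \<otimes>\<^bsub>K\<^esub> E i) = \<pi> j \<zero>\<^bsub>K\<^esub>"
          using Ec[OF i] E1[OF j] E0[OF i j] k cs ev0 alg_hom_ev(1)[OF K.comm_alg_axioms Lc[OF j] \<pi>[OF j] k cs]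
          by (cases "i = j") (auto simp: alg_homD(3)[OF \<pi>[OF j]])
      qed (use Ec i k cs in auto)
      show "psum K (bezoutian K k cs) \<otimes>\<^bsub>K\<^esub> (W \<otimes>\<^bsub>K\<^esub> E i) = E i"
      proof (rule inj)
        fix j assume j: "j < n"
        interpret Lj: ext_field F "L j" by (rule e[OF j])
        interpret p: lin_map F K "L j" "\<pi> j"
          by (intro lin_mapI K.vspace_axioms Lj.vspace_axioms alg_homD(1)[OF \<pi>[OF j]])
        have c: "\<pi> j (psum K (bezoutian K k cs)) \<in> carrier (L j)" "\<pi> j W \<in> carrier (L j)" using bzc W by simp_all
        show "\<pi> j (psum K (bezoutian K k cs) \<otimes>\<^bsub>K\<^esub> (W \<otimes>\<^bsub>K\<^esub> E i)) = \<pi> j (E i)"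
        proof (cases "i = j")
          case True
          thus ?thesis
            using Ec[OF i] E1[OF j] c W bzc d w alg_hom_ev(2)[OF K.comm_alg_axioms Lc[OF j] \<pi>[OF j] k cs]
            by (simp add: alg_homD(3)[OF \<pi>[OF j]])
        next
          case False
          thus ?thesis
            using Ec[OF i] E0[OF i j] c W bzc by (simp add: alg_homD(3)[OF \<pi>[OF j]])
        qed
      qed (use Ec i W bzc in auto)
    qed
  qed
  hence "\<exists>ps. set ps \<subseteq> carrier K \<times> carrier K \<and> psum K ps = lsum K (map E [0..<n]) \<and> balanced F K ps k"
    if "k \<in> carrier K" for k
    using that by (intro K.balanced_concat) auto
  thus ?thesis unfolding 1 by (intro K.separable_pointwise[OF K(1)])
qed

lemma (in tensor) alg_hom_left: "alg_hom F A T (\<lambda>a. tau a \<one>\<^bsub>B\<^esub>)"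
  using lin_tau_left[OF B.one_closed] by (simp add: alg_hom_def one_T tau_mult)

lemma (in tensor) alg_hom_right: "alg_hom F B T (\<lambda>b. tau \<one>\<^bsub>A\<^esub> b)"
  using lin_tau_right[OF A.one_closed] by (simp add: alg_hom_def one_T tau_mult)

lemma (in tensor) T_separable:
  assumes A: "comm_alg F A" "separable F A" and B: "comm_alg F B" "separable F B"
  shows "separable F T"
proof -
  interpret P: comm_pair F A B T "\<lambda>a. tau a \<one>\<^bsub>B\<^esub>" "\<lambda>b. tau \<one>\<^bsub>A\<^esub> b"
    by (intro comm_pair.intro comm_pair_axioms.intro A B T_comm_alg alg_hom_left alg_hom_right)
  show ?thesis
  proof (rule P.separable_span[OF A(2) B(2)])
    fix N assume N: "submodule N F T" and *: "\<And>k l. k \<in> carrier A \<Longrightarrow> l \<in> carrier B \<Longrightarrow> tau k \<one>\<^bsub>B\<^esub> \<otimes>\<^bsub>T\<^esub> tau \<one>\<^bsub>A\<^esub> l \<in> N"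
    show "N = carrier T"
      using * by (intro T_submodule_induct[OF N]) (simp add: tau_mult)
  qed
qed

section \<open>From separability elements to products of fields\<close>

context comm_alg
begin

lemma principal_submodule:
  assumes z: "z \<in> carrier A"
  shows "submodule ((\<lambda>k. z \<otimes>\<^bsub>A\<^esub> k) ` carrier A) F A"
proof -
  interpret l: lin_map F A A "\<lambda>k. z \<otimes>\<^bsub>A\<^esub> k" by (rule lin_map_mult_left[OF z])
  show ?thesis by (rule l.image_submodule[OF carrier_is_submodule])
qed

text \<open>Von Neumann regularity: by \<open>separable_ideal\<close> the principal ideal of
  \<open>z\<close> has an identity element, and this has the form z k.\<close>

lemma principal_idempotent:
  assumes sep: "separable F A" and fin: "fin_dim F A" and z: "z \<in> carrier A"
  shows "\<exists>k\<in>carrier A. z \<otimes>\<^bsub>A\<^esub> (z \<otimes>\<^bsub>A\<^esub> k) = z"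
proof -
  have "\<exists>e\<in>(\<lambda>k. z \<otimes>\<^bsub>A\<^esub> k) ` carrier A. \<forall>x\<in>(\<lambda>k. z \<otimes>\<^bsub>A\<^esub> k) ` carrier A. x \<otimes>\<^bsub>A\<^esub> e = x"
  proof (rule separable_ideal[OF sep fin principal_submodule[OF z]])
    fix k x assume k: "k \<in> carrier A" and "x \<in> (\<lambda>k. z \<otimes>\<^bsub>A\<^esub> k) ` carrier A"
    then obtain l where l: "l \<in> carrier A" "x = z \<otimes>\<^bsub>A\<^esub> l" by blast
    hence "k \<otimes>\<^bsub>A\<^esub> x = z \<otimes>\<^bsub>A\<^esub> (k \<otimes>\<^bsub>A\<^esub> l)" using k z by (simp add: lcomm)
    thus "k \<otimes>\<^bsub>A\<^esub> x \<in> (\<lambda>k. z \<otimes>\<^bsub>A\<^esub> k) ` carrier A" using k l by blast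
  qed
  then obtain k where k: "k \<in> carrier A" "\<forall>x\<in>(\<lambda>k. z \<otimes>\<^bsub>A\<^esub> k) ` carrier A. x \<otimes>\<^bsub>A\<^esub> (z \<otimes>\<^bsub>A\<^esub> k) = x" by blast
  moreover have "z \<in> (\<lambda>k. z \<otimes>\<^bsub>A\<^esub> k) ` carrier A" using z by (intro image_eqI[of _ _ "\<one>\<^bsub>A\<^esub>"]) auto
  ultimately show ?thesis by blast
qed

lemma separable_reduced:
  assumes "separable F A" "fin_dim F A" "z \<in> carrier A" "z \<otimes>\<^bsub>A\<^esub> z = \<zero>\<^bsub>A\<^esub>"
  shows "z = \<zero>\<^bsub>A\<^esub>"
proof -
  obtain k where k: "k \<in> carrier A" "z \<otimes>\<^bsub>A\<^esub> (z \<otimes>\<^bsub>A\<^esub> k) = z"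
    using principal_idempotent[OF assms(1-3)] by blast
  hence "z = (z \<otimes>\<^bsub>A\<^esub> z) \<otimes>\<^bsub>A\<^esub> k" using assms(3) by (simp add: assoc)
  thus ?thesis using assms k by simp
qed

text \<open>The degree in the left variable stays below the degree of the polynomial, which is
  \<open>length cs - 1\<close>. A form reading the highest remaining power can therefore isolate the
  leading coefficient.\<close>

lemma bezoutian_fst:
  assumes "q \<in> set (bezoutian A k cs)" "set cs \<subseteq> carrier F" 
  shows "\<exists>c i. c \<in> carrier F \<and> Suc i < length cs \<and> fst q = c \<odot>\<^bsub>A\<^esub> k [^]\<^bsub>A\<^esub> i"
  using assms
proof (induction cs)
  case (Cons c cs)
  from Cons.prems(1) consider i where "i < length cs" "q = (c \<odot>\<^bsub>A\<^esub> k [^]\<^bsub>A\<^esub> i, k [^]\<^bsub>A\<^esub> (length cs - Suc i))"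
    | "q \<in> set (bezoutian A k cs)" by auto
  thus ?case
  proof cases
    case 1
    thus ?thesis using Cons.prems(2) by (intro exI[of _ c] exI[of _ i]) auto
  next
    case 2
    then obtain d i where "d \<in> carrier F" "Suc i < length cs" "fst q = d \<odot>\<^bsub>A\<^esub> k [^]\<^bsub>A\<^esub> i" using Cons by auto
    thus ?thesis by (intro exI[of _ d] exI[of _ i]) auto
  qed
qed simp

end

context ext_field
begin

text \<open>The powers of \<open>x\<close> below the degree of its minimal polynomial are
  independent, so the highest of them is outside the span of the others and \<open>ex_form\<close>
  applies.\<close>

lemma exp_base_form:
  assumes x: "x \<in> carrier A" and n: "degree (A.Irr K0 x) = Suc m"
  shows "\<exists>\<phi>. lin F A (self_mod F) \<phi> \<and> (\<forall>i < m. \<phi> (x [^]\<^bsub>A\<^esub> i) = \<zero>) \<and> \<phi> (x [^]\<^bsub>A\<^esub> m) = \<one>"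
proof -
  have "A.independent K0 (A.exp_base x (Suc m))"
    using A.exp_base_independent[OF K0_subfield x algebraic[OF x]] n by simp
  moreover have "A.exp_base x (Suc m) = x [^]\<^bsub>A\<^esub> m # A.exp_base x m" by (simp add: A.exp_base_def)
  ultimately have 1: "x [^]\<^bsub>A\<^esub> m \<notin> A.Span K0 (A.exp_base x m)" using A.independent_backwards(1) by simp
  have c: "set (A.exp_base x m) \<subseteq> carrier A" by (rule A.exp_base_closed[OF x])
  have "x [^]\<^bsub>A\<^esub> m \<in> carrier A" using x by simp
  from fin_dim.ex_form[OF fin_dim Span_submodule[OF c] this 1] obtain \<phi> where
    \<phi>: "lin F A (self_mod F) \<phi>" "\<forall>u\<in>A.Span K0 (A.exp_base x m). \<phi> u = \<zero>" "\<phi> (x [^]\<^bsub>A\<^esub> m) = \<one>" by blast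
  moreover have "x [^]\<^bsub>A\<^esub> i \<in> A.Span K0 (A.exp_base x m)" if "i < m" for i
    using A.Span_base_incl[OF K0_subfield c] that by (auto simp: A.exp_base_def)
  ultimately show ?thesis by blast
qed

text \<open>If \<open>f'(x) = 0\<close> for the minimal polynomial \<open>f\<close> of \<open>x\<close>, then the Bezoutian of \<open>f\<close> is a nonzero
  element of \<open>A \<otimes> A\<close> of square zero.\<close>

lemma bezoutian_nonzero:
  assumes sep: "separable F A" and x: "x \<in> carrier A"
    and cs: "set cs \<subseteq> carrier F" "A.Irr K0 x = map emb cs" "ev A x cs = \<zero>\<^bsub>A\<^esub>"
  shows "psum A (bezoutian A x cs) \<noteq> \<zero>\<^bsub>A\<^esub>"
proof
  assume d0: "psum A (bezoutian A x cs) = \<zero>\<^bsub>A\<^esub>"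
  interpret T': comm_alg F TT.T by (rule TT.T_comm_alg[OF comm_alg_axioms comm_alg_axioms])
  define bs where "bs = bezoutian A x cs"
  have bs: "set bs \<subseteq> carrier A \<times> carrier A" unfolding bs_def by (rule bezoutian_closed[OF x cs(1)])
  have p: "fst p \<in> carrier A" "snd p \<in> carrier A" if "p \<in> set bs" for p
    using pair_mem[OF bs that] by auto
  define b where "b = lsum TT.T (map (\<lambda>p. TT.tau (fst p) (snd p)) bs)"
  have bc: "b \<in> carrier TT.T" unfolding b_def using p by auto
  have bal: "b \<otimes>\<^bsub>TT.T\<^esub> TT.tau x \<one>\<^bsub>A\<^esub> = b \<otimes>\<^bsub>TT.T\<^esub> TT.tau \<one>\<^bsub>A\<^esub> x"
  proof -
    have tz: "TT.tau \<zero>\<^bsub>A\<^esub> \<one>\<^bsub>A\<^esub> = \<zero>\<^bsub>TT.T\<^esub>" "TT.tau \<one>\<^bsub>A\<^esub> \<zero>\<^bsub>A\<^esub> = \<zero>\<^bsub>TT.T\<^esub>"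
      using lin_map.zero[OF lin_mapI[OF vspace_axioms TT.T.vspace_axioms TT.lin_tau_left]]
        lin_map.zero[OF lin_mapI[OF vspace_axioms TT.T.vspace_axioms TT.lin_tau_right]] by auto
    have c: "lsum TT.T (map (\<lambda>p. TT.tau (x \<otimes>\<^bsub>A\<^esub> fst p) (snd p)) bs) \<in> carrier TT.T"
      "lsum TT.T (map (\<lambda>p. TT.tau (fst p) (x \<otimes>\<^bsub>A\<^esub> snd p)) bs) \<in> carrier TT.T"
      using p x by (auto intro!: TT.T.M.lsum_map_closed)
    have "b \<otimes>\<^bsub>TT.T\<^esub> TT.tau x \<one>\<^bsub>A\<^esub> = lsum TT.T (map (\<lambda>p. TT.tau (fst p) (snd p) \<otimes>\<^bsub>TT.T\<^esub> TT.tau x \<one>\<^bsub>A\<^esub>) bs)"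
      unfolding b_def using p x
      by (intro lin_lsum_map[OF TT.T.vspace_axioms TT.T.vspace_axioms TT.T.lin_mult_right]) auto
    also have "\<dots> = lsum TT.T (map (\<lambda>p. TT.tau (x \<otimes>\<^bsub>A\<^esub> fst p) (snd p)) bs)"
      using p x by (auto intro!: arg_cong[where f = "lsum TT.T"] simp: TT.tau_mult comm)
    also have "\<dots> = lsum TT.T (map (\<lambda>p. TT.tau (fst p) (x \<otimes>\<^bsub>A\<^esub> snd p)) bs)"
      using bezoutian_telescope[OF TT.T.vspace_axioms TT.bilin_tau x cs(1)] c
      unfolding cs(3) tz bs_def by simp
    also have "\<dots> = lsum TT.T (map (\<lambda>p. TT.tau (fst p) (snd p) \<otimes>\<^bsub>TT.T\<^esub> TT.tau \<one>\<^bsub>A\<^esub> x) bs)"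
      using p x by (auto intro!: arg_cong[where f = "lsum TT.T"] simp: TT.tau_mult comm)
    also have "\<dots> = b \<otimes>\<^bsub>TT.T\<^esub> TT.tau \<one>\<^bsub>A\<^esub> x"
      unfolding b_def using p x
      by (intro lin_lsum_map[OF TT.T.vspace_axioms TT.T.vspace_axioms TT.T.lin_mult_right, symmetric]) auto
    finally show ?thesis .
  qed
  have balp: "b \<otimes>\<^bsub>TT.T\<^esub> TT.tau (x [^]\<^bsub>A\<^esub> (i::nat)) \<one>\<^bsub>A\<^esub> = b \<otimes>\<^bsub>TT.T\<^esub> TT.tau \<one>\<^bsub>A\<^esub> (x [^]\<^bsub>A\<^esub> i)" for i
  proof (induction i)
    case (Suc i)
    have xi: "x [^]\<^bsub>A\<^esub> i \<in> carrier A" using x by simp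
    have "b \<otimes>\<^bsub>TT.T\<^esub> TT.tau (x [^]\<^bsub>A\<^esub> Suc i) \<one>\<^bsub>A\<^esub> = (b \<otimes>\<^bsub>TT.T\<^esub> TT.tau (x [^]\<^bsub>A\<^esub> i) \<one>\<^bsub>A\<^esub>) \<otimes>\<^bsub>TT.T\<^esub> TT.tau x \<one>\<^bsub>A\<^esub>"
      using x xi bc by (simp add: T'.assoc TT.tau_mult)
    also have "\<dots> = (b \<otimes>\<^bsub>TT.T\<^esub> TT.tau x \<one>\<^bsub>A\<^esub>) \<otimes>\<^bsub>TT.T\<^esub> TT.tau \<one>\<^bsub>A\<^esub> (x [^]\<^bsub>A\<^esub> i)"
      unfolding Suc using x xi bc by (simp add: T'.assoc TT.tau_mult)
    also have "\<dots> = b \<otimes>\<^bsub>TT.T\<^esub> TT.tau \<one>\<^bsub>A\<^esub> (x [^]\<^bsub>A\<^esub> Suc i)"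
      unfolding bal using x xi bc by (simp add: T'.assoc TT.tau_mult comm)
    finally show ?case .
  qed simp
  \<comment> \<open>The left entries of \<open>b\<close> are polynomials in \<open>x\<close>, so by
    \<open>balp\<close> they can be moved across \<open>b\<close>: b (p \<otimes> q) = b (1
    \<otimes> p q). Summing over the entries of \<open>b\<close> gives b b = b (1 \<otimes> f'(x)),
    which is 0.\<close>
  have bf: "b \<otimes>\<^bsub>TT.T\<^esub> TT.tau (fst q) (snd q) = b \<otimes>\<^bsub>TT.T\<^esub> TT.tau \<one>\<^bsub>A\<^esub> (fst q \<otimes>\<^bsub>A\<^esub> snd q)" if q: "q \<in> set bs" for q
  proof -
    obtain c i where ci: "c \<in> carrier F" "fst q = c \<odot>\<^bsub>A\<^esub> x [^]\<^bsub>A\<^esub> (i::nat)"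
      using bezoutian_fst[OF q[unfolded bs_def] cs(1)] by blast
    have xi: "x [^]\<^bsub>A\<^esub> i \<in> carrier A" using x by simp
    have "TT.tau (fst q) (snd q) = c \<odot>\<^bsub>TT.T\<^esub> (TT.tau (x [^]\<^bsub>A\<^esub> i) \<one>\<^bsub>A\<^esub> \<otimes>\<^bsub>TT.T\<^esub> TT.tau \<one>\<^bsub>A\<^esub> (snd q))"
      unfolding ci(2) using ci(1) xi p(2)[OF q] lin_smult[OF TT.lin_tau_left] by (simp add: TT.tau_mult)
    hence "b \<otimes>\<^bsub>TT.T\<^esub> TT.tau (fst q) (snd q) = c \<odot>\<^bsub>TT.T\<^esub> ((b \<otimes>\<^bsub>TT.T\<^esub> TT.tau (x [^]\<^bsub>A\<^esub> i) \<one>\<^bsub>A\<^esub>) \<otimes>\<^bsub>TT.T\<^esub> TT.tau \<one>\<^bsub>A\<^esub> (snd q))"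
      using ci(1) xi p(2)[OF q] bc by (simp add: TT.T.mult_smult T'.assoc)
    also have "\<dots> = b \<otimes>\<^bsub>TT.T\<^esub> TT.tau \<one>\<^bsub>A\<^esub> (fst q \<otimes>\<^bsub>A\<^esub> snd q)"
      unfolding balp ci(2) using ci(1) xi p(2)[OF q] bc lin_smult[OF TT.lin_tau_right]
      by (simp add: T'.assoc TT.tau_mult smult_mult TT.T.mult_smult)
    finally show ?thesis .
  qed
  have "b \<otimes>\<^bsub>TT.T\<^esub> b = lsum TT.T (map (\<lambda>q. b \<otimes>\<^bsub>TT.T\<^esub> TT.tau (fst q) (snd q)) bs)"
    unfolding b_def[THEN arg_cong[where f = "\<lambda>z. b \<otimes>\<^bsub>TT.T\<^esub> z"]] using p bc
    by (intro lin_lsum_map[OF TT.T.vspace_axioms TT.T.vspace_axioms TT.T.lin_mult_left]) auto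
  also have "\<dots> = lsum TT.T (map (\<lambda>q. b \<otimes>\<^bsub>TT.T\<^esub> TT.tau \<one>\<^bsub>A\<^esub> (fst q \<otimes>\<^bsub>A\<^esub> snd q)) bs)"
    using bf by (auto intro!: arg_cong[where f = "lsum TT.T"])
  also have "\<dots> = b \<otimes>\<^bsub>TT.T\<^esub> TT.tau \<one>\<^bsub>A\<^esub> (psum A bs)"
    unfolding psum_def using p bc
    by (intro lin_lsum_map[OF vspace_axioms TT.T.vspace_axioms lin_comp[OF TT.lin_tau_right TT.T.lin_mult_left], symmetric]) auto
  also have "\<dots> = \<zero>\<^bsub>TT.T\<^esub>"
    using d0 bc lin_map.zero[OF lin_mapI[OF vspace_axioms TT.T.vspace_axioms TT.lin_tau_right[OF one_closed]]]
    by (simp add: bs_def)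
  \<comment> \<open>A \<otimes> A has a separability element together with \<open>A\<close>, so it
    is reduced.\<close>
  finally have b0: "b = \<zero>\<^bsub>TT.T\<^esub>"
    using T'.separable_reduced[OF TT.T_separable[OF comm_alg_axioms sep comm_alg_axioms sep] TT.T_fin_dim[OF fin_dim fin_dim] bc]
    by simp
  note Irr = A.IrrE[OF K0_subfield x algebraic[OF x]]
  have "degree (A.Irr K0 x) \<ge> 1" by (rule A.pirreducible_degree[OF K0_subfield Irr(1,2)])
  hence "length cs \<ge> 2" unfolding cs(2) by simp
  then obtain c cs' where cs': "cs = c # cs'" by (cases cs) auto
  hence "emb c = \<one>\<^bsub>A\<^esub>" using Irr(3) cs(2) by simp
  obtain m where m: "length cs' = Suc m" using cs' \<open>length cs \<ge> 2\<close> by (cases cs') auto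
  have "degree (A.Irr K0 x) = Suc m" using cs(2) cs' m by simp
  from exp_base_form[OF x this] obtain \<phi> where \<phi>: "lin F A (self_mod F) \<phi>"
    "\<And>i. i < m \<Longrightarrow> \<phi> (x [^]\<^bsub>A\<^esub> i) = \<zero>" "\<phi> (x [^]\<^bsub>A\<^esub> m) = \<one>" by blast
  have c: "c \<in> carrier F" and cs'F: "set cs' \<subseteq> carrier F" using cs cs' by auto
  have \<phi>c: "\<phi> a \<in> carrier F" if "a \<in> carrier A" for a using lin_closed[OF \<phi>(1) that] by simp
  \<comment> \<open>The form \<phi> kills every left entry except the power \<open>m\<close> coming
    from the leading coefficient \<open>c\<close>; the matching right entry is the zeroth power. So
    \<open>b\<close> contracts to the leading coefficient, which is 1.\<close>
  have "TT.conL \<phi> b = lsum A (map (\<lambda>p. TT.conL \<phi> (TT.tau (fst p) (snd p))) bs)"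
    unfolding b_def using p by (intro lin_lsum_map[OF TT.T.vspace_axioms vspace_axioms TT.conL(1)[OF \<phi>(1)]]) auto
  also have "map (\<lambda>p. TT.conL \<phi> (TT.tau (fst p) (snd p))) bs = map (\<lambda>p. \<phi> (fst p) \<odot>\<^bsub>A\<^esub> snd p) bs"
    using p by (auto simp: TT.conL(2)[OF \<phi>(1)])
  also have "lsum A \<dots> = emb c"
  proof -
    have 1: "lsum A (map (\<lambda>p. \<phi> (fst p) \<odot>\<^bsub>A\<^esub> snd p) (bezoutian A x cs')) = \<zero>\<^bsub>A\<^esub>"
    proof (rule M.lsum_map_zero)
      fix q assume q: "q \<in> set (bezoutian A x cs')"
      obtain d i where di: "d \<in> carrier F" "Suc i < length cs'" "fst q = d \<odot>\<^bsub>A\<^esub> x [^]\<^bsub>A\<^esub> i"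
        using bezoutian_fst[OF q cs'F] by blast
      hence "\<phi> (fst q) = \<zero>" using x \<phi>(2)[of i] m lin_smult[OF \<phi>(1)] by simp
      thus "\<phi> (fst q) \<odot>\<^bsub>A\<^esub> snd q = \<zero>\<^bsub>A\<^esub>"
        using pair_mem[OF bezoutian_closed[OF x cs'F] q] by simp
    qed
    define qs where "qs = map (\<lambda>i. (c \<odot>\<^bsub>A\<^esub> x [^]\<^bsub>A\<^esub> i, x [^]\<^bsub>A\<^esub> (length cs' - Suc i))) [0..<length cs']"
    have 2: "map (\<lambda>p. \<phi> (fst p) \<odot>\<^bsub>A\<^esub> snd p) qs = map (\<lambda>i. if i = m then emb c else \<zero>\<^bsub>A\<^esub>) [0..<length cs']"
      using c x \<phi>(2,3) m lin_smult[OF \<phi>(1)] by (auto simp: qs_def less_Suc_eq)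
    have "map (\<lambda>p. \<phi> (fst p) \<odot>\<^bsub>A\<^esub> snd p) bs = map (\<lambda>p. \<phi> (fst p) \<odot>\<^bsub>A\<^esub> snd p) qs @ map (\<lambda>p. \<phi> (fst p) \<odot>\<^bsub>A\<^esub> snd p) (bezoutian A x cs')"
      by (simp add: bs_def cs' qs_def)
    moreover have "set (map (\<lambda>p. \<phi> (fst p) \<odot>\<^bsub>A\<^esub> snd p) qs) \<subseteq> carrier A"
      unfolding 2 using c by auto
    moreover have "set (map (\<lambda>p. \<phi> (fst p) \<odot>\<^bsub>A\<^esub> snd p) (bezoutian A x cs')) \<subseteq> carrier A"
      using pair_mem[OF bezoutian_closed[OF x cs'F]] \<phi>c by auto
    ultimately have "lsum A (map (\<lambda>p. \<phi> (fst p) \<odot>\<^bsub>A\<^esub> snd p) bs) = lsum A (map (\<lambda>p. \<phi> (fst p) \<odot>\<^bsub>A\<^esub> snd p) qs) \<oplus>\<^bsub>A\<^esub> \<zero>\<^bsub>A\<^esub>"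
      using M.lsum_append 1 by simp
    also have "\<dots> = emb c" unfolding 2 using M.lsum_single[of "emb c" m "length cs'"] c m by simp
    finally show ?thesis .
  qed
  finally have "TT.conL \<phi> b = \<one>\<^bsub>A\<^esub>" using \<open>emb c = \<one>\<^bsub>A\<^esub>\<close> by simp
  moreover have "TT.conL \<phi> \<zero>\<^bsub>TT.T\<^esub> = \<zero>\<^bsub>A\<^esub>"
    using lin_map.zero[OF lin_mapI[OF TT.T.vspace_axioms vspace_axioms TT.conL(1)[OF \<phi>(1)]]] .
  ultimately show False using A.one_not_zero b0 by simp
qed

text \<open>By \<open>bezoutian_nonzero\<close> the derivative does not vanish at \<open>x\<close>,
  so it is not a multiple of the irreducible polynomial p. It is then invertible in the field of
  polynomials modulo p, and lifting an inverse yields the identity u p + v p' = 1.\<close>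

lemma separable_Irr:
  assumes sep: "separable F A" and x: "x \<in> carrier A"
  shows "separable_poly A K0 (A.Irr K0 x)"
proof -
  define p where "p = A.Irr K0 x"
  note Irr = A.IrrE[OF K0_subfield x algebraic[OF x], folded p_def]
  obtain cs where cs: "set cs \<subseteq> carrier F" "p = map emb cs" "ev A x cs = \<zero>\<^bsub>A\<^esub>"
    using Irr_emb[OF x] unfolding p_def by blast
  define q where "q = poly_deriv A p"
  have q: "q \<in> carrier (K0[X]\<^bsub>A\<^esub>)" unfolding q_def by (rule poly_deriv_closed[OF Irr(1)])
  interpret E: ring_hom_ring "K0[X]\<^bsub>A\<^esub>" A "\<lambda>p. A.eval p x"
    by (rule A.eval_ring_hom[OF K0_subring x])
  interpret P: domain "K0[X]\<^bsub>A\<^esub>" by (rule A.univ_poly_is_domain[OF K0_subring])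
  have "A.eval q x = psum A (bezoutian A x cs)"
    unfolding q_def cs(2) by (rule eval_poly_deriv_emb[OF cs(1) x])
  hence ne: "A.eval q x \<noteq> \<zero>\<^bsub>A\<^esub>"
    using bezoutian_nonzero[OF sep x cs(1) cs(2)[unfolded p_def] cs(3)] by simp
  define I where "I = PIdl\<^bsub>K0[X]\<^bsub>A\<^esub>\<^esub> p"
  have I_eq: "I = {u \<otimes>\<^bsub>K0[X]\<^bsub>A\<^esub>\<^esub> p | u. u \<in> carrier (K0[X]\<^bsub>A\<^esub>)}" by (simp add: I_def cgenideal_def)
  interpret I: ideal I "K0[X]\<^bsub>A\<^esub>" unfolding I_def by (rule P.cgenideal_ideal[OF Irr(1)])
  have "field (rupture A K0 p)"
    using A.rupture_is_field_iff_pirreducible[OF K0_subfield Irr(1)] Irr(2) by simp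
  then interpret RF: field "K0[X]\<^bsub>A\<^esub> Quot I" by (simp add: rupture_def I_def)
  have "q \<notin> I"
  proof
    assume "q \<in> I"
    then obtain u where "u \<in> carrier (K0[X]\<^bsub>A\<^esub>)" "q = u \<otimes>\<^bsub>K0[X]\<^bsub>A\<^esub>\<^esub> p" unfolding I_eq by blast
    hence "A.eval q x = A.eval u x \<otimes>\<^bsub>A\<^esub> A.eval p x" using E.hom_mult Irr(1) by blast
    thus False using ne Irr(4) E.hom_closed[OF \<open>u \<in> carrier (K0[X]\<^bsub>A\<^esub>)\<close>] by simp
  qed
  hence "I +>\<^bsub>K0[X]\<^bsub>A\<^esub>\<^esub> q \<noteq> \<zero>\<^bsub>K0[X]\<^bsub>A\<^esub> Quot I\<^esub>"
    using I.a_rcos_self[OF q] by (auto simp: FactRing_def)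
  moreover have "I +>\<^bsub>K0[X]\<^bsub>A\<^esub>\<^esub> q \<in> carrier (K0[X]\<^bsub>A\<^esub> Quot I)"
    using abelian_group.a_rcosetsI[OF ring.is_abelian_group[OF A.univ_poly_is_ring[OF K0_subring]] I.a_subset q] by (simp add: FactRing_def)
  ultimately have "I +>\<^bsub>K0[X]\<^bsub>A\<^esub>\<^esub> q \<in> Units (K0[X]\<^bsub>A\<^esub> Quot I)" unfolding RF.field_Units by blast
  then obtain C where C: "C \<in> carrier (K0[X]\<^bsub>A\<^esub> Quot I)"
    "C \<otimes>\<^bsub>K0[X]\<^bsub>A\<^esub> Quot I\<^esub> (I +>\<^bsub>K0[X]\<^bsub>A\<^esub>\<^esub> q) = \<one>\<^bsub>K0[X]\<^bsub>A\<^esub> Quot I\<^esub>"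
    using RF.Units_l_inv_ex by blast
  then obtain v where v: "v \<in> carrier (K0[X]\<^bsub>A\<^esub>)" "C = I +>\<^bsub>K0[X]\<^bsub>A\<^esub>\<^esub> v"
    unfolding FactRing_def A_RCOSETS_def' partial_object.simps a_r_coset_def' by blast
  have "I +>\<^bsub>K0[X]\<^bsub>A\<^esub>\<^esub> (v \<otimes>\<^bsub>K0[X]\<^bsub>A\<^esub>\<^esub> q) = I +>\<^bsub>K0[X]\<^bsub>A\<^esub>\<^esub> \<one>\<^bsub>K0[X]\<^bsub>A\<^esub>\<^esub>"
    using C(2) I.rcoset_mult_add[OF v(1) q] unfolding v(2) by (simp add: FactRing_def)
  hence "\<one>\<^bsub>K0[X]\<^bsub>A\<^esub>\<^esub> \<in> I +>\<^bsub>K0[X]\<^bsub>A\<^esub>\<^esub> (v \<otimes>\<^bsub>K0[X]\<^bsub>A\<^esub>\<^esub> q)" using I.a_rcos_self[of "\<one>\<^bsub>K0[X]\<^bsub>A\<^esub>\<^esub>"] by simp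
  then obtain h where "h \<in> I" "\<one>\<^bsub>K0[X]\<^bsub>A\<^esub>\<^esub> = h \<oplus>\<^bsub>K0[X]\<^bsub>A\<^esub>\<^esub> v \<otimes>\<^bsub>K0[X]\<^bsub>A\<^esub>\<^esub> q"
    by (auto simp: a_r_coset_def')
  moreover from this obtain u where "u \<in> carrier (K0[X]\<^bsub>A\<^esub>)" "h = u \<otimes>\<^bsub>K0[X]\<^bsub>A\<^esub>\<^esub> p" unfolding I_eq by blast
  ultimately have "u \<otimes>\<^bsub>K0[X]\<^bsub>A\<^esub>\<^esub> p \<oplus>\<^bsub>K0[X]\<^bsub>A\<^esub>\<^esub> v \<otimes>\<^bsub>K0[X]\<^bsub>A\<^esub>\<^esub> q = \<one>\<^bsub>K0[X]\<^bsub>A\<^esub>\<^esub>" by simp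
  thus ?thesis using v(1) \<open>u \<in> carrier (K0[X]\<^bsub>A\<^esub>)\<close>
    unfolding separable_poly_def p_def[symmetric] q_def[symmetric] by blast
qed

end

context comm_alg
begin

text \<open>Every nonzero element of the ideal e A is invertible relative to \<open>e\<close>; in
  other words, e A is a field with identity \<open>e\<close>.\<close>

definition primitive where
  "primitive e \<longleftrightarrow> e \<in> carrier A \<and> e \<otimes>\<^bsub>A\<^esub> e = e \<and> e \<noteq> \<zero>\<^bsub>A\<^esub> \<and>
     (\<forall>x\<in>carrier A. e \<otimes>\<^bsub>A\<^esub> x \<noteq> \<zero>\<^bsub>A\<^esub> \<longrightarrow> (\<exists>y\<in>carrier A. e \<otimes>\<^bsub>A\<^esub> (x \<otimes>\<^bsub>A\<^esub> y) = e))"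

text \<open>Stated for positions of the list, so that a nonzero idempotent cannot occur twice; each
  position will be one factor of a product.\<close>

definition orthogonal where
  "orthogonal es \<longleftrightarrow> (\<forall>i < length es. \<forall>j < length es. i \<noteq> j \<longrightarrow> es ! i \<otimes>\<^bsub>A\<^esub> es ! j = \<zero>\<^bsub>A\<^esub>)"

lemma orthogonal_append:
  assumes "orthogonal es" "orthogonal fs" "set es \<subseteq> carrier A" "set fs \<subseteq> carrier A"
    and "\<And>e f. e \<in> set es \<Longrightarrow> f \<in> set fs \<Longrightarrow> e \<otimes>\<^bsub>A\<^esub> f = \<zero>\<^bsub>A\<^esub>"
  shows "orthogonal (es @ fs)"
  unfolding orthogonal_def
proof (intro allI impI)
  have c: "f \<otimes>\<^bsub>A\<^esub> e = \<zero>\<^bsub>A\<^esub>" if "e \<in> set es" "f \<in> set fs" for e f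
  proof -
    have "e \<in> carrier A" "f \<in> carrier A" using assms(3,4) that by auto
    thus ?thesis using assms(5)[OF that] comm[of f e] by simp
  qed
  fix i j assume ij: "i < length (es @ fs)" "j < length (es @ fs)" "i \<noteq> j"
  consider "i < length es" "j < length es" | "i < length es" "\<not> j < length es"
    | "\<not> i < length es" "j < length es" | "\<not> i < length es" "\<not> j < length es" by blast
  thus "(es @ fs) ! i \<otimes>\<^bsub>A\<^esub> (es @ fs) ! j = \<zero>\<^bsub>A\<^esub>"
  proof cases
    case 1
    thus ?thesis using assms(1) ij by (simp add: nth_append orthogonal_def)
  next
    case 2
    thus ?thesis using assms(5) ij by (simp add: nth_append)
  next
    case 3
    thus ?thesis using c ij by (simp add: nth_append)
  next
    case 4
    hence "i - length es < length fs" "j - length es < length fs" "i - length es \<noteq> j - length es"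
      using ij by auto
    thus ?thesis using assms(2) 4 by (simp add: nth_append orthogonal_def)
  qed
qed

text \<open>An idempotent that is not primitive splits as f + (e - f), with f the identity element
  of a smaller principal ideal. Both parts generate ideals of smaller dimension than e A, so the
  splitting terminates.\<close>

lemma primitive_decomposition:
  assumes sep: "separable F A" and fin: "fin_dim F A" and e: "e \<in> carrier A" "e \<otimes>\<^bsub>A\<^esub> e = e"
  shows "\<exists>es. (\<forall>f\<in>set es. primitive f \<and> f \<otimes>\<^bsub>A\<^esub> e = f) \<and> orthogonal es \<and> lsum A es = e"
proof -
  interpret V: fin_dim F A by (rule fin)
  obtain d n where d: "\<And>U U'. submodule U F A \<Longrightarrow> submodule U' F A \<Longrightarrow> d U \<le> n \<and> (U \<subset> U' \<longrightarrow> d U < (d U' :: nat))"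
    using V.ex_dim by blast
  define PI where "PI e = (\<lambda>k. e \<otimes>\<^bsub>A\<^esub> k) ` carrier A" for e
  have dless: "d (PI f) < d (PI e)"
    if f: "f \<in> carrier A" "e \<in> carrier A" "f \<otimes>\<^bsub>A\<^esub> e = f" "f \<otimes>\<^bsub>A\<^esub> f = f" "f \<noteq> e" "e \<otimes>\<^bsub>A\<^esub> e = e" for e f
  proof -
    have "PI f \<subseteq> PI e"
    proof
      fix y assume "y \<in> PI f"
      then obtain k where "k \<in> carrier A" "y = f \<otimes>\<^bsub>A\<^esub> k" by (auto simp: PI_def)
      moreover from this have "y = e \<otimes>\<^bsub>A\<^esub> (f \<otimes>\<^bsub>A\<^esub> k)" using f by (metis assoc comm)
      ultimately show "y \<in> PI e" unfolding PI_def using f by (intro image_eqI[of y _ "f \<otimes>\<^bsub>A\<^esub> k"]) auto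
    qed
    moreover have "e \<in> PI e" using f by (auto simp: PI_def intro!: image_eqI[of _ _ e])
    moreover have "e \<notin> PI f"
    proof
      assume "e \<in> PI f"
      then obtain k where k: "k \<in> carrier A" "e = f \<otimes>\<^bsub>A\<^esub> k" by (auto simp: PI_def)
      hence "f \<otimes>\<^bsub>A\<^esub> e = (f \<otimes>\<^bsub>A\<^esub> f) \<otimes>\<^bsub>A\<^esub> k" using f(1) by (simp add: assoc)
      thus False using f k by simp
    qed
    ultimately have "PI f \<subset> PI e" by blast
    thus ?thesis using d principal_submodule f unfolding PI_def by blast
  qed
  show ?thesis using e
  proof (induction "d (PI e)" arbitrary: e rule: less_induct)
    case less
    note e = less.prems
    show ?case
    proof (cases "e = \<zero>\<^bsub>A\<^esub>")
      case True
      thus ?thesis by (intro exI[of _ "[]"]) (auto simp: orthogonal_def)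
    next
      case ne: False
      show ?thesis
      proof (cases "primitive e")
        case True
        thus ?thesis using e by (intro exI[of _ "[e]"]) (auto simp: orthogonal_def)
      next
        case False
        then obtain x where x: "x \<in> carrier A" "e \<otimes>\<^bsub>A\<^esub> x \<noteq> \<zero>\<^bsub>A\<^esub>" and nx: "\<And>y. y \<in> carrier A \<Longrightarrow> e \<otimes>\<^bsub>A\<^esub> (x \<otimes>\<^bsub>A\<^esub> y) \<noteq> e"
          using e ne by (auto simp: primitive_def)
        define z where "z = e \<otimes>\<^bsub>A\<^esub> x"
        have "z \<otimes>\<^bsub>A\<^esub> e = (e \<otimes>\<^bsub>A\<^esub> e) \<otimes>\<^bsub>A\<^esub> x" using e(1) x(1) by (simp add: z_def assoc comm[OF x(1) e(1)])
        hence z: "z \<in> carrier A" "z \<otimes>\<^bsub>A\<^esub> e = z" using e x unfolding z_def by simp_all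
        obtain k where k: "k \<in> carrier A" "z \<otimes>\<^bsub>A\<^esub> (z \<otimes>\<^bsub>A\<^esub> k) = z"
          using principal_idempotent[OF sep fin z(1)] by blast
        \<comment> \<open>The identity element of the ideal generated by \<open>z\<close>. It
          differs from \<open>e\<close>, for otherwise \<open>k\<close> would be an inverse of
          \<open>x\<close> relative to \<open>e\<close>.\<close>
        define f where "f = z \<otimes>\<^bsub>A\<^esub> k"
        have f: "f \<in> carrier A" "f \<otimes>\<^bsub>A\<^esub> e = f" "f \<otimes>\<^bsub>A\<^esub> f = f"
        proof -
          show "f \<in> carrier A" using z k by (simp add: f_def)
          have "f \<otimes>\<^bsub>A\<^esub> e = (z \<otimes>\<^bsub>A\<^esub> e) \<otimes>\<^bsub>A\<^esub> k" using z(1) k(1) e(1) by (simp add: f_def assoc comm lcomm)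
          thus "f \<otimes>\<^bsub>A\<^esub> e = f" unfolding z(2) f_def .
          have "f \<otimes>\<^bsub>A\<^esub> f = (z \<otimes>\<^bsub>A\<^esub> (z \<otimes>\<^bsub>A\<^esub> k)) \<otimes>\<^bsub>A\<^esub> k" using z(1) k(1) by (simp add: f_def assoc lcomm)
          thus "f \<otimes>\<^bsub>A\<^esub> f = f" unfolding k(2) f_def .
        qed
        have f0: "f \<noteq> \<zero>\<^bsub>A\<^esub>"
        proof
          assume "f = \<zero>\<^bsub>A\<^esub>"
          hence "z = \<zero>\<^bsub>A\<^esub>" using k z unfolding f_def by simp
          thus False using x by (simp add: z_def)
        qed
        have fe: "f \<noteq> e" using nx[OF k(1)] e x k by (auto simp: f_def z_def assoc)
        define g where "g = e \<ominus>\<^bsub>A\<^esub> f"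
        have fe': "e \<otimes>\<^bsub>A\<^esub> f = f" using f e comm by simp
        have g: "g \<in> carrier A" "g \<otimes>\<^bsub>A\<^esub> e = g" "g \<otimes>\<^bsub>A\<^esub> f = \<zero>\<^bsub>A\<^esub>"
          using e f fe' by (simp_all add: g_def minus_mult eq_minus_zero)
        have g2: "g \<otimes>\<^bsub>A\<^esub> g = g"
        proof -
          have "g \<otimes>\<^bsub>A\<^esub> g = g \<otimes>\<^bsub>A\<^esub> e \<ominus>\<^bsub>A\<^esub> g \<otimes>\<^bsub>A\<^esub> f" using g e f by (subst (2) g_def) (simp add: mult_minus)
          thus ?thesis using g by simp
        qed
        have ge: "g \<noteq> e"
        proof
          assume "g = e"
          thus False using g(3) fe' f0 by simp
        qed
        obtain es where es: "\<forall>h\<in>set es. primitive h \<and> h \<otimes>\<^bsub>A\<^esub> f = h" "orthogonal es" "lsum A es = f"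
          using less.hyps[OF dless[OF f(1) e(1) f(2,3) fe e(2)] f(1,3)] by blast
        obtain fs where fs: "\<forall>h\<in>set fs. primitive h \<and> h \<otimes>\<^bsub>A\<^esub> g = h" "orthogonal fs" "lsum A fs = g"
          using less.hyps[OF dless[OF g(1) e(1) g(2) g2 ge e(2)] g(1) g2] by blast
        have esc: "set es \<subseteq> carrier A" and fsc: "set fs \<subseteq> carrier A" using es fs by (auto simp: primitive_def)
        show ?thesis
        proof (intro exI[of _ "es @ fs"] conjI ballI)
          fix h assume "h \<in> set (es @ fs)"
          then consider "h \<in> set es" | "h \<in> set fs" by auto
          thus "primitive h" using es fs by cases auto
          from \<open>h \<in> set (es @ fs)\<close> consider "h \<in> set es" | "h \<in> set fs" by auto
          thus "h \<otimes>\<^bsub>A\<^esub> e = h"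
          proof cases
            case 1
            hence "h \<in> carrier A" "h \<otimes>\<^bsub>A\<^esub> f = h" using es esc by auto
            thus ?thesis using f e by (metis assoc)
          next
            case 2
            hence "h \<in> carrier A" "h \<otimes>\<^bsub>A\<^esub> g = h" using fs fsc by auto
            thus ?thesis using g e by (metis assoc)
          qed
        next
          show "orthogonal (es @ fs)"
          proof (rule orthogonal_append[OF es(2) fs(2) esc fsc])
            fix a b assume "a \<in> set es" "b \<in> set fs"
            hence "a \<in> carrier A" "a \<otimes>\<^bsub>A\<^esub> f = a" "b \<in> carrier A" "b \<otimes>\<^bsub>A\<^esub> g = b" using es fs esc fsc by auto
            hence "a \<otimes>\<^bsub>A\<^esub> b = (a \<otimes>\<^bsub>A\<^esub> f) \<otimes>\<^bsub>A\<^esub> (b \<otimes>\<^bsub>A\<^esub> g)" by simp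
            also have "\<dots> = a \<otimes>\<^bsub>A\<^esub> (b \<otimes>\<^bsub>A\<^esub> (g \<otimes>\<^bsub>A\<^esub> f))"
              using \<open>a \<in> carrier A\<close> \<open>b \<in> carrier A\<close> f(1) g(1) by (simp add: assoc lcomm comm)
            finally show "a \<otimes>\<^bsub>A\<^esub> b = \<zero>\<^bsub>A\<^esub>" using g \<open>a \<in> carrier A\<close> \<open>b \<in> carrier A\<close> by simp
          qed
          show "lsum A (es @ fs) = e"
            using M.lsum_append[OF esc fsc] es(3) fs(3) e f by (simp add: g_def a_minus_def M.a_lcomm M.r_neg)
        qed
      qed
    qed
  qed
qed

definition component where
  "component e = A\<lparr>carrier := (\<lambda>k. e \<otimes>\<^bsub>A\<^esub> k) ` carrier A, one := e\<rparr>"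

lemma component_simps [simp]:
  "carrier (component e) = (\<lambda>k. e \<otimes>\<^bsub>A\<^esub> k) ` carrier A"
  "monoid.mult (component e) = monoid.mult A" "\<one>\<^bsub>component e\<^esub> = e" "\<zero>\<^bsub>component e\<^esub> = \<zero>\<^bsub>A\<^esub>"
  "add (component e) = add A" "smult (component e) = smult A"
  by (simp_all add: component_def)

lemma component_mem:
  assumes "e \<in> carrier A" "e \<otimes>\<^bsub>A\<^esub> e = e"
  shows "x \<in> carrier (component e) \<longleftrightarrow> x \<in> carrier A \<and> e \<otimes>\<^bsub>A\<^esub> x = x"
proof
  assume "x \<in> carrier (component e)"
  then obtain k where "k \<in> carrier A" "x = e \<otimes>\<^bsub>A\<^esub> k" by auto
  thus "x \<in> carrier A \<and> e \<otimes>\<^bsub>A\<^esub> x = x" using assms by (simp add: assoc[symmetric])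
next
  assume "x \<in> carrier A \<and> e \<otimes>\<^bsub>A\<^esub> x = x"
  thus "x \<in> carrier (component e)" by (auto intro!: image_eqI[of _ _ x])
qed

lemma component_comm_alg:
  assumes e: "e \<in> carrier A" "e \<otimes>\<^bsub>A\<^esub> e = e"
  shows "comm_alg F (component e)" "alg_hom F A (component e) (\<lambda>k. e \<otimes>\<^bsub>A\<^esub> k)"
proof -
  note m = component_mem[OF e]
  have "module F (A\<lparr>carrier := (\<lambda>k. e \<otimes>\<^bsub>A\<^esub> k) ` carrier A\<rparr>)"
    using submodule.submodule_is_module[OF principal_submodule[OF e(1)] module_axioms] .
  then interpret S: module F "A\<lparr>carrier := (\<lambda>k. e \<otimes>\<^bsub>A\<^esub> k) ` carrier A\<rparr>" .
  have ag: "abelian_group (component e)"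
  proof -
    have "add_monoid (component e) = add_monoid (A\<lparr>carrier := (\<lambda>k. e \<otimes>\<^bsub>A\<^esub> k) ` carrier A\<rparr>)" by simp
    thus ?thesis using S.M.a_comm_monoid S.M.a_comm_group
      by (simp add: abelian_group_def abelian_monoid_def abelian_group_axioms_def)
  qed
  have mod: "module F (component e)"
  proof (rule moduleI)
    show "abelian_group (component e)" by (rule ag)
    show "c \<odot>\<^bsub>component e\<^esub> x \<in> carrier (component e)" if "c \<in> carrier F" "x \<in> carrier (component e)" for c x
      using that e unfolding m by (simp add: mult_smult)
  qed (unfold m, auto simp: R.is_cring smult_l_distr smult_r_distr smult_assoc1)
  have "nonassoc_algebra F (component e)"
  proof (intro nonassoc_algebra.intro nonassoc_algebra_axioms.intro mod R.field_axioms)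
    show "x \<otimes>\<^bsub>component e\<^esub> y \<in> carrier (component e)" if "x \<in> carrier (component e)" "y \<in> carrier (component e)" for x y
      using that e unfolding m by (simp add: assoc[symmetric])
    show "x \<otimes>\<^bsub>component e\<^esub> \<one>\<^bsub>component e\<^esub> = x" if "x \<in> carrier (component e)" for x
      using that e comm unfolding m by simp
  qed (unfold m, auto simp: add_mult mult_add smult_mult mult_smult e)
  hence "falg F (component e)" by (rule falgI)
  moreover have "x \<otimes>\<^bsub>component e\<^esub> y \<otimes>\<^bsub>component e\<^esub> z = x \<otimes>\<^bsub>component e\<^esub> (y \<otimes>\<^bsub>component e\<^esub> z)"
    "x \<otimes>\<^bsub>component e\<^esub> y = y \<otimes>\<^bsub>component e\<^esub> x"
    if "x \<in> carrier (component e)" "y \<in> carrier (component e)" "z \<in> carrier (component e)" for x y z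
    using that unfolding m by (simp add: assoc, simp add: comm[of x y])
  ultimately show "comm_alg F (component e)"
    by (simp add: comm_alg_def assoc_alg_def assoc_alg_axioms_def comm_alg_axioms_def del: component_simps(1))
  show "alg_hom F A (component e) (\<lambda>k. e \<otimes>\<^bsub>A\<^esub> k)"
    unfolding alg_hom_def
  proof (intro conjI ballI linI)
    show "e \<otimes>\<^bsub>A\<^esub> (x \<otimes>\<^bsub>A\<^esub> y) = (e \<otimes>\<^bsub>A\<^esub> x) \<otimes>\<^bsub>component e\<^esub> (e \<otimes>\<^bsub>A\<^esub> y)" if "x \<in> carrier A" "y \<in> carrier A" for x y
    proof -
      have "(e \<otimes>\<^bsub>A\<^esub> x) \<otimes>\<^bsub>A\<^esub> (e \<otimes>\<^bsub>A\<^esub> y) = (e \<otimes>\<^bsub>A\<^esub> e) \<otimes>\<^bsub>A\<^esub> (x \<otimes>\<^bsub>A\<^esub> y)"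
        using that e(1) by (simp add: assoc lcomm)
      thus ?thesis using e(2) by simp
    qed
  qed (use e in \<open>auto simp: mult_add mult_smult\<close>)
qed

text \<open>Primitivity makes the component a field. Its separability element is an image of that of
  \<open>A\<close> under multiplication by \<open>e\<close>, obtained from
  \<open>separable_span\<close>, and \<open>separable_Irr\<close> turns it into separability of
  minimal polynomials.\<close>

lemma component_extension:
  assumes sep: "separable F A" and fin: "fin_dim F A" and e: "primitive e"
  shows "finite_separable_extension F (component e)"
proof -
  have ec: "e \<in> carrier A" "e \<otimes>\<^bsub>A\<^esub> e = e" "e \<noteq> \<zero>\<^bsub>A\<^esub>" using e by (auto simp: primitive_def)
  note m = component_mem[OF ec(1,2)] and ca = component_comm_alg[OF ec(1,2)]
  interpret C: comm_alg F "component e" by (rule ca(1))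
  have "field (component e)"
  proof (rule C.A.cring_fieldI2)
    fix x assume x: "x \<in> carrier (component e)" "x \<noteq> \<zero>\<^bsub>component e\<^esub>"
    hence x': "x \<in> carrier A" "e \<otimes>\<^bsub>A\<^esub> x = x" "x \<noteq> \<zero>\<^bsub>A\<^esub>" unfolding m by auto
    then obtain y where y: "y \<in> carrier A" "e \<otimes>\<^bsub>A\<^esub> (x \<otimes>\<^bsub>A\<^esub> y) = e" using e by (auto simp: primitive_def)
    thus "\<exists>y\<in>carrier (component e). x \<otimes>\<^bsub>component e\<^esub> y = \<one>\<^bsub>component e\<^esub>"
      using x' ec by (intro bexI[of _ "e \<otimes>\<^bsub>A\<^esub> y"]) (auto simp: lcomm)
  qed (use ec in auto)
  moreover have fdim: "fin_dim F (component e)"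
    by (rule fin_dim_image[OF fin C.vspace_axioms alg_homD(1)[OF ca(2)]]) simp
  ultimately interpret C: ext_field F "component e"
    by (intro ext_field.intro ext_field_axioms.intro ca(1)) (auto simp: fin_dim_def fin_dim_axioms_def)
  interpret P: comm_pair F A A "component e" "\<lambda>k. e \<otimes>\<^bsub>A\<^esub> k" "\<lambda>k. e \<otimes>\<^bsub>A\<^esub> k"
    by (intro comm_pair.intro comm_pair_axioms.intro comm_alg_axioms ca)
  have "separable F (component e)"
  proof (rule P.separable_span[OF sep sep])
    fix N assume N: "submodule N F (component e)"
      and *: "\<And>k l. k \<in> carrier A \<Longrightarrow> l \<in> carrier A \<Longrightarrow> (e \<otimes>\<^bsub>A\<^esub> k) \<otimes>\<^bsub>component e\<^esub> (e \<otimes>\<^bsub>A\<^esub> l) \<in> N"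
    have "x \<in> N" if "x \<in> carrier (component e)" for x
    proof -
      have x: "x \<in> carrier A" "e \<otimes>\<^bsub>A\<^esub> x = x" using that unfolding m by auto
      hence "x \<otimes>\<^bsub>A\<^esub> e = x" using comm[OF ec(1) x(1)] by simp
      thus ?thesis using *[OF x(1) one_closed] x ec by simp
    qed
    thus "N = carrier (component e)" using C.submodule_subset[OF N] by blast
  qed
  thus ?thesis unfolding finite_separable_extension_def Let_def
    using C.A.field_axioms C.algebra_A C.fd C.separable_Irr by simp
qed

end

text \<open>A complete orthogonal system of primitive idempotents identifies \<open>K\<close> with
  the product of its components: \<open>k\<close> goes to the family of the products with the
  idempotents, and the inverse adds up the coordinates.\<close>

theorem separable_etale:
  fixes F :: "('f, 'k) ring_scheme" and K :: "('f, 'a) module"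
  assumes K: "comm_alg F K" and sep: "separable F K" and fin: "fin_dim F K"
  shows "etale F K"
proof -
  interpret K: comm_alg F K by fact
  obtain es where es: "\<forall>f\<in>set es. K.primitive f" "K.orthogonal es" "lsum K es = \<one>\<^bsub>K\<^esub>"
    using K.primitive_decomposition[OF sep fin K.one_closed] by auto
  define n where "n = length es"
  define L where "L i = K.component (es ! i)" for i
  have e: "es ! i \<in> carrier K" "es ! i \<otimes>\<^bsub>K\<^esub> es ! i = es ! i" "K.primitive (es ! i)" if "i < n" for i
    using es(1) nth_mem[of i es] that by (auto simp: n_def K.primitive_def)
  have esc: "set es \<subseteq> carrier K" using es by (auto simp: K.primitive_def)
  have orth: "es ! i \<otimes>\<^bsub>K\<^esub> es ! j = \<zero>\<^bsub>K\<^esub>" if "i < n" "j < n" "i \<noteq> j" for i j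
    using es(2) that by (simp add: K.orthogonal_def n_def)
  define h where "h k = (\<lambda>i \<in> {..<n}. es ! i \<otimes>\<^bsub>K\<^esub> k)" for k
  note hom = K.component_comm_alg(2)[OF e(1,2)]
  note Lm = K.component_mem[OF e(1,2)]
  have expand: "lsum K (map (\<lambda>f. f \<otimes>\<^bsub>K\<^esub> k) es) = k" if "k \<in> carrier K" for k
    using K.lsum_mult[OF that esc] es(3) that by simp
  have hc: "h x \<in> carrier (product_alg {..<n} L)" if "x \<in> carrier K" for x
    using that by (auto simp: h_def product_alg_def L_def)
  have "h \<in> ring_iso K (product_alg {..<n} L)"
  proof (rule ring_iso_memI)
    show "h x \<in> carrier (product_alg {..<n} L)" if "x \<in> carrier K" for x
      by (rule hc[OF that])
    show "h (x \<otimes>\<^bsub>K\<^esub> y) = h x \<otimes>\<^bsub>product_alg {..<n} L\<^esub> h y" if "x \<in> carrier K" "y \<in> carrier K" for x y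
      using alg_homD(3)[OF hom that] by (auto simp: h_def product_alg_def L_def fun_eq_iff)
    show "h (x \<oplus>\<^bsub>K\<^esub> y) = h x \<oplus>\<^bsub>product_alg {..<n} L\<^esub> h y" if "x \<in> carrier K" "y \<in> carrier K" for x y
      using that e by (auto simp: h_def product_alg_def L_def fun_eq_iff K.mult_add)
    show "h \<one>\<^bsub>K\<^esub> = \<one>\<^bsub>product_alg {..<n} L\<^esub>"
      using e by (auto simp: h_def product_alg_def L_def fun_eq_iff)
    show "bij_betw h (carrier K) (carrier (product_alg {..<n} L))"
      unfolding bij_betw_def
    proof
      show "inj_on h (carrier K)"
      proof (rule inj_onI)
        fix x y assume xy: "x \<in> carrier K" "y \<in> carrier K" "h x = h y"
        have "es ! i \<otimes>\<^bsub>K\<^esub> x = es ! i \<otimes>\<^bsub>K\<^esub> y" if "i < n" for i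
          using fun_cong[OF xy(3), of i] that by (simp add: h_def)
        hence "map (\<lambda>f. f \<otimes>\<^bsub>K\<^esub> x) es = map (\<lambda>f. f \<otimes>\<^bsub>K\<^esub> y) es"
          by (auto simp: n_def in_set_conv_nth)
        from arg_cong[where f = "lsum K", OF this] show "x = y" unfolding expand[OF xy(1)] expand[OF xy(2)] .
      qed
      show "h ` carrier K = carrier (product_alg {..<n} L)"
      proof (intro equalityI subsetI)
        fix y assume "y \<in> h ` carrier K"
        thus "y \<in> carrier (product_alg {..<n} L)" using hc by blast
      next
        fix y assume y: "y \<in> carrier (product_alg {..<n} L)"
        have yi: "y i \<in> carrier K" "es ! i \<otimes>\<^bsub>K\<^esub> y i = y i" if "i < n" for i
        proof -
          have "y i \<in> carrier (L i)" using y that by (auto simp: product_alg_def)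
          thus "y i \<in> carrier K" "es ! i \<otimes>\<^bsub>K\<^esub> y i = y i" using Lm[OF that that] by (auto simp: L_def simp del: K.component_simps)
        qed
        define k where "k = lsum K (map y [0..<n])"
        have yc: "set (map y [0..<n]) \<subseteq> carrier K" using yi by auto
        hence k: "k \<in> carrier K" by (simp add: k_def)
        have "es ! i \<otimes>\<^bsub>K\<^esub> k = y i" if i: "i < n" for i
        proof -
          have "es ! i \<otimes>\<^bsub>K\<^esub> k = lsum K (map (\<lambda>x. es ! i \<otimes>\<^bsub>K\<^esub> x) (map y [0..<n]))"
            unfolding k_def by (rule K.mult_lsum[OF e(1)[OF i] yc])
          also have "map (\<lambda>x. es ! i \<otimes>\<^bsub>K\<^esub> x) (map y [0..<n]) = map (\<lambda>j. if j = i then y i else \<zero>\<^bsub>K\<^esub>) [0..<n]"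
          proof -
            have "es ! i \<otimes>\<^bsub>K\<^esub> y j = (if j = i then y i else \<zero>\<^bsub>K\<^esub>)" if j: "j < n" for j
            proof (cases "j = i")
              case False
              have "es ! i \<otimes>\<^bsub>K\<^esub> y j = (es ! i \<otimes>\<^bsub>K\<^esub> es ! j) \<otimes>\<^bsub>K\<^esub> y j"
                using yi[OF j] e(1)[OF i] e(1)[OF j] by (simp add: K.assoc)
              thus ?thesis using orth[OF i j] False yi[OF j] by auto
            qed (use yi i in auto)
            thus ?thesis by auto
          qed
          also have "lsum K \<dots> = y i" by (rule K.M.lsum_single[OF yi(1)[OF i] i])
          finally show ?thesis .
        qed
        hence "h k = y" using y by (auto simp: h_def product_alg_def PiE_def extensional_def fun_eq_iff)
        thus "y \<in> h ` carrier K" using k by blast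
      qed
    qed
  qed
  moreover have "h (c \<odot>\<^bsub>K\<^esub> x) = c \<odot>\<^bsub>product_alg {..<n} L\<^esub> h x" if "c \<in> carrier F" "x \<in> carrier K" for c x
    using that e by (auto simp: h_def product_alg_def L_def fun_eq_iff K.mult_smult)
  ultimately have "alg_iso F K (product_alg {..<n} L)" by (auto simp: alg_iso_def)
  moreover have "\<forall>i<n. finite_separable_extension F (L i)"
    using K.component_extension[OF sep fin e(3)] by (simp add: L_def)
  ultimately show ?thesis unfolding etale_def by blast
qed

section \<open>Nucleus and center\<close>

lemma falg_restrict:
  fixes F :: "('f, 'k) ring_scheme" and A :: "('f, 'a) module"
  assumes A: "falg F A" and K: "subalgebra F A K"
  shows "falg F (A\<lparr>carrier := K\<rparr>)"
proof -
  interpret A: falg F A by fact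
  have s: "submodule K F A" and one: "\<one>\<^bsub>A\<^esub> \<in> K" and m: "\<And>x y. x \<in> K \<Longrightarrow> y \<in> K \<Longrightarrow> x \<otimes>\<^bsub>A\<^esub> y \<in> K"
    using K by (auto simp: subalgebra_def)
  have c: "\<And>x. x \<in> K \<Longrightarrow> x \<in> carrier A" by (rule A.submodule_mem[OF s])
  have "nonassoc_algebra F (A\<lparr>carrier := K\<rparr>)"
    by (intro nonassoc_algebra.intro nonassoc_algebra_axioms.intro A.R.field_axioms
        submodule.submodule_is_module[OF s A.module_axioms])
      (simp_all add: one m c A.add_mult A.mult_add A.smult_mult A.mult_smult)
  thus ?thesis by (rule falgI)
qed

lemma lin_restrict: "K \<subseteq> carrier A \<Longrightarrow> lin F (A\<lparr>carrier := K\<rparr>) A (\<lambda>x. x)"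
  by (auto simp: lin_def)

lemma lin_corestrict: "lin F V A h \<Longrightarrow> (\<And>x. x \<in> carrier V \<Longrightarrow> h x \<in> K) \<Longrightarrow> lin F V (A\<lparr>carrier := K\<rparr>) h"
  by (auto simp: lin_def)

lemma lsum_restrict [simp]: "lsum (A\<lparr>carrier := K\<rparr>) xs = lsum A xs"
  by (simp add: lsum_def)

context falg
begin

lemma nucleus_iff: "x \<in> nucleus A \<longleftrightarrow> x \<in> carrier A \<and> (\<forall>y\<in>carrier A. \<forall>z\<in>carrier A.
    (x \<otimes>\<^bsub>A\<^esub> y) \<otimes>\<^bsub>A\<^esub> z = x \<otimes>\<^bsub>A\<^esub> (y \<otimes>\<^bsub>A\<^esub> z) \<and> (y \<otimes>\<^bsub>A\<^esub> x) \<otimes>\<^bsub>A\<^esub> z = y \<otimes>\<^bsub>A\<^esub> (x \<otimes>\<^bsub>A\<^esub> z) \<and>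
    (y \<otimes>\<^bsub>A\<^esub> z) \<otimes>\<^bsub>A\<^esub> x = y \<otimes>\<^bsub>A\<^esub> (z \<otimes>\<^bsub>A\<^esub> x))"
  by (auto simp: nucleus_def associator_def eq_minus_zero)

lemma nucleusD:
  assumes "x \<in> nucleus A"
  shows "x \<in> carrier A"
    "y \<in> carrier A \<Longrightarrow> z \<in> carrier A \<Longrightarrow> (x \<otimes>\<^bsub>A\<^esub> y) \<otimes>\<^bsub>A\<^esub> z = x \<otimes>\<^bsub>A\<^esub> (y \<otimes>\<^bsub>A\<^esub> z)"
    "y \<in> carrier A \<Longrightarrow> z \<in> carrier A \<Longrightarrow> (y \<otimes>\<^bsub>A\<^esub> x) \<otimes>\<^bsub>A\<^esub> z = y \<otimes>\<^bsub>A\<^esub> (x \<otimes>\<^bsub>A\<^esub> z)"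
    "y \<in> carrier A \<Longrightarrow> z \<in> carrier A \<Longrightarrow> (y \<otimes>\<^bsub>A\<^esub> z) \<otimes>\<^bsub>A\<^esub> x = y \<otimes>\<^bsub>A\<^esub> (z \<otimes>\<^bsub>A\<^esub> x)"
  using assms by (simp_all add: nucleus_iff)

lemma nucleus_subset: "nucleus A \<subseteq> carrier A"
  by (auto simp: nucleus_iff)

lemma nucleus_mult:
  assumes x: "x \<in> nucleus A" and y: "y \<in> nucleus A"
  shows "x \<otimes>\<^bsub>A\<^esub> y \<in> nucleus A"
proof -
  note xc = nucleusD(1)[OF x] and yc = nucleusD(1)[OF y]
  have "((x \<otimes>\<^bsub>A\<^esub> y) \<otimes>\<^bsub>A\<^esub> u) \<otimes>\<^bsub>A\<^esub> v = (x \<otimes>\<^bsub>A\<^esub> y) \<otimes>\<^bsub>A\<^esub> (u \<otimes>\<^bsub>A\<^esub> v)"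
    "(u \<otimes>\<^bsub>A\<^esub> (x \<otimes>\<^bsub>A\<^esub> y)) \<otimes>\<^bsub>A\<^esub> v = u \<otimes>\<^bsub>A\<^esub> ((x \<otimes>\<^bsub>A\<^esub> y) \<otimes>\<^bsub>A\<^esub> v)"
    "(u \<otimes>\<^bsub>A\<^esub> v) \<otimes>\<^bsub>A\<^esub> (x \<otimes>\<^bsub>A\<^esub> y) = u \<otimes>\<^bsub>A\<^esub> (v \<otimes>\<^bsub>A\<^esub> (x \<otimes>\<^bsub>A\<^esub> y))"
    if u: "u \<in> carrier A" and v: "v \<in> carrier A" for u v
  proof -
    show "((x \<otimes>\<^bsub>A\<^esub> y) \<otimes>\<^bsub>A\<^esub> u) \<otimes>\<^bsub>A\<^esub> v = (x \<otimes>\<^bsub>A\<^esub> y) \<otimes>\<^bsub>A\<^esub> (u \<otimes>\<^bsub>A\<^esub> v)"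
      using xc yc u v by (simp add: nucleusD(2)[OF x] nucleusD(2)[OF y])
    have "(u \<otimes>\<^bsub>A\<^esub> (x \<otimes>\<^bsub>A\<^esub> y)) \<otimes>\<^bsub>A\<^esub> v = ((u \<otimes>\<^bsub>A\<^esub> x) \<otimes>\<^bsub>A\<^esub> y) \<otimes>\<^bsub>A\<^esub> v"
      using xc yc u v by (simp add: nucleusD(4)[OF y])
    also have "\<dots> = (u \<otimes>\<^bsub>A\<^esub> x) \<otimes>\<^bsub>A\<^esub> (y \<otimes>\<^bsub>A\<^esub> v)"
      by (rule nucleusD(3)[OF y]) (use xc u v in auto)
    also have "\<dots> = u \<otimes>\<^bsub>A\<^esub> (x \<otimes>\<^bsub>A\<^esub> (y \<otimes>\<^bsub>A\<^esub> v))"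
      by (rule nucleusD(3)[OF x]) (use yc u v in auto)
    also have "x \<otimes>\<^bsub>A\<^esub> (y \<otimes>\<^bsub>A\<^esub> v) = (x \<otimes>\<^bsub>A\<^esub> y) \<otimes>\<^bsub>A\<^esub> v"
      by (rule nucleusD(2)[OF x, symmetric]) (use yc v in auto)
    finally show "(u \<otimes>\<^bsub>A\<^esub> (x \<otimes>\<^bsub>A\<^esub> y)) \<otimes>\<^bsub>A\<^esub> v = u \<otimes>\<^bsub>A\<^esub> ((x \<otimes>\<^bsub>A\<^esub> y) \<otimes>\<^bsub>A\<^esub> v)" .
    have "(u \<otimes>\<^bsub>A\<^esub> v) \<otimes>\<^bsub>A\<^esub> (x \<otimes>\<^bsub>A\<^esub> y) = ((u \<otimes>\<^bsub>A\<^esub> v) \<otimes>\<^bsub>A\<^esub> x) \<otimes>\<^bsub>A\<^esub> y"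
      using xc yc u v by (simp add: nucleusD(4)[OF y])
    also have "\<dots> = u \<otimes>\<^bsub>A\<^esub> (v \<otimes>\<^bsub>A\<^esub> (x \<otimes>\<^bsub>A\<^esub> y))"
      using xc yc u v by (simp add: nucleusD(4)[OF x] nucleusD(4)[OF y])
    finally show "(u \<otimes>\<^bsub>A\<^esub> v) \<otimes>\<^bsub>A\<^esub> (x \<otimes>\<^bsub>A\<^esub> y) = u \<otimes>\<^bsub>A\<^esub> (v \<otimes>\<^bsub>A\<^esub> (x \<otimes>\<^bsub>A\<^esub> y))" .
  qed
  thus ?thesis using xc yc by (simp add: nucleus_iff)
qed

lemma nucleus_submodule: "submodule (nucleus A) F A"
  by (rule submoduleI)
    (auto simp: nucleus_iff add_mult mult_add smult_mult mult_smult mult_neg neg_mult)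

lemma nucleus_subalgebra: "subalgebra F A (nucleus A)"
  using nucleus_submodule nucleus_mult by (simp add: subalgebra_def) (simp add: nucleus_iff)

lemma assoc_alg_nucleus:
  assumes K: "subalgebra F A K" "K \<subseteq> nucleus A"
  shows "assoc_alg F (A\<lparr>carrier := K\<rparr>)"
proof (intro assoc_alg.intro assoc_alg_axioms.intro falg_restrict[OF falg_axioms K(1)])
  fix x y z assume "x \<in> carrier (A\<lparr>carrier := K\<rparr>)" "y \<in> carrier (A\<lparr>carrier := K\<rparr>)" "z \<in> carrier (A\<lparr>carrier := K\<rparr>)"
  hence "x \<in> nucleus A" "y \<in> carrier A" "z \<in> carrier A" using K(2) nucleus_subset by auto
  thus "x \<otimes>\<^bsub>A\<lparr>carrier := K\<rparr>\<^esub> y \<otimes>\<^bsub>A\<lparr>carrier := K\<rparr>\<^esub> z = x \<otimes>\<^bsub>A\<lparr>carrier := K\<rparr>\<^esub> (y \<otimes>\<^bsub>A\<lparr>carrier := K\<rparr>\<^esub> z)"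
    using nucleusD(2)[of x y z] by simp
qed

lemma alg_center_iff: "x \<in> alg_center A \<longleftrightarrow> x \<in> nucleus A \<and> (\<forall>y\<in>carrier A. x \<otimes>\<^bsub>A\<^esub> y = y \<otimes>\<^bsub>A\<^esub> x)"
  by (simp add: alg_center_def)

lemma smult_one_center: "c \<in> carrier F \<Longrightarrow> c \<odot>\<^bsub>A\<^esub> \<one>\<^bsub>A\<^esub> \<in> alg_center A"
  by (simp add: alg_center_iff nucleus_iff smult_mult mult_smult)

text \<open>Scalar multiples of 1 are always central, and they determine the scalar as soon as 1 is
  nonzero. So the bijection in \<open>central\<close> comes down to these two conditions.\<close>

lemma centralI:
  assumes "\<one>\<^bsub>A\<^esub> \<noteq> \<zero>\<^bsub>A\<^esub>" "\<And>x. x \<in> alg_center A \<Longrightarrow> \<exists>c\<in>carrier F. x = c \<odot>\<^bsub>A\<^esub> \<one>\<^bsub>A\<^esub>"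
  shows "central F A"
  unfolding central_def bij_betw_def
proof
  show "inj_on (\<lambda>c. c \<odot>\<^bsub>A\<^esub> \<one>\<^bsub>A\<^esub>) (carrier F)"
  proof (rule inj_onI)
    fix c d assume cd: "c \<in> carrier F" "d \<in> carrier F" "c \<odot>\<^bsub>A\<^esub> \<one>\<^bsub>A\<^esub> = d \<odot>\<^bsub>A\<^esub> \<one>\<^bsub>A\<^esub>"
    hence "(c \<ominus> d) \<odot>\<^bsub>A\<^esub> \<one>\<^bsub>A\<^esub> = \<zero>\<^bsub>A\<^esub>"
      by (simp add: a_minus_def smult_l_distr smult_l_minus M.r_neg)
    hence "c \<ominus> d = \<zero>" using smult_eq_zero[of "c \<ominus> d" "\<one>\<^bsub>A\<^esub>"] cd assms(1) by simp
    thus "c = d" using cd by simp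
  qed
  show "(\<lambda>c. c \<odot>\<^bsub>A\<^esub> \<one>\<^bsub>A\<^esub>) ` carrier F = alg_center A"
    using assms(2) smult_one_center by blast
qed

lemma centralD:
  assumes "central F A"
  shows "\<one>\<^bsub>A\<^esub> \<noteq> \<zero>\<^bsub>A\<^esub>" "x \<in> alg_center A \<Longrightarrow> \<exists>c\<in>carrier F. x = c \<odot>\<^bsub>A\<^esub> \<one>\<^bsub>A\<^esub>"
proof -
  have inj: "inj_on (\<lambda>c. c \<odot>\<^bsub>A\<^esub> \<one>\<^bsub>A\<^esub>) (carrier F)" and im: "(\<lambda>c. c \<odot>\<^bsub>A\<^esub> \<one>\<^bsub>A\<^esub>) ` carrier F = alg_center A"
    using assms by (auto simp: central_def bij_betw_def)
  show "\<one>\<^bsub>A\<^esub> \<noteq> \<zero>\<^bsub>A\<^esub>"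
  proof
    assume "\<one>\<^bsub>A\<^esub> = \<zero>\<^bsub>A\<^esub>"
    hence "\<one> \<odot>\<^bsub>A\<^esub> \<one>\<^bsub>A\<^esub> = \<zero> \<odot>\<^bsub>A\<^esub> \<one>\<^bsub>A\<^esub>" by simp
    hence "\<one> = \<zero>" using inj by (meson R.one_closed R.zero_closed inj_onD)
    thus False by simp
  qed
  show "x \<in> alg_center A \<Longrightarrow> \<exists>c\<in>carrier F. x = c \<odot>\<^bsub>A\<^esub> \<one>\<^bsub>A\<^esub>" using im by blast
qed

end

lemma (in fin_dim) ex_form_one:
  assumes "x \<in> carrier V" "x \<noteq> \<zero>\<^bsub>V\<^esub>"
  shows "\<exists>\<phi>. lin F V (self_mod F) \<phi> \<and> \<phi> x = \<one>"
  using ex_form[OF submodule_zero_set assms(1)] assms(2) by blast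

context tensor
begin

text \<open>The contraction only touches the factor \<open>A\<close>, so it commutes with
  multiplication by 1 \<otimes> b. Hence an associator in \<open>T\<close> whose other two entries
  come from \<open>B\<close> contracts to an associator in \<open>B\<close>, and likewise for
  commutators.\<close>

lemma conL_mult:
  assumes \<phi>: "lin F A (self_mod F) \<phi>" and b: "b \<in> carrier B" and t: "t \<in> carrier T"
  shows "conL \<phi> (t \<otimes>\<^bsub>T\<^esub> tau \<one>\<^bsub>A\<^esub> b) = conL \<phi> t \<otimes>\<^bsub>B\<^esub> b" "conL \<phi> (tau \<one>\<^bsub>A\<^esub> b \<otimes>\<^bsub>T\<^esub> t) = b \<otimes>\<^bsub>B\<^esub> conL \<phi> t"
proof -
  have o: "tau \<one>\<^bsub>A\<^esub> b \<in> carrier T" using b by simp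
  have c: "\<phi> a \<in> carrier F" if "a \<in> carrier A" for a using lin_closed[OF \<phi> that] by simp
  show "conL \<phi> (t \<otimes>\<^bsub>T\<^esub> tau \<one>\<^bsub>A\<^esub> b) = conL \<phi> t \<otimes>\<^bsub>B\<^esub> b"
    by (rule lin_T_eq[OF lin_comp[OF T.lin_mult_right[OF o] conL(1)[OF \<phi>]] lin_comp[OF conL(1)[OF \<phi>] B.lin_mult_right[OF b]] _ t])
      (use b c in \<open>simp add: tau_mult conL(2)[OF \<phi>] B.smult_mult\<close>)
  show "conL \<phi> (tau \<one>\<^bsub>A\<^esub> b \<otimes>\<^bsub>T\<^esub> t) = b \<otimes>\<^bsub>B\<^esub> conL \<phi> t"
    by (rule lin_T_eq[OF lin_comp[OF T.lin_mult_left[OF o] conL(1)[OF \<phi>]] lin_comp[OF conL(1)[OF \<phi>] B.lin_mult_left[OF b]] _ t])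
      (use b c in \<open>simp add: tau_mult conL(2)[OF \<phi>] B.mult_smult\<close>)
qed

lemma conR_mult:
  assumes \<psi>: "lin F B (self_mod F) \<psi>" and a: "a \<in> carrier A" and t: "t \<in> carrier T"
  shows "conR \<psi> (t \<otimes>\<^bsub>T\<^esub> tau a \<one>\<^bsub>B\<^esub>) = conR \<psi> t \<otimes>\<^bsub>A\<^esub> a" "conR \<psi> (tau a \<one>\<^bsub>B\<^esub> \<otimes>\<^bsub>T\<^esub> t) = a \<otimes>\<^bsub>A\<^esub> conR \<psi> t"
proof -
  have o: "tau a \<one>\<^bsub>B\<^esub> \<in> carrier T" using a by simp
  have c: "\<psi> b \<in> carrier F" if "b \<in> carrier B" for b using lin_closed[OF \<psi> that] by simp
  show "conR \<psi> (t \<otimes>\<^bsub>T\<^esub> tau a \<one>\<^bsub>B\<^esub>) = conR \<psi> t \<otimes>\<^bsub>A\<^esub> a"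
    by (rule lin_T_eq[OF lin_comp[OF T.lin_mult_right[OF o] conR(1)[OF \<psi>]] lin_comp[OF conR(1)[OF \<psi>] A.lin_mult_right[OF a]] _ t])
      (use a c in \<open>simp add: tau_mult conR(2)[OF \<psi>] A.smult_mult\<close>)
  show "conR \<psi> (tau a \<one>\<^bsub>B\<^esub> \<otimes>\<^bsub>T\<^esub> t) = a \<otimes>\<^bsub>A\<^esub> conR \<psi> t"
    by (rule lin_T_eq[OF lin_comp[OF T.lin_mult_left[OF o] conR(1)[OF \<psi>]] lin_comp[OF conR(1)[OF \<psi>] A.lin_mult_left[OF a]] _ t])
      (use a c in \<open>simp add: tau_mult conR(2)[OF \<psi>] A.mult_smult\<close>)
qed

lemma conL_nucleus:
  assumes \<phi>: "lin F A (self_mod F) \<phi>" and n: "n \<in> nucleus T"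
  shows "conL \<phi> n \<in> nucleus B"
proof -
  have nc: "n \<in> carrier T" using T.nucleusD(1)[OF n] .
  have "(conL \<phi> n \<otimes>\<^bsub>B\<^esub> y) \<otimes>\<^bsub>B\<^esub> z = conL \<phi> n \<otimes>\<^bsub>B\<^esub> (y \<otimes>\<^bsub>B\<^esub> z) \<and> (y \<otimes>\<^bsub>B\<^esub> conL \<phi> n) \<otimes>\<^bsub>B\<^esub> z = y \<otimes>\<^bsub>B\<^esub> (conL \<phi> n \<otimes>\<^bsub>B\<^esub> z) \<and>
    (y \<otimes>\<^bsub>B\<^esub> z) \<otimes>\<^bsub>B\<^esub> conL \<phi> n = y \<otimes>\<^bsub>B\<^esub> (z \<otimes>\<^bsub>B\<^esub> conL \<phi> n)" if y: "y \<in> carrier B" and z: "z \<in> carrier B" for y z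
  proof -
    have yz: "tau \<one>\<^bsub>A\<^esub> y \<in> carrier T" "tau \<one>\<^bsub>A\<^esub> z \<in> carrier T" using y z by auto
    have t: "tau \<one>\<^bsub>A\<^esub> y \<otimes>\<^bsub>T\<^esub> tau \<one>\<^bsub>A\<^esub> z = tau \<one>\<^bsub>A\<^esub> (y \<otimes>\<^bsub>B\<^esub> z)" using y z by (simp add: tau_mult)
    from arg_cong[where f = "conL \<phi>", OF T.nucleusD(2)[OF n yz]] arg_cong[where f = "conL \<phi>", OF T.nucleusD(3)[OF n yz]]
      arg_cong[where f = "conL \<phi>", OF T.nucleusD(4)[OF n yz]]
    show ?thesis using nc y z yz unfolding t by (simp add: conL_mult[OF \<phi>])
  qed
  thus ?thesis using lin_closed[OF conL(1)[OF \<phi>] nc] by (simp add: B.nucleus_iff)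
qed

lemma conR_nucleus:
  assumes \<psi>: "lin F B (self_mod F) \<psi>" and n: "n \<in> nucleus T"
  shows "conR \<psi> n \<in> nucleus A"
proof -
  have nc: "n \<in> carrier T" using T.nucleusD(1)[OF n] .
  have "(conR \<psi> n \<otimes>\<^bsub>A\<^esub> y) \<otimes>\<^bsub>A\<^esub> z = conR \<psi> n \<otimes>\<^bsub>A\<^esub> (y \<otimes>\<^bsub>A\<^esub> z) \<and> (y \<otimes>\<^bsub>A\<^esub> conR \<psi> n) \<otimes>\<^bsub>A\<^esub> z = y \<otimes>\<^bsub>A\<^esub> (conR \<psi> n \<otimes>\<^bsub>A\<^esub> z) \<and>
    (y \<otimes>\<^bsub>A\<^esub> z) \<otimes>\<^bsub>A\<^esub> conR \<psi> n = y \<otimes>\<^bsub>A\<^esub> (z \<otimes>\<^bsub>A\<^esub> conR \<psi> n)" if y: "y \<in> carrier A" and z: "z \<in> carrier A" for y z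
  proof -
    have yz: "tau y \<one>\<^bsub>B\<^esub> \<in> carrier T" "tau z \<one>\<^bsub>B\<^esub> \<in> carrier T" using y z by auto
    have t: "tau y \<one>\<^bsub>B\<^esub> \<otimes>\<^bsub>T\<^esub> tau z \<one>\<^bsub>B\<^esub> = tau (y \<otimes>\<^bsub>A\<^esub> z) \<one>\<^bsub>B\<^esub>" using y z by (simp add: tau_mult)
    from arg_cong[where f = "conR \<psi>", OF T.nucleusD(2)[OF n yz]] arg_cong[where f = "conR \<psi>", OF T.nucleusD(3)[OF n yz]]
      arg_cong[where f = "conR \<psi>", OF T.nucleusD(4)[OF n yz]]
    show ?thesis using nc y z yz unfolding t by (simp add: conR_mult[OF \<psi>])
  qed
  thus ?thesis using lin_closed[OF conR(1)[OF \<psi>] nc] by (simp add: A.nucleus_iff)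
qed

lemma tau_nucleus:
  assumes a: "a \<in> nucleus A" and b: "b \<in> nucleus B"
  shows "tau a b \<in> nucleus T"
proof -
  note ac = A.nucleusD(1)[OF a] and bc = B.nucleusD(1)[OF b]
  have tc: "tau a b \<in> carrier T" using ac bc by simp
  have "(tau a b \<otimes>\<^bsub>T\<^esub> s) \<otimes>\<^bsub>T\<^esub> t = tau a b \<otimes>\<^bsub>T\<^esub> (s \<otimes>\<^bsub>T\<^esub> t) \<and> (s \<otimes>\<^bsub>T\<^esub> tau a b) \<otimes>\<^bsub>T\<^esub> t = s \<otimes>\<^bsub>T\<^esub> (tau a b \<otimes>\<^bsub>T\<^esub> t) \<and>
      (s \<otimes>\<^bsub>T\<^esub> t) \<otimes>\<^bsub>T\<^esub> tau a b = s \<otimes>\<^bsub>T\<^esub> (t \<otimes>\<^bsub>T\<^esub> tau a b)" if s: "s \<in> carrier T" and t: "t \<in> carrier T" for s t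
    using s
  proof (induction rule: T_induct)
    case (tau c d)
    note cd = this
    show ?case using t
    proof (induction rule: T_induct)
      case (tau c' d')
      thus ?case using cd ac bc
        by (simp add: tau_mult A.nucleusD(2-4)[OF a] B.nucleusD(2-4)[OF b])
    next
      case (add u v)
      thus ?case using tc cd by (simp add: T.mult_add T.add_mult)
    qed
  next
    case (add u v)
    thus ?case using tc t by (simp add: T.mult_add T.add_mult)
  qed
  thus ?thesis using tc by (simp add: T.nucleus_iff)
qed

text \<open>An element of the nucleus has contractions in the nuclei of the factors; applying \<open>\<pi> \<otimes> id\<close>, with
  \<open>\<pi>\<close> a projection onto the nucleus of \<open>A\<close>, brings it into the tensor product of both nuclei.\<close>

lemma nucleus_T:
  assumes fA: "fin_dim F A" and fB: "fin_dim F B" and n: "n \<in> nucleus T"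
  shows "\<exists>ps. set ps \<subseteq> nucleus A \<times> nucleus B \<and> n = lsum T (map (\<lambda>(a, b). tau a b) ps)"
proof -
  have nc: "n \<in> carrier T" using T.nucleusD(1)[OF n] .
  obtain \<pi> where \<pi>: "lin F A A \<pi>" "\<And>v. v \<in> carrier A \<Longrightarrow> \<pi> v \<in> nucleus A" "\<And>u. u \<in> nucleus A \<Longrightarrow> \<pi> u = u"
    using fin_dim.ex_projection[OF fA A.nucleus_submodule] by blast
  obtain fa where fa: "frame F A fa" using fin_dim.ex_frame[OF fA] by blast
  obtain fb where fb: "frame F B fb" using fin_dim.ex_frame[OF fB] by blast
  have bl: "bilin F A B T (\<lambda>a b. tau (\<pi> a) b)" by (rule bilin_comp_lin[OF bilin_tau \<pi>(1) lin_id])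
  define p where "p = tensor_lift F T (\<lambda>a b. tau (\<pi> a) b)"
  have p: "lin F T T p" "\<And>a b. a \<in> carrier A \<Longrightarrow> b \<in> carrier B \<Longrightarrow> p (tau a b) = tau (\<pi> a) b"
    unfolding p_def using lin_lift[OF T.vspace_axioms bl] lift_tau[OF T.vspace_axioms bl] by auto
  interpret p: lin_map F T T p by (intro lin_mapI T.vspace_axioms p)
  have cR: "conR \<psi> n \<in> nucleus A" "conR \<psi> n \<in> carrier A" "b \<in> carrier B" if "(b, \<psi>) \<in> set fb" for b \<psi>
    using conR_nucleus[OF frameD(2)[OF fb that] n] A.nucleusD(1) frameD(1)[OF fb that] by auto
  have cL: "conL \<phi> n \<in> nucleus B" "conL \<phi> n \<in> carrier B" "a \<in> carrier A" if "(a, \<phi>) \<in> set fa" for a \<phi>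
    using conL_nucleus[OF frameD(2)[OF fa that] n] B.nucleusD(1) frameD(1)[OF fa that] by auto
  \<comment> \<open>The coefficients of this expansion are contractions of \<open>n\<close>, so they
    lie in the nucleus of \<open>A\<close> and are fixed by \<pi>.\<close>
  have "p n = p (lsum T (map (\<lambda>(b, \<psi>). tau (conR \<psi> n) b) fb))"
    using frame_expand_right[OF fb nc] by simp
  also have "\<dots> = lsum T (map p (map (\<lambda>(b, \<psi>). tau (conR \<psi> n) b) fb))"
    by (rule p.lsum) (use cR in auto)
  also have "map p (map (\<lambda>(b, \<psi>). tau (conR \<psi> n) b) fb) = map (\<lambda>(b, \<psi>). tau (conR \<psi> n) b) fb"
    using cR p(2) \<pi>(3) by auto
  also have "lsum T \<dots> = n" using frame_expand_right[OF fb nc] by simp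
  finally have pn: "p n = n" .
  \<comment> \<open>In the other expansion the coefficients lie in the nucleus of \<open>B\<close>,
    while the frame vectors of \<open>A\<close> are arbitrary; \<pi> moves those into the nucleus of
    \<open>A\<close>.\<close>
  have "p n = p (lsum T (map (\<lambda>(a, \<phi>). tau a (conL \<phi> n)) fa))"
    using frame_expand_left[OF fa nc] by simp
  also have "\<dots> = lsum T (map p (map (\<lambda>(a, \<phi>). tau a (conL \<phi> n)) fa))"
    by (rule p.lsum) (use cL in auto)
  also have "map p (map (\<lambda>(a, \<phi>). tau a (conL \<phi> n)) fa) = map (\<lambda>(a, b). tau a b) (map (\<lambda>(a, \<phi>). (\<pi> a, conL \<phi> n)) fa)"
    using cL p(2) by auto
  finally have "n = lsum T (map (\<lambda>(a, b). tau a b) (map (\<lambda>(a, \<phi>). (\<pi> a, conL \<phi> n)) fa))" unfolding pn .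
  moreover have "set (map (\<lambda>(a, \<phi>). (\<pi> a, conL \<phi> n)) fa) \<subseteq> nucleus A \<times> nucleus B"
    using cL \<pi>(2) by auto
  ultimately show ?thesis by blast
qed

text \<open>A contraction by a form with value 1 at the identity of \<open>A\<close> sends 1
  \<otimes> 1 to the identity of \<open>B\<close>.\<close>

lemma T_one_not_zero:
  assumes fA: "fin_dim F A" and "\<one>\<^bsub>A\<^esub> \<noteq> \<zero>\<^bsub>A\<^esub>" "\<one>\<^bsub>B\<^esub> \<noteq> \<zero>\<^bsub>B\<^esub>"
  shows "\<one>\<^bsub>T\<^esub> \<noteq> \<zero>\<^bsub>T\<^esub>"
proof
  obtain \<phi> where \<phi>: "lin F A (self_mod F) \<phi>" "\<phi> \<one>\<^bsub>A\<^esub> = \<one>"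
    using fin_dim.ex_form_one[OF fA _ assms(2)] by auto
  interpret c: lin_map F T B "conL \<phi>" by (intro lin_mapI T.vspace_axioms B.vspace_axioms conL(1)[OF \<phi>(1)])
  assume "\<one>\<^bsub>T\<^esub> = \<zero>\<^bsub>T\<^esub>"
  hence "conL \<phi> (tau \<one>\<^bsub>A\<^esub> \<one>\<^bsub>B\<^esub>) = \<zero>\<^bsub>B\<^esub>" by (simp add: one_T)
  thus False using \<phi> assms(3) by (simp add: conL(2)[OF \<phi>(1)])
qed

text \<open>The contractions of a central element to \<open>A\<close> are central, hence scalars,
  which gives the element the shape 1 \<otimes> c. Now \<open>c\<close> is itself a contraction to
  \<open>B\<close>, hence central there and a scalar too.\<close>

lemma T_central:
  assumes fA: "fin_dim F A" and fB: "fin_dim F B" and cA: "central F A" and cB: "central F B"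
  shows "central F T"
proof (rule T.centralI)
  show "\<one>\<^bsub>T\<^esub> \<noteq> \<zero>\<^bsub>T\<^esub>" by (rule T_one_not_zero[OF fA A.centralD(1)[OF cA] B.centralD(1)[OF cB]])
  fix n assume n: "n \<in> alg_center T"
  hence nn: "n \<in> nucleus T" and ncm: "\<And>t. t \<in> carrier T \<Longrightarrow> n \<otimes>\<^bsub>T\<^esub> t = t \<otimes>\<^bsub>T\<^esub> n" by (auto simp: T.alg_center_iff)
  have nc: "n \<in> carrier T" using T.nucleusD(1)[OF nn] .
  obtain fb where fb: "frame F B fb" using fin_dim.ex_frame[OF fB] by blast
  have "\<exists>c\<in>carrier F. conR \<psi> n = c \<odot>\<^bsub>A\<^esub> \<one>\<^bsub>A\<^esub>" if \<psi>: "lin F B (self_mod F) \<psi>" for \<psi>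
  proof (rule A.centralD(2)[OF cA], unfold A.alg_center_iff, intro conjI ballI conR_nucleus[OF \<psi> nn])
    fix y assume y: "y \<in> carrier A"
    have "n \<otimes>\<^bsub>T\<^esub> tau y \<one>\<^bsub>B\<^esub> = tau y \<one>\<^bsub>B\<^esub> \<otimes>\<^bsub>T\<^esub> n" using y by (intro ncm) auto
    thus "conR \<psi> n \<otimes>\<^bsub>A\<^esub> y = y \<otimes>\<^bsub>A\<^esub> conR \<psi> n" using conR_mult[OF \<psi> y nc] by simp
  qed
  then obtain \<gamma> where \<gamma>: "\<And>\<psi>. lin F B (self_mod F) \<psi> \<Longrightarrow> \<gamma> \<psi> \<in> carrier F"
    "\<And>\<psi>. lin F B (self_mod F) \<psi> \<Longrightarrow> conR \<psi> n = \<gamma> \<psi> \<odot>\<^bsub>A\<^esub> \<one>\<^bsub>A\<^esub>" by metis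
  define c where "c = lsum B (map (\<lambda>(b, \<psi>). \<gamma> \<psi> \<odot>\<^bsub>B\<^esub> b) fb)"
  have cs: "set (map (\<lambda>(b, \<psi>). \<gamma> \<psi> \<odot>\<^bsub>B\<^esub> b) fb) \<subseteq> carrier B"
    using \<gamma>(1)[OF frameD(2)[OF fb]] frameD(1)[OF fb] by auto
  have cc: "c \<in> carrier B" unfolding c_def by (rule B.M.lsum_closed[OF cs])
  have nt: "n = tau \<one>\<^bsub>A\<^esub> c"
  proof -
    have "n = lsum T (map (\<lambda>(b, \<psi>). tau (conR \<psi> n) b) fb)" by (rule frame_expand_right[OF fb nc])
    also have "map (\<lambda>(b, \<psi>). tau (conR \<psi> n) b) fb = map (tau \<one>\<^bsub>A\<^esub>) (map (\<lambda>(b, \<psi>). \<gamma> \<psi> \<odot>\<^bsub>B\<^esub> b) fb)"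
      using \<gamma>[OF frameD(2)[OF fb]] frameD(1)[OF fb] lin_smult[OF lin_tau_left] lin_smult[OF lin_tau_right[OF A.one_closed]]
      by (auto simp: split_def)
    also have "lsum T \<dots> = tau \<one>\<^bsub>A\<^esub> c" unfolding c_def by (rule tau_lsum_right[OF A.one_closed cs, symmetric])
    finally show ?thesis .
  qed
  obtain \<phi> where \<phi>: "lin F A (self_mod F) \<phi>" "\<phi> \<one>\<^bsub>A\<^esub> = \<one>"
    using fin_dim.ex_form_one[OF fA _ A.centralD(1)[OF cA]] by auto
  have c: "conL \<phi> n = c" unfolding nt using cc \<phi> by (simp add: conL(2)[OF \<phi>(1)])
  have "c \<in> alg_center B" unfolding B.alg_center_iff
  proof (intro conjI ballI)
    show "c \<in> nucleus B" using conL_nucleus[OF \<phi>(1) nn] unfolding c .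
    fix y assume y: "y \<in> carrier B"
    have "n \<otimes>\<^bsub>T\<^esub> tau \<one>\<^bsub>A\<^esub> y = tau \<one>\<^bsub>A\<^esub> y \<otimes>\<^bsub>T\<^esub> n" using y by (intro ncm) auto
    thus "c \<otimes>\<^bsub>B\<^esub> y = y \<otimes>\<^bsub>B\<^esub> c" using conL_mult[OF \<phi>(1) y nc] unfolding c by simp
  qed
  then obtain d where d: "d \<in> carrier F" "c = d \<odot>\<^bsub>B\<^esub> \<one>\<^bsub>B\<^esub>" using B.centralD(2)[OF cB] by blast
  thus "\<exists>c\<in>carrier F. n = c \<odot>\<^bsub>T\<^esub> \<one>\<^bsub>T\<^esub>"
    unfolding nt using lin_smult[OF lin_tau_right[OF A.one_closed]] by (intro bexI[of _ d]) (auto simp: one_T)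
qed

end

section \<open>Minimally faithful modules\<close>

lemma faithful_quot:
  assumes "rmodule R M" "submodule P R M"
  shows "faithful R (quot_alg M P) \<longleftrightarrow> (\<forall>r\<in>carrier R. (\<forall>x\<in>carrier M. r \<odot>\<^bsub>M\<^esub> x \<in> P) \<longrightarrow> r = \<zero>\<^bsub>R\<^esub>)"
proof -
  interpret Q: quot_module R M P
    using assms by (simp add: quot_module_def quot_module_axioms_def)
  have "(\<forall>t\<in>carrier Q.Q. r \<odot>\<^bsub>Q.Q\<^esub> t = \<zero>\<^bsub>Q.Q\<^esub>) \<longleftrightarrow> (\<forall>x\<in>carrier M. r \<odot>\<^bsub>M\<^esub> x \<in> P)" if r: "r \<in> carrier R" for r
  proof -
    have "r \<odot>\<^bsub>Q.Q\<^esub> (P +>\<^bsub>M\<^esub> x) = \<zero>\<^bsub>Q.Q\<^esub> \<longleftrightarrow> r \<odot>\<^bsub>M\<^esub> x \<in> P" if x: "x \<in> carrier M" for x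
      using Q.cls_smult[OF r x] Q.cls_eq_zero[of "r \<odot>\<^bsub>M\<^esub> x"] r x by simp
    thus ?thesis unfolding Q.carrier_quot by blast
  qed
  thus ?thesis by (auto simp: faithful_def)
qed

lemma faithful_section:
  assumes M: "rmodule R M" and N: "submodule N R M" and P: "submodule P R M" and PN: "P \<subseteq> N"
  shows "faithful R (quot_alg (M\<lparr>carrier := N\<rparr>) P) \<longleftrightarrow> (\<forall>r\<in>carrier R. (\<forall>x\<in>N. r \<odot>\<^bsub>M\<^esub> x \<in> P) \<longrightarrow> r = \<zero>\<^bsub>R\<^esub>)"
proof -
  interpret M: rmodule R M by fact
  have mN: "module R (M\<lparr>carrier := N\<rparr>)" by (rule submodule.submodule_is_module[OF N M.module_axioms])
  interpret N: module R "M\<lparr>carrier := N\<rparr>" by (rule mN)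
  have "submodule P R (M\<lparr>carrier := N\<rparr>)"
  proof (rule N.module_incl_imp_submodule)
    have "module R (M\<lparr>carrier := P\<rparr>)" by (rule submodule.submodule_is_module[OF P M.module_axioms])
    thus "module R (M\<lparr>carrier := N, carrier := P\<rparr>)" by simp
  qed (use PN in simp)
  from faithful_quot[OF _ this] mN show ?thesis by (simp add: rmodule_def)
qed

text \<open>For a module over a ring whose ideals are generated by idempotents, minimal faithfulness
  means being free of rank one.\<close>

locale separable_module = R: comm_alg F R + M: rmodule R M
  for F :: "('f, 'k) ring_scheme" and R :: "('f, 'a) module" and M :: "('a, 'm) module" +
  assumes sep: "separable F R" and fin: "fin_dim F R"
begin

text \<open>Scalars act as multiplication by c 1, so an ideal of the ring \<open>R\<close> is
  automatically an \<open>F\<close>-subspace and \<open>separable_ideal\<close> applies to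
  it.\<close>

lemma ideal_idempotent:
  assumes I: "I \<subseteq> carrier R" "\<zero>\<^bsub>R\<^esub> \<in> I" "\<And>x y. x \<in> I \<Longrightarrow> y \<in> I \<Longrightarrow> x \<oplus>\<^bsub>R\<^esub> y \<in> I"
    "\<And>x y. x \<in> carrier R \<Longrightarrow> y \<in> I \<Longrightarrow> x \<otimes>\<^bsub>R\<^esub> y \<in> I"
  shows "submodule I F R" "\<exists>e\<in>I. \<forall>x\<in>I. x \<otimes>\<^bsub>R\<^esub> e = x"
proof -
  show s: "submodule I F R"
  proof (rule R.submoduleI)
    show sm: "c \<odot>\<^bsub>R\<^esub> x \<in> I" if "c \<in> carrier F" "x \<in> I" for c x
    proof -
      have "(c \<odot>\<^bsub>R\<^esub> \<one>\<^bsub>R\<^esub>) \<otimes>\<^bsub>R\<^esub> x \<in> I" using that by (intro I(4)) auto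
      thus ?thesis using that I(1) by (simp add: R.smult_one_mult subset_iff)
    qed
    show "\<ominus>\<^bsub>R\<^esub> x \<in> I" if "x \<in> I" for x
    proof -
      have "(\<ominus>\<^bsub>R\<^esub> \<one>\<^bsub>R\<^esub>) \<otimes>\<^bsub>R\<^esub> x \<in> I" using that by (intro I(4)) auto
      thus ?thesis using that I(1) by (simp add: R.neg_mult subset_iff)
    qed
  qed (use I in auto)
  show "\<exists>e\<in>I. \<forall>x\<in>I. x \<otimes>\<^bsub>R\<^esub> e = x"
    by (rule R.separable_ideal[OF sep fin s I(4)])
qed

text \<open>An element \<open>m\<close> with minimal annihilator turns out to have annihilator 0;
  then R m is a faithful submodule, so it is all of \<open>M\<close> and \<open>m\<close> is a free
  generator.\<close>

lemma minimally_faithful_imp_free: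
  assumes mf: "minimally_faithful R M"
  shows "\<exists>m\<in>carrier M. bij_betw (\<lambda>r. r \<odot>\<^bsub>M\<^esub> m) (carrier R) (carrier M)"
proof -
  define Ann where "Ann m = {r \<in> carrier R. r \<odot>\<^bsub>M\<^esub> m = \<zero>\<^bsub>M\<^esub>}" for m
  have Ann: "submodule (Ann m) F R" "\<exists>e\<in>Ann m. \<forall>x\<in>Ann m. x \<otimes>\<^bsub>R\<^esub> e = x" if m: "m \<in> carrier M" for m
  proof -
    have z: "Ann m \<subseteq> carrier R" "\<zero>\<^bsub>R\<^esub> \<in> Ann m" using m by (auto simp: Ann_def)
    have ad: "x \<oplus>\<^bsub>R\<^esub> y \<in> Ann m" if "x \<in> Ann m" "y \<in> Ann m" for x y
      using m that by (simp add: Ann_def M.smult_l_distr)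
    have mu: "x \<otimes>\<^bsub>R\<^esub> y \<in> Ann m" if "x \<in> carrier R" "y \<in> Ann m" for x y
      using m that by (simp add: Ann_def M.smult_assoc1)
    show "submodule (Ann m) F R" by (rule ideal_idempotent(1)[OF z ad mu])
    show "\<exists>e\<in>Ann m. \<forall>x\<in>Ann m. x \<otimes>\<^bsub>R\<^esub> e = x" by (rule ideal_idempotent(2)[OF z ad mu])
  qed
  interpret V: fin_dim F R by (rule fin)
  have "\<exists>U\<in>Ann ` carrier M. \<forall>U' \<in> Ann ` carrier M. U' \<subseteq> U \<longrightarrow> U' = U"
    using Ann(1) by (intro V.ex_minimal_submodule[of _ "Ann \<zero>\<^bsub>M\<^esub>"]) auto
  hence "\<exists>m\<in>carrier M. \<forall>m' \<in> carrier M. Ann m' \<subseteq> Ann m \<longrightarrow> Ann m' = Ann m" by (simp only: ball_simps bex_simps)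
  then obtain m where m: "m \<in> carrier M" and min': "\<forall>m' \<in> carrier M. Ann m' \<subseteq> Ann m \<longrightarrow> Ann m' = Ann m" by (rule bexE)
  have min: "Ann m' = Ann m" if "m' \<in> carrier M" "Ann m' \<subseteq> Ann m" for m' using bspec[OF min' that(1)] that(2) by (rule mp)
  obtain f where "f \<in> Ann m" "\<forall>x\<in>Ann m. x \<otimes>\<^bsub>R\<^esub> f = x" using Ann(2)[OF m] by (rule bexE)
  hence f: "f \<in> Ann m" "\<And>x. x \<in> Ann m \<Longrightarrow> x \<otimes>\<^bsub>R\<^esub> f = x" by - (assumption, rule bspec)
  have fc: "f \<in> carrier R" "f \<odot>\<^bsub>M\<^esub> m = \<zero>\<^bsub>M\<^esub>" using f(1) by (simp_all add: Ann_def)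
  have ff: "f \<otimes>\<^bsub>R\<^esub> f = f" by (rule f(2)[OF f(1)])
  have faithfulR: "faithful R M" using mf unfolding minimally_faithful_def by (rule conjunct1)
  have f0: "f = \<zero>\<^bsub>R\<^esub>"
  proof (rule ccontr)
    assume "f \<noteq> \<zero>\<^bsub>R\<^esub>"
    then obtain m' where m': "m' \<in> carrier M" "f \<odot>\<^bsub>M\<^esub> m' \<noteq> \<zero>\<^bsub>M\<^esub>"
      using faithfulR fc(1) unfolding faithful_def by blast
    \<comment> \<open>Here \<open>f\<close> is the identity element of the annihilator of
      \<open>m\<close> and does not kill m'. Anything that kills the sum kills its parts separately,
      since f m = 0; so the annihilator shrinks and loses \<open>f\<close>.\<close>
    define m'' where "m'' = m \<oplus>\<^bsub>M\<^esub> f \<odot>\<^bsub>M\<^esub> m'"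
    have m''c: "m'' \<in> carrier M" using m m' fc by (simp add: m''_def)
    have act: "r \<odot>\<^bsub>M\<^esub> m'' = r \<odot>\<^bsub>M\<^esub> m \<oplus>\<^bsub>M\<^esub> (r \<otimes>\<^bsub>R\<^esub> f) \<odot>\<^bsub>M\<^esub> m'" if "r \<in> carrier R" for r
      using that m m' fc by (simp add: m''_def M.smult_r_distr M.smult_assoc1)
    have "Ann m'' \<subseteq> Ann m"
    proof
      fix r assume r: "r \<in> Ann m''"
      hence rc: "r \<in> carrier R" and r0: "r \<odot>\<^bsub>M\<^esub> m'' = \<zero>\<^bsub>M\<^esub>" by (auto simp: Ann_def)
      have "(f \<otimes>\<^bsub>R\<^esub> r) \<odot>\<^bsub>M\<^esub> m'' = \<zero>\<^bsub>M\<^esub>" using rc r0 fc m''c by (simp add: M.smult_assoc1)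
      moreover have "(f \<otimes>\<^bsub>R\<^esub> r) \<odot>\<^bsub>M\<^esub> m = \<zero>\<^bsub>M\<^esub>"
        using rc fc m by (subst R.comm) (simp_all add: M.smult_assoc1)
      moreover have "(f \<otimes>\<^bsub>R\<^esub> r) \<otimes>\<^bsub>R\<^esub> f = r \<otimes>\<^bsub>R\<^esub> (f \<otimes>\<^bsub>R\<^esub> f)" using rc fc by (simp add: R.assoc R.lcomm)
      ultimately have "(r \<otimes>\<^bsub>R\<^esub> f) \<odot>\<^bsub>M\<^esub> m' = \<zero>\<^bsub>M\<^esub>" using act[of "f \<otimes>\<^bsub>R\<^esub> r"] rc fc m' by (simp add: ff)
      hence "r \<odot>\<^bsub>M\<^esub> m = \<zero>\<^bsub>M\<^esub>" using act[OF rc] r0 rc m by simp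
      thus "r \<in> Ann m" using rc by (simp add: Ann_def)
    qed
    hence "Ann m'' = Ann m" by (rule min[OF m''c])
    hence "f \<in> Ann m''" using f(1) by simp
    hence "f \<odot>\<^bsub>M\<^esub> m'' = \<zero>\<^bsub>M\<^esub>" by (simp add: Ann_def)
    thus False using act[OF fc(1)] fc m' by (simp add: ff)
  qed
  have inj: "r = \<zero>\<^bsub>R\<^esub>" if "r \<in> carrier R" "r \<odot>\<^bsub>M\<^esub> m = \<zero>\<^bsub>M\<^esub>" for r
  proof -
    have "r \<in> Ann m" using that by (simp add: Ann_def)
    from f(2)[OF this] show ?thesis using that(1) by (simp add: f0)
  qed
  define N where "N = (\<lambda>r. r \<odot>\<^bsub>M\<^esub> m) ` carrier R"
  have N: "submodule N R M"
  proof (rule M.submoduleI)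
    show "N \<subseteq> carrier M" using m by (auto simp: N_def)
    show "\<zero>\<^bsub>M\<^esub> \<in> N" unfolding N_def using m by (intro image_eqI[of _ _ "\<zero>\<^bsub>R\<^esub>"]) auto
    show "\<ominus>\<^bsub>M\<^esub> a \<in> N" if a: "a \<in> N" for a
    proof -
      from a obtain r where "r \<in> carrier R" "a = r \<odot>\<^bsub>M\<^esub> m" by (auto simp: N_def)
      thus ?thesis unfolding N_def using m by (intro image_eqI[of _ _ "\<ominus>\<^bsub>R\<^esub> r"]) (auto simp: M.smult_l_minus)
    qed
    show "a \<oplus>\<^bsub>M\<^esub> b \<in> N" if ab: "a \<in> N" "b \<in> N" for a b
    proof -
      from ab obtain r s where "r \<in> carrier R" "a = r \<odot>\<^bsub>M\<^esub> m" "s \<in> carrier R" "b = s \<odot>\<^bsub>M\<^esub> m" by (auto simp: N_def)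
      thus ?thesis unfolding N_def using m by (intro image_eqI[of _ _ "r \<oplus>\<^bsub>R\<^esub> s"]) (auto simp: M.smult_l_distr)
    qed
    show "c \<odot>\<^bsub>M\<^esub> a \<in> N" if c: "c \<in> carrier R" and a: "a \<in> N" for c a
    proof -
      from a obtain r where "r \<in> carrier R" "a = r \<odot>\<^bsub>M\<^esub> m" by (auto simp: N_def)
      thus ?thesis unfolding N_def using m c by (intro image_eqI[of _ _ "c \<otimes>\<^bsub>R\<^esub> r"]) (auto simp: M.smult_assoc1)
    qed
  qed
  have "faithful R (quot_alg (M\<lparr>carrier := N\<rparr>) {\<zero>\<^bsub>M\<^esub>})"
  proof (subst faithful_section[OF M.rmodule_axioms N M.submodule_zero_set])
    show "{\<zero>\<^bsub>M\<^esub>} \<subseteq> N" using M.submodule_zero[OF N] by simp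
    have "m \<in> N" unfolding N_def using m by (intro image_eqI[of _ _ "\<one>\<^bsub>R\<^esub>"]) auto
    thus "\<forall>r\<in>carrier R. (\<forall>x\<in>N. r \<odot>\<^bsub>M\<^esub> x \<in> {\<zero>\<^bsub>M\<^esub>}) \<longrightarrow> r = \<zero>\<^bsub>R\<^esub>" using inj by blast
  qed
  moreover have "{\<zero>\<^bsub>M\<^esub>} \<subseteq> N" using M.submodule_zero[OF N] by simp
  ultimately have "N = carrier M"
    using mf N M.submodule_zero_set unfolding minimally_faithful_def by blast
  moreover have "inj_on (\<lambda>r. r \<odot>\<^bsub>M\<^esub> m) (carrier R)"
  proof (rule inj_onI)
    fix r s assume rs: "r \<in> carrier R" "s \<in> carrier R" "r \<odot>\<^bsub>M\<^esub> m = s \<odot>\<^bsub>M\<^esub> m"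
    hence "(r \<ominus>\<^bsub>R\<^esub> s) \<odot>\<^bsub>M\<^esub> m = \<zero>\<^bsub>M\<^esub>"
      using m by (simp add: a_minus_def M.smult_l_distr M.smult_l_minus M.M.r_neg)
    hence "r \<ominus>\<^bsub>R\<^esub> s = \<zero>\<^bsub>R\<^esub>" using rs by (intro inj) auto
    thus "r = s" using rs by (simp add: R.eq_minus_zero)
  qed
  ultimately show ?thesis using m by (auto simp: bij_betw_def N_def)
qed

text \<open>Submodules correspond to ideals, so each contains e m for an \<open>e\<close> acting as
  the identity on it. If N / P is faithful, then 1 - e kills N and must be 0, while the
  \<open>f\<close> belonging to P maps N into P and must be 0 too.\<close>

lemma free_imp_minimally_faithful:
  assumes m: "m \<in> carrier M" and bij: "bij_betw (\<lambda>r. r \<odot>\<^bsub>M\<^esub> m) (carrier R) (carrier M)"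
  shows "minimally_faithful R M"
proof -
  have inj: "r = \<zero>\<^bsub>R\<^esub>" if "r \<in> carrier R" "r \<odot>\<^bsub>M\<^esub> m = \<zero>\<^bsub>M\<^esub>" for r
    using bij that m inj_onD[of "\<lambda>r. r \<odot>\<^bsub>M\<^esub> m" "carrier R" r "\<zero>\<^bsub>R\<^esub>"] by (auto simp: bij_betw_def)
  have gen: "\<exists>r\<in>carrier R. x = r \<odot>\<^bsub>M\<^esub> m" if "x \<in> carrier M" for x
    using bij that unfolding bij_betw_def by blast
  have ex: "\<exists>e\<in>carrier R. e \<odot>\<^bsub>M\<^esub> m \<in> N \<and> (\<forall>x\<in>N. e \<odot>\<^bsub>M\<^esub> x = x)" if N: "submodule N R M" for N
  proof -
    define I where "I = {r \<in> carrier R. r \<odot>\<^bsub>M\<^esub> m \<in> N}"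
    have "\<exists>e\<in>I. \<forall>x\<in>I. x \<otimes>\<^bsub>R\<^esub> e = x"
      using m M.submodule_zero[OF N] M.submodule_add[OF N] M.submodule_smult[OF N]
      by (intro ideal_idempotent(2)) (auto simp: I_def M.smult_l_distr M.smult_assoc1)
    then obtain e where e: "e \<in> I" "\<And>x. x \<in> I \<Longrightarrow> x \<otimes>\<^bsub>R\<^esub> e = x" by blast
    have "e \<odot>\<^bsub>M\<^esub> x = x" if x: "x \<in> N" for x
    proof -
      obtain r where r: "r \<in> carrier R" "x = r \<odot>\<^bsub>M\<^esub> m" using gen M.submodule_mem[OF N x] by blast
      hence "r \<otimes>\<^bsub>R\<^esub> e = r" using x by (intro e(2)) (simp add: I_def)
      hence "e \<otimes>\<^bsub>R\<^esub> r = r" using r e(1) by (simp add: R.comm I_def)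
      thus ?thesis using r e(1) m M.smult_assoc1[of e r m] by (simp add: I_def)
    qed
    thus ?thesis using e(1) by (auto simp: I_def)
  qed
  have "faithful R M" using m inj by (auto simp: faithful_def)
  moreover have "N = carrier M \<and> P = {\<zero>\<^bsub>M\<^esub>}"
    if N: "submodule N R M" and P: "submodule P R M" and PN: "P \<subseteq> N" and f: "faithful R (quot_alg (M\<lparr>carrier := N\<rparr>) P)" for N P
  proof
    have f': "r = \<zero>\<^bsub>R\<^esub>" if "r \<in> carrier R" "\<And>x. x \<in> N \<Longrightarrow> r \<odot>\<^bsub>M\<^esub> x \<in> P" for r
      using f that unfolding faithful_section[OF M.rmodule_axioms N P PN] by blast
    obtain e where e: "e \<in> carrier R" "e \<odot>\<^bsub>M\<^esub> m \<in> N" "\<And>x. x \<in> N \<Longrightarrow> e \<odot>\<^bsub>M\<^esub> x = x" using ex[OF N] by blast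
    have "\<one>\<^bsub>R\<^esub> \<ominus>\<^bsub>R\<^esub> e = \<zero>\<^bsub>R\<^esub>"
    proof (rule f')
      fix x assume x: "x \<in> N"
      hence "(\<one>\<^bsub>R\<^esub> \<ominus>\<^bsub>R\<^esub> e) \<odot>\<^bsub>M\<^esub> x = \<zero>\<^bsub>M\<^esub>"
        using e M.submodule_mem[OF N x] by (simp add: a_minus_def M.smult_l_distr M.smult_l_minus M.M.r_neg)
      thus "(\<one>\<^bsub>R\<^esub> \<ominus>\<^bsub>R\<^esub> e) \<odot>\<^bsub>M\<^esub> x \<in> P" using M.submodule_zero[OF P] by simp
    qed (use e in auto)
    hence "e = \<one>\<^bsub>R\<^esub>" using e by (simp add: R.eq_minus_zero)
    hence mN: "m \<in> N" using e m by simp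
    show "N = carrier M"
    proof
      show "N \<subseteq> carrier M" by (rule M.submodule_subset[OF N])
      show "carrier M \<subseteq> N" using gen M.submodule_smult[OF N _ mN] by blast
    qed
    obtain f where f: "f \<in> carrier R" "f \<odot>\<^bsub>M\<^esub> m \<in> P" "\<And>x. x \<in> P \<Longrightarrow> f \<odot>\<^bsub>M\<^esub> x = x" using ex[OF P] by blast
    have "f = \<zero>\<^bsub>R\<^esub>"
    proof (rule f'[OF f(1)])
      fix x assume "x \<in> N"
      then obtain r where r: "r \<in> carrier R" "x = r \<odot>\<^bsub>M\<^esub> m" using gen M.submodule_mem[OF N] by blast
      have "f \<odot>\<^bsub>M\<^esub> x = (r \<otimes>\<^bsub>R\<^esub> f) \<odot>\<^bsub>M\<^esub> m"
        using r f(1) m by (simp add: M.smult_assoc1[symmetric] R.comm)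
      thus "f \<odot>\<^bsub>M\<^esub> x \<in> P" using r f(1,2) m M.submodule_smult[OF P] by (simp add: M.smult_assoc1)
    qed
    hence "x = \<zero>\<^bsub>M\<^esub>" if "x \<in> P" for x using f(3)[OF that] M.submodule_mem[OF P that] by simp
    thus "P = {\<zero>\<^bsub>M\<^esub>}" using M.submodule_zero[OF P] by blast
  qed
  ultimately show ?thesis unfolding minimally_faithful_def by blast
qed

end

section \<open>Nuclear bimodules\<close>

text \<open>\<open>etale\<close> is replaced by commutativity and a separability element, the
  properties that pass to the tensor product; \<open>separable_etale\<close> restores it at the
  end.\<close>

locale nuclear_etale = falg F A
  for F :: "('f, 'k) ring_scheme" (structure) and A :: "('f, 'a) module" (structure) +
  fixes K assumes K_nucleus: "K \<subseteq> nucleus A" and K_sub: "subalgebra F A K"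
    and K_comm: "\<And>x y. x \<in> K \<Longrightarrow> y \<in> K \<Longrightarrow> x \<otimes>\<^bsub>A\<^esub> y = y \<otimes>\<^bsub>A\<^esub> x"
    and K_sep: "separable F (A\<lparr>carrier := K\<rparr>)" and A_fin: "fin_dim F A"
begin

abbreviation KA where "KA \<equiv> A\<lparr>carrier := K\<rparr>"

lemma K_mem: "k \<in> K \<Longrightarrow> k \<in> carrier A" and K_nuc: "k \<in> K \<Longrightarrow> k \<in> nucleus A"
  using K_nucleus nucleus_subset by auto

lemma K_submodule: "submodule K F A"
  using K_sub by (simp add: subalgebra_def)

lemma KA_comm_alg: "comm_alg F KA"
  using assoc_alg_nucleus[OF K_sub K_nucleus] K_comm by (simp add: comm_alg_def comm_alg_axioms_def)

sublocale KA: comm_alg F KA by (rule KA_comm_alg)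

lemma KA_fin_dim: "fin_dim F KA"
  by (rule fin_dim_submodule[OF A_fin K_submodule])

abbreviation R2 where "R2 \<equiv> tensor_alg F KA KA"

lemma R2_comm_alg: "comm_alg F R2"
  by (rule KA.TT.T_comm_alg[OF KA_comm_alg KA_comm_alg])

lemma R2_separable: "separable F R2"
  by (rule KA.TT.T_separable[OF KA_comm_alg K_sep KA_comm_alg K_sep])

lemma R2_fin_dim: "fin_dim F R2"
  by (rule KA.TT.T_fin_dim[OF KA_fin_dim KA_fin_dim])

abbreviation M where "M \<equiv> bimodule F A"

lemma bimodule_simps:
  "carrier M = carrier A" "\<zero>\<^bsub>M\<^esub> = \<zero>\<^bsub>A\<^esub>" "add M = add A"
  "smult M = (\<lambda>t a. tensor_lift F A (\<lambda>k k'. k \<otimes>\<^bsub>A\<^esub> a \<otimes>\<^bsub>A\<^esub> k') t)"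
  by (simp_all add: bimodule_def)

lemma act_bilin:
  assumes a: "a \<in> carrier A"
  shows "bilin F KA KA A (\<lambda>k k'. k \<otimes>\<^bsub>A\<^esub> a \<otimes>\<^bsub>A\<^esub> k')"
  using a K_mem by (intro bilinI linI) (auto simp: mult_add add_mult smult_mult mult_smult)

lemma act_lin: "a \<in> carrier A \<Longrightarrow> lin F R2 A (\<lambda>t. t \<odot>\<^bsub>M\<^esub> a)"
  unfolding bimodule_simps by (rule KA.TT.lin_lift[OF vspace_axioms act_bilin])

lemma act_tau: "a \<in> carrier A \<Longrightarrow> k \<in> K \<Longrightarrow> k' \<in> K \<Longrightarrow> KA.TT.tau k k' \<odot>\<^bsub>M\<^esub> a = k \<otimes>\<^bsub>A\<^esub> a \<otimes>\<^bsub>A\<^esub> k'"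
  unfolding bimodule_simps by (rule KA.TT.lift_tau[OF vspace_axioms act_bilin]) auto

lemma act_closed: "t \<in> carrier R2 \<Longrightarrow> a \<in> carrier A \<Longrightarrow> t \<odot>\<^bsub>M\<^esub> a \<in> carrier A"
  using lin_closed[OF act_lin] by blast

lemma act_add: 
  assumes t: "t \<in> carrier R2" and a: "a \<in> carrier A" "b \<in> carrier A"
  shows "t \<odot>\<^bsub>M\<^esub> (a \<oplus>\<^bsub>A\<^esub> b) = t \<odot>\<^bsub>M\<^esub> a \<oplus>\<^bsub>A\<^esub> t \<odot>\<^bsub>M\<^esub> b"
  using t
proof (induction rule: KA.TT.T_induct)
  case (tau k k')
  thus ?case using a K_mem by (simp add: act_tau mult_add add_mult)
next
  case (add s t)
  thus ?case using a by (simp add: lin_add[OF act_lin] act_closed M.a_ac)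
qed

text \<open>Acting twice produces the right factors in reversed order, which is where commutativity
  of \<open>K\<close> enters; the brackets can be moved because \<open>K\<close> lies in the
  nucleus.\<close>

lemma act_mult:
  assumes s: "s \<in> carrier R2" and t: "t \<in> carrier R2" and a: "a \<in> carrier A"
  shows "(s \<otimes>\<^bsub>R2\<^esub> t) \<odot>\<^bsub>M\<^esub> a = s \<odot>\<^bsub>M\<^esub> (t \<odot>\<^bsub>M\<^esub> a)"
  using s
proof (induction rule: KA.TT.T_induct)
  case (tau k k')
  hence k: "k \<in> K" "k' \<in> K" by auto
  note kc = K_mem[OF k(1)] K_mem[OF k(2)]
  show ?case using t
  proof (induction rule: KA.TT.T_induct)
    case (tau l l')
    hence l: "l \<in> K" "l' \<in> K" by auto
    note lc = K_mem[OF l(1)] K_mem[OF l(2)]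
    have c: "k \<otimes>\<^bsub>A\<^esub> l \<in> K" "k' \<otimes>\<^bsub>A\<^esub> l' \<in> K" using k l K_sub by (auto simp: subalgebra_def)
    have "(KA.TT.tau k k' \<otimes>\<^bsub>R2\<^esub> KA.TT.tau l l') \<odot>\<^bsub>M\<^esub> a = (k \<otimes>\<^bsub>A\<^esub> l) \<otimes>\<^bsub>A\<^esub> a \<otimes>\<^bsub>A\<^esub> (l' \<otimes>\<^bsub>A\<^esub> k')"
      using k l a c by (simp add: KA.TT.tau_mult act_tau K_comm[OF k(2) l(2)])
    also have "\<dots> = (((k \<otimes>\<^bsub>A\<^esub> l) \<otimes>\<^bsub>A\<^esub> a) \<otimes>\<^bsub>A\<^esub> l') \<otimes>\<^bsub>A\<^esub> k'"
      using kc lc a by (simp add: nucleusD(4)[OF K_nuc[OF k(2)]])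
    also have "\<dots> = (k \<otimes>\<^bsub>A\<^esub> (l \<otimes>\<^bsub>A\<^esub> a \<otimes>\<^bsub>A\<^esub> l')) \<otimes>\<^bsub>A\<^esub> k'"
      using kc lc a by (simp add: nucleusD(2)[OF K_nuc[OF k(1)]])
    also have "\<dots> = KA.TT.tau k k' \<odot>\<^bsub>M\<^esub> (KA.TT.tau l l' \<odot>\<^bsub>M\<^esub> a)"
      using kc lc k l a by (simp add: act_tau)
    finally show ?case .
  next
    case (add u v)
    thus ?case using a k
      by (simp add: lin_add[OF act_lin] act_closed KA.TT.T.mult_add act_add)
  qed
next
  case (add u v)
  thus ?case using a t
    by (simp add: lin_add[OF act_lin] act_closed KA.TT.T.add_mult)
qed

lemma M_module: "rmodule R2 M"
proof -
  interpret R2: comm_alg F R2 by (rule R2_comm_alg)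
  have "module R2 M"
  proof (rule moduleI)
    show "cring R2" by (rule R2.cring_A)
    show "abelian_group M"
    proof (rule abelian_groupI)
      fix x assume "x \<in> carrier M"
      thus "\<exists>y\<in>carrier M. y \<oplus>\<^bsub>M\<^esub> x = \<zero>\<^bsub>M\<^esub>"
        by (intro bexI[of _ "\<ominus>\<^bsub>A\<^esub> x"]) (auto simp: bimodule_simps(1-3) M.l_neg)
    qed (simp_all add: bimodule_simps(1-3) M.a_ac)
    show "\<one>\<^bsub>R2\<^esub> \<odot>\<^bsub>M\<^esub> x = x" if "x \<in> carrier M" for x
      using that act_tau[of x "\<one>\<^bsub>A\<^esub>" "\<one>\<^bsub>A\<^esub>"] K_sub by (simp add: KA.TT.one_T bimodule_simps(1) subalgebra_def)
  qed (simp_all add: bimodule_simps(1-3) act_closed lin_add[OF act_lin] act_add act_mult)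
  thus ?thesis by (simp add: rmodule_def)
qed

sublocale SM: separable_module F R2 M
  by (intro separable_module.intro separable_module_axioms.intro R2_comm_alg M_module R2_separable R2_fin_dim)

end

lemma lin_inverse:
  assumes V: "vspace F V" and l: "lin F V W h" and bij: "bij_betw h (carrier V) (carrier W)"
  shows "lin F W V (inv_into (carrier V) h)" "v \<in> carrier V \<Longrightarrow> inv_into (carrier V) h (h v) = v"
    "w \<in> carrier W \<Longrightarrow> h (inv_into (carrier V) h w) = w"
proof -
  interpret V: vspace F V by fact
  have inj: "inj_on h (carrier V)" and im: "h ` carrier V = carrier W" using bij by (auto simp: bij_betw_def)
  show 1: "inv_into (carrier V) h (h v) = v" if "v \<in> carrier V" for v using inj that by (rule inv_into_f_f)
  show 2: "h (inv_into (carrier V) h w) = w" if "w \<in> carrier W" for w using that im by (intro f_inv_into_f) simp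
  have c: "inv_into (carrier V) h w \<in> carrier V" if "w \<in> carrier W" for w using that im by (intro inv_into_into) simp
  show "lin F W V (inv_into (carrier V) h)"
  proof (rule linI)
    show "inv_into (carrier V) h (x \<oplus>\<^bsub>W\<^esub> y) = inv_into (carrier V) h x \<oplus>\<^bsub>V\<^esub> inv_into (carrier V) h y"
      if "x \<in> carrier W" "y \<in> carrier W" for x y
      using 1[of "inv_into (carrier V) h x \<oplus>\<^bsub>V\<^esub> inv_into (carrier V) h y"] that
      by (simp add: c lin_add[OF l] 2)
    show "inv_into (carrier V) h (a \<odot>\<^bsub>W\<^esub> x) = a \<odot>\<^bsub>V\<^esub> inv_into (carrier V) h x"
      if "a \<in> carrier F" "x \<in> carrier W" for a x
      using 1[of "a \<odot>\<^bsub>V\<^esub> inv_into (carrier V) h x"] that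
      by (simp add: c lin_smult[OF l] 2)
  qed (use c in auto)
qed

section \<open>The tensor product of two nuclear bimodules\<close>

locale nuclear_pair = NA: nuclear_etale F A K + NB: nuclear_etale F B L
  for F :: "('f, 'k) ring_scheme" (structure) and A :: "('f, 'a) module" (structure) and K
    and B :: "('f, 'b) module" (structure) and L
begin

sublocale AB: tensor F A B by (intro tensor.intro NA.falg_axioms NB.falg_axioms)

sublocale S: tensor F NA.KA NB.KA by (intro tensor.intro NA.KA.falg_axioms NB.KA.falg_axioms)

abbreviation "T \<equiv> AB.T"
abbreviation "tau \<equiv> AB.tau"

text \<open>The map from K \<otimes> L to A \<otimes> B induced by the inclusions. The two tensor
  products are quotients of different free modules, so the first is not a subset of the
  second.\<close>

definition j where "j = tensor_lift F T tau"

lemma bilin_j: "bilin F NA.KA NB.KA T tau"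
  by (rule bilin_comp_lin[OF AB.bilin_tau lin_restrict lin_restrict]) (auto simp: NA.K_mem NB.K_mem)

lemma lin_j: "lin F S.T T j"
  unfolding j_def by (rule S.lin_lift[OF AB.T.vspace_axioms bilin_j])

lemma j_tau: "k \<in> K \<Longrightarrow> l \<in> L \<Longrightarrow> j (S.tau k l) = tau k l"
  unfolding j_def by (rule S.lift_tau[OF AB.T.vspace_axioms bilin_j]) auto

sublocale j: lin_map F S.T T j
  by (intro lin_mapI S.T.vspace_axioms AB.T.vspace_axioms lin_j)

lemma j_mult:
  assumes s: "s \<in> carrier S.T" and t: "t \<in> carrier S.T"
  shows "j (s \<otimes>\<^bsub>S.T\<^esub> t) = j s \<otimes>\<^bsub>T\<^esub> j t"
  using s
proof (induction rule: S.T_induct)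
  case (tau a b)
  note ab = this
  show ?case using t
  proof (induction rule: S.T_induct)
    case (tau c d)
    moreover from this ab have "a \<otimes>\<^bsub>A\<^esub> c \<in> K" "b \<otimes>\<^bsub>B\<^esub> d \<in> L"
      using NA.K_sub NB.K_sub by (auto simp: subalgebra_def)
    ultimately show ?case using ab by (simp add: S.tau_mult j_tau AB.tau_mult NA.K_mem NB.K_mem)
  next
    case (add u v)
    thus ?case using ab by (simp add: S.T.mult_add AB.T.mult_add)
  qed
next
  case (add u v)
  thus ?case using t by (simp add: S.T.add_mult AB.T.add_mult)
qed

text \<open>The etale subalgebra of the tensor product, taken as an image so that it lies inside
  \<open>T\<close>.\<close>

definition KT where "KT = j ` carrier S.T"

lemma KT_submodule: "submodule KT F T"
  unfolding KT_def by (rule j.image_submodule[OF S.T.carrier_is_submodule])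

lemma tau_KT: "k \<in> K \<Longrightarrow> l \<in> L \<Longrightarrow> tau k l \<in> KT"
  unfolding KT_def by (rule image_eqI[of _ _ "S.tau k l"]) (auto simp: j_tau)

lemma one_K: "\<one>\<^bsub>A\<^esub> \<in> K" "\<one>\<^bsub>B\<^esub> \<in> L"
  using NA.K_sub NB.K_sub by (auto simp: subalgebra_def)

lemma KT_subalgebra: "subalgebra F T KT"
  unfolding subalgebra_def
proof (intro conjI ballI KT_submodule)
  show "\<one>\<^bsub>T\<^esub> \<in> KT" unfolding AB.one_T by (intro tau_KT one_K)
  fix x y assume "x \<in> KT" "y \<in> KT"
  then obtain s t where "s \<in> carrier S.T" "t \<in> carrier S.T" "x = j s" "y = j t" by (auto simp: KT_def)
  thus "x \<otimes>\<^bsub>T\<^esub> y \<in> KT" unfolding KT_def by (intro image_eqI[of _ _ "s \<otimes>\<^bsub>S.T\<^esub> t"]) (auto simp: j_mult)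
qed

lemma KT_induct [consumes 1, case_names tau add]:
  assumes "x \<in> KT" "\<And>k l. k \<in> K \<Longrightarrow> l \<in> L \<Longrightarrow> Pr (tau k l)"
    "\<And>x y. x \<in> KT \<Longrightarrow> y \<in> KT \<Longrightarrow> Pr x \<Longrightarrow> Pr y \<Longrightarrow> Pr (x \<oplus>\<^bsub>T\<^esub> y)"
  shows "Pr x"
proof -
  obtain s where s: "s \<in> carrier S.T" "x = j s" using assms(1) by (auto simp: KT_def)
  have "Pr (j s)" using s(1)
  proof (induction rule: S.T_induct)
    case (tau a b)
    thus ?case using assms(2) by (simp add: j_tau)
  next
    case (add s t)
    thus ?case using assms(3)[of "j s" "j t"] by (simp add: KT_def)
  qed
  thus ?thesis using s by simp
qed

lemma KT_nucleus: "KT \<subseteq> nucleus T"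
proof
  fix x assume "x \<in> KT"
  thus "x \<in> nucleus T"
    by (induction rule: KT_induct)
      (auto intro: AB.tau_nucleus NA.K_nuc NB.K_nuc AB.T.submodule_add[OF AB.T.nucleus_submodule])
qed

lemma KT_comm: "x \<in> KT \<Longrightarrow> y \<in> KT \<Longrightarrow> x \<otimes>\<^bsub>T\<^esub> y = y \<otimes>\<^bsub>T\<^esub> x"
proof -
  interpret ST: comm_alg F S.T by (rule S.T_comm_alg[OF NA.KA_comm_alg NB.KA_comm_alg])
  assume "x \<in> KT" "y \<in> KT"
  then obtain s t where "s \<in> carrier S.T" "t \<in> carrier S.T" "x = j s" "y = j t" by (auto simp: KT_def)
  thus ?thesis using j_mult[of s t] j_mult[of t s] by (simp add: ST.comm)
qed

text \<open>\<open>KT\<close> is spanned by products of the commuting images of \<open>K\<close> and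
  \<open>L\<close>, so the product of their separability elements serves.\<close>

lemma KT_separable: "separable F (T\<lparr>carrier := KT\<rparr>)"
proof -
  have ca: "comm_alg F (T\<lparr>carrier := KT\<rparr>)"
    using AB.T.assoc_alg_nucleus[OF KT_subalgebra KT_nucleus] KT_comm by (simp add: comm_alg_def comm_alg_axioms_def)
  interpret C: comm_alg F "T\<lparr>carrier := KT\<rparr>" by (rule ca)
  have hA: "alg_hom F NA.KA (T\<lparr>carrier := KT\<rparr>) (\<lambda>a. tau a \<one>\<^bsub>B\<^esub>)"
    unfolding alg_hom_def
  proof (intro conjI ballI)
    show "lin F NA.KA (T\<lparr>carrier := KT\<rparr>) (\<lambda>a. tau a \<one>\<^bsub>B\<^esub>)"
      by (rule lin_corestrict[OF lin_comp[OF lin_restrict AB.lin_tau_left]])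
        (auto simp: NA.K_mem tau_KT one_K)
  qed (auto simp: AB.one_T AB.tau_mult NA.K_mem)
  have hB: "alg_hom F NB.KA (T\<lparr>carrier := KT\<rparr>) (\<lambda>b. tau \<one>\<^bsub>A\<^esub> b)"
    unfolding alg_hom_def
  proof (intro conjI ballI)
    show "lin F NB.KA (T\<lparr>carrier := KT\<rparr>) (\<lambda>b. tau \<one>\<^bsub>A\<^esub> b)"
      by (rule lin_corestrict[OF lin_comp[OF lin_restrict AB.lin_tau_right]])
        (auto simp: NB.K_mem tau_KT one_K)
  qed (auto simp: AB.one_T AB.tau_mult NB.K_mem)
  interpret P: comm_pair F NA.KA NB.KA "T\<lparr>carrier := KT\<rparr>" "\<lambda>a. tau a \<one>\<^bsub>B\<^esub>" "\<lambda>b. tau \<one>\<^bsub>A\<^esub> b"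
    by (intro comm_pair.intro comm_pair_axioms.intro NA.KA_comm_alg NB.KA_comm_alg ca hA hB)
  show ?thesis
  proof (rule P.separable_span[OF NA.K_sep NB.K_sep])
    fix N assume N: "submodule N F (T\<lparr>carrier := KT\<rparr>)"
      and *: "\<And>k l. k \<in> carrier NA.KA \<Longrightarrow> l \<in> carrier NB.KA \<Longrightarrow> tau k \<one>\<^bsub>B\<^esub> \<otimes>\<^bsub>T\<lparr>carrier := KT\<rparr>\<^esub> tau \<one>\<^bsub>A\<^esub> l \<in> N"
    have "x \<in> N" if "x \<in> KT" for x
      using that
    proof (induction rule: KT_induct)
      case (tau k l)
      thus ?case using *[of k l] by (simp add: AB.tau_mult NA.K_mem NB.K_mem)
    next
      case (add x y)
      thus ?case using C.submodule_add[OF N] by simp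
    qed
    thus "N = carrier (T\<lparr>carrier := KT\<rparr>)" using C.submodule_subset[OF N] by auto
  qed
qed

lemma nuclear_etale_T: "nuclear_etale F T KT"
  by (intro nuclear_etale.intro nuclear_etale_axioms.intro AB.T_falg KT_nucleus KT_subalgebra KT_comm
      KT_separable AB.T_fin_dim NA.A_fin NB.A_fin)

sublocale NT: nuclear_etale F T KT by (rule nuclear_etale_T)

lemma KT_etale: "etale F (T\<lparr>carrier := KT\<rparr>)"
  by (rule separable_etale[OF NT.KA_comm_alg KT_separable NT.KA_fin_dim])

text \<open>With \<open>hB\<close> this realises the interchange of the middle factors, from (K
  \<otimes> K) \<otimes> (L \<otimes> L) to (K \<otimes> L) \<otimes> (K \<otimes> L), as a product
  of two maps; see \<open>hA_hB\<close>. It lets the bimodule action on A \<otimes> B be computed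
  factor by factor.\<close>

definition hA where "hA = tensor_lift F NT.R2 (\<lambda>k k'. NT.KA.TT.tau (tau k \<one>\<^bsub>B\<^esub>) (tau k' \<one>\<^bsub>B\<^esub>))"
definition hB where "hB = tensor_lift F NT.R2 (\<lambda>l l'. NT.KA.TT.tau (tau \<one>\<^bsub>A\<^esub> l) (tau \<one>\<^bsub>A\<^esub> l'))"

lemma lin_embA: "lin F NA.KA NT.KA (\<lambda>a. tau a \<one>\<^bsub>B\<^esub>)"
  by (rule lin_corestrict[OF lin_comp[OF lin_restrict AB.lin_tau_left]]) (auto simp: NA.K_mem tau_KT one_K)

lemma lin_embB: "lin F NB.KA NT.KA (\<lambda>b. tau \<one>\<^bsub>A\<^esub> b)"
  by (rule lin_corestrict[OF lin_comp[OF lin_restrict AB.lin_tau_right]]) (auto simp: NB.K_mem tau_KT one_K)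

lemma hA: "lin F NA.R2 NT.R2 hA"
  "k \<in> K \<Longrightarrow> k' \<in> K \<Longrightarrow> hA (NA.KA.TT.tau k k') = NT.KA.TT.tau (tau k \<one>\<^bsub>B\<^esub>) (tau k' \<one>\<^bsub>B\<^esub>)"
proof -
  note bl = bilin_comp_lin[OF NT.KA.TT.bilin_tau lin_embA lin_embA]
  show "lin F NA.R2 NT.R2 hA" unfolding hA_def by (rule NA.KA.TT.lin_lift[OF NT.KA.TT.T.vspace_axioms bl])
  show "k \<in> K \<Longrightarrow> k' \<in> K \<Longrightarrow> hA (NA.KA.TT.tau k k') = NT.KA.TT.tau (tau k \<one>\<^bsub>B\<^esub>) (tau k' \<one>\<^bsub>B\<^esub>)"
    unfolding hA_def by (rule NA.KA.TT.lift_tau[OF NT.KA.TT.T.vspace_axioms bl]) auto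
qed

lemma hB: "lin F NB.R2 NT.R2 hB"
  "l \<in> L \<Longrightarrow> l' \<in> L \<Longrightarrow> hB (NB.KA.TT.tau l l') = NT.KA.TT.tau (tau \<one>\<^bsub>A\<^esub> l) (tau \<one>\<^bsub>A\<^esub> l')"
proof -
  note bl = bilin_comp_lin[OF NT.KA.TT.bilin_tau lin_embB lin_embB]
  show "lin F NB.R2 NT.R2 hB" unfolding hB_def by (rule NB.KA.TT.lin_lift[OF NT.KA.TT.T.vspace_axioms bl])
  show "l \<in> L \<Longrightarrow> l' \<in> L \<Longrightarrow> hB (NB.KA.TT.tau l l') = NT.KA.TT.tau (tau \<one>\<^bsub>A\<^esub> l) (tau \<one>\<^bsub>A\<^esub> l')"
    unfolding hB_def by (rule NB.KA.TT.lift_tau[OF NT.KA.TT.T.vspace_axioms bl]) auto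
qed

lemma hA_hB:
  assumes "k \<in> K" "k' \<in> K" "l \<in> L" "l' \<in> L"
  shows "hA (NA.KA.TT.tau k k') \<otimes>\<^bsub>NT.R2\<^esub> hB (NB.KA.TT.tau l l') = NT.KA.TT.tau (tau k l) (tau k' l')"
proof -
  have "tau x y \<in> KT" if "x \<in> K" "y \<in> L" for x y using that by (rule tau_KT)
  thus ?thesis using assms one_K
    by (simp add: hA hB NT.KA.TT.tau_mult AB.tau_mult NA.K_mem NB.K_mem)
qed

lemma act_product:
  assumes a: "a \<in> carrier A" and b: "b \<in> carrier B" and r: "r \<in> carrier NA.R2" and s: "s \<in> carrier NB.R2"
  shows "(hA r \<otimes>\<^bsub>NT.R2\<^esub> hB s) \<odot>\<^bsub>NT.M\<^esub> tau a b = tau (r \<odot>\<^bsub>NA.M\<^esub> a) (s \<odot>\<^bsub>NB.M\<^esub> b)"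
  using r
proof (induction rule: NA.KA.TT.T_induct)
  case (tau k k')
  hence k: "k \<in> K" "k' \<in> K" by auto
  have hAc: "hA (NA.KA.TT.tau k k') \<in> carrier NT.R2" using k by (intro lin_closed[OF hA(1)]) auto
  have ka: "NA.KA.TT.tau k k' \<odot>\<^bsub>NA.M\<^esub> a \<in> carrier A" using k a by (intro NA.act_closed) auto
  show ?case using s
  proof (induction rule: NB.KA.TT.T_induct)
    case (tau l l')
    hence l: "l \<in> L" "l' \<in> L" by auto
    have ab: "tau a b \<in> carrier T" using a b by simp
    show ?case unfolding hA_hB[OF k l] NT.act_tau[OF ab tau_KT[OF k(1) l(1)] tau_KT[OF k(2) l(2)]]
      NA.act_tau[OF a k] NB.act_tau[OF b l]
      using k l a b by (simp add: AB.tau_mult NA.K_mem NB.K_mem)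
  next
    case (add u v)
    have "hB u \<in> carrier NT.R2" "hB v \<in> carrier NT.R2" using add lin_closed[OF hB(1)] by auto
    thus ?case using add a b hAc ka
      by (simp add: lin_add[OF hB(1)] NT.KA.TT.T.mult_add lin_add[OF NT.act_lin] lin_add[OF NB.act_lin]
        lin_add[OF AB.lin_tau_right] NB.act_closed)
  qed
next
  case (add u v)
  have "hA u \<in> carrier NT.R2" "hA v \<in> carrier NT.R2" "hB s \<in> carrier NT.R2"
    using add s lin_closed[OF hA(1)] lin_closed[OF hB(1)] by auto
  thus ?case using add a b s
    by (simp add: lin_add[OF hA(1)] NT.KA.TT.T.add_mult lin_add[OF NT.act_lin] lin_add[OF NA.act_lin]
        lin_add[OF AB.lin_tau_left] NA.act_closed NB.act_closed)
qed

text \<open>If \<open>a\<close> and \<open>b\<close> are free generators, then a \<otimes> b is one.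
  An inverse of the action on it is written down directly: \<Lambda> sends x \<otimes> y to the
  product of the ring elements that produce x from \<open>a\<close> and y from
  \<open>b\<close>.\<close>

lemma minimally_faithful_T:
  assumes mA: "minimally_faithful NA.R2 NA.M" and mB: "minimally_faithful NB.R2 NB.M"
  shows "minimally_faithful NT.R2 NT.M"
proof -
  obtain a where a: "a \<in> carrier A" and bA: "bij_betw (\<lambda>r. r \<odot>\<^bsub>NA.M\<^esub> a) (carrier NA.R2) (carrier A)"
    using NA.SM.minimally_faithful_imp_free[OF mA] by (auto simp: NA.bimodule_simps(1))
  obtain b where b: "b \<in> carrier B" and bB: "bij_betw (\<lambda>r. r \<odot>\<^bsub>NB.M\<^esub> b) (carrier NB.R2) (carrier B)"
    using NB.SM.minimally_faithful_imp_free[OF mB] by (auto simp: NB.bimodule_simps(1))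
  define \<rho>A where "\<rho>A = inv_into (carrier NA.R2) (\<lambda>r. r \<odot>\<^bsub>NA.M\<^esub> a)"
  define \<rho>B where "\<rho>B = inv_into (carrier NB.R2) (\<lambda>r. r \<odot>\<^bsub>NB.M\<^esub> b)"
  note rA = lin_inverse[OF NA.KA.TT.T.vspace_axioms NA.act_lin[OF a] bA, folded \<rho>A_def]
  note rB = lin_inverse[OF NB.KA.TT.T.vspace_axioms NB.act_lin[OF b] bB, folded \<rho>B_def]
  define m where "m = tau a b"
  have m: "m \<in> carrier T" using a b by (simp add: m_def)
  define \<Lambda> where "\<Lambda> = tensor_lift F NT.R2 (\<lambda>x y. hA (\<rho>A x) \<otimes>\<^bsub>NT.R2\<^esub> hB (\<rho>B y))"
  have bl: "bilin F A B NT.R2 (\<lambda>x y. hA (\<rho>A x) \<otimes>\<^bsub>NT.R2\<^esub> hB (\<rho>B y))"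
    by (rule bilin_comp_lin[OF NT.KA.TT.T.bilin_mult lin_comp[OF rA(1) hA(1)] lin_comp[OF rB(1) hB(1)]])
  have \<Lambda>: "lin F T NT.R2 \<Lambda>" "\<And>x y. x \<in> carrier A \<Longrightarrow> y \<in> carrier B \<Longrightarrow> \<Lambda> (tau x y) = hA (\<rho>A x) \<otimes>\<^bsub>NT.R2\<^esub> hB (\<rho>B y)"
    unfolding \<Lambda>_def using AB.lin_lift[OF NT.KA.TT.T.vspace_axioms bl] AB.lift_tau[OF NT.KA.TT.T.vspace_axioms bl] by auto
  note lact = NT.act_lin[OF m]
  \<comment> \<open>Linear in \<open>r\<close>, so elementary tensors of elements of
    \<open>KT\<close> suffice; expanding these elements in turn leaves a single product of the form
    in \<open>hA_hB\<close>, on which the action is known from \<open>act_product\<close>.\<close>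
  have left_inv: "\<Lambda> (r \<odot>\<^bsub>NT.M\<^esub> m) = r" if "r \<in> carrier NT.R2" for r
  proof (rule NT.KA.TT.lin_T_eq[OF lin_comp[OF lact \<Lambda>(1)] lin_id _ that])
    fix x y assume "x \<in> carrier NT.KA" "y \<in> carrier NT.KA"
    hence x: "x \<in> KT" and y: "y \<in> KT" by auto
    have tl: "NT.KA.TT.tau (x \<oplus>\<^bsub>T\<^esub> x') y = NT.KA.TT.tau x y \<oplus>\<^bsub>NT.R2\<^esub> NT.KA.TT.tau x' y"
      "NT.KA.TT.tau y (x \<oplus>\<^bsub>T\<^esub> x') = NT.KA.TT.tau y x \<oplus>\<^bsub>NT.R2\<^esub> NT.KA.TT.tau y x'"
      if "x \<in> KT" "x' \<in> KT" "y \<in> KT" for x x' y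
      using lin_add[OF NT.KA.TT.lin_tau_left, of y x x'] lin_add[OF NT.KA.TT.lin_tau_right, of y x x'] that by auto
    have ac: "z \<odot>\<^bsub>NT.M\<^esub> m \<in> carrier T" if "z \<in> carrier NT.R2" for z using NT.act_closed[OF that m] .
    show "\<Lambda> (NT.KA.TT.tau x y \<odot>\<^bsub>NT.M\<^esub> m) = NT.KA.TT.tau x y"
      using x
    proof (induction rule: KT_induct)
      case (tau k l)
      note kl = this
      have tkl: "AB.tau k l \<in> KT" using kl by (rule tau_KT)
      show ?case using y
      proof (induction rule: KT_induct)
        case (tau k' l')
        have r: "NA.KA.TT.tau k k' \<in> carrier NA.R2" "NB.KA.TT.tau l l' \<in> carrier NB.R2" using kl tau by auto
        show ?case
          unfolding hA_hB[OF kl(1) tau(1) kl(2) tau(2), symmetric] m_def act_product[OF a b r]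
          using r a b by (simp add: \<Lambda>(2) NA.act_closed NB.act_closed rA(2) rB(2))
      next
        case (add x x')
        thus ?case using tkl
          by (simp add: tl lin_add[OF lact] ac lin_add[OF \<Lambda>(1)])
      qed
    next
      case (add x x')
      thus ?case using y
        by (simp add: tl lin_add[OF lact] ac lin_add[OF \<Lambda>(1)])
    qed
  qed
  have "bij_betw (\<lambda>r. r \<odot>\<^bsub>NT.M\<^esub> m) (carrier NT.R2) (carrier NT.M)"
    unfolding bij_betw_def NT.bimodule_simps(1)
  proof
    show "inj_on (\<lambda>r. r \<odot>\<^bsub>NT.M\<^esub> m) (carrier NT.R2)" using left_inv by (rule inj_on_inverseI)
    interpret l: lin_map F NT.R2 T "\<lambda>r. r \<odot>\<^bsub>NT.M\<^esub> m"
      by (intro lin_mapI NT.KA.TT.T.vspace_axioms AB.T.vspace_axioms lact)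
    show "(\<lambda>r. r \<odot>\<^bsub>NT.M\<^esub> m) ` carrier NT.R2 = carrier T"
    proof (rule AB.T_submodule_induct[OF l.image_submodule[OF NT.KA.TT.T.carrier_is_submodule]])
      fix x y assume x: "x \<in> carrier A" and y: "y \<in> carrier B"
      have c: "\<rho>A x \<in> carrier NA.R2" "\<rho>B y \<in> carrier NB.R2" using lin_closed[OF rA(1) x] lin_closed[OF rB(1) y] .
      have "tau x y = (hA (\<rho>A x) \<otimes>\<^bsub>NT.R2\<^esub> hB (\<rho>B y)) \<odot>\<^bsub>NT.M\<^esub> m"
        unfolding m_def act_product[OF a b c] using rA(3)[OF x] rB(3)[OF y] by simp
      thus "tau x y \<in> (\<lambda>r. r \<odot>\<^bsub>NT.M\<^esub> m) ` carrier NT.R2"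
        using lin_closed[OF hA(1) c(1)] lin_closed[OF hB(1) c(2)]
        by (intro image_eqI[of _ _ "hA (\<rho>A x) \<otimes>\<^bsub>NT.R2\<^esub> hB (\<rho>B y)"]) auto
    qed
  qed
  thus ?thesis using m by (intro NT.SM.free_imp_minimally_faithful) (auto simp: NT.bimodule_simps(1))
qed

end

lemma semiassociativeD:
  fixes F :: "('f, 'k) ring_scheme" and A :: "('f, 'a) module"
  assumes "semiassociative F A"
  shows "falg F A" "fin_dim F A" "central F A"
    "\<exists>K. nuclear_etale F A K \<and> minimally_faithful (tensor_alg F (A\<lparr>carrier := K\<rparr>) (A\<lparr>carrier := K\<rparr>)) (bimodule F A)"
proof -
  show A: "falg F A" and c: "central F A" using assms by (auto simp: semiassociative_def intro: falgI)
  interpret A: falg F A by (rule A)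
  show fd: "fin_dim F A" using assms A.vspace_axioms by (simp add: semiassociative_def fin_dim_def fin_dim_axioms_def)
  obtain K where K: "K \<subseteq> nucleus A" "subalgebra F A K" "etale F (A\<lparr>carrier := K\<rparr>)"
    "minimally_faithful (tensor_alg F (A\<lparr>carrier := K\<rparr>) (A\<lparr>carrier := K\<rparr>)) (bimodule F A)"
    using assms by (auto simp: semiassociative_def)
  have KA: "falg F (A\<lparr>carrier := K\<rparr>)" by (rule falg_restrict[OF A K(2)])
  have Kf: "fin_dim F (A\<lparr>carrier := K\<rparr>)" using K(2) by (intro fin_dim_submodule[OF fd]) (simp add: subalgebra_def)
  have "x \<otimes>\<^bsub>A\<^esub> y = y \<otimes>\<^bsub>A\<^esub> x" if "x \<in> K" "y \<in> K" for x y
    using comm_alg.comm[OF etale_comm_alg[OF KA K(3)], of x y] that by simp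
  hence "nuclear_etale F A K"
    by (intro nuclear_etale.intro nuclear_etale_axioms.intro A fd K(1,2) etale_separable[OF Kf KA K(3)])
  thus "\<exists>K. nuclear_etale F A K \<and> minimally_faithful (tensor_alg F (A\<lparr>carrier := K\<rparr>) (A\<lparr>carrier := K\<rparr>)) (bimodule F A)"
    using K(4) by blast
qed

theorem semiassociative_tensor:
  fixes F :: "('f, 'k) ring_scheme" and A :: "('f, 'a) module" and B :: "('f, 'b) module"
  assumes A: "semiassociative F A" and B: "semiassociative F B"
  shows "semiassociative F (tensor_alg F A B)"
proof -
  obtain K where K: "nuclear_etale F A K" "minimally_faithful (tensor_alg F (A\<lparr>carrier := K\<rparr>) (A\<lparr>carrier := K\<rparr>)) (bimodule F A)"
    using semiassociativeD(4)[OF A] by blast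
  obtain L where L: "nuclear_etale F B L" "minimally_faithful (tensor_alg F (B\<lparr>carrier := L\<rparr>) (B\<lparr>carrier := L\<rparr>)) (bimodule F B)"
    using semiassociativeD(4)[OF B] by blast
  interpret P: nuclear_pair F A K B L by (intro nuclear_pair.intro K L)
  have "finite_dimensional F P.T" using P.NT.A_fin by (simp add: fin_dim_def fin_dim_axioms_def)
  moreover have "central F P.T"
    by (rule P.AB.T_central[OF semiassociativeD(2)[OF A] semiassociativeD(2)[OF B] semiassociativeD(3)[OF A] semiassociativeD(3)[OF B]])
  moreover have "minimally_faithful P.NT.R2 P.NT.M" by (rule P.minimally_faithful_T[OF K(2) L(2)])
  ultimately show ?thesis
    using P.AB.T.nonassoc_algebra_axioms P.KT_nucleus P.KT_subalgebra P.KT_etale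
    unfolding semiassociative_def by blast
qed

section \<open>The radical\<close>

lemma (in lin_map) vimage_submodule:
  assumes U: "submodule U F W"
  shows "submodule {x \<in> carrier V. h x \<in> U} F V"
  by (rule V.submoduleI)
    (auto intro: W.submodule_zero[OF U] W.submodule_neg[OF U] W.submodule_add[OF U] W.submodule_smult[OF U])

context assoc_alg
begin

text \<open>Multiplication by c 1 makes a left ideal stable under scalars. Minimal and maximal
  choices, available for subspaces of a finite-dimensional space, can thus be made among
  ideals.\<close>

lemma additive_subgroup_submodule:
  assumes I: "additive_subgroup I A" and l: "\<And>x p. x \<in> carrier A \<Longrightarrow> p \<in> I \<Longrightarrow> x \<otimes>\<^bsub>A\<^esub> p \<in> I"
  shows "submodule I F A"
proof (rule submoduleI)
  interpret I: additive_subgroup I A by (rule I)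
  show s: "I \<subseteq> carrier A" by (rule I.a_subset)
  show "\<zero>\<^bsub>A\<^esub> \<in> I" by simp
  show "x \<oplus>\<^bsub>A\<^esub> y \<in> I" if "x \<in> I" "y \<in> I" for x y using that by simp
  show "\<ominus>\<^bsub>A\<^esub> x \<in> I" if x: "x \<in> I" for x
  proof -
    have "(\<ominus>\<^bsub>A\<^esub> \<one>\<^bsub>A\<^esub>) \<otimes>\<^bsub>A\<^esub> x \<in> I" using x by (intro l) auto
    thus ?thesis using x s by (simp add: neg_mult subset_iff)
  qed
  show "c \<odot>\<^bsub>A\<^esub> x \<in> I" if c: "c \<in> carrier F" and x: "x \<in> I" for c x
  proof -
    have "(c \<odot>\<^bsub>A\<^esub> \<one>\<^bsub>A\<^esub>) \<otimes>\<^bsub>A\<^esub> x \<in> I" using c x by (intro l) auto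
    thus ?thesis using c x s by (simp add: smult_one_mult subset_iff)
  qed
qed

lemma left_ideal_iff: "left_ideal I A \<longleftrightarrow> submodule I F A \<and> (\<forall>x\<in>carrier A. \<forall>p\<in>I. x \<otimes>\<^bsub>A\<^esub> p \<in> I)"
proof
  assume "left_ideal I A"
  thus "submodule I F A \<and> (\<forall>x\<in>carrier A. \<forall>p\<in>I. x \<otimes>\<^bsub>A\<^esub> p \<in> I)"
    using additive_subgroup_submodule[of I] by (auto simp: left_ideal_def)
next
  assume "submodule I F A \<and> (\<forall>x\<in>carrier A. \<forall>p\<in>I. x \<otimes>\<^bsub>A\<^esub> p \<in> I)"
  thus "left_ideal I A" by (simp add: left_ideal_def additive_subgroup_def submodule_def)
qed

lemma ideal_iff: "ideal I A \<longleftrightarrow>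
    submodule I F A \<and> (\<forall>x\<in>carrier A. \<forall>p\<in>I. x \<otimes>\<^bsub>A\<^esub> p \<in> I \<and> p \<otimes>\<^bsub>A\<^esub> x \<in> I)"
proof
  assume I: "ideal I A"
  hence "submodule I F A"
    by (intro additive_subgroup_submodule) (simp_all add: ideal_def ideal_axioms_def)
  with I show "submodule I F A \<and> (\<forall>x\<in>carrier A. \<forall>p\<in>I. x \<otimes>\<^bsub>A\<^esub> p \<in> I \<and> p \<otimes>\<^bsub>A\<^esub> x \<in> I)"
    by (simp add: ideal_def ideal_axioms_def)
next
  assume "submodule I F A \<and> (\<forall>x\<in>carrier A. \<forall>p\<in>I. x \<otimes>\<^bsub>A\<^esub> p \<in> I \<and> p \<otimes>\<^bsub>A\<^esub> x \<in> I)"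
  thus "ideal I A" using ring_A by (simp add: ideal_def ideal_axioms_def additive_subgroup_def submodule_def)
qed

lemma left_ideal_one: "left_ideal I A \<Longrightarrow> \<one>\<^bsub>A\<^esub> \<in> I \<Longrightarrow> I = carrier A"
  unfolding left_ideal_iff using submodule_subset[of I] one_right by force

lemma maximal_left_idealD:
  assumes "maximal_left_ideal I A"
  shows "left_ideal I A" "submodule I F A" "x \<in> carrier A \<Longrightarrow> p \<in> I \<Longrightarrow> x \<otimes>\<^bsub>A\<^esub> p \<in> I" "\<one>\<^bsub>A\<^esub> \<notin> I"
    "left_ideal I' A \<Longrightarrow> I \<subseteq> I' \<Longrightarrow> I' = I \<or> I' = carrier A"
  using assms left_ideal_one unfolding maximal_left_ideal_def left_ideal_iff by blast+

lemma left_ideal_sum: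
  assumes I: "left_ideal I A" and x: "x \<in> carrier A"
  shows "left_ideal {u \<oplus>\<^bsub>A\<^esub> v | u v. u \<in> I \<and> v \<in> (\<lambda>s. s \<otimes>\<^bsub>A\<^esub> x) ` carrier A} A" (is "left_ideal ?W A")
  unfolding left_ideal_iff
proof (intro conjI ballI)
  have sI: "submodule I F A" and lI: "\<And>r p. r \<in> carrier A \<Longrightarrow> p \<in> I \<Longrightarrow> r \<otimes>\<^bsub>A\<^esub> p \<in> I"
    using I unfolding left_ideal_iff by blast+
  show "submodule ?W F A"
    by (intro submodule_sum sI lin_map.image_submodule[OF lin_map_mult_right[OF x]] carrier_is_submodule)
  fix r w assume r: "r \<in> carrier A" and "w \<in> ?W"
  then obtain u s where w: "u \<in> I" "s \<in> carrier A" "w = u \<oplus>\<^bsub>A\<^esub> s \<otimes>\<^bsub>A\<^esub> x" by blast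
  hence "r \<otimes>\<^bsub>A\<^esub> w = r \<otimes>\<^bsub>A\<^esub> u \<oplus>\<^bsub>A\<^esub> (r \<otimes>\<^bsub>A\<^esub> s) \<otimes>\<^bsub>A\<^esub> x"
    using r x submodule_mem[OF sI w(1)] by (simp add: mult_add assoc mult_closed)
  thus "r \<otimes>\<^bsub>A\<^esub> w \<in> ?W" using lI[OF r w(1)] r w(2) by (blast intro: mult_closed)
qed

text \<open>The left ideal I + A x is strictly larger than \<open>I\<close>, so it contains
  1.\<close>

lemma maximal_left_ideal_sum:
  assumes I: "maximal_left_ideal I A" and x: "x \<in> carrier A" "x \<notin> I"
  shows "\<exists>m\<in>I. \<exists>s\<in>carrier A. \<one>\<^bsub>A\<^esub> = m \<oplus>\<^bsub>A\<^esub> s \<otimes>\<^bsub>A\<^esub> x"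
proof -
  define W where "W = {u \<oplus>\<^bsub>A\<^esub> v | u v. u \<in> I \<and> v \<in> (\<lambda>s. s \<otimes>\<^bsub>A\<^esub> x) ` carrier A}"
  note sI = maximal_left_idealD(2)[OF I]
  have "left_ideal W A" unfolding W_def by (rule left_ideal_sum[OF maximal_left_idealD(1)[OF I] x(1)])
  moreover have "I \<subseteq> W"
  proof
    fix u assume u: "u \<in> I"
    hence "u = u \<oplus>\<^bsub>A\<^esub> \<zero>\<^bsub>A\<^esub> \<otimes>\<^bsub>A\<^esub> x" using submodule_mem[OF sI u] x by simp
    thus "u \<in> W" using u unfolding W_def by blast
  qed
  moreover have "x \<in> W"
  proof -
    have "x = \<zero>\<^bsub>A\<^esub> \<oplus>\<^bsub>A\<^esub> \<one>\<^bsub>A\<^esub> \<otimes>\<^bsub>A\<^esub> x" using x by simp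
    thus ?thesis using submodule_zero[OF sI] one_closed unfolding W_def by blast
  qed
  ultimately have "W = carrier A" using maximal_left_idealD(5)[OF I, of W] x by blast
  hence "\<one>\<^bsub>A\<^esub> \<in> W" by simp
  thus ?thesis unfolding W_def by blast
qed

abbreviation "J \<equiv> jacobson_radical A"

lemma radicalI: "x \<in> carrier A \<Longrightarrow> (\<And>I. maximal_left_ideal I A \<Longrightarrow> x \<in> I) \<Longrightarrow> x \<in> J"
  by (simp add: jacobson_radical_def)

lemma radicalD: "x \<in> J \<Longrightarrow> maximal_left_ideal I A \<Longrightarrow> x \<in> I" "x \<in> J \<Longrightarrow> x \<in> carrier A"
  by (simp_all add: jacobson_radical_def)

lemma radical_submodule: "submodule J F A"
proof (rule submoduleI)
  note s = maximal_left_idealD(2)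
  show "\<zero>\<^bsub>A\<^esub> \<in> J" by (rule radicalI) (auto intro: submodule_zero[OF s])
  show "\<ominus>\<^bsub>A\<^esub> x \<in> J" if "x \<in> J" for x
    using that s by (intro radicalI) (auto intro: submodule_neg dest: radicalD)
  show "x \<oplus>\<^bsub>A\<^esub> y \<in> J" if "x \<in> J" "y \<in> J" for x y
    using that s by (intro radicalI) (auto intro: submodule_add dest: radicalD)
  show "c \<odot>\<^bsub>A\<^esub> x \<in> J" if "c \<in> carrier F" "x \<in> J" for c x
    using that s by (intro radicalI) (auto intro: submodule_smult dest: radicalD)
qed (auto dest: radicalD)

lemma radical_left: "x \<in> carrier A \<Longrightarrow> q \<in> J \<Longrightarrow> x \<otimes>\<^bsub>A\<^esub> q \<in> J"
  by (rule radicalI) (auto dest: radicalD intro: mult_closed maximal_left_idealD(3))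

end

text \<open>The radical annihilates the simple module \<open>B / V\<close>: the annihilator of a nonzero
  element of a simple module is a maximal left ideal.\<close>

lemma radical_action:
  fixes F :: "('f, 'k) ring_scheme" and A :: "('f, 'a) module" and B :: "('f, 'b) module"
  assumes A: "assoc_alg F A" and B: "assoc_alg F B" and h: "alg_hom F A B h"
    and V: "submodule V F B" and stable: "\<And>a v. a \<in> carrier A \<Longrightarrow> v \<in> V \<Longrightarrow> h a \<otimes>\<^bsub>B\<^esub> v \<in> V"
    and max: "\<And>W. submodule W F B \<Longrightarrow> (\<And>a v. a \<in> carrier A \<Longrightarrow> v \<in> W \<Longrightarrow> h a \<otimes>\<^bsub>B\<^esub> v \<in> W) \<Longrightarrow>
      V \<subseteq> W \<Longrightarrow> W = V \<or> W = carrier B"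
    and q: "q \<in> jacobson_radical A" and v: "v \<in> carrier B"
  shows "h q \<otimes>\<^bsub>B\<^esub> v \<in> V"
proof (cases "v \<in> V")
  case True
  interpret A: assoc_alg F A by (rule A)
  show ?thesis using stable True A.radicalD(2)[OF q] by blast
next
  case False
  interpret A: assoc_alg F A by (rule A)
  interpret B: assoc_alg F B by (rule B)
  note hc = alg_homD(4)[OF h]
  have lh: "lin F A B (\<lambda>a. h a \<otimes>\<^bsub>B\<^esub> v)"
    by (rule lin_comp[OF alg_homD(1)[OF h] B.lin_mult_right[OF v]])
  interpret l: lin_map F A B "\<lambda>a. h a \<otimes>\<^bsub>B\<^esub> v"
    by (intro lin_mapI A.vspace_axioms B.vspace_axioms lh)
  define Y where "Y = {a \<in> carrier A. h a \<otimes>\<^bsub>B\<^esub> v \<in> V}"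
  have hass: "h (a \<otimes>\<^bsub>A\<^esub> b) \<otimes>\<^bsub>B\<^esub> v = h a \<otimes>\<^bsub>B\<^esub> (h b \<otimes>\<^bsub>B\<^esub> v)" if "a \<in> carrier A" "b \<in> carrier A" for a b
    using that v by (simp add: alg_homD(3)[OF h] hc B.assoc)
  have "maximal_left_ideal Y A"
    unfolding maximal_left_ideal_def
  proof (intro conjI allI impI)
    show "left_ideal Y A"
      unfolding A.left_ideal_iff Y_def using l.vimage_submodule[OF V] stable
      by (auto simp: hass A.mult_closed)
    have "\<one>\<^bsub>A\<^esub> \<notin> Y" using False v by (simp add: Y_def alg_homD(2)[OF h] B.one_left)
    thus "Y \<noteq> carrier A" using A.one_closed by blast
    fix I assume I: "left_ideal I A \<and> Y \<subseteq> I"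
    hence sI: "submodule I F A" and lI: "\<And>x p. x \<in> carrier A \<Longrightarrow> p \<in> I \<Longrightarrow> x \<otimes>\<^bsub>A\<^esub> p \<in> I"
      unfolding A.left_ideal_iff by blast+
    show "I = Y \<or> I = carrier A"
    proof (rule disjCI)
      assume "I \<noteq> carrier A"
      \<comment> \<open>A left ideal I above Y gives the stable subspace V + h(I) v. If it is all of
        \<open>B\<close>, then v itself is reached and 1 - b lies in Y for some b in I, so 1 is in
        I; if it is \<open>V\<close>, then I is contained in Y.\<close>
      define W where "W = {w \<oplus>\<^bsub>B\<^esub> z | w z. w \<in> V \<and> z \<in> (\<lambda>a. h a \<otimes>\<^bsub>B\<^esub> v) ` I}"
      have W: "submodule W F B" unfolding W_def by (intro B.submodule_sum V l.image_submodule sI)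
      have VW: "V \<subseteq> W"
      proof
        fix w assume w: "w \<in> V"
        have "w = w \<oplus>\<^bsub>B\<^esub> h \<zero>\<^bsub>A\<^esub> \<otimes>\<^bsub>B\<^esub> v" using B.submodule_mem[OF V w] l.zero by simp
        thus "w \<in> W" using w A.submodule_zero[OF sI] unfolding W_def by blast
      qed
      have W_stable: "h a \<otimes>\<^bsub>B\<^esub> w \<in> W" if a: "a \<in> carrier A" and w: "w \<in> W" for a w
      proof -
        obtain w' b where w': "w' \<in> V" "b \<in> I" "w = w' \<oplus>\<^bsub>B\<^esub> h b \<otimes>\<^bsub>B\<^esub> v" using w unfolding W_def by blast
        note bc = A.submodule_mem[OF sI w'(2)] B.submodule_mem[OF V w'(1)]
        have "h a \<otimes>\<^bsub>B\<^esub> w = h a \<otimes>\<^bsub>B\<^esub> w' \<oplus>\<^bsub>B\<^esub> h (a \<otimes>\<^bsub>A\<^esub> b) \<otimes>\<^bsub>B\<^esub> v"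
          using w' a bc v hc[OF a] hc[OF bc(1)] by (simp add: hass B.mult_add B.mult_closed)
        thus ?thesis using stable[OF a w'(1)] lI[OF a w'(2)] unfolding W_def by blast
      qed
      have "W \<noteq> carrier B"
      proof
        assume "W = carrier B"
        hence "v \<in> W" using v by simp
        have "\<exists>w\<in>V. \<exists>b\<in>I. x = w \<oplus>\<^bsub>B\<^esub> h b \<otimes>\<^bsub>B\<^esub> v" if "x \<in> W" for x
          using that unfolding W_def by blast
        from this[OF \<open>v \<in> W\<close>]
        obtain w b where wb: "w \<in> V" "b \<in> I" "v = w \<oplus>\<^bsub>B\<^esub> h b \<otimes>\<^bsub>B\<^esub> v" by (elim bexE) (rule that)
        note c = A.submodule_mem[OF sI wb(2)] B.submodule_mem[OF V wb(1)]
        have hb: "h b \<otimes>\<^bsub>B\<^esub> v \<in> carrier B" using l.closed[OF c(1)] .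
        have "h (\<one>\<^bsub>A\<^esub> \<ominus>\<^bsub>A\<^esub> b) \<otimes>\<^bsub>B\<^esub> v = v \<ominus>\<^bsub>B\<^esub> h b \<otimes>\<^bsub>B\<^esub> v"
          using c l.minus[of "\<one>\<^bsub>A\<^esub>" b] v by (simp add: alg_homD(2)[OF h] B.one_left A.one_closed)
        also have "\<dots> = w"
          by (subst wb(3)) (use c hb in \<open>simp add: a_minus_def B.M.a_assoc B.M.r_neg\<close>)
        finally have "\<one>\<^bsub>A\<^esub> \<ominus>\<^bsub>A\<^esub> b \<in> Y" using wb(1) c A.one_closed by (simp add: Y_def)
        hence "(\<one>\<^bsub>A\<^esub> \<ominus>\<^bsub>A\<^esub> b) \<oplus>\<^bsub>A\<^esub> b \<in> I" using I wb(2) A.submodule_add[OF sI] by blast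
        hence "\<one>\<^bsub>A\<^esub> \<in> I" using c A.one_closed by (simp add: a_minus_def A.M.a_assoc A.M.l_neg)
        thus False using A.left_ideal_one I \<open>I \<noteq> carrier A\<close> by blast
      qed
      hence "W = V" using max[OF W W_stable VW] by blast
      have "I \<subseteq> Y"
      proof
        fix b assume b: "b \<in> I"
        note c = A.submodule_mem[OF sI b]
        have "h b \<otimes>\<^bsub>B\<^esub> v = \<zero>\<^bsub>B\<^esub> \<oplus>\<^bsub>B\<^esub> h b \<otimes>\<^bsub>B\<^esub> v" using l.closed[OF c] by simp
        hence "h b \<otimes>\<^bsub>B\<^esub> v \<in> W" using b B.submodule_zero[OF V] unfolding W_def by blast
        thus "b \<in> Y" using c \<open>W = V\<close> by (simp add: Y_def)
      qed
      thus "I = Y" using I by blast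
    qed
  qed
  hence "q \<in> Y" by (rule A.radicalD(1)[OF q])
  thus ?thesis by (simp add: Y_def)
qed

context assoc_alg
begin

text \<open>\<open>radical_action\<close> for the simple module A / I: \<open>q\<close> annihilates
  the whole module, in particular the class of \<open>x\<close>.\<close>

lemma radical_right:
  assumes x: "x \<in> carrier A" and q: "q \<in> J"
  shows "q \<otimes>\<^bsub>A\<^esub> x \<in> J"
proof (rule radicalI)
  show "q \<otimes>\<^bsub>A\<^esub> x \<in> carrier A" using x radicalD(2)[OF q] by (intro mult_closed)
  fix I assume I: "maximal_left_ideal I A"
  show "q \<otimes>\<^bsub>A\<^esub> x \<in> I"
  proof (rule radical_action[OF assoc_alg_axioms assoc_alg_axioms alg_hom_id maximal_left_idealD(2,3)[OF I] _ q x])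
    fix W assume "submodule W F A" "\<And>a v. a \<in> carrier A \<Longrightarrow> v \<in> W \<Longrightarrow> a \<otimes>\<^bsub>A\<^esub> v \<in> W" "I \<subseteq> W"
    thus "W = I \<or> W = carrier A" by (intro maximal_left_idealD(5)[OF I]) (simp_all add: left_ideal_iff)
  qed
qed

lemma quot_ideal_radical: "quot_ideal F A J"
  by (intro quot_ideal.intro quot_ideal_axioms.intro falg_axioms radical_submodule radical_left radical_right)

text \<open>If \<open>x\<close> avoided a maximal left ideal, then 1 = m + s x with m in this ideal.
  Multiplying by \<open>x\<close> from the left gives x = x m + x s x, and both terms lie in the
  ideal.\<close>

lemma radical_square:
  assumes x: "x \<in> carrier A" and q: "\<And>s. s \<in> carrier A \<Longrightarrow> x \<otimes>\<^bsub>A\<^esub> s \<otimes>\<^bsub>A\<^esub> x \<in> J"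
  shows "x \<in> J"
proof (rule radicalI[OF x], rule ccontr)
  fix I assume I: "maximal_left_ideal I A" and "x \<notin> I"
  then obtain m s where ms: "m \<in> I" "s \<in> carrier A" "\<one>\<^bsub>A\<^esub> = m \<oplus>\<^bsub>A\<^esub> s \<otimes>\<^bsub>A\<^esub> x"
    using maximal_left_ideal_sum[OF I x] by blast
  note sI = maximal_left_idealD(2)[OF I]
  have "x = x \<otimes>\<^bsub>A\<^esub> (m \<oplus>\<^bsub>A\<^esub> s \<otimes>\<^bsub>A\<^esub> x)" using x by (simp add: ms(3)[symmetric] one_right)
  also have "\<dots> = x \<otimes>\<^bsub>A\<^esub> m \<oplus>\<^bsub>A\<^esub> x \<otimes>\<^bsub>A\<^esub> s \<otimes>\<^bsub>A\<^esub> x"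
    using x ms(2) submodule_mem[OF sI ms(1)] by (simp add: mult_add mult_closed assoc)
  also have "\<dots> \<in> I"
    by (intro submodule_add[OF sI] maximal_left_idealD(3)[OF I] radicalD(1)[OF q I] x ms)
  finally show False using \<open>x \<notin> I\<close> by simp
qed

text \<open>The identity element comes from a left ideal \<open>U\<close> minimal with \<open>L + U = A\<close>:
  then \<open>L \<inter> U\<close> lies in the radical.\<close>

lemma ideal_unit_mod_radical:
  assumes fd: "fin_dim F A" and L: "ideal L A" and JL: "J \<subseteq> L"
  shows "\<exists>e\<in>L. \<forall>x\<in>L. x \<ominus>\<^bsub>A\<^esub> x \<otimes>\<^bsub>A\<^esub> e \<in> J \<and> x \<ominus>\<^bsub>A\<^esub> e \<otimes>\<^bsub>A\<^esub> x \<in> J"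
proof -
  have sL: "submodule L F A" and lL: "\<And>x p. x \<in> carrier A \<Longrightarrow> p \<in> L \<Longrightarrow> x \<otimes>\<^bsub>A\<^esub> p \<in> L"
    and rL: "\<And>x p. x \<in> carrier A \<Longrightarrow> p \<in> L \<Longrightarrow> p \<otimes>\<^bsub>A\<^esub> x \<in> L"
    using L unfolding ideal_iff by blast+
  note Lc = submodule_mem[OF sL]
  \<comment> \<open>The condition L + U = A, expressed by a decomposition of 1.\<close>
  define \<U> where "\<U> = {U. left_ideal U A \<and> (\<exists>l\<in>L. \<exists>u\<in>U. \<one>\<^bsub>A\<^esub> = l \<oplus>\<^bsub>A\<^esub> u)}"
  have "\<exists>U\<in>\<U>. \<forall>U' \<in> \<U>. U' \<subseteq> U \<longrightarrow> U' = U"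
  proof (rule fin_dim.ex_minimal_submodule[OF fd])
    show "submodule U F A" if "U \<in> \<U>" for U using that by (simp add: \<U>_def left_ideal_iff)
    have "\<one>\<^bsub>A\<^esub> = \<zero>\<^bsub>A\<^esub> \<oplus>\<^bsub>A\<^esub> \<one>\<^bsub>A\<^esub>" by (simp add: one_closed)
    hence "\<exists>l\<in>L. \<exists>u\<in>carrier A. \<one>\<^bsub>A\<^esub> = l \<oplus>\<^bsub>A\<^esub> u" using submodule_zero[OF sL] one_closed by blast
    thus "carrier A \<in> \<U>"
      using carrier_is_submodule mult_closed by (simp add: \<U>_def left_ideal_iff)
  qed
  then obtain U where U: "U \<in> \<U>" and min: "\<forall>U' \<in> \<U>. U' \<subseteq> U \<longrightarrow> U' = U" by (rule bexE)
  have U': "left_ideal U A" and ex: "\<exists>l\<in>L. \<exists>u\<in>U. \<one>\<^bsub>A\<^esub> = l \<oplus>\<^bsub>A\<^esub> u" using U by (simp_all add: \<U>_def)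
  hence sU: "submodule U F A" and lU: "\<And>x p. x \<in> carrier A \<Longrightarrow> p \<in> U \<Longrightarrow> x \<otimes>\<^bsub>A\<^esub> p \<in> U"
    unfolding left_ideal_iff by blast+
  note Uc = submodule_mem[OF sU]
  obtain e u where eu: "e \<in> L" "u \<in> U" "\<one>\<^bsub>A\<^esub> = e \<oplus>\<^bsub>A\<^esub> u" using ex by blast
  have LU: "x \<in> J" if x: "x \<in> L" "x \<in> U" for x
  proof (rule radicalI[OF Lc[OF x(1)]], rule ccontr)
    fix I assume I: "maximal_left_ideal I A" and "x \<notin> I"
    then obtain m s where ms: "m \<in> I" "s \<in> carrier A" "\<one>\<^bsub>A\<^esub> = m \<oplus>\<^bsub>A\<^esub> s \<otimes>\<^bsub>A\<^esub> x"
      using maximal_left_ideal_sum[OF I Lc[OF x(1)]] by blast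
    define y where "y = s \<otimes>\<^bsub>A\<^esub> x"
    have y: "y \<in> L" "y \<in> U" using lL[OF ms(2) x(1)] lU[OF ms(2) x(2)] by (simp_all add: y_def)
    note sI = maximal_left_idealD(2)[OF I]
    note c = Lc[OF eu(1)] Uc[OF eu(2)] Lc[OF y(1)] submodule_mem[OF sI ms(1)]
    \<comment> \<open>The part u y lies in \<open>L\<close>, so the remaining part u m, an element
      of U and of the maximal left ideal I, already complements \<open>L\<close>. By minimality U is
      contained in I, although it contains \<open>x\<close>.\<close>
    have u: "u = u \<otimes>\<^bsub>A\<^esub> m \<oplus>\<^bsub>A\<^esub> u \<otimes>\<^bsub>A\<^esub> y"
      using c mult_add[OF c(2,4,3)] one_right[OF c(2)] ms(3) by (simp add: y_def)
    have "u \<otimes>\<^bsub>A\<^esub> m = u \<ominus>\<^bsub>A\<^esub> u \<otimes>\<^bsub>A\<^esub> y"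
      by (subst (2) u) (use c in \<open>simp add: a_minus_def M.a_assoc M.r_neg mult_closed\<close>)
    hence umU: "u \<otimes>\<^bsub>A\<^esub> m \<in> U" using submodule_minus[OF sU eu(2) lU[OF c(2) y(2)]] by simp
    have "\<one>\<^bsub>A\<^esub> = (e \<oplus>\<^bsub>A\<^esub> u \<otimes>\<^bsub>A\<^esub> y) \<oplus>\<^bsub>A\<^esub> u \<otimes>\<^bsub>A\<^esub> m"
      unfolding eu(3) by (subst (1) u) (use c in \<open>simp add: M.a_ac mult_closed\<close>)
    moreover have "e \<oplus>\<^bsub>A\<^esub> u \<otimes>\<^bsub>A\<^esub> y \<in> L" by (intro submodule_add[OF sL] eu(1) lL c(2) y(1))
    moreover have "u \<otimes>\<^bsub>A\<^esub> m \<in> U \<inter> I" using umU maximal_left_idealD(3)[OF I c(2) ms(1)] by simp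
    moreover have "left_ideal (U \<inter> I) A"
      using maximal_left_idealD(3)[OF I] lU submodule_Int[OF sU sI] by (simp add: left_ideal_iff)
    ultimately have "U \<inter> I \<in> \<U>" unfolding \<U>_def by blast
    hence "U \<inter> I = U" using min by blast
    thus False using x(2) \<open>x \<notin> I\<close> by blast
  qed
  note ec = Lc[OF eu(1)] and uc = Uc[OF eu(2)]
  have r: "x \<otimes>\<^bsub>A\<^esub> u \<in> J" if x: "x \<in> L" for x
    by (intro LU rL[OF uc x] lU[OF Lc[OF x] eu(2)])
  have one_e: "u = \<one>\<^bsub>A\<^esub> \<ominus>\<^bsub>A\<^esub> e"
    unfolding eu(3) M.a_comm[OF ec uc] using ec uc by (simp add: a_minus_def M.a_assoc M.r_neg)
  have "x \<ominus>\<^bsub>A\<^esub> x \<otimes>\<^bsub>A\<^esub> e \<in> J" if x: "x \<in> L" for x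
    using r[OF x] Lc[OF x] ec by (simp add: one_e mult_minus one_right one_closed)
  \<comment> \<open>\<open>U\<close> is only a left ideal, so u x need not lie in it. But u x s u x
    contains the factor x s u, which is in the radical as in \<open>r\<close>;
    \<open>radical_square\<close> then removes the repetition.\<close>
  moreover have "x \<ominus>\<^bsub>A\<^esub> e \<otimes>\<^bsub>A\<^esub> x \<in> J" if x: "x \<in> L" for x
  proof -
    note xc = Lc[OF x]
    have "u \<otimes>\<^bsub>A\<^esub> x \<in> J"
    proof (rule radical_square)
      fix s assume s: "s \<in> carrier A"
      have "u \<otimes>\<^bsub>A\<^esub> ((x \<otimes>\<^bsub>A\<^esub> s) \<otimes>\<^bsub>A\<^esub> u) \<otimes>\<^bsub>A\<^esub> x \<in> J"
        by (intro radical_left radical_right r rL uc xc s x)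
      thus "u \<otimes>\<^bsub>A\<^esub> x \<otimes>\<^bsub>A\<^esub> s \<otimes>\<^bsub>A\<^esub> (u \<otimes>\<^bsub>A\<^esub> x) \<in> J"
        using uc xc s by (simp add: assoc mult_closed)
    qed (use uc xc in \<open>simp add: mult_closed\<close>)
    thus ?thesis using xc ec by (simp add: one_e minus_mult one_left one_closed)
  qed
  ultimately show ?thesis using eu(1) by blast
qed

end

text \<open>The form in which semisimplicity of \<open>sigma_alg\<close> is used: every ideal has an
  identity element, so ideals split off as direct factors.\<close>

definition unital_ideals :: "('f, 'a) module \<Rightarrow> bool" where
  "unital_ideals S \<longleftrightarrow> (\<forall>I. ideal I S \<longrightarrow> (\<exists>e\<in>I. \<forall>x\<in>I. e \<otimes>\<^bsub>S\<^esub> x = x \<and> x \<otimes>\<^bsub>S\<^esub> e = x))"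

lemma (in quot_ideal) quot_assoc_alg:
  assumes "assoc_alg F A"
  shows "assoc_alg F Q"
proof -
  interpret A: assoc_alg F A by fact
  have "(x \<otimes>\<^bsub>Q\<^esub> y) \<otimes>\<^bsub>Q\<^esub> z = x \<otimes>\<^bsub>Q\<^esub> (y \<otimes>\<^bsub>Q\<^esub> z)" if "x \<in> carrier Q" "y \<in> carrier Q" "z \<in> carrier Q" for x y z
    using that by (elim quotE) (simp add: cls_mult mult_closed A.assoc)
  thus ?thesis using quot_falg by (simp add: assoc_alg_def assoc_alg_axioms_def)
qed

lemma (in quot_ideal) quot_fin_dim:
  assumes "fin_dim F A"
  shows "fin_dim F Q"
proof -
  interpret Q: falg F Q by (rule quot_falg)
  show ?thesis using fin_dim_image[OF assms Q.vspace_axioms lin_cls] carrier_quot by simp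
qed

lemma (in assoc_alg) unital_ideals_semisimple:
  assumes fd: "fin_dim F A"
  shows "unital_ideals (quot_alg A J)"
  unfolding unital_ideals_def
proof (intro allI impI)
  interpret Q: quot_ideal F A J by (rule quot_ideal_radical)
  interpret QA: assoc_alg F "quot_alg A J" by (rule Q.quot_assoc_alg[OF assoc_alg_axioms])
  fix I assume "ideal I (quot_alg A J)"
  hence sI: "submodule I F Q.Q" and lrI: "\<And>x p. x \<in> carrier Q.Q \<Longrightarrow> p \<in> I \<Longrightarrow> x \<otimes>\<^bsub>Q.Q\<^esub> p \<in> I \<and> p \<otimes>\<^bsub>Q.Q\<^esub> x \<in> I"
    unfolding QA.ideal_iff by blast+
  interpret c: lin_map F A Q.Q "\<lambda>x. J +>\<^bsub>A\<^esub> x"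
    by (intro lin_mapI vspace_axioms QA.vspace_axioms Q.lin_cls)
  define L where "L = {x \<in> carrier A. J +>\<^bsub>A\<^esub> x \<in> I}"
  have L: "ideal L A"
    unfolding ideal_iff L_def using c.vimage_submodule[OF sI] lrI
    by (auto simp: mult_closed Q.cls_mult[symmetric])
  have "J \<subseteq> L"
  proof
    fix x assume x: "x \<in> J"
    hence xc: "x \<in> carrier A" by (rule radicalD(2))
    hence "J +>\<^bsub>A\<^esub> x = \<zero>\<^bsub>Q.Q\<^esub>" using x Q.cls_eq_zero by blast
    thus "x \<in> L" using xc QA.submodule_zero[OF sI] by (simp add: L_def)
  qed
  then obtain e where e: "e \<in> L" and eL: "\<forall>x\<in>L. x \<ominus>\<^bsub>A\<^esub> x \<otimes>\<^bsub>A\<^esub> e \<in> J \<and> x \<ominus>\<^bsub>A\<^esub> e \<otimes>\<^bsub>A\<^esub> x \<in> J"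
    using ideal_unit_mod_radical[OF fd L] by blast
  have ec: "e \<in> carrier A" "J +>\<^bsub>A\<^esub> e \<in> I" using e by (simp_all add: L_def)
  have "(J +>\<^bsub>A\<^esub> e) \<otimes>\<^bsub>Q.Q\<^esub> t = t \<and> t \<otimes>\<^bsub>Q.Q\<^esub> (J +>\<^bsub>A\<^esub> e) = t" if t: "t \<in> I" for t
  proof -
    obtain x where x: "x \<in> carrier A" "t = J +>\<^bsub>A\<^esub> x" using QA.submodule_mem[OF sI t] by (rule Q.quotE)
    hence "x \<in> L" using t by (simp add: L_def)
    hence "x \<ominus>\<^bsub>A\<^esub> x \<otimes>\<^bsub>A\<^esub> e \<in> J" "x \<ominus>\<^bsub>A\<^esub> e \<otimes>\<^bsub>A\<^esub> x \<in> J" using eL by blast+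
    hence "J +>\<^bsub>A\<^esub> x = J +>\<^bsub>A\<^esub> (x \<otimes>\<^bsub>A\<^esub> e)" "J +>\<^bsub>A\<^esub> x = J +>\<^bsub>A\<^esub> (e \<otimes>\<^bsub>A\<^esub> x)"
      using x ec by (simp_all add: Q.cls_eq mult_closed)
    from this[symmetric] show ?thesis using x ec by (simp add: Q.cls_mult)
  qed
  thus "\<exists>e\<in>I. \<forall>x\<in>I. e \<otimes>\<^bsub>quot_alg A J\<^esub> x = x \<and> x \<otimes>\<^bsub>quot_alg A J\<^esub> e = x" using ec(2) by blast
qed

section \<open>Multiplication operators\<close>

text \<open>The multiplication algebra of \<open>A\<close>, as a set of functions. A scalar acts as
  multiplication by c 1, and composites are obtained in \<open>mult_ops_comp\<close>, so neither
  needs a rule.\<close>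

inductive_set mult_ops :: "('f, 'a) module \<Rightarrow> ('a \<Rightarrow> 'a) set" for A :: "('f, 'a) module" where
  mult_ops_id: "(\<lambda>x. x) \<in> mult_ops A"
| mult_ops_left: "a \<in> carrier A \<Longrightarrow> f \<in> mult_ops A \<Longrightarrow> (\<lambda>x. a \<otimes>\<^bsub>A\<^esub> f x) \<in> mult_ops A"
| mult_ops_right: "a \<in> carrier A \<Longrightarrow> f \<in> mult_ops A \<Longrightarrow> (\<lambda>x. f x \<otimes>\<^bsub>A\<^esub> a) \<in> mult_ops A"
| mult_ops_add: "f \<in> mult_ops A \<Longrightarrow> g \<in> mult_ops A \<Longrightarrow> (\<lambda>x. f x \<oplus>\<^bsub>A\<^esub> g x) \<in> mult_ops A"

lemma mult_ops_comp: "f \<in> mult_ops A \<Longrightarrow> g \<in> mult_ops A \<Longrightarrow> (\<lambda>x. f (g x)) \<in> mult_ops A"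
  by (induction rule: mult_ops.induct) (auto intro: mult_ops.intros)

context assoc_alg
begin

lemma mult_ops_lin: "f \<in> mult_ops A \<Longrightarrow> lin F A A f"
proof (induction rule: mult_ops.induct)
  case mult_ops_id
  thus ?case by (rule lin_id)
next
  case (mult_ops_left a f)
  show ?case by (rule lin_comp[OF mult_ops_left(3) lin_mult_left[OF mult_ops_left(1)]])
next
  case (mult_ops_right a f)
  show ?case by (rule lin_comp[OF mult_ops_right(3) lin_mult_right[OF mult_ops_right(1)]])
next
  case (mult_ops_add f g)
  thus ?case by (intro lin_plus)
qed

lemma mult_ops_closed: "f \<in> mult_ops A \<Longrightarrow> x \<in> carrier A \<Longrightarrow> f x \<in> carrier A"
  by (rule lin_closed[OF mult_ops_lin])

lemma mult_ops_zero: "f \<in> mult_ops A \<Longrightarrow> f \<zero>\<^bsub>A\<^esub> = \<zero>\<^bsub>A\<^esub>"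
  by (rule lin_map.zero[OF lin_mapI[OF vspace_axioms vspace_axioms mult_ops_lin]])

lemma mult_ops_ideal:
  assumes I: "ideal I A" and x: "x \<in> I" and f: "f \<in> mult_ops A"
  shows "f x \<in> I"
  using f
proof (induction rule: mult_ops.induct)
  case (mult_ops_add f g)
  thus ?case using I submodule_add[of I] unfolding ideal_iff by blast
qed (use I x in \<open>simp_all add: ideal_iff\<close>)

lemma mult_ops_sub:
  assumes f: "f \<in> mult_ops A" and g: "g \<in> mult_ops A"
  shows "\<exists>h\<in>mult_ops A. \<forall>x\<in>carrier A. h x = f x \<ominus>\<^bsub>A\<^esub> g x"
proof (intro bexI ballI)
  show "(\<lambda>x. f x \<oplus>\<^bsub>A\<^esub> (\<ominus>\<^bsub>A\<^esub> \<one>\<^bsub>A\<^esub>) \<otimes>\<^bsub>A\<^esub> g x) \<in> mult_ops A"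
    by (intro mult_ops.intros f g) (simp add: one_closed)
  show "f x \<oplus>\<^bsub>A\<^esub> (\<ominus>\<^bsub>A\<^esub> \<one>\<^bsub>A\<^esub>) \<otimes>\<^bsub>A\<^esub> g x = f x \<ominus>\<^bsub>A\<^esub> g x" if "x \<in> carrier A" for x
    using mult_ops_closed[OF g that] by (simp add: neg_mult one_left one_closed a_minus_def)
qed

lemma ideal_unit_central:
  assumes S: "ideal S A" and e: "e \<in> S" "\<forall>x\<in>S. e \<otimes>\<^bsub>A\<^esub> x = x \<and> x \<otimes>\<^bsub>A\<^esub> e = x" and x: "x \<in> carrier A"
  shows "e \<otimes>\<^bsub>A\<^esub> x = x \<otimes>\<^bsub>A\<^esub> e"
proof -
  have m: "e \<otimes>\<^bsub>A\<^esub> x \<in> S" "x \<otimes>\<^bsub>A\<^esub> e \<in> S" and c: "e \<in> carrier A"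
    using S x e(1) submodule_mem[of S e] unfolding ideal_iff by blast+
  have "e \<otimes>\<^bsub>A\<^esub> x = (e \<otimes>\<^bsub>A\<^esub> x) \<otimes>\<^bsub>A\<^esub> e" using e(2) m(1) by simp
  also have "\<dots> = e \<otimes>\<^bsub>A\<^esub> (x \<otimes>\<^bsub>A\<^esub> e)" using c x by (simp add: assoc)
  also have "\<dots> = x \<otimes>\<^bsub>A\<^esub> e" using e(2) m(2) by simp
  finally show ?thesis .
qed

text \<open>Removes the description operator from \<open>simple_components\<close>, identity
  elements being unique, and the nucleus from \<open>central\<close>, which is everything in an
  associative algebra.\<close>

lemma component_central_iff:
  assumes S: "ideal S A" and e: "e \<in> S" "\<forall>x\<in>S. e \<otimes>\<^bsub>A\<^esub> x = x \<and> x \<otimes>\<^bsub>A\<^esub> e = x"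
  shows "central F (A\<lparr>carrier := S, one := (THE e. e \<in> S \<and> (\<forall>x\<in>S. e \<otimes>\<^bsub>A\<^esub> x = x \<and> x \<otimes>\<^bsub>A\<^esub> e = x))\<rparr>) \<longleftrightarrow>
    e \<noteq> \<zero>\<^bsub>A\<^esub> \<and> (\<forall>c\<in>S. (\<forall>x\<in>S. c \<otimes>\<^bsub>A\<^esub> x = x \<otimes>\<^bsub>A\<^esub> c) \<longrightarrow> (\<exists>k\<in>carrier F. c = k \<odot>\<^bsub>A\<^esub> e))"
proof -
  have sS: "submodule S F A" and mS: "x \<otimes>\<^bsub>A\<^esub> y \<in> S" if "x \<in> S" "y \<in> S" for x y
    using S that submodule_mem[of S] unfolding ideal_iff by blast+
  have sS: "submodule S F A" using S by (simp add: ideal_iff)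
  note Sc = submodule_mem[OF sS]
  have the: "(THE e. e \<in> S \<and> (\<forall>x\<in>S. e \<otimes>\<^bsub>A\<^esub> x = x \<and> x \<otimes>\<^bsub>A\<^esub> e = x)) = e"
  proof (rule the_equality)
    fix e' assume "e' \<in> S \<and> (\<forall>x\<in>S. e' \<otimes>\<^bsub>A\<^esub> x = x \<and> x \<otimes>\<^bsub>A\<^esub> e' = x)"
    hence "e' \<otimes>\<^bsub>A\<^esub> e = e" "e' \<otimes>\<^bsub>A\<^esub> e = e'" using e by blast+
    thus "e' = e" by simp
  qed (use e in blast)
  define C where "C = A\<lparr>carrier := S, one := e\<rparr>"
  have Cs: "carrier C = S" "\<one>\<^bsub>C\<^esub> = e" "\<zero>\<^bsub>C\<^esub> = \<zero>\<^bsub>A\<^esub>" "monoid.mult C = monoid.mult A" "add C = add A" "smult C = smult A"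
    by (simp_all add: C_def)
  have "module F (A\<lparr>carrier := S\<rparr>)" by (rule submodule.submodule_is_module[OF sS module_axioms])
  hence "module F C"
    unfolding module_def abelian_group_def abelian_monoid_def abelian_group_axioms_def module_axioms_def by (simp add: C_def)
  hence "nonassoc_algebra F C"
    using e by (intro nonassoc_algebra.intro nonassoc_algebra_axioms.intro R.field_axioms)
      (auto simp: Cs mS Sc add_mult mult_add smult_mult mult_smult)
  then interpret C: falg F C by (rule falgI)
  have cen: "x \<in> alg_center C \<longleftrightarrow> x \<in> S \<and> (\<forall>y\<in>S. x \<otimes>\<^bsub>A\<^esub> y = y \<otimes>\<^bsub>A\<^esub> x)" for x
    unfolding C.alg_center_iff C.nucleus_iff Cs using Sc by (auto simp: assoc)
  show ?thesis
    unfolding the C_def[symmetric]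
  proof (intro iffI conjI ballI impI)
    assume c: "central F C"
    show "e \<noteq> \<zero>\<^bsub>A\<^esub>" using C.centralD(1)[OF c] by (simp add: Cs)
    fix x assume "x \<in> S" "\<forall>y\<in>S. x \<otimes>\<^bsub>A\<^esub> y = y \<otimes>\<^bsub>A\<^esub> x"
    thus "\<exists>k\<in>carrier F. x = k \<odot>\<^bsub>A\<^esub> e" using C.centralD(2)[OF c, of x] by (simp add: cen Cs)
  next
    assume "e \<noteq> \<zero>\<^bsub>A\<^esub> \<and> (\<forall>c\<in>S. (\<forall>x\<in>S. c \<otimes>\<^bsub>A\<^esub> x = x \<otimes>\<^bsub>A\<^esub> c) \<longrightarrow> (\<exists>k\<in>carrier F. c = k \<odot>\<^bsub>A\<^esub> e))"
    thus "central F C" by (intro C.centralI) (simp_all add: cen Cs)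
  qed
qed

end

text \<open>The component is kept inside the ambient algebra instead of becoming a record of its
  own, so that its operators use coefficients from \<open>A\<close> and can be lifted along maps out
  of \<open>A\<close>.\<close>

locale central_component = assoc_alg +
  fixes S e
  assumes S: "minimal_ideal S A" and e: "e \<in> S" "\<forall>x\<in>S. e \<otimes>\<^bsub>A\<^esub> x = x \<and> x \<otimes>\<^bsub>A\<^esub> e = x"
    and center: "\<And>c. c \<in> S \<Longrightarrow> (\<And>x. x \<in> S \<Longrightarrow> c \<otimes>\<^bsub>A\<^esub> x = x \<otimes>\<^bsub>A\<^esub> c) \<Longrightarrow> \<exists>k\<in>carrier F. c = k \<odot>\<^bsub>A\<^esub> e"
begin

lemma S_ideal: "ideal S A"
  using S by (simp add: minimal_ideal_def)

lemma S_submodule: "submodule S F A"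
  and S_right: "x \<in> carrier A \<Longrightarrow> s \<in> S \<Longrightarrow> s \<otimes>\<^bsub>A\<^esub> x \<in> S"
  using S_ideal by (simp_all add: ideal_iff)

lemmas S_mem = submodule_mem[OF S_submodule]
lemmas e_mem = S_mem[OF e(1)]

lemma e_unit: "x \<in> S \<Longrightarrow> e \<otimes>\<^bsub>A\<^esub> x = x" "x \<in> S \<Longrightarrow> x \<otimes>\<^bsub>A\<^esub> e = x"
  using e(2) by simp_all

lemma e_central: "x \<in> carrier A \<Longrightarrow> e \<otimes>\<^bsub>A\<^esub> x = x \<otimes>\<^bsub>A\<^esub> e"
  by (rule ideal_unit_central[OF S_ideal e])

text \<open>The values of the multiplication operators at \<open>x\<close> form the ideal generated
  by \<open>x\<close>, which is \<open>S\<close> by minimality and so contains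
  \<open>e\<close>.\<close>

lemma ex_mult_op_unit:
  assumes x: "x \<in> S" "x \<noteq> \<zero>\<^bsub>A\<^esub>"
  shows "\<exists>f\<in>mult_ops A. f x = e"
proof -
  define I where "I = (\<lambda>f. f x) ` mult_ops A"
  note xc = S_mem[OF x(1)]
  have IS: "I \<subseteq> S" unfolding I_def using mult_ops_ideal[OF S_ideal x(1)] by blast
  have I_val: "f x \<in> I" if "f \<in> mult_ops A" for f unfolding I_def using that by (rule imageI)
  have L: "a \<otimes>\<^bsub>A\<^esub> y \<in> I" and Rr: "y \<otimes>\<^bsub>A\<^esub> a \<in> I" if a: "a \<in> carrier A" and y: "y \<in> I" for a y
  proof -
    obtain f where f: "f \<in> mult_ops A" "y = f x" using y unfolding I_def by (rule imageE)
    show "a \<otimes>\<^bsub>A\<^esub> y \<in> I" "y \<otimes>\<^bsub>A\<^esub> a \<in> I"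
      unfolding f(2) using I_val[OF mult_ops_left[OF a f(1)]] I_val[OF mult_ops_right[OF a f(1)]] .
  qed
  have xI: "x \<in> I" by (rule I_val[OF mult_ops_id])
  have "additive_subgroup I A"
  proof (rule additive_subgroupI, rule M.add.subgroupI)
    show "I \<subseteq> carrier A" using IS S_mem by blast
    show "I \<noteq> {}" using xI by blast
    show "\<ominus>\<^bsub>A\<^esub> y \<in> I" if y: "y \<in> I" for y
    proof -
      have yc: "y \<in> carrier A" using y IS S_mem by blast
      have "(\<ominus>\<^bsub>A\<^esub> \<one>\<^bsub>A\<^esub>) \<otimes>\<^bsub>A\<^esub> y \<in> I" by (intro L y) (simp add: one_closed)
      thus ?thesis using yc by (simp add: neg_mult one_closed one_left)
    qed
    show "y \<oplus>\<^bsub>A\<^esub> z \<in> I" if yz: "y \<in> I" "z \<in> I" for y z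
    proof -
      obtain f g where fg: "f \<in> mult_ops A" "y = f x" "g \<in> mult_ops A" "z = g x"
        using yz unfolding I_def by (elim imageE)
      show ?thesis unfolding fg(2,4) by (rule I_val[OF mult_ops_add[OF fg(1,3)]])
    qed
  qed
  hence "submodule I F A" by (rule additive_subgroup_submodule) (rule L)
  hence "ideal I A" using L Rr by (simp add: ideal_iff)
  hence "I = S" using S IS xI x(2) unfolding minimal_ideal_def by blast
  hence "e \<in> I" using e(1) by simp
  then obtain f where "f \<in> mult_ops A" "e = f x" unfolding I_def by (rule imageE)
  thus ?thesis by (intro bexI[of _ f]) simp_all
qed

text \<open>Artin--Whaples: multiplication operators act densely on a central simple algebra.\<close>

lemma density:
  assumes "x \<in> S" "set ys \<subseteq> S" "\<forall>f\<in>mult_ops A. (\<forall>y\<in>set ys. f y = \<zero>\<^bsub>A\<^esub>) \<longrightarrow> f x = \<zero>\<^bsub>A\<^esub>"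
    and N: "submodule N F A" "set ys \<subseteq> N"
  shows "x \<in> N"
  using assms(1,2,3,5)
proof (induction ys arbitrary: x)
  case Nil
  hence "x = \<zero>\<^bsub>A\<^esub>" using mult_ops_id[of A] by auto
  thus ?case using submodule_zero[OF N(1)] by simp
next
  case (Cons y ys)
  define O' where "O' = {f \<in> mult_ops A. \<forall>z\<in>set ys. f z = \<zero>\<^bsub>A\<^esub>}"
  have kill: "f x = \<zero>\<^bsub>A\<^esub>" if "f \<in> O'" "f y = \<zero>\<^bsub>A\<^esub>" for f
    using Cons.prems(3) that by (simp add: O'_def)
  have y: "y \<in> S" "y \<in> N" and ys: "set ys \<subseteq> S" "set ys \<subseteq> N" using Cons.prems by auto
  show ?case
  proof (cases "\<forall>f\<in>O'. f y = \<zero>\<^bsub>A\<^esub>")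
    case True
    show ?thesis
    proof (rule Cons.IH[OF Cons.prems(1) ys(1) ballI[OF impI] ys(2)])
      fix f assume "f \<in> mult_ops A" "\<forall>y\<in>set ys. f y = \<zero>\<^bsub>A\<^esub>"
      hence "f \<in> O'" by (simp add: O'_def)
      thus "f x = \<zero>\<^bsub>A\<^esub>" using bspec[OF True, of f] by (intro kill[of f]) simp_all
    qed
  next
    case False
    then obtain f where f: "f \<in> O'" "f y \<noteq> \<zero>\<^bsub>A\<^esub>" by blast
    hence "f y \<in> S" using mult_ops_ideal[OF S_ideal y(1)] by (simp add: O'_def)
    then obtain g where g: "g \<in> mult_ops A" "g (f y) = e" using ex_mult_op_unit f(2) by blast
    define m where "m = (\<lambda>x. g (f x))"
    have m: "m \<in> mult_ops A" "m y = e" and mys: "\<And>z. z \<in> set ys \<Longrightarrow> m z = \<zero>\<^bsub>A\<^esub>"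
      using f(1) g mult_ops_zero[OF g(1)] by (simp_all add: m_def O'_def mult_ops_comp)
    \<comment> \<open>An operator that kills \<open>ys\<close> and \<open>y\<close> kills
      \<open>x\<close>; so among operators killing \<open>ys\<close>, the value at \<open>x\<close>
      is determined by the value at \<open>y\<close>.\<close>
    have sub: "n x = p x" if n: "n \<in> mult_ops A" "p \<in> mult_ops A" "n y = p y"
      and z: "\<And>z. z \<in> set ys \<Longrightarrow> n z = \<zero>\<^bsub>A\<^esub>" "\<And>z. z \<in> set ys \<Longrightarrow> p z = \<zero>\<^bsub>A\<^esub>" for n p
    proof -
      obtain h where h: "h \<in> mult_ops A" "\<forall>x\<in>carrier A. h x = n x \<ominus>\<^bsub>A\<^esub> p x" using mult_ops_sub[OF n(1,2)] by blast
      note cl = mult_ops_closed[OF n(2) S_mem]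
      have "h \<in> O'" using h z S_mem ys by (auto simp: O'_def)
      moreover have "h y = \<zero>\<^bsub>A\<^esub>" using h S_mem[OF y(1)] n(3) cl[OF y(1)] by (simp add: eq_minus_zero)
      ultimately have "h x = \<zero>\<^bsub>A\<^esub>" by (rule kill[of h])
      thus ?thesis using h(2) S_mem[OF Cons.prems(1)] mult_ops_closed n(1,2) by (simp add: eq_minus_zero)
    qed
    define c where "c = m x"
    have cS: "c \<in> S" unfolding c_def by (rule mult_ops_ideal[OF S_ideal Cons.prems(1) m(1)])
    \<comment> \<open>Following \<open>m\<close> by left or right multiplication with s gives two
      operators that kill \<open>ys\<close> and have the same value s at \<open>y\<close>. They
      agree at \<open>x\<close>, so \<open>c\<close> commutes with s.\<close>
    have "\<exists>k\<in>carrier F. c = k \<odot>\<^bsub>A\<^esub> e"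
    proof (rule center[OF cS])
      fix s assume s: "s \<in> S"
      note sc = S_mem[OF s]
      have "m x \<otimes>\<^bsub>A\<^esub> s = s \<otimes>\<^bsub>A\<^esub> m x"
        by (rule sub[of "\<lambda>x. m x \<otimes>\<^bsub>A\<^esub> s" "\<lambda>x. s \<otimes>\<^bsub>A\<^esub> m x"])
          (use sc s e_unit mys m in \<open>simp_all add: mult_ops_left mult_ops_right\<close>)
      thus "c \<otimes>\<^bsub>A\<^esub> s = s \<otimes>\<^bsub>A\<^esub> c" by (simp add: c_def)
    qed
    then obtain k where k: "k \<in> carrier F" "c = k \<odot>\<^bsub>A\<^esub> e" by blast
    \<comment> \<open>For an operator n that kills \<open>ys\<close>, \<open>sub\<close> gives n(x)
      = n(y) m(x) = k n(y), so n kills \<open>z\<close> and the induction hypothesis applies to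
      \<open>z\<close>.\<close>
    define z where "z = x \<ominus>\<^bsub>A\<^esub> k \<odot>\<^bsub>A\<^esub> y"
    have ky: "k \<odot>\<^bsub>A\<^esub> y \<in> S" by (rule submodule_smult[OF S_submodule k(1) y(1)])
    have zS: "z \<in> S" unfolding z_def by (rule submodule_minus[OF S_submodule Cons.prems(1) ky])
    note xc = S_mem[OF Cons.prems(1)] and yc = S_mem[OF y(1)] and kyc = S_mem[OF ky]
    have "z \<in> N"
    proof (rule Cons.IH[OF zS ys(1) ballI[OF impI] ys(2)])
      fix n assume n: "n \<in> mult_ops A" "\<forall>y\<in>set ys. n y = \<zero>\<^bsub>A\<^esub>"
      define s where "s = n y"
      have s: "s \<in> S" unfolding s_def by (rule mult_ops_ideal[OF S_ideal y(1) n(1)])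
      note sc = S_mem[OF s]
      have "n x = s \<otimes>\<^bsub>A\<^esub> m x"
        by (rule sub[of n "\<lambda>x. s \<otimes>\<^bsub>A\<^esub> m x"])
          (use n m sc s e_unit mys in \<open>simp_all add: mult_ops_left s_def[symmetric]\<close>)
      also have "\<dots> = k \<odot>\<^bsub>A\<^esub> s" unfolding c_def[symmetric] k(2) using k(1) sc e_mem s by (simp add: mult_smult e_unit)
      finally have nx: "n x = k \<odot>\<^bsub>A\<^esub> s" .
      interpret n: lin_map F A A n by (rule lin_mapI[OF vspace_axioms vspace_axioms mult_ops_lin[OF n(1)]])
      have "n z = n x \<ominus>\<^bsub>A\<^esub> k \<odot>\<^bsub>A\<^esub> n y" unfolding z_def using xc yc kyc k(1) by simp
      thus "n z = \<zero>\<^bsub>A\<^esub>" unfolding nx using k(1) sc by (simp add: s_def[symmetric] eq_minus_zero)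
    qed
    hence "z \<oplus>\<^bsub>A\<^esub> k \<odot>\<^bsub>A\<^esub> y \<in> N" by (intro submodule_add[OF N(1)] submodule_smult[OF N(1)] k(1) y(2))
    thus ?thesis using xc kyc by (simp add: z_def a_minus_def M.a_assoc M.l_neg)
  qed
qed

text \<open>Normalise a vector x0 of \<open>S\<close> to have value 1 under \<phi>. It lies outside
  the kernel of \<phi>, so by \<open>density\<close> some operator kills finitely many given vectors
  of that kernel but not x0, and it can be arranged to send x0 to \<open>e\<close>.\<close>

lemma mult_op_form:
  assumes fd: "fin_dim F A" and \<phi>: "lin F A (self_mod F) \<phi>"
  shows "\<exists>f\<in>mult_ops A. \<forall>x\<in>carrier A. f x = \<phi> (e \<otimes>\<^bsub>A\<^esub> x) \<odot>\<^bsub>A\<^esub> e"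
proof (cases "\<forall>x\<in>S. \<phi> x = \<zero>")
  case True
  show ?thesis
  proof (intro bexI ballI)
    show "(\<lambda>x. \<zero>\<^bsub>A\<^esub> \<otimes>\<^bsub>A\<^esub> x) \<in> mult_ops A" by (intro mult_ops.intros) simp
    fix x assume x: "x \<in> carrier A"
    have "\<phi> (e \<otimes>\<^bsub>A\<^esub> x) = \<zero>" using True S_right[OF x e(1)] by blast
    thus "\<zero>\<^bsub>A\<^esub> \<otimes>\<^bsub>A\<^esub> x = \<phi> (e \<otimes>\<^bsub>A\<^esub> x) \<odot>\<^bsub>A\<^esub> e" using x e_mem by simp
  qed
next
  case False
  then obtain x1 where x1: "x1 \<in> S" "\<phi> x1 \<noteq> \<zero>" by blast
  interpret \<phi>: lin_map F A "self_mod F" \<phi> by (intro lin_mapI vspace_axioms R.vspace_self_mod \<phi>)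
  have \<phi>c: "\<And>x. x \<in> carrier A \<Longrightarrow> \<phi> x \<in> carrier F" using lin_closed[OF \<phi>] by simp
  have i: "inv (\<phi> x1) \<in> carrier F" "inv (\<phi> x1) \<otimes> \<phi> x1 = \<one>"
    using \<phi>c[OF S_mem[OF x1(1)]] x1(2) by (simp_all add: R.field_Units)
  define x0 where "x0 = inv (\<phi> x1) \<odot>\<^bsub>A\<^esub> x1"
  have x0: "x0 \<in> S" "\<phi> x0 = \<one>"
    using submodule_smult[OF S_submodule i(1) x1(1)] \<phi>.smult[OF i(1) S_mem[OF x1(1)]] i(2) by (simp_all add: x0_def)
  note x0c = S_mem[OF x0(1)]
  obtain fr where fr: "frame F A fr" using fin_dim.ex_frame[OF fd] by blast
  \<comment> \<open>Multiplication by \<open>e\<close> followed by the projection of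
    \<open>S\<close> onto the kernel of \<phi> along x0. An operator that kills the values on a
    frame kills all values, and then only the coefficient of x0 is left.\<close>
  define L where "L = (\<lambda>u. e \<otimes>\<^bsub>A\<^esub> u \<ominus>\<^bsub>A\<^esub> \<phi> (e \<otimes>\<^bsub>A\<^esub> u) \<odot>\<^bsub>A\<^esub> x0)"
  have linL: "lin F A A L"
    unfolding L_def by (intro lin_diff lin_mult_left e_mem lin_form_smult x0c lin_comp[OF lin_mult_left[OF e_mem] \<phi>])
  have eS: "e \<otimes>\<^bsub>A\<^esub> u \<in> S" if "u \<in> carrier A" for u by (rule S_right[OF that e(1)])
  have LS: "L u \<in> S" if u: "u \<in> carrier A" for u
    unfolding L_def by (intro submodule_minus[OF S_submodule] submodule_smult[OF S_submodule] eS u x0 \<phi>c S_mem)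
  have L\<phi>: "\<phi> (L u) = \<zero>" if u: "u \<in> carrier A" for u
    unfolding L_def using S_mem[OF eS[OF u]] x0c x0(2) \<phi>c[OF S_mem[OF eS[OF u]]]
    by (simp add: a_minus_def R.r_neg)
  define ys where "ys = map (\<lambda>p. L (fst p)) fr"
  have fst_fr: "fst p \<in> carrier A" if "p \<in> set fr" for p using frameD(1)[OF fr, of "fst p" "snd p"] that by simp
  have "\<exists>m\<in>mult_ops A. (\<forall>y\<in>set ys. m y = \<zero>\<^bsub>A\<^esub>) \<and> m x0 \<noteq> \<zero>\<^bsub>A\<^esub>"
  proof (rule ccontr)
    assume no: "\<not> ?thesis"
    have "x0 \<in> {x \<in> carrier A. \<phi> x = \<zero>\<^bsub>self_mod F\<^esub>}"
    proof (rule density[OF x0(1) _ _ \<phi>.kernel_submodule])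
      show "set ys \<subseteq> S" "set ys \<subseteq> {x \<in> carrier A. \<phi> x = \<zero>\<^bsub>self_mod F\<^esub>}"
        using fst_fr LS L\<phi> S_mem by (auto simp: ys_def)
      show "\<forall>f\<in>mult_ops A. (\<forall>y\<in>set ys. f y = \<zero>\<^bsub>A\<^esub>) \<longrightarrow> f x0 = \<zero>\<^bsub>A\<^esub>" using no by blast
    qed
    thus False using x0(2) by simp
  qed
  then obtain m where m: "m \<in> mult_ops A" "\<forall>y\<in>set ys. m y = \<zero>\<^bsub>A\<^esub>" "m x0 \<noteq> \<zero>\<^bsub>A\<^esub>" by blast
  obtain g where g: "g \<in> mult_ops A" "g (m x0) = e"
    using ex_mult_op_unit[OF mult_ops_ideal[OF S_ideal x0(1) m(1)] m(3)] by blast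
  have gm: "(\<lambda>x. g (m x)) \<in> mult_ops A" by (rule mult_ops_comp[OF g(1) m(1)])
  interpret h: lin_map F A A "\<lambda>x. g (m x)" by (rule lin_mapI[OF vspace_axioms vspace_axioms mult_ops_lin[OF gm]])
  have hL: "lin F A A (\<lambda>x. g (m (L x)))" by (rule lin_comp[OF linL mult_ops_lin[OF gm]])
  have z: "g (m (L x)) = \<zero>\<^bsub>A\<^esub>" if x: "x \<in> carrier A" for x
  proof -
    have c: "snd p x \<in> carrier F" if "p \<in> set fr" for p
      using lin_closed[OF frameD(2)[OF fr, of "fst p" "snd p"] x] that by simp
    have "g (m (L x)) = g (m (L (lsum A (map (\<lambda>p. snd p x \<odot>\<^bsub>A\<^esub> fst p) fr))))"
      using frameD(3)[OF fr x] by (simp add: split_def)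
    also have "\<dots> = lsum A (map (\<lambda>p. g (m (L (snd p x \<odot>\<^bsub>A\<^esub> fst p)))) fr)"
      by (rule lin_lsum_map[OF vspace_axioms vspace_axioms hL]) (simp add: c fst_fr)
    also have "\<dots> = \<zero>\<^bsub>A\<^esub>"
    proof (rule M.lsum_map_zero)
      fix p assume p: "p \<in> set fr"
      have "m (L (fst p)) = \<zero>\<^bsub>A\<^esub>" using m(2) p by (simp add: ys_def)
      hence "g (m (L (fst p))) = \<zero>\<^bsub>A\<^esub>" using mult_ops_zero[OF g(1)] by simp
      thus "g (m (L (snd p x \<odot>\<^bsub>A\<^esub> fst p))) = \<zero>\<^bsub>A\<^esub>" using lin_smult[OF hL c[OF p] fst_fr[OF p]] c[OF p] by simp
    qed
    finally show ?thesis .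
  qed
  show ?thesis
  proof (intro bexI ballI)
    show "(\<lambda>x. g (m (e \<otimes>\<^bsub>A\<^esub> x))) \<in> mult_ops A"
      by (rule mult_ops_comp[OF gm mult_ops_left[OF e_mem mult_ops_id]])
    fix x assume x: "x \<in> carrier A"
    note ex = S_mem[OF eS[OF x]]
    have hc: "g (m (e \<otimes>\<^bsub>A\<^esub> x)) \<in> carrier A" by (rule h.closed[OF ex])
    have "g (m (e \<otimes>\<^bsub>A\<^esub> x)) \<ominus>\<^bsub>A\<^esub> \<phi> (e \<otimes>\<^bsub>A\<^esub> x) \<odot>\<^bsub>A\<^esub> e = \<zero>\<^bsub>A\<^esub>"
      using z[OF x] h.minus[OF ex, of "\<phi> (e \<otimes>\<^bsub>A\<^esub> x) \<odot>\<^bsub>A\<^esub> x0"] h.smult[OF \<phi>c[OF ex] x0c] \<phi>c[OF ex] x0c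
      by (simp add: L_def g(2))
    thus "g (m (e \<otimes>\<^bsub>A\<^esub> x)) = \<phi> (e \<otimes>\<^bsub>A\<^esub> x) \<odot>\<^bsub>A\<^esub> e"
      using hc \<phi>c[OF ex] e_mem by (simp add: eq_minus_zero)
  qed
qed

end

section \<open>Components of an algebra spanned by two commuting subalgebras\<close>

text \<open>A weak form of C = A \<otimes> B that asks for commutation and spanning only. It passes
  to the quotients by the radicals once \<open>\<alpha>_radical\<close> is known, see
  \<open>commuting_pair_radical\<close>.\<close>

locale commuting_pair = A: assoc_alg F A + B: assoc_alg F B + C: assoc_alg F C
  for F :: "('f, 'k) ring_scheme" (structure) and A :: "('f, 'a) module" (structure)
    and B :: "('f, 'b) module" (structure) and C :: "('f, 'c) module" (structure) +
  fixes \<alpha> \<beta>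
  assumes \<alpha>: "alg_hom F A C \<alpha>" and \<beta>: "alg_hom F B C \<beta>"
    and comm: "a \<in> carrier A \<Longrightarrow> b \<in> carrier B \<Longrightarrow> \<alpha> a \<otimes>\<^bsub>C\<^esub> \<beta> b = \<beta> b \<otimes>\<^bsub>C\<^esub> \<alpha> a"
    and span: "submodule N F C \<Longrightarrow>
      (\<And>a b. a \<in> carrier A \<Longrightarrow> b \<in> carrier B \<Longrightarrow> \<alpha> a \<otimes>\<^bsub>C\<^esub> \<beta> b \<in> N) \<Longrightarrow> N = carrier C"
begin

lemma swap: "commuting_pair F B A C \<beta> \<alpha>"
proof (intro commuting_pair.intro commuting_pair_axioms.intro B.assoc_alg_axioms A.assoc_alg_axioms C.assoc_alg_axioms \<alpha> \<beta>)
  show "\<beta> b \<otimes>\<^bsub>C\<^esub> \<alpha> a = \<alpha> a \<otimes>\<^bsub>C\<^esub> \<beta> b" if "b \<in> carrier B" "a \<in> carrier A" for a b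
    using comm[OF that(2,1)] by simp
  fix N assume N: "submodule N F C" and g: "\<And>b a. b \<in> carrier B \<Longrightarrow> a \<in> carrier A \<Longrightarrow> \<beta> b \<otimes>\<^bsub>C\<^esub> \<alpha> a \<in> N"
  show "N = carrier C"
  proof (rule span[OF N])
    fix a b assume ab: "a \<in> carrier A" "b \<in> carrier B"
    show "\<alpha> a \<otimes>\<^bsub>C\<^esub> \<beta> b \<in> N" unfolding comm[OF ab] by (rule g[OF ab(2,1)])
  qed
qed

lemmas comm' = comm[symmetric]

lemmas \<alpha>_closed [simp, intro] = alg_homD(4)[OF \<alpha>]
lemmas \<beta>_closed [simp, intro] = alg_homD(4)[OF \<beta>]
lemmas \<alpha>_mult = alg_homD(3)[OF \<alpha>]

lemma lin_eq_span:
  assumes g: "lin F C C g" and h: "lin F C C h"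
    and eq: "\<And>a b. a \<in> carrier A \<Longrightarrow> b \<in> carrier B \<Longrightarrow> g (\<alpha> a \<otimes>\<^bsub>C\<^esub> \<beta> b) = h (\<alpha> a \<otimes>\<^bsub>C\<^esub> \<beta> b)"
    and q: "q \<in> carrier C"
  shows "g q = h q"
proof -
  interpret d: lin_map F C C "\<lambda>x. g x \<ominus>\<^bsub>C\<^esub> h x"
    by (intro lin_mapI C.vspace_axioms C.lin_diff g h)
  have "{x \<in> carrier C. g x \<ominus>\<^bsub>C\<^esub> h x = \<zero>\<^bsub>C\<^esub>} = carrier C"
  proof (rule span[OF d.kernel_submodule])
    fix a b assume ab: "a \<in> carrier A" "b \<in> carrier B"
    hence c: "\<alpha> a \<otimes>\<^bsub>C\<^esub> \<beta> b \<in> carrier C" by (intro C.mult_closed) auto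
    thus "\<alpha> a \<otimes>\<^bsub>C\<^esub> \<beta> b \<in> {x \<in> carrier C. g x \<ominus>\<^bsub>C\<^esub> h x = \<zero>\<^bsub>C\<^esub>}"
      using eq[OF ab] lin_closed[OF h c] by (simp add: C.eq_minus_zero)
  qed
  hence "g q \<ominus>\<^bsub>C\<^esub> h q = \<zero>\<^bsub>C\<^esub>" using q by blast
  thus ?thesis using lin_closed[OF g q] lin_closed[OF h q] by (simp add: C.eq_minus_zero)
qed

text \<open>Enlarge a maximal left ideal I of \<open>C\<close> to a proper subspace V maximal among
  those stable under the image of \<open>A\<close>. Then C / V is a simple \<open>A\<close>-module,
  which the radical of \<open>A\<close> annihilates. The elements u with C u inside V form a proper
  left ideal containing I, hence equal to I, and the image of \<open>q\<close> is one of
  them.\<close>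

lemma \<alpha>_radical:
  assumes fd: "fin_dim F C" and q: "q \<in> jacobson_radical A"
  shows "\<alpha> q \<in> jacobson_radical C"
proof (rule C.radicalI)
  have qc: "q \<in> carrier A" by (rule A.radicalD(2)[OF q])
  thus "\<alpha> q \<in> carrier C" by simp
  fix I assume I: "maximal_left_ideal I C"
  note sI = C.maximal_left_idealD(2)[OF I] and lI = C.maximal_left_idealD(3)[OF I]
  define \<V> where "\<V> = {V. submodule V F C \<and> (\<forall>a\<in>carrier A. \<forall>v\<in>V. \<alpha> a \<otimes>\<^bsub>C\<^esub> v \<in> V) \<and> I \<subseteq> V \<and> V \<noteq> carrier C}"
  have "\<exists>V\<in>\<V>. \<forall>V' \<in> \<V>. V \<subseteq> V' \<longrightarrow> V' = V"
  proof (rule fin_dim.ex_maximal_submodule[OF fd])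
    have "I \<noteq> carrier C" using C.maximal_left_idealD(4)[OF I] C.one_closed by blast
    thus "I \<in> \<V>" using sI lI by (simp add: \<V>_def)
  qed (simp add: \<V>_def)
  then obtain V where "V \<in> \<V>" and max: "\<forall>V' \<in> \<V>. V \<subseteq> V' \<longrightarrow> V' = V" by (rule bexE)
  hence V: "submodule V F C" "\<And>a v. a \<in> carrier A \<Longrightarrow> v \<in> V \<Longrightarrow> \<alpha> a \<otimes>\<^bsub>C\<^esub> v \<in> V" "I \<subseteq> V" "V \<noteq> carrier C"
    by (simp_all add: \<V>_def)
  have act: "\<alpha> p \<otimes>\<^bsub>C\<^esub> v \<in> V" if p: "p \<in> jacobson_radical A" and v: "v \<in> carrier C" for p v
  proof (rule radical_action[OF A.assoc_alg_axioms C.assoc_alg_axioms \<alpha> V(1,2) _ p v])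
    fix W assume W: "submodule W F C" "\<And>a v. a \<in> carrier A \<Longrightarrow> v \<in> W \<Longrightarrow> \<alpha> a \<otimes>\<^bsub>C\<^esub> v \<in> W" "V \<subseteq> W"
    have "W \<in> \<V>" if "W \<noteq> carrier C" using W(1,2) that subset_trans[OF V(3) W(3)] by (simp add: \<V>_def)
    thus "W = V \<or> W = carrier C" using max W(3) by blast
  qed
  define U where "U = {u \<in> carrier C. \<forall>x\<in>carrier C. x \<otimes>\<^bsub>C\<^esub> u \<in> V}"
  have "submodule U F C"
    by (rule C.submoduleI)
      (auto simp: U_def C.mult_add C.mult_neg C.mult_smult C.submodule_zero[OF V(1)]
        intro: C.submodule_add[OF V(1)] C.submodule_neg[OF V(1)] C.submodule_smult[OF V(1)])
  hence "left_ideal U C"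
    unfolding C.left_ideal_iff by (auto simp: U_def C.mult_closed C.assoc[symmetric])
  moreover have "I \<subseteq> U" using lI V(3) C.submodule_mem[OF sI] by (auto simp: U_def)
  moreover have "U \<noteq> carrier C"
  proof
    assume "U = carrier C"
    hence "\<one>\<^bsub>C\<^esub> \<in> U" using C.one_closed by simp
    hence "carrier C \<subseteq> V" by (auto simp: U_def C.one_right)
    thus False using V(4) C.submodule_subset[OF V(1)] by blast
  qed
  ultimately have "U = I" using C.maximal_left_idealD(5)[OF I] by blast
  interpret r: lin_map F C C "\<lambda>x. x \<otimes>\<^bsub>C\<^esub> \<alpha> q" by (rule C.lin_map_mult_right) (simp add: qc)
  have "{x \<in> carrier C. x \<otimes>\<^bsub>C\<^esub> \<alpha> q \<in> V} = carrier C"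
  proof (rule span[OF r.vimage_submodule[OF V(1)]])
    fix a b assume ab: "a \<in> carrier A" "b \<in> carrier B"
    have "\<alpha> a \<otimes>\<^bsub>C\<^esub> \<beta> b \<otimes>\<^bsub>C\<^esub> \<alpha> q = \<alpha> (a \<otimes>\<^bsub>A\<^esub> q) \<otimes>\<^bsub>C\<^esub> \<beta> b"
      using ab qc by (simp add: C.assoc \<alpha>_mult comm')
    also have "\<dots> \<in> V" using ab by (intro act A.radical_left q) auto
    finally show "\<alpha> a \<otimes>\<^bsub>C\<^esub> \<beta> b \<in> {x \<in> carrier C. x \<otimes>\<^bsub>C\<^esub> \<alpha> q \<in> V}" using ab by (simp add: C.mult_closed)
  qed
  hence "\<alpha> q \<in> U" using qc by (auto simp: U_def)
  thus "\<alpha> q \<in> I" using \<open>U = I\<close> by simp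
qed

text \<open>\<open>E\<close> plays the part of f \<otimes> id. As \<open>C\<close> is merely spanned
  by the products, a linear f on \<open>A\<close> need not induce such a map; a multiplication
  operator does, by the same operations with coefficients in the image of \<open>A\<close>. The last
  two clauses record what is lost in mere linearity: ideals are preserved, and an element
  centralising the image of \<open>A\<close> is only multiplied.\<close>

definition lifts :: "('a \<Rightarrow> 'a) \<Rightarrow> ('c \<Rightarrow> 'c) \<Rightarrow> bool" where
  "lifts f E \<longleftrightarrow> lin F C C E \<and> (\<forall>a\<in>carrier A. \<forall>b\<in>carrier B. E (\<alpha> a \<otimes>\<^bsub>C\<^esub> \<beta> b) = \<alpha> (f a) \<otimes>\<^bsub>C\<^esub> \<beta> b) \<and>
    (\<forall>I. ideal I C \<longrightarrow> (\<forall>q\<in>I. E q \<in> I)) \<and>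
    (\<forall>c\<in>carrier C. (\<forall>a\<in>carrier A. \<alpha> a \<otimes>\<^bsub>C\<^esub> c = c \<otimes>\<^bsub>C\<^esub> \<alpha> a) \<longrightarrow> E c = \<alpha> (f \<one>\<^bsub>A\<^esub>) \<otimes>\<^bsub>C\<^esub> c)"

lemma liftsD:
  assumes "lifts f E"
  shows "lin F C C E" "\<forall>a\<in>carrier A. \<forall>b\<in>carrier B. E (\<alpha> a \<otimes>\<^bsub>C\<^esub> \<beta> b) = \<alpha> (f a) \<otimes>\<^bsub>C\<^esub> \<beta> b"
    "\<forall>I. ideal I C \<longrightarrow> (\<forall>q\<in>I. E q \<in> I)"
    "\<forall>c\<in>carrier C. (\<forall>a\<in>carrier A. \<alpha> a \<otimes>\<^bsub>C\<^esub> c = c \<otimes>\<^bsub>C\<^esub> \<alpha> a) \<longrightarrow> E c = \<alpha> (f \<one>\<^bsub>A\<^esub>) \<otimes>\<^bsub>C\<^esub> c"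
  using assms unfolding lifts_def by simp_all

lemma lift_mult_op:
  assumes f: "f \<in> mult_ops A"
  shows "\<exists>E. lifts f E"
  using f
proof (induction rule: mult_ops.induct)
  case mult_ops_id
  show ?case by (rule exI[of _ "\<lambda>x. x"]) (simp add: lifts_def lin_id alg_homD(2)[OF \<alpha>] C.one_left)
next
  case (mult_ops_left a f)
  then obtain E where "lifts f E" by blast
  note E = liftsD[OF this]
  note fc = A.mult_ops_closed[OF mult_ops_left(2)] and a = mult_ops_left(1)
  show ?case unfolding lifts_def
  proof (intro exI[of _ "\<lambda>x. \<alpha> a \<otimes>\<^bsub>C\<^esub> E x"] conjI allI ballI impI)
    show "lin F C C (\<lambda>x. \<alpha> a \<otimes>\<^bsub>C\<^esub> E x)" using a by (intro lin_comp[OF E(1) C.lin_mult_left]) simp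
    show "\<alpha> a \<otimes>\<^bsub>C\<^esub> E (\<alpha> x \<otimes>\<^bsub>C\<^esub> \<beta> b) = \<alpha> (a \<otimes>\<^bsub>A\<^esub> f x) \<otimes>\<^bsub>C\<^esub> \<beta> b" if "x \<in> carrier A" "b \<in> carrier B" for x b
      using that a fc[OF that(1)] E(2) by (simp add: \<alpha>_mult C.assoc)
    show "\<alpha> a \<otimes>\<^bsub>C\<^esub> E q \<in> I" if "ideal I C" "q \<in> I" for I q
      using E(3) that a unfolding C.ideal_iff by simp
    fix c assume c: "c \<in> carrier C" "\<forall>a\<in>carrier A. \<alpha> a \<otimes>\<^bsub>C\<^esub> c = c \<otimes>\<^bsub>C\<^esub> \<alpha> a"
    hence "E c = \<alpha> (f \<one>\<^bsub>A\<^esub>) \<otimes>\<^bsub>C\<^esub> c" using E(4) by blast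
    thus "\<alpha> a \<otimes>\<^bsub>C\<^esub> E c = \<alpha> (a \<otimes>\<^bsub>A\<^esub> f \<one>\<^bsub>A\<^esub>) \<otimes>\<^bsub>C\<^esub> c"
      using a c(1) fc[OF A.one_closed] by (simp add: \<alpha>_mult C.assoc)
  qed
next
  case (mult_ops_right a f)
  then obtain E where "lifts f E" by blast
  note E = liftsD[OF this]
  note fc = A.mult_ops_closed[OF mult_ops_right(2)] and a = mult_ops_right(1)
  show ?case unfolding lifts_def
  proof (intro exI[of _ "\<lambda>x. E x \<otimes>\<^bsub>C\<^esub> \<alpha> a"] conjI allI ballI impI)
    show "lin F C C (\<lambda>x. E x \<otimes>\<^bsub>C\<^esub> \<alpha> a)" using a by (intro lin_comp[OF E(1) C.lin_mult_right]) simp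
    show "E (\<alpha> x \<otimes>\<^bsub>C\<^esub> \<beta> b) \<otimes>\<^bsub>C\<^esub> \<alpha> a = \<alpha> (f x \<otimes>\<^bsub>A\<^esub> a) \<otimes>\<^bsub>C\<^esub> \<beta> b" if "x \<in> carrier A" "b \<in> carrier B" for x b
      using that a fc[OF that(1)] E(2) by (simp add: \<alpha>_mult C.assoc comm')
    show "E q \<otimes>\<^bsub>C\<^esub> \<alpha> a \<in> I" if "ideal I C" "q \<in> I" for I q
      using E(3) that a unfolding C.ideal_iff by simp
    fix c assume c: "c \<in> carrier C" "\<forall>a\<in>carrier A. \<alpha> a \<otimes>\<^bsub>C\<^esub> c = c \<otimes>\<^bsub>C\<^esub> \<alpha> a"
    hence "E c = \<alpha> (f \<one>\<^bsub>A\<^esub>) \<otimes>\<^bsub>C\<^esub> c" using E(4) by blast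
    moreover have "c \<otimes>\<^bsub>C\<^esub> \<alpha> a = \<alpha> a \<otimes>\<^bsub>C\<^esub> c" using c(2) a by simp
    ultimately show "E c \<otimes>\<^bsub>C\<^esub> \<alpha> a = \<alpha> (f \<one>\<^bsub>A\<^esub> \<otimes>\<^bsub>A\<^esub> a) \<otimes>\<^bsub>C\<^esub> c"
      using a c(1) fc[OF A.one_closed] by (simp add: \<alpha>_mult C.assoc)
  qed
next
  case (mult_ops_add f g)
  obtain E where "lifts f E" using mult_ops_add(3) by (rule exE)
  note E = liftsD[OF this]
  obtain E' where "lifts g E'" using mult_ops_add(4) by (rule exE)
  note E' = liftsD[OF this]
  note fc = A.mult_ops_closed[OF mult_ops_add(1)] and gc = A.mult_ops_closed[OF mult_ops_add(2)]
  have add: "\<alpha> (f x \<oplus>\<^bsub>A\<^esub> g x) = \<alpha> (f x) \<oplus>\<^bsub>C\<^esub> \<alpha> (g x)" if "x \<in> carrier A" for x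
    using alg_homD(5)[OF \<alpha> fc[OF that] gc[OF that]] .
  show ?case unfolding lifts_def
  proof (intro exI[of _ "\<lambda>x. E x \<oplus>\<^bsub>C\<^esub> E' x"] conjI allI ballI impI)
    show "lin F C C (\<lambda>x. E x \<oplus>\<^bsub>C\<^esub> E' x)" by (intro C.lin_plus E(1) E'(1))
    show "E (\<alpha> x \<otimes>\<^bsub>C\<^esub> \<beta> b) \<oplus>\<^bsub>C\<^esub> E' (\<alpha> x \<otimes>\<^bsub>C\<^esub> \<beta> b) = \<alpha> (f x \<oplus>\<^bsub>A\<^esub> g x) \<otimes>\<^bsub>C\<^esub> \<beta> b" if "x \<in> carrier A" "b \<in> carrier B" for x b
      using that fc[OF that(1)] gc[OF that(1)] E(2) E'(2) by (simp add: add C.add_mult)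
    show "E q \<oplus>\<^bsub>C\<^esub> E' q \<in> I" if I: "ideal I C" "q \<in> I" for I q
    proof (rule C.submodule_add)
      show "submodule I F C" using I(1) by (simp add: C.ideal_iff)
      show "E q \<in> I" "E' q \<in> I" using E(3) E'(3) I by blast+
    qed
    fix c assume c: "c \<in> carrier C" "\<forall>a\<in>carrier A. \<alpha> a \<otimes>\<^bsub>C\<^esub> c = c \<otimes>\<^bsub>C\<^esub> \<alpha> a"
    hence "E c = \<alpha> (f \<one>\<^bsub>A\<^esub>) \<otimes>\<^bsub>C\<^esub> c" "E' c = \<alpha> (g \<one>\<^bsub>A\<^esub>) \<otimes>\<^bsub>C\<^esub> c" using E(4) E'(4) by blast+
    thus "E c \<oplus>\<^bsub>C\<^esub> E' c = \<alpha> (f \<one>\<^bsub>A\<^esub> \<oplus>\<^bsub>A\<^esub> g \<one>\<^bsub>A\<^esub>) \<otimes>\<^bsub>C\<^esub> c"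
      using c(1) fc[OF A.one_closed] gc[OF A.one_closed] by (simp add: add A.one_closed C.add_mult)
  qed
qed

text \<open>\<open>E\<close> is the operator x \<mapsto> \<phi>(e x) e tensored with the identity: a
  contraction by \<phi> that stays inside \<open>C\<close> and inside each of its ideals.\<close>

definition slice :: "'a \<Rightarrow> ('a \<Rightarrow> 'f) \<Rightarrow> ('c \<Rightarrow> 'c) \<Rightarrow> bool" where
  "slice e \<phi> E \<longleftrightarrow> lin F C C E \<and>
    (\<forall>a\<in>carrier A. \<forall>b\<in>carrier B. E (\<alpha> a \<otimes>\<^bsub>C\<^esub> \<beta> b) = \<phi> (e \<otimes>\<^bsub>A\<^esub> a) \<odot>\<^bsub>C\<^esub> (\<alpha> e \<otimes>\<^bsub>C\<^esub> \<beta> b)) \<and>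
    (\<forall>I. ideal I C \<longrightarrow> (\<forall>q\<in>I. E q \<in> I)) \<and>
    (\<forall>c\<in>carrier C. (\<forall>a\<in>carrier A. \<alpha> a \<otimes>\<^bsub>C\<^esub> c = c \<otimes>\<^bsub>C\<^esub> \<alpha> a) \<longrightarrow> E c = \<phi> e \<odot>\<^bsub>C\<^esub> (\<alpha> e \<otimes>\<^bsub>C\<^esub> c))"

lemma sliceD:
  assumes "slice e \<phi> E"
  shows "lin F C C E"
    "a \<in> carrier A \<Longrightarrow> b \<in> carrier B \<Longrightarrow> E (\<alpha> a \<otimes>\<^bsub>C\<^esub> \<beta> b) = \<phi> (e \<otimes>\<^bsub>A\<^esub> a) \<odot>\<^bsub>C\<^esub> (\<alpha> e \<otimes>\<^bsub>C\<^esub> \<beta> b)"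
    "ideal I C \<Longrightarrow> q \<in> I \<Longrightarrow> E q \<in> I"
    "c \<in> carrier C \<Longrightarrow> (\<And>a. a \<in> carrier A \<Longrightarrow> \<alpha> a \<otimes>\<^bsub>C\<^esub> c = c \<otimes>\<^bsub>C\<^esub> \<alpha> a) \<Longrightarrow> E c = \<phi> e \<odot>\<^bsub>C\<^esub> (\<alpha> e \<otimes>\<^bsub>C\<^esub> c)"
  using assms unfolding slice_def by blast+

lemma ex_slice:
  assumes S: "central_component F A S e" and fd: "fin_dim F A" and \<phi>: "lin F A (self_mod F) \<phi>"
  shows "\<exists>E. slice e \<phi> E"
proof -
  interpret S: central_component F A S e by (rule S)
  obtain f where f: "f \<in> mult_ops A" "\<forall>x\<in>carrier A. f x = \<phi> (e \<otimes>\<^bsub>A\<^esub> x) \<odot>\<^bsub>A\<^esub> e"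
    using S.mult_op_form[OF fd \<phi>] by blast
  obtain E where "lifts f E" using lift_mult_op[OF f(1)] by blast
  note E = liftsD[OF this]
  have \<phi>c: "\<phi> (e \<otimes>\<^bsub>A\<^esub> x) \<in> carrier F" if "x \<in> carrier A" for x
    using lin_closed[OF \<phi> A.mult_closed[OF S.e_mem that]] by simp
  have *: "\<alpha> (f x) \<otimes>\<^bsub>C\<^esub> c = \<phi> (e \<otimes>\<^bsub>A\<^esub> x) \<odot>\<^bsub>C\<^esub> (\<alpha> e \<otimes>\<^bsub>C\<^esub> c)" if "x \<in> carrier A" "c \<in> carrier C" for x c
    using that f(2) \<phi>c[OF that(1)] S.e_mem by (simp add: alg_homD(6)[OF \<alpha>] C.smult_mult)
  have "\<alpha> (f \<one>\<^bsub>A\<^esub>) \<otimes>\<^bsub>C\<^esub> c = \<phi> e \<odot>\<^bsub>C\<^esub> (\<alpha> e \<otimes>\<^bsub>C\<^esub> c)" if "c \<in> carrier C" for c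
    using *[OF A.one_closed that] S.e_mem by (simp add: A.one_right)
  hence "slice e \<phi> E" unfolding slice_def using E * by simp
  thus ?thesis by (intro exI[of _ E])
qed

text \<open>Over a frame of \<open>A\<close> with vectors b and forms \<phi>, the element
  \<alpha>(e) q is the sum of \<alpha>(b) times the slice of q by \<phi>, as one checks on the
  spanning products. If all slices vanished at \<open>q\<close>, then so would
  \<open>q\<close>.\<close>

lemma slice_separates:
  assumes S: "central_component F A S e" and fd: "fin_dim F A"
    and q: "q \<in> carrier C" "\<alpha> e \<otimes>\<^bsub>C\<^esub> q = q" "q \<noteq> \<zero>\<^bsub>C\<^esub>"
  shows "\<exists>\<phi> E. lin F A (self_mod F) \<phi> \<and> slice e \<phi> E \<and> E q \<noteq> \<zero>\<^bsub>C\<^esub>"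
proof (rule ccontr)
  assume no: "\<not> ?thesis"
  interpret S: central_component F A S e by (rule S)
  note ec = S.e_mem
  obtain fr where fr: "frame F A fr" using fin_dim.ex_frame[OF fd] by blast
  have frc: "fst p \<in> carrier A" "lin F A (self_mod F) (snd p)" if "p \<in> set fr" for p
    using frameD(1,2)[OF fr, of "fst p" "snd p"] that by simp_all
  define E where "E = (\<lambda>p :: 'a \<times> ('a \<Rightarrow> 'f). SOME E. slice e (snd p) E)"
  have E: "slice e (snd p) (E p)" if "p \<in> set fr" for p
    unfolding E_def by (rule someI_ex[OF ex_slice[OF S fd frc(2)[OF that]]])
  define h where "h = (\<lambda>q. lsum C (map (\<lambda>p. \<alpha> (fst p) \<otimes>\<^bsub>C\<^esub> E p q) fr))"
  have h: "lin F C C h"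
    unfolding h_def
  proof (rule C.lin_lsum)
    fix p assume p: "p \<in> set fr"
    show "lin F C C (\<lambda>q. \<alpha> (fst p) \<otimes>\<^bsub>C\<^esub> E p q)"
      using frc[OF p] by (intro lin_comp[OF sliceD(1)[OF E[OF p]] C.lin_mult_left]) simp
  qed
  have "\<alpha> e \<otimes>\<^bsub>C\<^esub> q = h q"
  proof (rule lin_eq_span[OF C.lin_mult_left h _ q(1)])
    show "\<alpha> e \<in> carrier C" using ec by simp
    fix a b assume ab: "a \<in> carrier A" "b \<in> carrier B"
    define ea where "ea = e \<otimes>\<^bsub>A\<^esub> a"
    have ea: "ea \<in> carrier A" "ea \<otimes>\<^bsub>A\<^esub> e = ea"
      using ab(1) ec S.e_unit(2)[OF S.S_right[OF ab(1) S.e(1)]] by (simp_all add: ea_def A.mult_closed)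
    have c: "snd p ea \<in> carrier F" if "p \<in> set fr" for p using lin_closed[OF frc(2)[OF that] ea(1)] by simp
    have "\<alpha> ea = lsum C (map (\<lambda>p. \<alpha> (snd p ea \<odot>\<^bsub>A\<^esub> fst p)) fr)"
      using lin_lsum_map[OF A.vspace_axioms C.vspace_axioms alg_homD(1)[OF \<alpha>], of fr "\<lambda>p. snd p ea \<odot>\<^bsub>A\<^esub> fst p"]
        frameD(3)[OF fr ea(1)] c frc by (simp add: split_def)
    also have "\<dots> = lsum C (map (\<lambda>p. snd p ea \<odot>\<^bsub>C\<^esub> \<alpha> (fst p)) fr)"
      by (rule arg_cong[where f="lsum C"], rule map_cong[OF refl]) (simp add: c frc alg_homD(6)[OF \<alpha>])
    finally have aea: "\<alpha> ea = lsum C (map (\<lambda>p. snd p ea \<odot>\<^bsub>C\<^esub> \<alpha> (fst p)) fr)" .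
    have d: "\<alpha> e \<otimes>\<^bsub>C\<^esub> \<beta> b \<in> carrier C" using ec ab by (simp add: C.mult_closed)
    have "\<alpha> e \<otimes>\<^bsub>C\<^esub> (\<alpha> a \<otimes>\<^bsub>C\<^esub> \<beta> b) = \<alpha> (ea \<otimes>\<^bsub>A\<^esub> e) \<otimes>\<^bsub>C\<^esub> \<beta> b"
      unfolding ea(2) using ec ab by (simp add: ea_def \<alpha>_mult C.assoc)
    also have "\<dots> = \<alpha> ea \<otimes>\<^bsub>C\<^esub> (\<alpha> e \<otimes>\<^bsub>C\<^esub> \<beta> b)" using ec ab ea(1) by (simp add: \<alpha>_mult C.assoc)
    also have "\<dots> = lsum C (map (\<lambda>p. (snd p ea \<odot>\<^bsub>C\<^esub> \<alpha> (fst p)) \<otimes>\<^bsub>C\<^esub> (\<alpha> e \<otimes>\<^bsub>C\<^esub> \<beta> b)) fr)"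
      unfolding aea using c frc d by (subst C.lsum_mult) (auto simp: comp_def)
    also have "\<dots> = h (\<alpha> a \<otimes>\<^bsub>C\<^esub> \<beta> b)"
      unfolding h_def
    proof (rule arg_cong[where f="lsum C"], rule map_cong[OF refl])
      fix p assume p: "p \<in> set fr"
      have "E p (\<alpha> a \<otimes>\<^bsub>C\<^esub> \<beta> b) = snd p ea \<odot>\<^bsub>C\<^esub> (\<alpha> e \<otimes>\<^bsub>C\<^esub> \<beta> b)"
        using sliceD(2)[OF E[OF p] ab] by (simp add: ea_def)
      thus "(snd p ea \<odot>\<^bsub>C\<^esub> \<alpha> (fst p)) \<otimes>\<^bsub>C\<^esub> (\<alpha> e \<otimes>\<^bsub>C\<^esub> \<beta> b) = \<alpha> (fst p) \<otimes>\<^bsub>C\<^esub> E p (\<alpha> a \<otimes>\<^bsub>C\<^esub> \<beta> b)"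
        using c[OF p] frc(1)[OF p] d by (simp add: C.smult_mult C.mult_smult)
    qed
    finally show "\<alpha> e \<otimes>\<^bsub>C\<^esub> (\<alpha> a \<otimes>\<^bsub>C\<^esub> \<beta> b) = h (\<alpha> a \<otimes>\<^bsub>C\<^esub> \<beta> b)" .
  qed
  also have "\<dots> = \<zero>\<^bsub>C\<^esub>"
    unfolding h_def
  proof (rule C.M.lsum_map_zero)
    fix p assume p: "p \<in> set fr"
    have "E p q = \<zero>\<^bsub>C\<^esub>" using no E[OF p] frc(2)[OF p] by blast
    thus "\<alpha> (fst p) \<otimes>\<^bsub>C\<^esub> E p q = \<zero>\<^bsub>C\<^esub>" using frc(1)[OF p] by simp
  qed
  finally show False using q by simp
qed

lemma \<alpha>_central:
  assumes e: "e \<in> carrier A" "\<And>x. x \<in> carrier A \<Longrightarrow> e \<otimes>\<^bsub>A\<^esub> x = x \<otimes>\<^bsub>A\<^esub> e" and c: "c \<in> carrier C"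
  shows "\<alpha> e \<otimes>\<^bsub>C\<^esub> c = c \<otimes>\<^bsub>C\<^esub> \<alpha> e"
proof (rule lin_eq_span[OF C.lin_mult_left C.lin_mult_right _ c])
  fix a b assume ab: "a \<in> carrier A" "b \<in> carrier B"
  have "\<alpha> e \<otimes>\<^bsub>C\<^esub> (\<alpha> a \<otimes>\<^bsub>C\<^esub> \<beta> b) = \<alpha> (a \<otimes>\<^bsub>A\<^esub> e) \<otimes>\<^bsub>C\<^esub> \<beta> b"
    using ab e(1) by (simp add: e(2)[symmetric] \<alpha>_mult C.assoc)
  also have "\<dots> = \<alpha> a \<otimes>\<^bsub>C\<^esub> \<beta> b \<otimes>\<^bsub>C\<^esub> \<alpha> e" using ab e(1) by (simp add: \<alpha>_mult C.assoc comm')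
  finally show "\<alpha> e \<otimes>\<^bsub>C\<^esub> (\<alpha> a \<otimes>\<^bsub>C\<^esub> \<beta> b) = \<alpha> a \<otimes>\<^bsub>C\<^esub> \<beta> b \<otimes>\<^bsub>C\<^esub> \<alpha> e" .
qed (use e(1) in auto)

text \<open>The annihilator of \<open>I\<close> in \<open>A\<close> has a complement, and a minimal ideal in this complement
  has an identity that fixes \<open>I\<close>, because \<open>I\<close> is minimal.\<close>

lemma ex_component:
  assumes u: "unital_ideals A" and fd: "fin_dim F A" and I: "minimal_ideal I C"
  shows "\<exists>S e. minimal_ideal S A \<and> e \<in> S \<and> (\<forall>x\<in>S. e \<otimes>\<^bsub>A\<^esub> x = x \<and> x \<otimes>\<^bsub>A\<^esub> e = x) \<and> (\<forall>z\<in>I. \<alpha> e \<otimes>\<^bsub>C\<^esub> z = z)"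
proof -
  have iI: "ideal I C" and I0: "I \<noteq> {\<zero>\<^bsub>C\<^esub>}" and minI: "\<And>J. ideal J C \<Longrightarrow> J \<subseteq> I \<Longrightarrow> J = {\<zero>\<^bsub>C\<^esub>} \<or> J = I"
    using I unfolding minimal_ideal_def by blast+
  have sI: "submodule I F C" and lrI: "\<And>x p. x \<in> carrier C \<Longrightarrow> p \<in> I \<Longrightarrow> x \<otimes>\<^bsub>C\<^esub> p \<in> I \<and> p \<otimes>\<^bsub>C\<^esub> x \<in> I"
    using iI unfolding C.ideal_iff by blast+
  note Ic = C.submodule_mem[OF sI]
  obtain z0 where z0: "z0 \<in> I" "z0 \<noteq> \<zero>\<^bsub>C\<^esub>" using I0 C.submodule_zero[OF sI] by blast
  define N where "N = {a \<in> carrier A. \<forall>z\<in>I. \<alpha> a \<otimes>\<^bsub>C\<^esub> z = \<zero>\<^bsub>C\<^esub>}"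
  interpret \<alpha>: lin_map F A C \<alpha> by (intro lin_mapI A.vspace_axioms C.vspace_axioms alg_homD(1)[OF \<alpha>])
  have "ideal N A"
    unfolding A.ideal_iff
  proof (intro conjI ballI)
    show "submodule N F A"
      by (rule A.submoduleI)
        (auto simp: N_def Ic C.neg_mult alg_homD(5,6)[OF \<alpha>] C.add_mult C.smult_mult)
    fix x p assume x: "x \<in> carrier A" and p: "p \<in> N"
    hence pc: "p \<in> carrier A" and p0: "\<And>z. z \<in> I \<Longrightarrow> \<alpha> p \<otimes>\<^bsub>C\<^esub> z = \<zero>\<^bsub>C\<^esub>" by (simp_all add: N_def)
    show "x \<otimes>\<^bsub>A\<^esub> p \<in> N" using x pc by (simp add: N_def A.mult_closed \<alpha>_mult C.assoc Ic p0)
    have "\<alpha> p \<otimes>\<^bsub>C\<^esub> (\<alpha> x \<otimes>\<^bsub>C\<^esub> z) = \<zero>\<^bsub>C\<^esub>" if "z \<in> I" for z using lrI[OF _ that, of "\<alpha> x"] x by (intro p0) simp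
    thus "p \<otimes>\<^bsub>A\<^esub> x \<in> N" using x pc by (simp add: N_def A.mult_closed \<alpha>_mult C.assoc Ic)
  qed
  then obtain n where n: "n \<in> N" "\<forall>x\<in>N. n \<otimes>\<^bsub>A\<^esub> x = x \<and> x \<otimes>\<^bsub>A\<^esub> n = x"
    using u unfolding unital_ideals_def by blast
  have nc: "n \<in> carrier A" using n(1) by (simp add: N_def)
  note ncen = A.ideal_unit_central[OF \<open>ideal N A\<close> n]
  \<comment> \<open>The complement (1 - n) A of the annihilator \<open>N\<close>; the identity
    \<open>n\<close> of \<open>N\<close> is a central idempotent.\<close>
  define Y where "Y = {a \<in> carrier A. n \<otimes>\<^bsub>A\<^esub> a = \<zero>\<^bsub>A\<^esub>}"
  have Y: "ideal Y A"
    unfolding A.ideal_iff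
  proof (intro conjI ballI)
    show "submodule Y F A"
      using lin_map.kernel_submodule[OF A.lin_map_mult_left[OF nc]] by (simp add: Y_def)
    fix x p assume x: "x \<in> carrier A" and p: "p \<in> Y"
    have "n \<otimes>\<^bsub>A\<^esub> (x \<otimes>\<^bsub>A\<^esub> p) = (x \<otimes>\<^bsub>A\<^esub> n) \<otimes>\<^bsub>A\<^esub> p"
      using x p nc by (simp add: A.assoc[symmetric] ncen Y_def)
    thus "x \<otimes>\<^bsub>A\<^esub> p \<in> Y" using x p nc by (simp add: Y_def A.assoc A.mult_closed)
    have "n \<otimes>\<^bsub>A\<^esub> (p \<otimes>\<^bsub>A\<^esub> x) = (n \<otimes>\<^bsub>A\<^esub> p) \<otimes>\<^bsub>A\<^esub> x" by (rule A.assoc[symmetric]) (use x p nc in \<open>simp_all add: Y_def\<close>)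
    thus "p \<otimes>\<^bsub>A\<^esub> x \<in> Y" using x p nc by (simp add: Y_def A.mult_closed)
  qed
  have Y0: "Y \<noteq> {\<zero>\<^bsub>A\<^esub>}"
  proof
    assume Y0: "Y = {\<zero>\<^bsub>A\<^esub>}"
    have "\<one>\<^bsub>A\<^esub> \<ominus>\<^bsub>A\<^esub> n \<in> Y"
      using nc n by (simp add: Y_def A.mult_minus A.one_right A.one_closed A.eq_minus_zero)
    hence "\<one>\<^bsub>A\<^esub> = n" using Y0 nc A.one_closed by (simp add: A.eq_minus_zero)
    hence "\<alpha> \<one>\<^bsub>A\<^esub> \<otimes>\<^bsub>C\<^esub> z0 = \<zero>\<^bsub>C\<^esub>" using n(1) z0(1) by (simp add: N_def)
    thus False using z0 Ic by (simp add: alg_homD(2)[OF \<alpha>] C.one_left)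
  qed
  define \<U> where "\<U> = {S. ideal S A \<and> S \<noteq> {\<zero>\<^bsub>A\<^esub>} \<and> S \<subseteq> Y}"
  have "\<exists>S\<in>\<U>. \<forall>S' \<in> \<U>. S' \<subseteq> S \<longrightarrow> S' = S"
    by (rule fin_dim.ex_minimal_submodule[OF fd, of _ Y]) (use Y Y0 in \<open>simp_all add: \<U>_def A.ideal_iff\<close>)
  then obtain S where "S \<in> \<U>" and min: "\<forall>S' \<in> \<U>. S' \<subseteq> S \<longrightarrow> S' = S" by (rule bexE)
  hence S: "ideal S A" "S \<noteq> {\<zero>\<^bsub>A\<^esub>}" "S \<subseteq> Y" by (simp_all add: \<U>_def)
  have "minimal_ideal S A"
    unfolding minimal_ideal_def
  proof (intro conjI allI impI S(1,2))
    fix J assume J: "ideal J A \<and> J \<subseteq> S"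
    have "J \<in> \<U>" if "J \<noteq> {\<zero>\<^bsub>A\<^esub>}" using J that S(3) unfolding \<U>_def by blast
    thus "J = {\<zero>\<^bsub>A\<^esub>} \<or> J = S" using min J by blast
  qed
  obtain e where e: "e \<in> S" "\<forall>x\<in>S. e \<otimes>\<^bsub>A\<^esub> x = x \<and> x \<otimes>\<^bsub>A\<^esub> e = x"
    using u S(1) unfolding unital_ideals_def by blast
  have sS: "submodule S F A" using S(1) by (simp add: A.ideal_iff)
  have ec: "e \<in> carrier A" by (rule A.submodule_mem[OF sS e(1)])
  note ecen = A.ideal_unit_central[OF S(1) e]
  have e0: "e \<noteq> \<zero>\<^bsub>A\<^esub>"
  proof
    assume "e = \<zero>\<^bsub>A\<^esub>"
    hence "x = \<zero>\<^bsub>A\<^esub>" if "x \<in> S" for x using e(2) that A.submodule_mem[OF sS that] by force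
    thus False using S(2) A.submodule_zero[OF sS] by blast
  qed
  have eN: "e \<notin> N"
  proof
    assume "e \<in> N"
    hence "n \<otimes>\<^bsub>A\<^esub> e = e" using n(2) by blast
    moreover have "n \<otimes>\<^bsub>A\<^esub> e = \<zero>\<^bsub>A\<^esub>" using e(1) S(3) by (auto simp: Y_def)
    ultimately show False using e0 by simp
  qed
  \<comment> \<open>The part of \<open>I\<close> killed by the image of \<open>e\<close> is an
    ideal, and a proper one because \<open>e\<close> is not in \<open>N\<close>. So it is 0, yet it
    contains the difference of z and \<alpha>(e) z for each z in \<open>I\<close>.\<close>
  define K where "K = {z \<in> carrier C. \<alpha> e \<otimes>\<^bsub>C\<^esub> z = \<zero>\<^bsub>C\<^esub>} \<inter> I"
  have ecenC: "\<alpha> e \<otimes>\<^bsub>C\<^esub> c = c \<otimes>\<^bsub>C\<^esub> \<alpha> e" if "c \<in> carrier C" for c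
    by (rule \<alpha>_central[OF ec _ that]) (rule ecen)
  have aec: "\<alpha> e \<in> carrier C" using ec by simp
  have "ideal K C"
    unfolding C.ideal_iff
  proof (intro conjI ballI)
    show "submodule K F C"
      unfolding K_def by (intro C.submodule_Int sI lin_map.kernel_submodule[OF C.lin_map_mult_left[OF aec]])
    fix x p assume x: "x \<in> carrier C" and p: "p \<in> K"
    hence pc: "p \<in> carrier C" "\<alpha> e \<otimes>\<^bsub>C\<^esub> p = \<zero>\<^bsub>C\<^esub>" "p \<in> I" by (simp_all add: K_def)
    have "\<alpha> e \<otimes>\<^bsub>C\<^esub> (x \<otimes>\<^bsub>C\<^esub> p) = x \<otimes>\<^bsub>C\<^esub> (\<alpha> e \<otimes>\<^bsub>C\<^esub> p)"
      using x pc(1) aec ecenC[OF x] by (simp add: C.assoc[symmetric])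
    thus "x \<otimes>\<^bsub>C\<^esub> p \<in> K" using x pc lrI[OF x pc(3)] by (simp add: K_def C.mult_closed)
    have "\<alpha> e \<otimes>\<^bsub>C\<^esub> (p \<otimes>\<^bsub>C\<^esub> x) = (\<alpha> e \<otimes>\<^bsub>C\<^esub> p) \<otimes>\<^bsub>C\<^esub> x" using x pc(1) aec by (simp add: C.assoc)
    thus "p \<otimes>\<^bsub>C\<^esub> x \<in> K" using x pc lrI[OF x pc(3)] by (simp add: K_def C.mult_closed)
  qed
  moreover have "K \<subseteq> I" by (simp add: K_def)
  moreover have "K \<noteq> I"
  proof
    assume "K = I"
    hence "e \<in> N" using ec by (auto simp: N_def K_def)
    thus False using eN by simp
  qed
  ultimately have K: "K = {\<zero>\<^bsub>C\<^esub>}" using minI by blast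
  have "\<alpha> e \<otimes>\<^bsub>C\<^esub> z = z" if z: "z \<in> I" for z
  proof -
    note zc = Ic[OF z]
    have ez: "\<alpha> e \<otimes>\<^bsub>C\<^esub> z \<in> I" using lrI[OF aec z] by simp
    have "\<alpha> e \<otimes>\<^bsub>C\<^esub> (\<alpha> e \<otimes>\<^bsub>C\<^esub> z) = \<alpha> e \<otimes>\<^bsub>C\<^esub> z"
      using e zc ec \<alpha>_mult[OF ec ec] by (simp add: C.assoc[symmetric])
    hence "z \<ominus>\<^bsub>C\<^esub> \<alpha> e \<otimes>\<^bsub>C\<^esub> z \<in> K"
      using zc aec C.submodule_minus[OF sI z ez] by (simp add: K_def C.mult_minus C.mult_closed C.eq_minus_zero)
    thus ?thesis using K zc aec by (simp add: C.eq_minus_zero C.mult_closed)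
  qed
  thus ?thesis using \<open>minimal_ideal S A\<close> e by blast
qed

text \<open>Slicing on both sides turns every element of \<open>C\<close> into a multiple of u =
  \<alpha>(e) \<beta>(f). Slices preserve \<open>I\<close> and some double slice of a nonzero
  element of \<open>I\<close> is nonzero, so u lies in \<open>I\<close> and is its identity. A
  central element of \<open>I\<close> is fixed by suitably normalised slices, so it is a multiple of
  u.\<close>

lemma component_central:
  assumes SA: "central_component F A S e" and SB: "central_component F B S' f"
    and fA: "fin_dim F A" and fB: "fin_dim F B"
    and I: "minimal_ideal I C" and eI: "\<forall>z\<in>I. \<alpha> e \<otimes>\<^bsub>C\<^esub> z = z" and fI: "\<forall>z\<in>I. \<beta> f \<otimes>\<^bsub>C\<^esub> z = z"
  shows "\<exists>u\<in>I. (\<forall>z\<in>I. u \<otimes>\<^bsub>C\<^esub> z = z \<and> z \<otimes>\<^bsub>C\<^esub> u = z) \<and> u \<noteq> \<zero>\<^bsub>C\<^esub> \<and>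
    (\<forall>c\<in>I. (\<forall>x\<in>I. c \<otimes>\<^bsub>C\<^esub> x = x \<otimes>\<^bsub>C\<^esub> c) \<longrightarrow> (\<exists>k\<in>carrier F. c = k \<odot>\<^bsub>C\<^esub> u))"
proof -
  interpret SA: central_component F A S e by (rule SA)
  interpret SB: central_component F B S' f by (rule SB)
  interpret P: commuting_pair F B A C \<beta> \<alpha> by (rule swap)
  have iI: "ideal I C" and I0: "I \<noteq> {\<zero>\<^bsub>C\<^esub>}" using I unfolding minimal_ideal_def by blast+
  have sI: "submodule I F C" and lrI: "\<And>x p. x \<in> carrier C \<Longrightarrow> p \<in> I \<Longrightarrow> x \<otimes>\<^bsub>C\<^esub> p \<in> I \<and> p \<otimes>\<^bsub>C\<^esub> x \<in> I"
    using iI unfolding C.ideal_iff by blast+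
  note Ic = C.submodule_mem[OF sI]
  define u where "u = \<alpha> e \<otimes>\<^bsub>C\<^esub> \<beta> f"
  have ef: "\<alpha> e \<in> carrier C" "\<beta> f \<in> carrier C" using SA.e_mem SB.e_mem by auto
  have uc: "u \<in> carrier C" using ef by (simp add: u_def C.mult_closed)
  \<comment> \<open>Multiples of \<open>u\<close> form a subspace, so it suffices to slice the
    spanning products; there the result is \<phi>(e a) \<psi>(f b) u.\<close>
  have double: "\<exists>k\<in>carrier F. E' (E q) = k \<odot>\<^bsub>C\<^esub> u"
    if E: "slice e \<phi> E" "lin F A (self_mod F) \<phi>" and E': "P.slice f \<psi> E'" "lin F B (self_mod F) \<psi>"
      and q: "q \<in> carrier C" for \<phi> E \<psi> E' q
  proof -
    interpret k: lin_map F "self_mod F" C "\<lambda>k. k \<odot>\<^bsub>C\<^esub> u"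
      by (intro lin_mapI A.R.vspace_self_mod C.vspace_axioms linI) (use uc in \<open>auto simp: C.smult_l_distr C.smult_assoc1\<close>)
    interpret L: lin_map F C C "\<lambda>q. E' (E q)"
      by (intro lin_mapI C.vspace_axioms lin_comp[OF sliceD(1)[OF E(1)] P.sliceD(1)[OF E'(1)]])
    have "{q \<in> carrier C. E' (E q) \<in> (\<lambda>k. k \<odot>\<^bsub>C\<^esub> u) ` carrier (self_mod F)} = carrier C"
    proof (rule span[OF L.vimage_submodule[OF k.image_submodule[OF k.V.carrier_is_submodule]]])
      fix a b assume ab: "a \<in> carrier A" "b \<in> carrier B"
      have k: "\<phi> (e \<otimes>\<^bsub>A\<^esub> a) \<in> carrier F" "\<psi> (f \<otimes>\<^bsub>B\<^esub> b) \<in> carrier F"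
        using lin_closed[OF E(2) A.mult_closed[OF SA.e_mem ab(1)]] lin_closed[OF E'(2) B.mult_closed[OF SB.e_mem ab(2)]] by simp_all
      have c: "\<alpha> e \<otimes>\<^bsub>C\<^esub> \<beta> b \<in> carrier C" using ab ef by (simp add: C.mult_closed)
      have "E' (E (\<alpha> a \<otimes>\<^bsub>C\<^esub> \<beta> b)) = \<phi> (e \<otimes>\<^bsub>A\<^esub> a) \<odot>\<^bsub>C\<^esub> E' (\<beta> b \<otimes>\<^bsub>C\<^esub> \<alpha> e)"
        using sliceD(2)[OF E(1) ab] lin_smult[OF P.sliceD(1)[OF E'(1)] k(1) c] comm[OF SA.e_mem ab(2)] by simp
      also have "E' (\<beta> b \<otimes>\<^bsub>C\<^esub> \<alpha> e) = \<psi> (f \<otimes>\<^bsub>B\<^esub> b) \<odot>\<^bsub>C\<^esub> u"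
        using P.sliceD(2)[OF E'(1) ab(2) SA.e_mem] comm[OF SA.e_mem SB.e_mem] by (simp add: u_def)
      also have "\<phi> (e \<otimes>\<^bsub>A\<^esub> a) \<odot>\<^bsub>C\<^esub> (\<psi> (f \<otimes>\<^bsub>B\<^esub> b) \<odot>\<^bsub>C\<^esub> u) = (\<phi> (e \<otimes>\<^bsub>A\<^esub> a) \<otimes> \<psi> (f \<otimes>\<^bsub>B\<^esub> b)) \<odot>\<^bsub>C\<^esub> u"
        using k uc by (simp add: C.smult_assoc1)
      finally show "\<alpha> a \<otimes>\<^bsub>C\<^esub> \<beta> b \<in> {q \<in> carrier C. E' (E q) \<in> (\<lambda>k. k \<odot>\<^bsub>C\<^esub> u) ` carrier (self_mod F)}"
        using k ab by (auto simp: C.mult_closed)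
    qed
    thus ?thesis using q by auto
  qed
  obtain q where q: "q \<in> I" "q \<noteq> \<zero>\<^bsub>C\<^esub>" using I0 C.submodule_zero[OF sI] by blast
  have e0: "e \<noteq> \<zero>\<^bsub>A\<^esub>"
  proof
    assume "e = \<zero>\<^bsub>A\<^esub>"
    hence "\<alpha> e = \<zero>\<^bsub>C\<^esub>"
      using lin_map.zero[OF lin_mapI[OF A.vspace_axioms C.vspace_axioms alg_homD(1)[OF \<alpha>]]] by simp
    thus False using bspec[OF eI q(1)] Ic[OF q(1)] q(2) by simp
  qed
  have f0: "f \<noteq> \<zero>\<^bsub>B\<^esub>"
  proof
    assume "f = \<zero>\<^bsub>B\<^esub>"
    hence "\<beta> f = \<zero>\<^bsub>C\<^esub>"
      using lin_map.zero[OF lin_mapI[OF B.vspace_axioms C.vspace_axioms alg_homD(1)[OF \<beta>]]] by simp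
    thus False using bspec[OF fI q(1)] Ic[OF q(1)] q(2) by simp
  qed
  obtain \<phi> E where E: "lin F A (self_mod F) \<phi>" "slice e \<phi> E" "E q \<noteq> \<zero>\<^bsub>C\<^esub>"
    using slice_separates[OF SA fA Ic[OF q(1)] bspec[OF eI q(1)] q(2)] by blast
  have EI: "E q \<in> I" by (rule sliceD(3)[OF E(2) iI q(1)])
  obtain \<psi> E' where E': "lin F B (self_mod F) \<psi>" "P.slice f \<psi> E'" "E' (E q) \<noteq> \<zero>\<^bsub>C\<^esub>"
    using P.slice_separates[OF SB fB Ic[OF EI] bspec[OF fI EI] E(3)] by blast
  obtain k where k: "k \<in> carrier F" "E' (E q) = k \<odot>\<^bsub>C\<^esub> u"
    using double[OF E(2,1) E'(2,1) Ic[OF q(1)]] by blast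
  have k0: "k \<noteq> \<zero>" and u0: "u \<noteq> \<zero>\<^bsub>C\<^esub>" using k E'(3) uc by auto
  have ku: "k \<odot>\<^bsub>C\<^esub> u \<in> I" using P.sliceD(3)[OF E'(2) iI EI] k(2) by simp
  have "inv k \<odot>\<^bsub>C\<^esub> (k \<odot>\<^bsub>C\<^esub> u) \<in> I"
    by (rule C.submodule_smult[OF sI _ ku]) (use k(1) k0 in \<open>simp add: A.R.field_Units\<close>)
  hence uI: "u \<in> I" using C.smult_inv[OF k(1) k0 uc] by simp
  have ea: "\<alpha> e \<otimes>\<^bsub>C\<^esub> c = c \<otimes>\<^bsub>C\<^esub> \<alpha> e" if "c \<in> carrier C" for c
    by (rule \<alpha>_central[OF SA.e_mem _ that]) (rule SA.e_central)
  have fa: "\<beta> f \<otimes>\<^bsub>C\<^esub> c = c \<otimes>\<^bsub>C\<^esub> \<beta> f" if "c \<in> carrier C" for c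
    by (rule P.\<alpha>_central[OF SB.e_mem _ that]) (rule SB.e_central)
  have unit: "u \<otimes>\<^bsub>C\<^esub> z = z \<and> z \<otimes>\<^bsub>C\<^esub> u = z" if z: "z \<in> I" for z
  proof -
    note zc = Ic[OF z]
    have ez: "\<alpha> e \<otimes>\<^bsub>C\<^esub> z = z" and fz: "\<beta> f \<otimes>\<^bsub>C\<^esub> z = z" using eI fI z by simp_all
    have "u \<otimes>\<^bsub>C\<^esub> z = z" using ef zc ez fz by (simp add: u_def C.assoc)
    moreover have "z \<otimes>\<^bsub>C\<^esub> u = z"
    proof -
      have "z \<otimes>\<^bsub>C\<^esub> u = (z \<otimes>\<^bsub>C\<^esub> \<alpha> e) \<otimes>\<^bsub>C\<^esub> \<beta> f" using ef zc by (simp add: u_def C.assoc)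
      also have "\<dots> = z" using ea[OF zc] fa[OF zc] ez fz by simp
      finally show ?thesis .
    qed
    ultimately show ?thesis ..
  qed
  \<comment> \<open>Because c = u c, the element y may be replaced by y u, which lies in
    \<open>I\<close>, where c commutes with everything.\<close>
  have commute: "y \<otimes>\<^bsub>C\<^esub> c = c \<otimes>\<^bsub>C\<^esub> y"
    if c: "c \<in> I" "\<forall>x\<in>I. c \<otimes>\<^bsub>C\<^esub> x = x \<otimes>\<^bsub>C\<^esub> c" and y: "y \<in> carrier C" "y \<otimes>\<^bsub>C\<^esub> u = u \<otimes>\<^bsub>C\<^esub> y" for c y
  proof -
    note cc = Ic[OF c(1)]
    have yu: "y \<otimes>\<^bsub>C\<^esub> u \<in> I" using lrI[OF y(1) uI] by simp
    have "y \<otimes>\<^bsub>C\<^esub> c = (y \<otimes>\<^bsub>C\<^esub> u) \<otimes>\<^bsub>C\<^esub> c" using y(1) uc cc unit[OF c(1)] by (simp add: C.assoc)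
    also have "\<dots> = c \<otimes>\<^bsub>C\<^esub> (u \<otimes>\<^bsub>C\<^esub> y)" using c(2) yu y(2) by simp
    also have "\<dots> = (c \<otimes>\<^bsub>C\<^esub> u) \<otimes>\<^bsub>C\<^esub> y" using y(1) uc cc by (simp add: C.assoc)
    also have "\<dots> = c \<otimes>\<^bsub>C\<^esub> y" using unit[OF c(1)] by simp
    finally show ?thesis .
  qed
  have au: "\<alpha> a \<otimes>\<^bsub>C\<^esub> u = u \<otimes>\<^bsub>C\<^esub> \<alpha> a" if a: "a \<in> carrier A" for a
  proof -
    have "\<alpha> a \<otimes>\<^bsub>C\<^esub> u = (\<alpha> a \<otimes>\<^bsub>C\<^esub> \<alpha> e) \<otimes>\<^bsub>C\<^esub> \<beta> f" using a ef by (simp add: u_def C.assoc)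
    also have "\<dots> = \<alpha> e \<otimes>\<^bsub>C\<^esub> (\<alpha> a \<otimes>\<^bsub>C\<^esub> \<beta> f)" using a ef ea[of "\<alpha> a"] by (simp add: C.assoc[symmetric])
    also have "\<dots> = u \<otimes>\<^bsub>C\<^esub> \<alpha> a" using a ef comm[OF a SB.e_mem] by (simp add: u_def C.assoc)
    finally show ?thesis .
  qed
  have bu: "\<beta> b \<otimes>\<^bsub>C\<^esub> u = u \<otimes>\<^bsub>C\<^esub> \<beta> b" if b: "b \<in> carrier B" for b
  proof -
    have "\<beta> b \<otimes>\<^bsub>C\<^esub> u = \<alpha> e \<otimes>\<^bsub>C\<^esub> (\<beta> b \<otimes>\<^bsub>C\<^esub> \<beta> f)"
      using b ef comm'[OF SA.e_mem b] by (simp add: u_def C.assoc[symmetric])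
    also have "\<dots> = u \<otimes>\<^bsub>C\<^esub> \<beta> b" using b ef fa[of "\<beta> b"] by (simp add: u_def C.assoc)
    finally show ?thesis .
  qed
  have "\<exists>k\<in>carrier F. c = k \<odot>\<^bsub>C\<^esub> u" if c: "c \<in> I" "\<forall>x\<in>I. c \<otimes>\<^bsub>C\<^esub> x = x \<otimes>\<^bsub>C\<^esub> c" for c
  proof -
    note cc = Ic[OF c(1)]
    have ec: "\<alpha> e \<otimes>\<^bsub>C\<^esub> c = c" and fc: "\<beta> f \<otimes>\<^bsub>C\<^esub> c = c" using eI fI c(1) by simp_all
    \<comment> \<open>With values 1 at \<open>e\<close> and \<open>f\<close>, the last clause of
      \<open>slice\<close> says that both slices fix \<open>c\<close>, which commutes with the
      images of \<open>A\<close> and \<open>B\<close>.\<close>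
    obtain \<phi> where \<phi>: "lin F A (self_mod F) \<phi>" "\<phi> e = \<one>"
      using fin_dim.ex_form_one[OF fA SA.e_mem e0] by blast
    obtain \<psi> where \<psi>: "lin F B (self_mod F) \<psi>" "\<psi> f = \<one>"
      using fin_dim.ex_form_one[OF fB SB.e_mem f0] by blast
    obtain E E' where E: "slice e \<phi> E" and E': "P.slice f \<psi> E'"
      using ex_slice[OF SA fA \<phi>(1)] P.ex_slice[OF SB fB \<psi>(1)] by blast
    have "E c = c"
      using sliceD(4)[OF E cc commute[OF c _ au]] \<phi>(2) ec cc by simp
    moreover have "E' c = c"
      using P.sliceD(4)[OF E' cc commute[OF c _ bu]] \<psi>(2) fc cc by simp
    ultimately show ?thesis using double[OF E \<phi>(1) E' \<psi>(1) cc] by simp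
  qed
  thus ?thesis using uI unit u0 by blast
qed

theorem components_central:
  assumes uA: "unital_ideals A" and uB: "unital_ideals B" and fA: "fin_dim F A" and fB: "fin_dim F B"
    and cA: "\<forall>S\<in>simple_components A. central F S" and cB: "\<forall>S\<in>simple_components B. central F S"
    and S: "S \<in> simple_components C"
  shows "central F S"
proof -
  interpret P: commuting_pair F B A C \<beta> \<alpha> by (rule swap)
  obtain I where I: "minimal_ideal I C"
    and S_def: "S = C\<lparr>carrier := I, one := (THE e. e \<in> I \<and> (\<forall>x\<in>I. e \<otimes>\<^bsub>C\<^esub> x = x \<and> x \<otimes>\<^bsub>C\<^esub> e = x))\<rparr>"
    using S unfolding simple_components_def by blast
  obtain U e where U: "minimal_ideal U A" "e \<in> U" "\<forall>x\<in>U. e \<otimes>\<^bsub>A\<^esub> x = x \<and> x \<otimes>\<^bsub>A\<^esub> e = x"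
    and eI: "\<forall>z\<in>I. \<alpha> e \<otimes>\<^bsub>C\<^esub> z = z"
    using ex_component[OF uA fA I] by blast
  obtain W f where W: "minimal_ideal W B" "f \<in> W" "\<forall>x\<in>W. f \<otimes>\<^bsub>B\<^esub> x = x \<and> x \<otimes>\<^bsub>B\<^esub> f = x"
    and fI: "\<forall>z\<in>I. \<beta> f \<otimes>\<^bsub>C\<^esub> z = z"
    using P.ex_component[OF uB fB I] by blast
  have iU: "ideal U A" and iW: "ideal W B" and iI: "ideal I C" using U W I by (simp_all add: minimal_ideal_def)
  have "central F (A\<lparr>carrier := U, one := (THE e. e \<in> U \<and> (\<forall>x\<in>U. e \<otimes>\<^bsub>A\<^esub> x = x \<and> x \<otimes>\<^bsub>A\<^esub> e = x))\<rparr>)"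
    using cA U(1) unfolding simple_components_def by blast
  hence "central_component F A U e"
    using U A.component_central_iff[OF iU U(2,3)]
    by (intro central_component.intro central_component_axioms.intro A.assoc_alg_axioms) simp_all
  moreover have "central F (B\<lparr>carrier := W, one := (THE e. e \<in> W \<and> (\<forall>x\<in>W. e \<otimes>\<^bsub>B\<^esub> x = x \<and> x \<otimes>\<^bsub>B\<^esub> e = x))\<rparr>)"
    using cB W(1) unfolding simple_components_def by blast
  hence "central_component F B W f"
    using W B.component_central_iff[OF iW W(2,3)]
    by (intro central_component.intro central_component_axioms.intro B.assoc_alg_axioms) simp_all
  ultimately obtain u where u: "u \<in> I" "\<forall>z\<in>I. u \<otimes>\<^bsub>C\<^esub> z = z \<and> z \<otimes>\<^bsub>C\<^esub> u = z" "u \<noteq> \<zero>\<^bsub>C\<^esub>"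
    "\<forall>c\<in>I. (\<forall>x\<in>I. c \<otimes>\<^bsub>C\<^esub> x = x \<otimes>\<^bsub>C\<^esub> c) \<longrightarrow> (\<exists>k\<in>carrier F. c = k \<odot>\<^bsub>C\<^esub> u)"
    using component_central[OF _ _ fA fB I eI fI] by blast
  show ?thesis unfolding S_def C.component_central_iff[OF iI u(1,2)] using u(3,4) by blast
qed

end

section \<open>Passage to nuclei and to their quotients by the radicals\<close>

abbreviation quot_radical :: "('f, 'a) module \<Rightarrow> ('f, 'a set) module" where
  "quot_radical A \<equiv> quot_alg A (jacobson_radical A)"

abbreviation nucleus_alg :: "('f, 'a) module \<Rightarrow> ('f, 'a) module" where
  "nucleus_alg A \<equiv> A\<lparr>carrier := nucleus A\<rparr>"

definition quot_map :: "('f, 'b) module \<Rightarrow> 'b set \<Rightarrow> ('a \<Rightarrow> 'b) \<Rightarrow> 'a set \<Rightarrow> 'b set" where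
  "quot_map B P h t = the_elem ((\<lambda>x. P +>\<^bsub>B\<^esub> h x) ` t)"

lemma quot_map:
  fixes F :: "('f, 'k) ring_scheme" and A :: "('f, 'a) module" and B :: "('f, 'b) module"
  assumes A: "quot_ideal F A P" and B: "quot_ideal F B P'" and h: "alg_hom F A B h" and hP: "\<And>x. x \<in> P \<Longrightarrow> h x \<in> P'"
  shows "x \<in> carrier A \<Longrightarrow> quot_map B P' h (P +>\<^bsub>A\<^esub> x) = P' +>\<^bsub>B\<^esub> h x"
    "alg_hom F (quot_alg A P) (quot_alg B P') (quot_map B P' h)"
proof -
  interpret A: quot_ideal F A P by (rule A)
  interpret B: quot_ideal F B P' by (rule B)
  interpret h: lin_map F A B h by (intro lin_mapI A.vspace_axioms B.vspace_axioms alg_homD(1)[OF h])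
  show cls: "quot_map B P' h (P +>\<^bsub>A\<^esub> x) = P' +>\<^bsub>B\<^esub> h x" if x: "x \<in> carrier A" for x
    unfolding quot_map_def
  proof (rule A.the_elem_cls[OF _ x])
    fix x y assume "x \<in> carrier A" "y \<in> carrier A" "x \<ominus>\<^bsub>A\<^esub> y \<in> P"
    thus "P' +>\<^bsub>B\<^esub> h x = P' +>\<^bsub>B\<^esub> h y" using hP[of "x \<ominus>\<^bsub>A\<^esub> y"] by (simp add: B.cls_eq)
  qed
  show "alg_hom F (quot_alg A P) (quot_alg B P') (quot_map B P' h)"
    unfolding alg_hom_def
  proof (intro conjI ballI linI)
    show "quot_map B P' h t \<in> carrier B.Q" if "t \<in> carrier A.Q" for t
      using that by (elim A.quotE) (simp add: cls B.cls_closed)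
    show "quot_map B P' h (s \<oplus>\<^bsub>A.Q\<^esub> t) = quot_map B P' h s \<oplus>\<^bsub>B.Q\<^esub> quot_map B P' h t"
      if "s \<in> carrier A.Q" "t \<in> carrier A.Q" for s t
      using that by (elim A.quotE) (simp add: cls A.cls_add B.cls_add)
    show "quot_map B P' h (c \<odot>\<^bsub>A.Q\<^esub> t) = c \<odot>\<^bsub>B.Q\<^esub> quot_map B P' h t" if "c \<in> carrier F" "t \<in> carrier A.Q" for c t
      using that by (elim A.quotE) (simp add: cls A.cls_smult B.cls_smult)
    show "quot_map B P' h (s \<otimes>\<^bsub>A.Q\<^esub> t) = quot_map B P' h s \<otimes>\<^bsub>B.Q\<^esub> quot_map B P' h t"
      if "s \<in> carrier A.Q" "t \<in> carrier A.Q" for s t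
      using that by (elim A.quotE) (simp add: cls A.cls_mult B.cls_mult A.mult_closed alg_homD(3)[OF h])
    show "quot_map B P' h \<one>\<^bsub>A.Q\<^esub> = \<one>\<^bsub>B.Q\<^esub>"
      by (simp add: A.cls_one[symmetric] B.cls_one[symmetric] cls A.one_closed alg_homD(2)[OF h])
  qed
qed

text \<open>Both maps descend because radicals map into the radical, by
  \<open>\<alpha>_radical\<close> and its mirror image; commutation and spanning are inherited by
  quotients.\<close>

lemma (in commuting_pair) commuting_pair_radical:
  assumes fd: "fin_dim F C"
  shows "commuting_pair F (quot_radical A) (quot_radical B) (quot_radical C)
    (quot_map C (jacobson_radical C) \<alpha>) (quot_map C (jacobson_radical C) \<beta>)"
proof -
  interpret P: commuting_pair F B A C \<beta> \<alpha> by (rule swap)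
  interpret QA: quot_ideal F A "jacobson_radical A" by (rule A.quot_ideal_radical)
  interpret QB: quot_ideal F B "jacobson_radical B" by (rule B.quot_ideal_radical)
  interpret QC: quot_ideal F C "jacobson_radical C" by (rule C.quot_ideal_radical)
  note ma = quot_map[OF A.quot_ideal_radical C.quot_ideal_radical \<alpha> \<alpha>_radical[OF fd]]
  note mb = quot_map[OF B.quot_ideal_radical C.quot_ideal_radical \<beta> P.\<alpha>_radical[OF fd]]
  interpret c: lin_map F C QC.Q "\<lambda>x. jacobson_radical C +>\<^bsub>C\<^esub> x"
    by (intro lin_mapI C.vspace_axioms falg.axioms(1)[OF QC.quot_falg] QC.lin_cls)
  show ?thesis
  proof (intro commuting_pair.intro commuting_pair_axioms.intro ma(2) mb(2)
      QA.quot_assoc_alg[OF A.assoc_alg_axioms] QB.quot_assoc_alg[OF B.assoc_alg_axioms] QC.quot_assoc_alg[OF C.assoc_alg_axioms])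
    fix s t assume "s \<in> carrier QA.Q" "t \<in> carrier QB.Q"
    thus "quot_map C (jacobson_radical C) \<alpha> s \<otimes>\<^bsub>QC.Q\<^esub> quot_map C (jacobson_radical C) \<beta> t =
      quot_map C (jacobson_radical C) \<beta> t \<otimes>\<^bsub>QC.Q\<^esub> quot_map C (jacobson_radical C) \<alpha> s"
      by (elim QA.quotE QB.quotE) (simp add: ma(1) mb(1) QC.cls_mult comm)
  next
    fix N assume N: "submodule N F QC.Q"
      and *: "\<And>s t. s \<in> carrier QA.Q \<Longrightarrow> t \<in> carrier QB.Q \<Longrightarrow>
        quot_map C (jacobson_radical C) \<alpha> s \<otimes>\<^bsub>QC.Q\<^esub> quot_map C (jacobson_radical C) \<beta> t \<in> N"
    have "{x \<in> carrier C. jacobson_radical C +>\<^bsub>C\<^esub> x \<in> N} = carrier C"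
    proof (rule span[OF c.vimage_submodule[OF N]])
      fix a b assume ab: "a \<in> carrier A" "b \<in> carrier B"
      have "jacobson_radical C +>\<^bsub>C\<^esub> (\<alpha> a \<otimes>\<^bsub>C\<^esub> \<beta> b) \<in> N"
        using *[OF QA.cls_closed[OF ab(1)] QB.cls_closed[OF ab(2)]] ab by (simp add: ma(1) mb(1) QC.cls_mult)
      thus "\<alpha> a \<otimes>\<^bsub>C\<^esub> \<beta> b \<in> {x \<in> carrier C. jacobson_radical C +>\<^bsub>C\<^esub> x \<in> N}" using ab by (simp add: C.mult_closed)
    qed
    thus "N = carrier QC.Q"
      using c.W.submodule_subset[OF N] unfolding QC.carrier_quot by blast
  qed
qed

text \<open>The spanning condition is \<open>nucleus_T\<close>, as the product of a \<otimes> 1 and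
  1 \<otimes> b is a \<otimes> b.\<close>

lemma (in tensor) commuting_pair_nucleus:
  assumes fA: "fin_dim F A" and fB: "fin_dim F B"
  shows "commuting_pair F (nucleus_alg A) (nucleus_alg B) (nucleus_alg T)
    (\<lambda>a. tau a \<one>\<^bsub>B\<^esub>) (\<lambda>b. tau \<one>\<^bsub>A\<^esub> b)"
proof -
  have one: "\<one>\<^bsub>A\<^esub> \<in> nucleus A" "\<one>\<^bsub>B\<^esub> \<in> nucleus B"
    using A.nucleus_subalgebra B.nucleus_subalgebra by (simp_all add: subalgebra_def)
  note sA = A.nucleus_subset and sB = B.nucleus_subset
  have NA: "\<And>x. x \<in> nucleus A \<Longrightarrow> x \<in> carrier A" and NB: "\<And>x. x \<in> nucleus B \<Longrightarrow> x \<in> carrier B" using sA sB by blast+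
  note aT = T.assoc_alg_nucleus[OF T.nucleus_subalgebra subset_refl]
  interpret N: assoc_alg F "nucleus_alg T" by (rule aT)
  show ?thesis
  proof (intro commuting_pair.intro commuting_pair_axioms.intro A.assoc_alg_nucleus[OF A.nucleus_subalgebra subset_refl]
      B.assoc_alg_nucleus[OF B.nucleus_subalgebra subset_refl] aT)
    show "alg_hom F (nucleus_alg A) (nucleus_alg T) (\<lambda>a. tau a \<one>\<^bsub>B\<^esub>)"
      unfolding alg_hom_def
    proof (intro conjI ballI)
      show "lin F (nucleus_alg A) (nucleus_alg T) (\<lambda>a. tau a \<one>\<^bsub>B\<^esub>)"
        by (rule lin_corestrict[OF lin_comp[OF lin_restrict[OF sA] lin_tau_left]])
          (simp_all add: tau_nucleus one B.one_closed)
    qed (simp_all add: one_T tau_mult NA B.one_closed B.one_left)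
    show "alg_hom F (nucleus_alg B) (nucleus_alg T) (\<lambda>b. tau \<one>\<^bsub>A\<^esub> b)"
      unfolding alg_hom_def
    proof (intro conjI ballI)
      show "lin F (nucleus_alg B) (nucleus_alg T) (\<lambda>b. tau \<one>\<^bsub>A\<^esub> b)"
        by (rule lin_corestrict[OF lin_comp[OF lin_restrict[OF sB] lin_tau_right]])
          (simp_all add: tau_nucleus one A.one_closed)
    qed (simp_all add: one_T tau_mult NB A.one_closed A.one_left)
  next
    fix N assume N: "submodule N F (nucleus_alg T)"
      and *: "\<And>a b. a \<in> carrier (nucleus_alg A) \<Longrightarrow> b \<in> carrier (nucleus_alg B) \<Longrightarrow>
        tau a \<one>\<^bsub>B\<^esub> \<otimes>\<^bsub>nucleus_alg T\<^esub> tau \<one>\<^bsub>A\<^esub> b \<in> N"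
    have "n \<in> N" if n: "n \<in> nucleus T" for n
    proof -
      obtain ps where ps: "set ps \<subseteq> nucleus A \<times> nucleus B" "n = lsum T (map (\<lambda>(a, b). tau a b) ps)"
        using nucleus_T[OF fA fB n] by blast
      have "tau a b \<in> N" if "a \<in> nucleus A" "b \<in> nucleus B" for a b
        using *[of a b] that by (simp add: tau_mult NA NB A.one_closed B.one_closed A.one_right B.one_left)
      hence "set (map (\<lambda>(a, b). tau a b) ps) \<subseteq> N" using ps(1) by auto
      thus ?thesis using N.submodule_lsum[OF N] ps(2) by simp
    qed
    thus "N = carrier (nucleus_alg T)" using N.submodule_subset[OF N] by auto
  qed (simp add: tau_mult NA NB A.one_closed B.one_closed A.one_left A.one_right B.one_left B.one_right)
qed

theorem proposition16p3:
  fixes F :: "('f, 'k) ring_scheme"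
    and A :: "('f, 'a) module"
    and B :: "('f, 'b) module"
  assumes "field F"
    and "semicentral F A"
    and "semicentral F B"
  shows "semicentral F (tensor_alg F A B)"
proof -
  have sA: "semiassociative F A" and cA: "\<forall>S\<in>atoms A. central F S"
    and sB: "semiassociative F B" and cB: "\<forall>S\<in>atoms B. central F S"
    using assms by (simp_all add: semicentral_def)
  note fA = semiassociativeD(2)[OF sA] and fB = semiassociativeD(2)[OF sB]
  interpret AB: tensor F A B by (intro tensor.intro semiassociativeD(1)[OF sA] semiassociativeD(1)[OF sB])
  have fN: "fin_dim F (nucleus_alg A)" "fin_dim F (nucleus_alg B)"
    "fin_dim F (nucleus_alg AB.T)"
    by (intro fin_dim_submodule fA fB AB.T_fin_dim AB.A.nucleus_submodule AB.B.nucleus_submodule AB.T.nucleus_submodule)+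
  interpret N: commuting_pair F "nucleus_alg A" "nucleus_alg B"
    "nucleus_alg AB.T" "\<lambda>a. AB.tau a \<one>\<^bsub>B\<^esub>" "\<lambda>b. AB.tau \<one>\<^bsub>A\<^esub> b"
    by (rule AB.commuting_pair_nucleus[OF fA fB])
  note cp = N.commuting_pair_radical[OF fN(3)]
  have "central F S" if "S \<in> atoms AB.T" for S
  proof (rule commuting_pair.components_central[OF cp])
    show "unital_ideals (quot_radical (nucleus_alg A))"
      by (rule N.A.unital_ideals_semisimple[OF fN(1)])
    show "unital_ideals (quot_radical (nucleus_alg B))"
      by (rule N.B.unital_ideals_semisimple[OF fN(2)])
    show "fin_dim F (quot_radical (nucleus_alg A))"
      by (rule quot_ideal.quot_fin_dim[OF N.A.quot_ideal_radical fN(1)])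
    show "fin_dim F (quot_radical (nucleus_alg B))"
      by (rule quot_ideal.quot_fin_dim[OF N.B.quot_ideal_radical fN(2)])
    show "S \<in> simple_components (quot_radical (nucleus_alg AB.T))"
      using that by (simp add: atoms_def sigma_alg_def Let_def)
  qed (use cA cB in \<open>simp_all add: atoms_def sigma_alg_def Let_def\<close>)
  thus ?thesis using semiassociative_tensor[OF sA sB] by (simp add: semicentral_def)
qed

end
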